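(* For every $q\in\mathbb{N}=\{1,2,\dots\}$ there exist a constant $C(q)>0$ and real-valued functions $a_q,b_q$ of $\gamma$ with $a_q(\gamma)\to 0$ as $\gamma\to\infty$ and $b_q(\gamma)\to 0$ as $\gamma\to 0$ such that $$\text{(i)}\quad d_{TV}\big(\mathcal{L}(W_{q,\gamma}(1)),\,\mathcal{N}(0,1)\big)\le C(q)\,\gamma^{-1/2}\,(1+a_q(\gamma))\qquad\text{for all }\gamma\ge 1,$$ $$\text{(ii)}\quad d_{TV}\Big(\mathcal{L}(W_{q,\gamma}(1)),\,\mathcal{L}\Big(\frac{H_q(Z)}{\sqrt{q!}}\Big)\Big)\le C(q)\,\gamma^{1/(4q)}\,(1+b_q(\gamma))\qquad\text{for all }\gamma>0,$$ where $Z\sim\mathcal{N}(0,1)$.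
   Context: $d_{TV}(\mu,\nu)=\sup_A|\mu(A)-\nu(A)|$ is the total variation distance and $\mathcal{L}(\cdot)$ denotes the law. $H_q$ is the (probabilists') Hermite polynomial of order $q$, so that $\{H_q/\sqrt{q!}:q\ge 0\}$ is an orthonormal basis of $L^2(\mathcal{N}(0,1))$. For $q\in\mathbb{N}$ and $\gamma>0$, the tempered Hermite process $W_{q,\gamma}=(W_{q,\gamma}(t))_{t\in[0,1]}$ is the (continuous) process given by the multiple Wiener–Itô integral of order $q$ with respect to a two-sided standard Brownian motion $B$ on $\mathbb{R}$ (integration off the diagonals $x_i=x_j$, $i\ne j$) $$W_{q,\gamma}(t)=K_q^{(\gamma)}\int_{\mathbb{R}^q}'\Big(\int_0^t\prod_{r=1}^q e^{-\gamma(s-x_r)}\mathbf{1}_{\{x_r\le s\}}\,ds\Big)\,dB(x_1)\cdots dB(x_q),$$ with $$K_q^{(\gamma)}=\sqrt{\frac{2^{q-1}q^2\gamma^{q+2}}{q!\,(e^{-\gamma q}-1+\gamma q)}}.$$ Equivalently (in law), $W_{q,\gamma}(t)=K_q^{(\gamma)}\int_{\mathbb{R}^q}''\frac{e^{i(\sum_r\lambda_r)t}-1}{i\sum_r\lambda_r}\frac{1}{(2\pi)^{q/2}}\prod_{r=1}^q\frac{1}{i\lambda_r+\gamma}\,d\tilde B_0(\lambda_1)\cdots d\tilde B_0(\lambda_q)$ with $\tilde B_0$ the complex Gaussian white noise random measure. *)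

theory Defs
  imports "HOL-Probability.Probability" "HOL-Computational_Algebra.Polynomial"
begin

text \<open>For measures with the same measurable sets; here only laws on the Borel sets of the reals
  are compared.\<close>

definition tv_dist :: "'a measure \<Rightarrow> 'a measure \<Rightarrow> real" where
  "tv_dist \<mu> \<nu> = (SUP A\<in>sets \<mu>. \<bar>measure \<mu> A - measure \<nu> A\<bar>)"

text \<open>Probabilists' normalisation (leading coefficient 1, orthogonal for the standard normal law).\<close>

primrec hermite_poly :: "nat \<Rightarrow> real poly" where
  "hermite_poly 0 = 1"
| "hermite_poly (Suc n) = [:0, 1:] * hermite_poly n - pderiv (hermite_poly n)"

locale two_sided_brownian_motion = prob_space M
  for M :: "'a measure" and B :: "real \<Rightarrow> 'a \<Rightarrow> real" +
  assumes measurable_B: "\<And>t. B t \<in> borel_measurable M"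
    and B_zero: "AE \<omega> in M. B 0 \<omega> = 0"
    and gaussian_increments: "\<And>s t. s < t \<Longrightarrow>
      distributed M lborel (\<lambda>\<omega>. B t \<omega> - B s \<omega>) (normal_density 0 (sqrt (t - s)))"
    and indep_increments: "\<And>(n::nat) \<tau>. strict_mono_on {..n} \<tau> \<Longrightarrow>
      indep_vars (\<lambda>_. borel) (\<lambda>i \<omega>. B (\<tau> (Suc i)) \<omega> - B (\<tau> i) \<omega>) {..<n}"
    and continuous_paths: "AE \<omega> in M. continuous_on UNIV (\<lambda>t. B t \<omega>)"

text \<open>Points of \<open>q\<close>-dimensional space are functions on \<open>{..<q}\<close>, with Lebesgue measure
  \<open>\<Pi>\<^sub>M r\<in>{..<q}. lborel\<close>. An elementary function is a linear combination of indicators of boxes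
  \<open>\<Prod>r<q. {\<tau> (i r)<..\<tau> (Suc (i r))}\<close> over cells of a partition \<open>\<tau> 0 < \<dots> < \<tau> n\<close>. Only
  injective multi-indices \<open>i\<close> occur: the functions vanish on the diagonals, which is the
  off-diagonal convention of the Wiener-Ito integral.\<close>

definition offdiag_indices :: "nat \<Rightarrow> nat \<Rightarrow> (nat \<Rightarrow> nat) set" where
  "offdiag_indices q n = {i \<in> {..<q} \<rightarrow>\<^sub>E {..<n}. inj_on i {..<q}}"

definition elementary_fun ::
    "nat \<Rightarrow> nat \<Rightarrow> (nat \<Rightarrow> real) \<Rightarrow> ((nat \<Rightarrow> nat) \<Rightarrow> real) \<Rightarrow> (nat \<Rightarrow> real) \<Rightarrow> real" where
  "elementary_fun q n \<tau> c x =
     (\<Sum>i\<in>offdiag_indices q n. c i * (\<Prod>r<q. indicator {\<tau> (i r)<..\<tau> (Suc (i r))} (x r)))"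

definition elementary_integral ::
    "(real \<Rightarrow> 'a \<Rightarrow> real) \<Rightarrow> nat \<Rightarrow> nat \<Rightarrow> (nat \<Rightarrow> real) \<Rightarrow> ((nat \<Rightarrow> nat) \<Rightarrow> real) \<Rightarrow> 'a \<Rightarrow> real" where
  "elementary_integral B q n \<tau> c \<omega> =
     (\<Sum>i\<in>offdiag_indices q n. c i * (\<Prod>r<q. B (\<tau> (Suc (i r))) \<omega> - B (\<tau> (i r)) \<omega>))"

text \<open>The Wiener-Ito integral of order \<open>q\<close> is the \<open>L\<^sup>2\<close>-continuous extension of
  \<open>elementary_integral\<close>; \<open>Y\<close> is (a version of) the integral of \<open>f\<close> if both are \<open>L\<^sup>2\<close>-limits along
  a common sequence of elementary functions. Square integrability of \<open>f\<close> and \<open>Y\<close> is implied,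
  since elementary functions and their integrals are square integrable and the nonnegative
  integrals below are finite for large \<open>k\<close>.\<close>

definition has_multiple_wiener_integral ::
    "'a measure \<Rightarrow> (real \<Rightarrow> 'a \<Rightarrow> real) \<Rightarrow> nat \<Rightarrow> ((nat \<Rightarrow> real) \<Rightarrow> real) \<Rightarrow> ('a \<Rightarrow> real) \<Rightarrow> bool" where
  "has_multiple_wiener_integral M B q f Y \<longleftrightarrow>
     f \<in> borel_measurable (\<Pi>\<^sub>M r\<in>{..<q}. lborel) \<and>
     Y \<in> borel_measurable M \<and>
     (\<exists>(n :: nat \<Rightarrow> nat) \<tau> c.
        (\<forall>k. strict_mono_on {..n k} (\<tau> k)) \<and>
        (\<lambda>k. \<integral>\<^sup>+x. ennreal ((f x - elementary_fun q (n k) (\<tau> k) (c k) x)\<^sup>2)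
           \<partial>(\<Pi>\<^sub>M r\<in>{..<q}. lborel)) \<longlonglongrightarrow> 0 \<and>
        (\<lambda>k. \<integral>\<^sup>+\<omega>. ennreal ((Y \<omega> - elementary_integral B q (n k) (\<tau> k) (c k) \<omega>)\<^sup>2) \<partial>M)
           \<longlonglongrightarrow> 0)"

definition tempered_hermite_const :: "nat \<Rightarrow> real \<Rightarrow> real" where
  "tempered_hermite_const q \<gamma> =
     sqrt (2 ^ (q - 1) * (real q)\<^sup>2 * \<gamma> ^ (q + 2) /
           (fact q * (exp (- \<gamma> * real q) - 1 + \<gamma> * real q)))"

definition tempered_hermite_kernel :: "nat \<Rightarrow> real \<Rightarrow> real \<Rightarrow> (nat \<Rightarrow> real) \<Rightarrow> real" where
  "tempered_hermite_kernel q \<gamma> t x =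
     (LBINT s:{0..t}. (\<Prod>r<q. exp (- \<gamma> * (s - x r)) * indicator {..s} (x r)))"

locale tempered_hermite_process = two_sided_brownian_motion M B
  for M :: "'a measure" and B :: "real \<Rightarrow> 'a \<Rightarrow> real" and q :: nat and \<gamma> :: real
    and W :: "real \<Rightarrow> 'a \<Rightarrow> real" +
  assumes wiener_integral: "\<And>t. t \<in> {0..1} \<Longrightarrow>
      has_multiple_wiener_integral M B q
        (\<lambda>x. tempered_hermite_const q \<gamma> * tempered_hermite_kernel q \<gamma> t x) (W t)"
    and continuous_W: "AE \<omega> in M. continuous_on {0..1} (\<lambda>t. W t \<omega>)"

end

theory Submission
  imports Defs "HOL-Real_Asymp.Real_Asymp" "HOL-Computational_Algebra.Fundamental_Theorem_Algebra"
begin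

text \<open>
  With \<open>X\<close> the stationary Ornstein-Uhlenbeck process of rate \<open>\<gamma>\<close>, the variable \<open>W 1\<close> is a normalised
  time average of \<open>hermite q (X s)\<close> over \<open>[0, 1]\<close>. Discretising the kernel exhibits it as a mean square
  limit of Hermite sums along a stationary autoregressive Gaussian sequence with correlations
  \<open>\<rho> ^ \<bar>j - l\<bar>\<close>; only the isometry of the Wiener integrals is needed for this. As the total variation
  distance is controlled by smooth test functions, it suffices to bound such sums uniformly in the mesh.

  For large \<open>\<gamma>\<close>, Stein's equation and Gaussian integration by parts reduce the bound to the variance
  of the double sum of \<open>\<rho> ^ \<bar>j - l\<bar> * hermite (q - 1) (X j) * hermite (q - 1) (X l)\<close>, which is of order
  \<open>1 / \<gamma>\<close>. For small \<open>\<gamma>\<close>, the normalised sum is a perturbation of size \<open>sqrt \<gamma>\<close> of the single term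
  \<open>hermite q (X 0)\<close>. Integration by parts along \<open>X 0\<close> transfers this to total variation once the critical
  points of the Hermite polynomial are cut off, and the small-ball estimate for its derivative,
  obtained by factoring into complex linear factors, yields the exponent \<open>1 / (4 * q)\<close>.
\<close>

section \<open>Total variation distance and smooth test functions\<close>

text \<open>The obstacle is that a total variation bound may not see the derivative of a test
  function. Mesh errors do involve it, so the grid is refined for each fixed test function before
  the supremum is taken; every other estimate has to be free of \<open>L\<close> and uniform in the
  grid. In the normal case Stein's equation absorbs the derivative. In the Hermite case it is
  integrated away in the direction \<open>a 0\<close>: all correlations with this direction are
  powers \<open>\<rho> ^ j\<close> close to 1, so differentiating along it keeps the perturbation of
  order \<open>sqrt \<gamma>\<close>.

  With cut-off level \<open>k\<close> and a radius \<open>r\<close> around the critical points, the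
  Hermite error is of order \<open>sqrt \<gamma> / k + k / r ^ (2 * (q - 1)) + r\<close>. All three
  terms are \<open>r\<close> when \<open>k = r ^ (2 * q - 1)\<close> and
  \<open>r ^ (2 * q) = sqrt \<gamma>\<close>, which fixes the exponent. No lower order correction
  remains, so the two correction functions of the theorem can be zero.\<close>

lemma tv_dist_le_one:
  assumes "prob_space \<mu>" "prob_space \<nu>"
  shows "tv_dist \<mu> \<nu> \<le> 1"
proof -
  interpret \<mu>: prob_space \<mu> by fact
  interpret \<nu>: prob_space \<nu> by fact
  have "\<bar>measure \<mu> A - measure \<nu> A\<bar> \<le> 1" for A
    using \<mu>.prob_le_1[of A] \<nu>.prob_le_1[of A] measure_nonneg[of \<mu> A] measure_nonneg[of \<nu> A]
    by linarith
  then show ?thesis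
    unfolding tv_dist_def by (intro cSUP_least) (auto intro: sets.top)
qed

text \<open>The bound \<open>L\<close> is qualitative: it makes the discretisation error vanish for
  each fixed \<open>\<phi>\<close>. Since such functions approximate indicators, \<open>L\<close>
  may not enter a final estimate.\<close>

definition test_function :: "(real \<Rightarrow> real) \<Rightarrow> (real \<Rightarrow> real) \<Rightarrow> real \<Rightarrow> bool" where
  "test_function \<phi> \<phi>' L \<longleftrightarrow> (\<forall>x. 0 \<le> \<phi> x \<and> \<phi> x \<le> 1) \<and> (\<forall>x. (\<phi> has_real_derivative \<phi>' x) (at x)) \<and>
     continuous_on UNIV \<phi>' \<and> (\<forall>x. \<bar>\<phi>' x\<bar> \<le> L)"

lemma test_function_lipschitz:
  assumes "test_function \<phi> \<phi>' L"
  shows "\<bar>\<phi> x - \<phi> y\<bar> \<le> L * \<bar>x - y\<bar>"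
proof -
  have "norm (\<phi> x - \<phi> y) \<le> L * norm (x - y)"
    by (rule field_differentiable_bound[of UNIV \<phi> \<phi>'])
      (use assms in \<open>auto simp: test_function_def intro: has_field_derivative_at_within\<close>)
  then show ?thesis by simp
qed

lemma test_function_measurable:
  assumes "test_function \<phi> \<phi>' L"
  shows "\<phi> \<in> borel_measurable borel" "\<phi>' \<in> borel_measurable borel"
proof -
  have "continuous_on UNIV \<phi>"
    using assms unfolding test_function_def
    by (meson DERIV_continuous continuous_at_imp_continuous_on)
  then show "\<phi> \<in> borel_measurable borel" by (rule borel_measurable_continuous_onI)
  show "\<phi>' \<in> borel_measurable borel"
    using assms unfolding test_function_def by (auto intro: borel_measurable_continuous_onI)
qed

text \<open>Averaging \<open>g\<close> over a window of length \<open>h\<close> gives a difference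
  quotient of an antiderivative. It is continuously differentiable, keeps the range of
  \<open>g\<close>, and by the mean value theorem differs from \<open>g\<close> by at most
  \<open>L * h\<close>.\<close>

lemma test_function_approx:
  assumes "L-lipschitz_on UNIV g" and g: "\<And>x. 0 \<le> g x \<and> g x \<le> (1::real)" and "e > 0"
  obtains \<phi> \<phi>' K where "test_function \<phi> \<phi>' K" "\<And>x. \<bar>\<phi> x - g x\<bar> \<le> e"
proof -
  have L: "L \<ge> 0" using assms(1) lipschitz_on_nonneg by blast
  have cont: "continuous_on S g" for S
    using lipschitz_on_continuous_on[OF assms(1)] continuous_on_subset by blast
  \<comment> \<open>The denominator \<open>L + 1\<close> gives \<open>L * h \<le> e\<close> also for
    \<open>L = 0\<close>.\<close>
  define h where "h = e / (L + 1)"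
  have h: "h > 0" "L * h \<le> e"
    using L \<open>e > 0\<close> by (auto simp: h_def field_simps)
  have "\<exists>G. \<forall>x. (G has_real_derivative g x) (at x)"
  proof -
    obtain G where "\<forall>x\<in>einterval (-\<infinity>) \<infinity>. (G has_vector_derivative g x) (at x)"
      using einterval_antiderivative[of "-\<infinity>" \<infinity> g] cont continuous_on_eq_continuous_at[of UNIV g]
      by auto
    then show ?thesis by (auto simp: has_real_derivative_iff_has_vector_derivative)
  qed
  then obtain G where G: "\<And>x. (G has_real_derivative g x) (at x)" by blast
  define \<phi> where "\<phi> x = (G (x + h) - G x) / h" for x
  define \<phi>' where "\<phi>' x = (g (x + h) - g x) / h" for x
  have mvt: "\<exists>z. x < z \<and> z < x + h \<and> \<phi> x = g z" for x
  proof -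
    obtain z where "x < z" "z < x + h" "G (x + h) - G x = (x + h - x) * g z"
      using MVT2[of x "x + h" G g] G h by auto
    then show ?thesis using h by (auto simp: \<phi>_def intro!: exI[of _ z])
  qed
  have d: "(\<phi> has_real_derivative \<phi>' x) (at x)" for x
  proof -
    have "((\<lambda>x. G (x + h)) has_real_derivative g (x + h)) (at x)"
      using DERIV_shift[of G "g (x + h)" x h] G by simp
    then show ?thesis unfolding \<phi>_def \<phi>'_def
      by (intro DERIV_cdivide DERIV_diff G)
  qed
  have "test_function \<phi> \<phi>' (1 / h)"
    unfolding test_function_def
  proof (intro conjI allI)
    fix x
    show "0 \<le> \<phi> x" "\<phi> x \<le> 1" using mvt[of x] g by auto
    show "(\<phi> has_real_derivative \<phi>' x) (at x)" by (rule d)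
    have "\<bar>g (x + h) - g x\<bar> \<le> 1" using g[of x] g[of "x + h"] by linarith
    then show "\<bar>\<phi>' x\<bar> \<le> 1 / h" using h by (simp add: \<phi>'_def divide_right_mono)
  next
    show "continuous_on UNIV \<phi>'" unfolding \<phi>'_def
      by (intro continuous_intros continuous_on_compose2[OF cont[of UNIV]]) (use h in auto)
  qed
  moreover have "\<bar>\<phi> x - g x\<bar> \<le> e" for x
  proof -
    obtain z where z: "x < z" "z < x + h" "\<phi> x = g z" using mvt by blast
    have "dist (g z) (g x) \<le> L * dist z x"
      using lipschitz_onD[OF assms(1)] by auto
    also have "\<dots> \<le> L * h" using z L by (intro mult_left_mono) (auto simp: dist_real_def)
    finally show ?thesis using z h by (simp add: dist_real_def)
  qed
  ultimately show ?thesis using that by blast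
qed

text \<open>Dominated convergence: the truncated distance functions decrease to the indicator of
  \<open>K\<close>, since points outside a closed set have positive distance. \<open>K\<close> is
  nonempty because \<open>infdist\<close> to the empty set is 0, which would make the limit
  1.\<close>

lemma measure_approx_lipschitz:
  fixes M :: "real measure"
  assumes "prob_space M" "closed K" "K \<noteq> {}" "sets M = sets borel"
  shows "(\<lambda>n. \<integral>x. max 0 (1 - real n * infdist x K) \<partial>M) \<longlonglongrightarrow> measure M K"
proof -
  interpret prob_space M by fact
  have [measurable]: "K \<in> sets borel" using assms by auto
  have mb: "f \<in> borel_measurable borel \<Longrightarrow> f \<in> borel_measurable M" for f :: "real \<Rightarrow> real"
    using measurable_cong_sets[OF assms(4) refl] by blast
  have "(\<lambda>n. \<integral>x. max 0 (1 - real n * infdist x K) \<partial>M) \<longlonglongrightarrow> (\<integral>x. indicator K x \<partial>M)"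
  proof (rule integral_dominated_convergence[where w="\<lambda>_. 1"])
    show "AE x in M. (\<lambda>n. max 0 (1 - real n * infdist x K)) \<longlonglongrightarrow> indicator K x"
    proof (rule AE_I2)
      fix x
      show "(\<lambda>n. max 0 (1 - real n * infdist x K)) \<longlonglongrightarrow> indicator K x"
      proof (cases "x \<in> K")
        case True
        then show ?thesis by simp
      next
        case False
        then have "infdist x K > 0"
          using in_closed_iff_infdist_zero[OF assms(2,3)] infdist_nonneg[of x K] by fastforce
        moreover obtain N where "real N > 1 / infdist x K" using reals_Archimedean2 by blast
        ultimately have "1 - real n * infdist x K \<le> 0" if "n \<ge> N" for n
          using that by (smt (verit) divide_less_eq mult_right_mono of_nat_mono)
        then show ?thesis using False
          by (intro tendsto_eventually) (auto simp: eventually_sequentially intro!: exI[of _ N])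
      qed
    qed
    show "AE x in M. norm (max 0 (1 - real n * infdist x K)) \<le> 1" for n
      by (auto simp: infdist_nonneg)
    show "(\<lambda>x. max 0 (1 - real n * infdist x K)) \<in> borel_measurable M" for n
      by (intro mb borel_measurable_continuous_onI continuous_intros)
    show "(indicator K :: real \<Rightarrow> real) \<in> borel_measurable M"
      by (intro mb) simp
  qed auto
  then show ?thesis using assms by simp
qed

text \<open>The bound passes from smooth to Lipschitz functions by uniform approximation, to compact
  sets by truncated distances, and to Borel sets by inner regularity.\<close>

lemma tv_dist_le_test_functions:
  assumes "prob_space \<mu>" "prob_space \<nu>" and sets: "sets \<mu> = sets borel" "sets \<nu> = sets borel"
    and le: "\<And>\<phi> \<phi>' L. test_function \<phi> \<phi>' L \<Longrightarrow> \<bar>(\<integral>x. \<phi> x \<partial>\<mu>) - (\<integral>x. \<phi> x \<partial>\<nu>)\<bar> \<le> K"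
  shows "tv_dist \<mu> \<nu> \<le> K"
proof -
  interpret \<mu>: prob_space \<mu> by fact
  interpret \<nu>: prob_space \<nu> by fact
  have mb: "f \<in> borel_measurable borel \<Longrightarrow> f \<in> borel_measurable \<mu> \<and> f \<in> borel_measurable \<nu>"
    for f :: "real \<Rightarrow> real"
    using measurable_cong_sets[OF sets(1) refl] measurable_cong_sets[OF sets(2) refl] by blast
  have lip: "\<bar>(\<integral>x. g x \<partial>\<mu>) - (\<integral>x. g x \<partial>\<nu>)\<bar> \<le> K"
    if g: "L-lipschitz_on UNIV g" "\<And>x. 0 \<le> g x \<and> g x \<le> 1" for g L
  proof (rule field_le_epsilon)
    fix e :: real assume "e > 0"
    then obtain \<phi> \<phi>' L' where \<phi>: "test_function \<phi> \<phi>' L'" "\<And>x. \<bar>\<phi> x - g x\<bar> \<le> e / 2"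
      using test_function_approx[OF g, of "e / 2"] by auto
    have mg: "g \<in> borel_measurable borel"
      using lipschitz_on_continuous_on[OF g(1)] by (rule borel_measurable_continuous_onI)
    have "0 \<le> \<phi> x \<and> \<phi> x \<le> 1" for x using \<phi>(1) by (auto simp: test_function_def)
    note bd = this
    have int: "integrable \<mu> g" "integrable \<mu> \<phi>" "integrable \<nu> g" "integrable \<nu> \<phi>"
      using mb[OF mg] mb[OF test_function_measurable(1)[OF \<phi>(1)]] g(2) bd
      by (auto intro!: \<mu>.integrable_const_bound[where B=1] \<nu>.integrable_const_bound[where B=1])
    have 1: "\<bar>(\<integral>x. \<phi> x \<partial>\<mu>) - (\<integral>x. g x \<partial>\<mu>)\<bar> \<le> e / 2"
    proof -
      have "\<bar>\<integral>x. \<phi> x - g x \<partial>\<mu>\<bar> \<le> (\<integral>x. \<bar>\<phi> x - g x\<bar> \<partial>\<mu>)" by (rule integral_abs_bound)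
      also have "\<dots> \<le> (\<integral>x. e / 2 \<partial>\<mu>)" using int \<phi>(2) by (intro integral_mono) auto
      finally show ?thesis using int by (simp add: \<mu>.prob_space)
    qed
    have 2: "\<bar>(\<integral>x. \<phi> x \<partial>\<nu>) - (\<integral>x. g x \<partial>\<nu>)\<bar> \<le> e / 2"
    proof -
      have "\<bar>\<integral>x. \<phi> x - g x \<partial>\<nu>\<bar> \<le> (\<integral>x. \<bar>\<phi> x - g x\<bar> \<partial>\<nu>)" by (rule integral_abs_bound)
      also have "\<dots> \<le> (\<integral>x. e / 2 \<partial>\<nu>)" using int \<phi>(2) by (intro integral_mono) auto
      finally show ?thesis using int by (simp add: \<nu>.prob_space)
    qed
    show "\<bar>(\<integral>x. g x \<partial>\<mu>) - (\<integral>x. g x \<partial>\<nu>)\<bar> \<le> K + e"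
      using 1 2 le[OF \<phi>(1)] by linarith
  qed
  have comp: "\<bar>measure \<mu> C - measure \<nu> C\<bar> \<le> K" if "compact C" for C
  proof (cases "C = {}")
    case True
    \<comment> \<open>The empty set only asks for \<open>0 \<le> K\<close>, which the zero test
      function provides.\<close>
    have "test_function (\<lambda>_. 0) (\<lambda>_. 0) 0" by (auto simp: test_function_def)
    from le[OF this] True show ?thesis by simp
  next
    case False
    have "(\<lambda>n. \<bar>(\<integral>x. max 0 (1 - real n * infdist x C) \<partial>\<mu>) - (\<integral>x. max 0 (1 - real n * infdist x C) \<partial>\<nu>)\<bar>)
      \<longlonglongrightarrow> \<bar>measure \<mu> C - measure \<nu> C\<bar>"
      using that False
      by (intro tendsto_intros measure_approx_lipschitz assms(1,2) sets)
        (auto simp: compact_imp_closed)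
    then show ?thesis
    proof (rule LIMSEQ_le_const2, intro exI allI impI)
      fix n :: nat
      have "(real n)-lipschitz_on UNIV (\<lambda>x. max 0 (1 - real n * infdist x C))"
      proof (rule lipschitz_onI)
        fix x y
        have "\<bar>infdist x C - infdist y C\<bar> \<le> dist x y"
          using infdist_triangle[of x C y] infdist_triangle[of y C x] by (auto simp: dist_commute)
        then have "real n * \<bar>infdist x C - infdist y C\<bar> \<le> real n * dist x y"
          by (intro mult_left_mono) auto
        moreover have "real n * \<bar>infdist x C - infdist y C\<bar> = \<bar>real n * infdist x C - real n * infdist y C\<bar>"
          by (simp add: abs_mult flip: right_diff_distrib)
        ultimately show "dist (max 0 (1 - real n * infdist x C)) (max 0 (1 - real n * infdist y C)) \<le> real n * dist x y"
          unfolding dist_real_def by linarith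
      qed auto
      then show "\<bar>(\<integral>x. max 0 (1 - real n * infdist x C) \<partial>\<mu>) - (\<integral>x. max 0 (1 - real n * infdist x C) \<partial>\<nu>)\<bar> \<le> K"
        by (intro lip) (auto simp: infdist_nonneg)
    qed
  qed
  have "\<bar>measure \<mu> A - measure \<nu> A\<bar> \<le> K" if A: "A \<in> sets borel" for A
  proof (rule field_le_epsilon)
    fix e :: real assume e: "e > 0"
    have ir: "\<exists>C. C \<subseteq> A \<and> compact C \<and> measure M A - e / 2 < measure M C"
      if "prob_space M" "sets M = sets borel" for M
    proof -
      interpret prob_space M by fact
      have "emeasure M A = (SUP C\<in>{C. C \<subseteq> A \<and> compact C}. emeasure M C)"
        by (rule inner_regular) (use that A in \<open>auto simp: emeasure_space_1\<close>)
      moreover have "ennreal (measure M A - e / 2) < emeasure M A \<or> measure M A - e/2 < 0"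
        using e by (auto simp: emeasure_eq_measure ennreal_less_iff)
      ultimately show ?thesis
      proof (elim disjE)
        assume "measure M A - e/2 < 0"
        then show ?thesis by (intro exI[of _ "{}"]) auto
      next
        assume "emeasure M A = (SUP C\<in>{C. C \<subseteq> A \<and> compact C}. emeasure M C)"
          "ennreal (measure M A - e / 2) < emeasure M A"
        then obtain C where "C \<subseteq> A" "compact C" "ennreal (measure M A - e / 2) < emeasure M C"
          by (auto simp: less_SUP_iff)
        then show ?thesis
          by (smt (verit) emeasure_eq_measure ennreal_less_iff measure_nonneg ennreal_neg)
      qed
    qed
    obtain C1 C2 where C: "C1 \<subseteq> A" "compact C1" "measure \<mu> A - e / 2 < measure \<mu> C1"
        "C2 \<subseteq> A" "compact C2" "measure \<nu> A - e / 2 < measure \<nu> C2"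
      using ir[of \<mu>] ir[of \<nu>] assms(1-4) by blast
    \<comment> \<open>A compact set that is good for one law may miss mass of the other; the union
      serves both.\<close>
    have "C1 \<union> C2 \<in> sets borel"
      using C by (intro sets.Un) (auto simp: borel_compact)
    then have "measure \<mu> C1 \<le> measure \<mu> (C1 \<union> C2)" "measure \<mu> (C1 \<union> C2) \<le> measure \<mu> A"
      "measure \<nu> C2 \<le> measure \<nu> (C1 \<union> C2)" "measure \<nu> (C1 \<union> C2) \<le> measure \<nu> A"
      using C A sets by (auto intro!: \<mu>.finite_measure_mono \<nu>.finite_measure_mono)
    moreover have "\<bar>measure \<mu> (C1 \<union> C2) - measure \<nu> (C1 \<union> C2)\<bar> \<le> K"
      using C by (intro comp compact_Un)
    ultimately show "\<bar>measure \<mu> A - measure \<nu> A\<bar> \<le> K + e"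
      using C by linarith
  qed
  then show ?thesis
    unfolding tv_dist_def using sets by (intro cSUP_least) (auto intro: sets.top)
qed

section \<open>One-dimensional Gaussian analysis\<close>

abbreviation "N01 \<equiv> std_normal_distribution"

lemma prob_space_N01: "prob_space N01"
  by (simp add: prob_space_normal_density)

lemma integral_N01:
  assumes "f \<in> borel_measurable borel"
  shows "(\<integral>x. f x \<partial>N01) = (\<integral>x. std_normal_density x * f x \<partial>lborel)"
  using assms by (subst integral_density) auto

section \<open>Polynomial growth against the Gaussian density\<close>

definition poly_growth :: "(real \<Rightarrow> real) \<Rightarrow> bool" where
  "poly_growth f \<longleftrightarrow> (\<exists>C k. \<forall>x. \<bar>f x\<bar> \<le> C * (1 + \<bar>x\<bar>) ^ k)"

lemma poly_growthI: "(\<And>x. \<bar>f x\<bar> \<le> C * (1 + \<bar>x\<bar>) ^ k) \<Longrightarrow> poly_growth f"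
  by (auto simp: poly_growth_def)

lemma poly_growthE:
  assumes "poly_growth f"
  obtains C k where "C \<ge> 0" "\<And>x. \<bar>f x\<bar> \<le> C * (1 + \<bar>x\<bar>) ^ k"
proof -
  obtain C k where C: "\<And>x. \<bar>f x\<bar> \<le> C * (1 + \<bar>x\<bar>) ^ k" using assms by (auto simp: poly_growth_def)
  have "C \<ge> 0" using C[of 0] by auto
  then show ?thesis using C that by blast
qed

lemma poly_growth_bounded: "(\<And>x. \<bar>f x\<bar> \<le> C) \<Longrightarrow> poly_growth f"
  by (rule poly_growthI[of f C 0]) auto

lemma poly_growth_const: "poly_growth (\<lambda>_. c)"
  by (rule poly_growth_bounded[of _ "\<bar>c\<bar>"]) auto

lemma poly_growth_ident: "poly_growth (\<lambda>x. x)"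
  by (rule poly_growthI[of _ 1 1]) auto

lemma poly_growth_add:
  assumes "poly_growth f" "poly_growth g"
  shows "poly_growth (\<lambda>x. f x + g x)"
proof -
  obtain C k where C: "C \<ge> 0" "\<And>x. \<bar>f x\<bar> \<le> C * (1 + \<bar>x\<bar>) ^ k" using poly_growthE[OF assms(1)] by metis
  obtain D l where D: "D \<ge> 0" "\<And>x. \<bar>g x\<bar> \<le> D * (1 + \<bar>x\<bar>) ^ l" using poly_growthE[OF assms(2)] by metis
  show ?thesis
  proof (rule poly_growthI)
    fix x :: real
    have "\<bar>f x + g x\<bar> \<le> C * (1 + \<bar>x\<bar>) ^ k + D * (1 + \<bar>x\<bar>) ^ l"
      using C(2)[of x] D(2)[of x] by linarith
    also have "\<dots> \<le> C * (1 + \<bar>x\<bar>) ^ max k l + D * (1 + \<bar>x\<bar>) ^ max k l"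
      using C D by (intro add_mono mult_left_mono power_increasing) auto
    finally show "\<bar>f x + g x\<bar> \<le> (C + D) * (1 + \<bar>x\<bar>) ^ max k l" by (simp add: algebra_simps)
  qed
qed

lemma poly_growth_mult:
  assumes "poly_growth f" "poly_growth g"
  shows "poly_growth (\<lambda>x. f x * g x)"
proof -
  obtain C k where C: "C \<ge> 0" "\<And>x. \<bar>f x\<bar> \<le> C * (1 + \<bar>x\<bar>) ^ k" using poly_growthE[OF assms(1)] by metis
  obtain D l where D: "D \<ge> 0" "\<And>x. \<bar>g x\<bar> \<le> D * (1 + \<bar>x\<bar>) ^ l" using poly_growthE[OF assms(2)] by metis
  show ?thesis
  proof (rule poly_growthI)
    fix x :: real
    have "\<bar>f x * g x\<bar> \<le> (C * (1 + \<bar>x\<bar>) ^ k) * (D * (1 + \<bar>x\<bar>) ^ l)"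
      unfolding abs_mult using C D by (intro mult_mono) auto
    then show "\<bar>f x * g x\<bar> \<le> (C * D) * (1 + \<bar>x\<bar>) ^ (k + l)" by (simp add: power_add algebra_simps)
  qed
qed

lemma poly_growth_poly: "poly_growth (poly p)"
proof (induction p)
  case 0
  then show ?case using poly_growth_const[of 0] by (simp add: poly_growth_def)
next
  case (pCons a p)
  have "poly_growth (\<lambda>x. a + x * poly p x)"
    by (intro poly_growth_add poly_growth_mult poly_growth_const poly_growth_ident pCons)
  then show ?case by (simp add: poly_growth_def)
qed

lemma integrable_N01_power: "integrable N01 (\<lambda>x. (1 + \<bar>x\<bar>) ^ k)"
proof -
  have "integrable lborel (\<lambda>x. \<Sum>i\<le>k. (of_nat (k choose i)) * (std_normal_density x * \<bar>x\<bar> ^ i))"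
    by (intro Bochner_Integration.integrable_sum integrable_mult_right integrable_std_normal_moment_abs)
  also have "(\<lambda>x. \<Sum>i\<le>k. (of_nat (k choose i)) * (std_normal_density x * \<bar>x\<bar> ^ i)) =
      (\<lambda>x. std_normal_density x * (1 + \<bar>x\<bar>) ^ k)"
    by (subst add.commute, subst binomial_ring) (auto simp: sum_distrib_left algebra_simps)
  finally show ?thesis by (subst integrable_density) auto
qed

lemma integrable_N01_poly_growth:
  assumes "poly_growth f" "f \<in> borel_measurable borel"
  shows "integrable N01 f"
proof -
  obtain C k where C: "C \<ge> 0" "\<And>x. \<bar>f x\<bar> \<le> C * (1 + \<bar>x\<bar>) ^ k" using poly_growthE[OF assms(1)] by metis
  show ?thesis
    by (rule Bochner_Integration.integrable_bound[OF integrable_mult_right[OF integrable_N01_power[of k], of C]])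
      (use C assms in auto)
qed

lemma deriv_std_normal_density:
  "(std_normal_density has_real_derivative - x * std_normal_density x) (at x)"
  unfolding std_normal_density_def
  by (rule derivative_eq_intros refl | simp)+

text \<open>A power is at most a factorial times an exponential. This removes the unknown exponent
  and leaves the explicit limit of
  \<open>exp (1 + \<bar>x\<bar>) * std_normal_density x\<close>.\<close>

lemma std_normal_density_decay:
  assumes "poly_growth g"
  shows "((\<lambda>x. g x * std_normal_density x) \<longlongrightarrow> 0) at_top"
    and "((\<lambda>x. g x * std_normal_density x) \<longlongrightarrow> 0) at_bot"
proof -
  obtain C k where C: "C \<ge> 0" "\<And>x. \<bar>g x\<bar> \<le> C * (1 + \<bar>x\<bar>) ^ k" using poly_growthE[OF assms(1)] by metis
  have pe: "y ^ k \<le> fact k * exp y" if "y \<ge> 0" for y :: real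
  proof -
    have "(\<Sum>n\<in>{k}. y ^ n /\<^sub>R fact n) \<le> (\<Sum>n. y ^ n /\<^sub>R fact n)"
      using that by (intro sum_le_suminf summable_exp_generic) auto
    then have "y ^ k /\<^sub>R fact k \<le> exp y" by (simp add: exp_def)
    then show ?thesis by (simp add: field_simps)
  qed
  have bd: "\<bar>g x * std_normal_density x\<bar> \<le> C * fact k * (exp (1 + \<bar>x\<bar>) * std_normal_density x)" for x
  proof -
    have "\<bar>g x\<bar> \<le> C * (fact k * exp (1 + \<bar>x\<bar>))"
      using C(2)[of x] mult_left_mono[OF pe[of "1 + \<bar>x\<bar>"] C(1)] by linarith
    then have "\<bar>g x\<bar> * std_normal_density x \<le> C * (fact k * exp (1 + \<bar>x\<bar>)) * std_normal_density x"
      by (intro mult_right_mono) auto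
    then show ?thesis by (simp add: abs_mult algebra_simps)
  qed
  have t: "((\<lambda>x. exp (1 + x) * std_normal_density x) \<longlongrightarrow> 0) at_top"
    unfolding std_normal_density_def by real_asymp
  have b: "((\<lambda>x. exp (1 - x) * std_normal_density x) \<longlongrightarrow> 0) at_bot"
    unfolding std_normal_density_def by real_asymp
  have t': "((\<lambda>x. exp (1 + \<bar>x\<bar>) * std_normal_density x) \<longlongrightarrow> 0) at_top"
    by (rule Lim_transform_eventually[OF t]) (use eventually_ge_at_top[of 0] in eventually_elim, simp)
  have b': "((\<lambda>x. exp (1 + \<bar>x\<bar>) * std_normal_density x) \<longlongrightarrow> 0) at_bot"
    by (rule Lim_transform_eventually[OF b]) (use eventually_le_at_bot[of 0] in eventually_elim, simp)
  show "((\<lambda>x. g x * std_normal_density x) \<longlongrightarrow> 0) at_top"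
    by (rule Lim_null_comparison[OF _ tendsto_mult_right_zero[OF t', of "C * fact k"]]) (use bd in auto)
  show "((\<lambda>x. g x * std_normal_density x) \<longlongrightarrow> 0) at_bot"
    by (rule Lim_null_comparison[OF _ tendsto_mult_right_zero[OF b', of "C * fact k"]]) (use bd in auto)
qed

section \<open>Integration by parts and Stein's equation in one variable\<close>

lemma DERIV_imp_borel:
  assumes "\<And>x. (g has_real_derivative g' x) (at x)"
  shows "g \<in> borel_measurable borel" "continuous_on UNIV g"
proof -
  show "continuous_on UNIV g"
    using assms by (meson DERIV_continuous continuous_at_imp_continuous_on)
  then show "g \<in> borel_measurable borel" by (rule borel_measurable_continuous_onI)
qed

text \<open>Weighted with the density, \<open>g' x - x * g x\<close> is the derivative of
  \<open>g * std_normal_density\<close>, whose limits at both infinities vanish by polynomial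
  growth.\<close>

lemma gaussian_ibp_1d:
  assumes g: "\<And>x. (g has_real_derivative g' x) (at x)" "continuous_on UNIV g'"
    and gr: "poly_growth g" "poly_growth g'"
  shows "(\<integral>x. x * g x \<partial>N01) = (\<integral>x. g' x \<partial>N01)"
proof -
  have [measurable]: "g \<in> borel_measurable borel" "g' \<in> borel_measurable borel"
    using DERIV_imp_borel[OF g(1)] borel_measurable_continuous_onI[OF g(2)] by auto
  let ?f = "\<lambda>x. g' x * std_normal_density x + g x * (- x * std_normal_density x)"
  have i1: "integrable N01 (\<lambda>x. x * g x)" "integrable N01 g'"
    by (intro integrable_N01_poly_growth poly_growth_mult poly_growth_ident gr; measurable)+
  then have i2: "integrable lborel (\<lambda>x. std_normal_density x * (x * g x))"
      "integrable lborel (\<lambda>x. std_normal_density x * g' x)"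
    by (simp_all add: integrable_density)
  have i3: "integrable lborel ?f"
    using Bochner_Integration.integrable_diff[OF i2(2,1)] by (simp add: algebra_simps)
  have c: "isCont g x" "isCont g' x" for x
    using g DERIV_isCont continuous_on_eq_continuous_at by blast+
  have "(LBINT x=-\<infinity>..\<infinity>. ?f x) = 0 - 0"
  proof (rule interval_integral_FTC_integrable[where F="\<lambda>x. g x * std_normal_density x"])
    fix x
    show "((\<lambda>x. g x * std_normal_density x) has_vector_derivative ?f x) (at x)"
      unfolding has_real_derivative_iff_has_vector_derivative[symmetric]
      by (rule derivative_eq_intros g deriv_std_normal_density refl | simp)+
    show "isCont ?f x" using c deriv_std_normal_density[of x, THEN DERIV_isCont]
      by (intro continuous_intros) auto
  next
    show "set_integrable lborel (einterval (-\<infinity>) \<infinity>) ?f"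
      using i3 by (simp add: set_integrable_def)
    show "(((\<lambda>x. g x * std_normal_density x) \<circ> real_of_ereal) \<longlongrightarrow> 0) (at_right (- \<infinity>))"
      "(((\<lambda>x. g x * std_normal_density x) \<circ> real_of_ereal) \<longlongrightarrow> 0) (at_left \<infinity>)"
      using std_normal_density_decay[OF gr(1)] by (simp_all add: ereal_tendsto_simps)
  qed auto
  then have "(\<integral>x. ?f x \<partial>lborel) = 0"
    by (simp add: interval_lebesgue_integral_def set_lebesgue_integral_def)
  moreover have "(\<integral>x. ?f x \<partial>lborel) = (\<integral>x. std_normal_density x * g' x \<partial>lborel) - (\<integral>x. std_normal_density x * (x * g x) \<partial>lborel)"
    using i2 by (subst Bochner_Integration.integral_diff[symmetric]) (auto simp: algebra_simps)
  ultimately show ?thesis by (simp add: integral_N01)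
qed

text \<open>Mills' ratio: on the right tail \<open>t / x\<close> is at least 1, and
  \<open>t * std_normal_density t\<close> has the explicit antiderivative
  \<open>- std_normal_density\<close>. The left tail follows by reflection.\<close>

lemma gaussian_tail:
  assumes "x > 0"
  shows "(\<integral>t. indicator {x..} t * std_normal_density t \<partial>lborel) \<le> std_normal_density x / x"
    and "(\<integral>t. indicator {..-x} t * std_normal_density t \<partial>lborel) \<le> std_normal_density x / x"
proof -
  have "(\<integral>\<^sup>+t. ennreal (t * std_normal_density t) * indicator {x..} t \<partial>lborel) = ennreal (0 - (- std_normal_density x))"
  proof (rule nn_integral_FTC_atLeast)
    show "((\<lambda>x. - std_normal_density x) \<longlongrightarrow> 0) at_top"
      using tendsto_minus[OF std_normal_density_decay(1)[OF poly_growth_const[of 1]]] by simp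
    show "((\<lambda>x. - std_normal_density x) has_real_derivative t * std_normal_density t) (at t)" for t
      using DERIV_minus[OF deriv_std_normal_density[of t]] by simp
  qed (use assms in auto)
  then have nn: "(\<integral>\<^sup>+t. ennreal (t * std_normal_density t * indicator {x..} t) \<partial>lborel) = ennreal (std_normal_density x)"
    by (simp add: ennreal_mult' ennreal_indicator[symmetric] mult.assoc)
      (simp add: ennreal_mult'' ennreal_indicator mult.assoc)
  have nonneg: "AE t in lborel. 0 \<le> t * std_normal_density t * indicator {x..} t"
    using assms by (auto split: split_indicator)
  have int: "integrable lborel (\<lambda>t. t * std_normal_density t * indicator {x..} t)"
    by (rule integrableI_nn_integral_finite[OF _ nonneg nn]) auto
  have val: "(\<integral>t. t * std_normal_density t * indicator {x..} t \<partial>lborel) = std_normal_density x"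
    using nn_integral_eq_integral[OF int nonneg] nn integral_nonneg_AE[OF nonneg]
    by (metis ennreal_inj normal_density_nonneg)
  have "(\<integral>t. indicator {x..} t * std_normal_density t \<partial>lborel)
     \<le> (\<integral>t. (t * std_normal_density t * indicator {x..} t) / x \<partial>lborel)"
  proof (rule integral_mono)
    show "integrable lborel (\<lambda>t. indicator {x..} t * std_normal_density t)"
      using integrable_mult_indicator[OF _ integrable_normal_moment[of 1 0 0], of "{x..}"] by simp
    show "indicator {x..} t * std_normal_density t \<le> t * std_normal_density t * indicator {x..} t / x" for t
      using assms by (auto split: split_indicator simp: field_simps intro: mult_right_mono)
  qed (use int in auto)
  also have "\<dots> = std_normal_density x / x" using val by simp
  finally show 1: "(\<integral>t. indicator {x..} t * std_normal_density t \<partial>lborel) \<le> std_normal_density x / x" .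
  have "(\<integral>t. indicator {..-x} t * std_normal_density t \<partial>lborel) = (\<integral>t. indicator {x..} t * std_normal_density t \<partial>lborel)"
    by (subst lborel_integral_real_affine[of "-1" _ 0])
      (auto simp: std_normal_density_def intro!: Bochner_Integration.integral_cong split: split_indicator)
  with 1 show "(\<integral>t. indicator {..-x} t * std_normal_density t \<partial>lborel) \<le> std_normal_density x / x" by simp
qed

text \<open>The solution is the integral up to \<open>x\<close> of the centred \<open>\<phi>\<close>
  against the density, divided by the density. Mills' ratio bounds \<open>x * f x\<close> by 1, and
  the equation then bounds the derivative by 2. What matters is that this bound is the same for all
  admissible \<open>\<phi>\<close>.\<close>

lemma stein_equation:
  assumes \<phi>: "continuous_on UNIV \<phi>" "\<And>x. 0 \<le> \<phi> x \<and> \<phi> x \<le> (1::real)"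
  obtains f where "\<And>x. (f has_real_derivative x * f x + \<phi> x - (\<integral>x. \<phi> x \<partial>N01)) (at x)"
    "\<And>x. \<bar>x * f x + \<phi> x - (\<integral>x. \<phi> x \<partial>N01)\<bar> \<le> 2"
proof -
  interpret N: prob_space N01 by (rule prob_space_N01)
  have [measurable]: "\<phi> \<in> borel_measurable borel" using \<phi>(1) by (rule borel_measurable_continuous_onI)
  define m where "m = (\<integral>x. \<phi> x \<partial>N01)"
  have i\<phi>: "integrable N01 \<phi>" by (intro N.integrable_const_bound[where B=1]) (use \<phi> in auto)
  have m: "0 \<le> m" "m \<le> 1"
  proof -
    show "0 \<le> m" unfolding m_def using \<phi> by (intro Bochner_Integration.integral_nonneg) auto
    have "m \<le> (\<integral>x. 1 \<partial>N01)" unfolding m_def using \<phi> i\<phi> by (intro integral_mono) auto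
    then show "m \<le> 1" using N.prob_space by simp
  qed
  define p where "p t = (\<phi> t - m) * std_normal_density t" for t
  have psi: "\<bar>\<phi> t - m\<bar> \<le> 1" for t using \<phi>(2)[of t] m by linarith
  have pb: "\<bar>p t\<bar> \<le> std_normal_density t" for t
    using mult_right_mono[OF psi[of t], of "std_normal_density t"] by (simp add: p_def abs_mult)
  have [measurable]: "p \<in> borel_measurable borel" unfolding p_def by measurable
  have in01: "integrable lborel std_normal_density"
    using integrable_normal_moment[of 1 0 0] by simp
  have ip: "integrable lborel p"
    by (rule Bochner_Integration.integrable_bound[OF in01]) (use pb in auto)
  have ipi: "integrable lborel (\<lambda>t. indicator A t * p t)" if "A \<in> sets borel" for A
    using integrable_real_mult_indicator[OF _ ip, of A] that by (simp add: mult.commute)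
  have ini: "integrable lborel (\<lambda>t. indicator A t * std_normal_density t)" if "A \<in> sets borel" for A
    using integrable_real_mult_indicator[OF _ in01, of A] that by (simp add: mult.commute)
  have p0: "(\<integral>t. p t \<partial>lborel) = 0"
  proof -
    have "(\<integral>t. p t \<partial>lborel) = (\<integral>x. \<phi> x - m \<partial>N01)"
      by (subst integral_N01) (auto simp: p_def[abs_def] mult.commute)
    also have "\<dots> = 0" using i\<phi> by (subst Bochner_Integration.integral_diff) (use N.prob_space in \<open>auto simp: m_def\<close>)
    finally show ?thesis .
  qed
  have contp: "isCont p x" for x
    unfolding p_def using \<phi>(1) deriv_std_normal_density[of x, THEN DERIV_isCont]
    by (intro continuous_intros) (auto simp: continuous_on_eq_continuous_at)
  \<comment> \<open>\<open>U\<close> and a global antiderivative \<open>G\<close> of the continuous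
    \<open>p\<close> have the same increments, so \<open>U\<close> inherits the derivative.\<close>
  obtain G where G: "\<And>x. (G has_real_derivative p x) (at x)"
    using einterval_antiderivative[of "-\<infinity>" \<infinity> p] contp
    by (auto simp: has_real_derivative_iff_has_vector_derivative)
  define U where "U x = (\<integral>t. indicator {..x} t * p t \<partial>lborel)" for x
  have Udiff: "U b - U a = G b - G a" if "a \<le> b" for a b
  proof -
    have "U b - U a = (\<integral>t. indicator {..b} t * p t - indicator {..a} t * p t \<partial>lborel)"
      unfolding U_def by (subst Bochner_Integration.integral_diff) (auto intro: ipi)
    also have "\<dots> = (\<integral>t. p t * indicator {a..b} t \<partial>lborel)"
    proof (rule integral_cong_AE)
      show "AE t in lborel. indicator {..b} t * p t - indicator {..a} t * p t = p t * indicator {a..b} t"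
        using AE_lborel_singleton[of a] by eventually_elim (use that in \<open>auto split: split_indicator\<close>)
    qed auto
    also have "\<dots> = G b - G a"
      by (rule integral_FTC_Icc_real) (use that G contp in auto)
    finally show ?thesis .
  qed
  have UG: "U x = G x + (U 0 - G 0)" for x
    using Udiff[of 0 x] Udiff[of x 0] by (cases "0 \<le> x") auto
  have Ud: "(U has_real_derivative p x) (at x)" for x
  proof -
    have "U = (\<lambda>x. G x + (U 0 - G 0))" using UG by blast
    then show ?thesis using DERIV_add[OF G[of x] DERIV_const[of "U 0 - G 0"]] by simp
  qed
  have Ub: "\<bar>x * U x\<bar> \<le> std_normal_density x" for x
  proof -
    consider "x = 0" | "x > 0" | "x < 0" by linarith
    then show ?thesis
    proof cases
      case 2
      \<comment> \<open>For positive \<open>x\<close> the integral \<open>U x\<close> runs over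
        almost all mass; as \<open>p\<close> has total integral 0, it is minus the right
        tail.\<close>
      have "U x + (\<integral>t. indicator {x<..} t * p t \<partial>lborel) = (\<integral>t. p t \<partial>lborel)"
        unfolding U_def by (subst Bochner_Integration.integral_add[symmetric])
          (auto intro!: ipi Bochner_Integration.integral_cong split: split_indicator)
      then have "\<bar>U x\<bar> = \<bar>\<integral>t. indicator {x<..} t * p t \<partial>lborel\<bar>" using p0 by linarith
      also have "\<dots> \<le> (\<integral>t. \<bar>indicator {x<..} t * p t\<bar> \<partial>lborel)" by (rule integral_abs_bound)
      also have "\<dots> \<le> (\<integral>t. indicator {x..} t * std_normal_density t \<partial>lborel)"
        by (intro integral_mono integrable_abs ipi ini)
          (use pb in \<open>auto split: split_indicator\<close>)
      also have "\<dots> \<le> std_normal_density x / x" by (rule gaussian_tail) fact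
      finally show ?thesis using 2 by (simp add: abs_mult field_simps)
    next
      case 3
      have "\<bar>U x\<bar> \<le> (\<integral>t. \<bar>indicator {..x} t * p t\<bar> \<partial>lborel)" unfolding U_def by (rule integral_abs_bound)
      also have "\<dots> \<le> (\<integral>t. indicator {..-(-x)} t * std_normal_density t \<partial>lborel)"
        by (intro integral_mono integrable_abs ipi ini)
          (use pb in \<open>auto split: split_indicator\<close>)
      also have "\<dots> \<le> std_normal_density (-x) / (-x)" by (rule gaussian_tail) (use 3 in auto)
      also have "\<dots> = std_normal_density x / (-x)" by (simp add: std_normal_density_def)
      finally have "(-x) * \<bar>U x\<bar> \<le> (-x) * (std_normal_density x / (-x))" using 3 by (intro mult_left_mono) auto
      then show ?thesis using 3 by (simp add: abs_mult)
    qed auto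
  qed
  have npos: "std_normal_density x > 0" for x by (simp add: normal_density_pos)
  define f where "f x = U x / std_normal_density x" for x
  show thesis
  proof
    fix x
    have "(f has_real_derivative (p x * std_normal_density x - U x * (- x * std_normal_density x)) / (std_normal_density x * std_normal_density x)) (at x)"
      unfolding f_def using npos[of x] by (intro DERIV_divide Ud deriv_std_normal_density) auto
    also have "(p x * std_normal_density x - U x * (- x * std_normal_density x)) / (std_normal_density x * std_normal_density x)
       = x * f x + \<phi> x - m"
      using npos[of x] by (simp add: f_def p_def field_simps)
    finally show "(f has_real_derivative x * f x + \<phi> x - (\<integral>x. \<phi> x \<partial>N01)) (at x)" by (simp add: m_def)
    have "\<bar>x * f x\<bar> = \<bar>x * U x\<bar> / std_normal_density x" using npos[of x] by (simp add: f_def abs_mult)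
    also have "\<dots> \<le> 1" using Ub[of x] npos[of x] by simp
    finally show "\<bar>x * f x + \<phi> x - (\<integral>x. \<phi> x \<partial>N01)\<bar> \<le> 2" using psi[of x] unfolding m_def[symmetric] by linarith
  qed
qed


section \<open>Hermite polynomials and their derivatives\<close>

lemma hermite_poly_pderiv: "pderiv (hermite_poly (Suc n)) = smult (of_nat (Suc n)) (hermite_poly n)"
proof (induction n)
  case 0
  show ?case by (simp add: pderiv_pCons)
next
  case (Suc n)
  have "pderiv (hermite_poly (Suc (Suc n))) =
      hermite_poly (Suc n) + [:0, 1:] * pderiv (hermite_poly (Suc n)) - pderiv (pderiv (hermite_poly (Suc n)))"
    by (subst hermite_poly.simps(2)) (simp only: pderiv_diff pderiv_mult, simp add: pderiv_pCons)
  also have "\<dots> = hermite_poly (Suc n) + smult (of_nat (Suc n)) ([:0, 1:] * hermite_poly n - pderiv (hermite_poly n))"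
    unfolding Suc.IH by (simp add: pderiv_smult smult_diff_right mult_smult_right)
  also have "\<dots> = hermite_poly (Suc n) + smult (of_nat (Suc n)) (hermite_poly (Suc n))" by simp
  also have "\<dots> = smult (of_nat (Suc (Suc n))) (hermite_poly (Suc n))"
    by (metis (no_types, lifting) add.commute of_nat_Suc smult_1_left smult_add_left)
  finally show ?case .
qed

lemma hermite_poly_degree: "degree (hermite_poly n) = n \<and> lead_coeff (hermite_poly n) = 1"
proof (induction n)
  case (Suc n)
  have nz: "hermite_poly n \<noteq> 0" using Suc by auto
  have "degree ([:0, 1:] * hermite_poly n) = Suc n"
    using Suc nz by (subst degree_mult_eq) auto
  moreover have "degree (pderiv (hermite_poly n)) < Suc n"
    using Suc by (simp add: degree_pderiv less_Suc_eq_le)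
  moreover have "lead_coeff ([:0, 1:] * hermite_poly n) = 1"
    using Suc by (subst lead_coeff_mult) auto
  moreover define A where "A = [:0, 1:] * hermite_poly n"
  moreover define B where "B = pderiv (hermite_poly n)"
  ultimately have *: "degree A = Suc n" "degree B < Suc n" "lead_coeff A = 1" by auto
  then have "degree (A - B) = Suc n" using degree_add_eq_left[of "- B" A] by simp
  with * show ?case unfolding hermite_poly.simps A_def[symmetric] B_def[symmetric]
    by (simp add: coeff_eq_0)
qed auto

definition hermite :: "nat \<Rightarrow> real \<Rightarrow> real" where
  "hermite n x = poly (hermite_poly n) x"

lemma hermite_0 [simp]: "hermite 0 x = 1"
  by (simp add: hermite_def)

text \<open>At \<open>n = 0\<close> the truncated index \<open>n - 1\<close> carries the coefficient
  0, so later computations need no case distinction.\<close>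

lemma DERIV_hermite: "(hermite n has_real_derivative real n * hermite (n - 1) x) (at x)"
proof (cases n)
  case 0
  have "hermite 0 = (\<lambda>_. 1)" by auto
  then show ?thesis using 0 by simp
next
  case (Suc k)
  show ?thesis using poly_DERIV[of "hermite_poly n" x]
    unfolding Suc hermite_poly_pderiv by (simp add: hermite_def[abs_def] del: hermite_poly.simps)
qed

lemma hermite_Suc: "hermite (Suc n) x = x * hermite n x - real n * hermite (n - 1) x"
proof -
  have "poly (pderiv (hermite_poly n)) x = real n * hermite (n - 1) x"
    by (cases n) (use hermite_poly_pderiv in \<open>auto simp: hermite_def simp del: hermite_poly.simps(2)\<close>)
  then show ?thesis by (simp add: hermite_def)
qed

lemma poly_growth_hermite: "poly_growth (hermite n)"
  using poly_growth_poly[of "hermite_poly n"] by (simp add: hermite_def[abs_def])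

lemma continuous_on_hermite [continuous_intros]: "continuous_on S f \<Longrightarrow> continuous_on S (\<lambda>x. hermite n (f x))"
  unfolding hermite_def by (intro continuous_intros)

lemma hermite_measurable [measurable]: "hermite n \<in> borel_measurable borel"
  by (intro borel_measurable_continuous_onI continuous_intros)

section \<open>Small values of monic polynomials\<close>

lemma monic_poly_sublevel:
  fixes p :: "real poly" and r :: real
  assumes "lead_coeff p = 1" "r > 0"
  shows "emeasure lborel {x. \<bar>poly p x\<bar> < r ^ degree p} \<le> ennreal (2 * degree p * r)"
proof -
  define P where "P = map_poly complex_of_real p"
  have lc: "lead_coeff P = 1" using assms by (simp add: P_def lead_coeff_map_poly_nz)
  have dP: "degree P = degree p" by (simp add: P_def degree_map_poly)
  have fac: "P = (\<Prod>x\<in>#proots P. [:- x, 1:])" using complex_poly_decompose_multiset[of P] lc by simp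
  have ev: "complex_of_real (poly p x) = poly P (of_real x)" for x
    unfolding P_def by (induction p) (auto simp: map_poly_pCons)
  have np: "cmod (poly (\<Prod>x\<in>#A. [:- x, 1:]) y) = (\<Prod>z\<in>#A. cmod (y - z))" for A :: "complex multiset" and y
    by (induction A) (auto simp: norm_mult simp flip: left_diff_distrib)
  have norm: "\<bar>poly p x\<bar> = prod_mset (image_mset (\<lambda>z. cmod (of_real x - z)) (proots P))" for x
  proof -
    have "\<bar>poly p x\<bar> = cmod (poly P (of_real x))" by (metis ev norm_of_real)
    also have "\<dots> = cmod (poly (\<Prod>x\<in>#proots P. [:- x, 1:]) (of_real x))" by (rule arg_cong[OF fac, of "\<lambda>P. cmod (poly P (of_real x))"])
    also have "\<dots> = prod_mset (image_mset (\<lambda>z. cmod (of_real x - z)) (proots P))"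
      by (rule np)
    finally show ?thesis .
  qed
  have cs: "card (set_mset A) \<le> size A" for A :: "complex multiset"
    by (induction A) (auto simp: card_insert_if)
  have pl: "r ^ size A \<le> prod_mset (image_mset f A)" if "\<And>z. z \<in># A \<Longrightarrow> r \<le> f z" for f :: "complex \<Rightarrow> real" and A
    using that
  proof (induction A)
    case (add x A)
    have "r * r ^ size A \<le> f x * prod_mset (image_mset f A)"
      using add assms by (intro mult_mono) (auto intro: order_trans[of 0 r])
    then show ?case by simp
  qed simp
  \<comment> \<open>If every complex root had distance at least \<open>r\<close> from
    \<open>x\<close>, the product of the distances would be at least \<open>r ^ degree p\<close>. So
    some root is within \<open>r\<close>, and then so is its real part. Complex factors are
    essential: a real polynomial may be small near the real part of a non-real root.\<close>
  have sub: "{x. \<bar>poly p x\<bar> < r ^ degree p} \<subseteq> (\<Union>z\<in>set_mset (proots P). {Re z - r..Re z + r})"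
  proof
    fix x assume "x \<in> {x. \<bar>poly p x\<bar> < r ^ degree p}"
    then have "\<not> (\<forall>z\<in>#proots P. r \<le> cmod (of_real x - z))"
      using pl[of "proots P" "\<lambda>z. cmod (of_real x - z)"] norm[of x] dP size_proots_complex[of P] by fastforce
    then obtain z where z: "z \<in># proots P" "cmod (of_real x - z) < r" by auto
    have "\<bar>x - Re z\<bar> \<le> cmod (of_real x - z)" using abs_Re_le_cmod[of "of_real x - z"] by simp
    with z show "x \<in> (\<Union>z\<in>set_mset (proots P). {Re z - r..Re z + r})" by (auto intro!: bexI[of _ z])
  qed
  have "emeasure lborel {x. \<bar>poly p x\<bar> < r ^ degree p} \<le> emeasure lborel (\<Union>z\<in>set_mset (proots P). {Re z - r..Re z + r})"
    using sub by (intro emeasure_mono) auto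
  also have "\<dots> \<le> (\<Sum>z\<in>set_mset (proots P). emeasure lborel {Re z - r..Re z + r})"
    by (intro emeasure_subadditive_finite) auto
  also have "\<dots> = (\<Sum>z\<in>set_mset (proots P). ennreal (2 * r))" using assms by (intro sum.cong) auto
  also have "\<dots> = ennreal (real (card (set_mset (proots P))) * (2 * r))"
    using assms by (simp add: ennreal_mult ennreal_of_nat_eq_real_of_nat)
  also have "\<dots> \<le> ennreal (2 * degree p * r)"
  proof (intro ennreal_leI)
    have "card (set_mset (proots P)) \<le> degree p"
      using size_proots_complex[of P] dP cs[of "proots P"] by simp
    then have "real (card (set_mset (proots P))) * (2 * r) \<le> real (degree p) * (2 * r)"
      using assms by (intro mult_right_mono) auto
    then show "real (card (set_mset (proots P))) * (2 * r) \<le> 2 * degree p * r" by (simp add: mult_ac)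
  qed
  finally show ?thesis .
qed

lemma ratio_le_one:
  fixes u v :: real
  assumes "0 \<le> u" "0 \<le> v"
  shows "v / (u + v) \<le> 1"
  using assms by (cases "u + v = 0") (auto simp: divide_le_eq_1)

text \<open>The integrand is 1 minus the cut-off and never exceeds 1. It is estimated by 1 on the
  sublevel set of radius \<open>r\<close>, whose Gaussian measure is at most its Lebesgue measure
  because the density is at most 1; elsewhere the denominator is at least
  \<open>a\<^sup>2 * r ^ (2 * d)\<close>.\<close>

lemma expectation_small_derivative:
  fixes r a k :: real
  assumes "r > 0" "a > 0"
  shows "(\<integral>x. k\<^sup>2 / ((a * hermite d x)\<^sup>2 + k\<^sup>2) \<partial>N01) \<le> 2 * d * r + k\<^sup>2 / (a\<^sup>2 * r ^ (2 * d))"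
proof -
  interpret N: prob_space N01 by (rule prob_space_N01)
  have dl: "degree (hermite_poly d) = d" "lead_coeff (hermite_poly d) = 1"
    using hermite_poly_degree[of d] by auto
  define S where "S = {x. \<bar>poly (hermite_poly d) x\<bar> < r ^ degree (hermite_poly d)}"
  have S_eq: "S = {x. \<bar>hermite d x\<bar> < r ^ d}" using hermite_poly_degree[of d] by (simp add: S_def hermite_def)
  have S[measurable]: "S \<in> sets borel" unfolding S_eq by measurable
  have "emeasure N01 S = (\<integral>\<^sup>+x. ennreal (std_normal_density x) * indicator S x \<partial>lborel)"
    by (subst emeasure_density) auto
  also have "\<dots> \<le> (\<integral>\<^sup>+x. indicator S x \<partial>lborel)"
  proof (intro nn_integral_mono)
    fix x
    have "std_normal_density x \<le> 1"
    proof -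
      have "1 / sqrt (2 * pi) \<le> 1" using pi_gt3 by (simp add: real_le_rsqrt)
      moreover have "exp (- x\<^sup>2 / 2) \<le> 1" by simp
      ultimately show ?thesis unfolding std_normal_density_def
        by (intro mult_le_one) auto
    qed
    then show "ennreal (std_normal_density x) * indicator S x \<le> indicator S x"
      by (auto split: split_indicator simp: ennreal_le_1)
  qed
  also have "\<dots> = emeasure lborel S" by simp
  also have "\<dots> \<le> ennreal (2 * d * r)"
    using monic_poly_sublevel[OF dl(2) assms(1)] unfolding S_def dl(1) .
  finally have mS: "measure N01 S \<le> 2 * d * r"
    using assms by (simp add: N.emeasure_eq_measure)
  have bd: "k\<^sup>2 / ((a * hermite d x)\<^sup>2 + k\<^sup>2) \<le> indicator S x + k\<^sup>2 / (a\<^sup>2 * r ^ (2 * d))" for x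
  proof (cases "x \<in> S")
    case True
    have "k\<^sup>2 / ((a * hermite d x)\<^sup>2 + k\<^sup>2) \<le> 1"
      by (intro ratio_le_one) auto
    moreover have "0 \<le> k\<^sup>2 / (a\<^sup>2 * r ^ (2 * d))" using assms by simp
    moreover have "indicator S x = (1::real)" using True by simp
    ultimately show ?thesis by linarith
  next
    case False
    then have "r ^ d \<le> \<bar>hermite d x\<bar>" by (simp add: S_eq)
    then have "(r ^ d)\<^sup>2 \<le> (hermite d x)\<^sup>2" using assms
      by (metis abs_le_square_iff abs_of_pos zero_less_power)
    then have "a\<^sup>2 * r ^ (2 * d) \<le> (a * hermite d x)\<^sup>2"
      by (simp add: power_mult_distrib power_mult[symmetric] mult.commute[of 2 d] mult_left_mono)
    moreover have "a\<^sup>2 * r ^ (2 * d) > 0" using assms by simp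
    ultimately have "k\<^sup>2 / ((a * hermite d x)\<^sup>2 + k\<^sup>2) \<le> k\<^sup>2 / (a\<^sup>2 * r ^ (2 * d))"
      by (intro divide_left_mono) (auto intro!: mult_pos_pos add_pos_nonneg add_increasing2)
    then show ?thesis using False by simp
  qed
  have "(\<integral>x. k\<^sup>2 / ((a * hermite d x)\<^sup>2 + k\<^sup>2) \<partial>N01) \<le> (\<integral>x. indicator S x + k\<^sup>2 / (a\<^sup>2 * r ^ (2 * d)) \<partial>N01)"
  proof (rule integral_mono)
    show "integrable N01 (\<lambda>x. k\<^sup>2 / ((a * hermite d x)\<^sup>2 + k\<^sup>2))"
    proof (rule N.integrable_const_bound[where B=1])
      show "AE x in N01. norm (k\<^sup>2 / ((a * hermite d x)\<^sup>2 + k\<^sup>2)) \<le> 1"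
        by (simp add: ratio_le_one)
    qed auto
    show "integrable N01 (\<lambda>x. indicator S x + k\<^sup>2 / (a\<^sup>2 * r ^ (2 * d)))"
      by (intro Bochner_Integration.integrable_add integrable_real_indicator) (auto simp: N.emeasure_eq_measure)
  qed (use bd in auto)
  also have "\<dots> = measure N01 S + k\<^sup>2 / (a\<^sup>2 * r ^ (2 * d))"
    using N.prob_space by (subst Bochner_Integration.integral_add) (auto simp: N.emeasure_eq_measure intro!: integrable_real_indicator)
  finally show ?thesis using mS by simp
qed

text \<open>A single pair \<open>A\<close>, \<open>m\<close> controls size and increments. For the
  increments the mean value theorem is used on the segment between \<open>y\<close> and
  \<open>z\<close>, where the weight \<open>1 + \<bar>y\<bar> + \<bar>z\<bar>\<close> dominates
  every point.\<close>

lemma poly_difference_bound: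
  fixes p :: "real poly"
  shows
  "\<exists>A m. A \<ge> 0 \<and> (\<forall>x. \<bar>poly p x\<bar> \<le> A * (1 + \<bar>x\<bar>) ^ m) \<and>
     (\<forall>y z. \<bar>poly p y - poly p z\<bar> \<le> A * \<bar>y - z\<bar> * (1 + \<bar>y\<bar> + \<bar>z\<bar>) ^ m)"
proof -
  obtain C k where C: "C \<ge> 0" "\<And>x. \<bar>poly p x\<bar> \<le> C * (1 + \<bar>x\<bar>) ^ k"
    using poly_growthE[OF poly_growth_poly[of p]] by metis
  obtain D l where D: "D \<ge> 0" "\<And>x. \<bar>poly (pderiv p) x\<bar> \<le> D * (1 + \<bar>x\<bar>) ^ l"
    using poly_growthE[OF poly_growth_poly[of "pderiv p"]] by metis
  have "\<bar>poly p x\<bar> \<le> (C + D) * (1 + \<bar>x\<bar>) ^ (k + l)" for x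
  proof -
    have "C * (1 + \<bar>x\<bar>) ^ k \<le> (C + D) * (1 + \<bar>x\<bar>) ^ (k + l)"
      using C D by (intro mult_mono power_increasing) auto
    then show ?thesis using C(2)[of x] by linarith
  qed
  moreover have "\<bar>poly p y - poly p z\<bar> \<le> (C + D) * \<bar>y - z\<bar> * (1 + \<bar>y\<bar> + \<bar>z\<bar>) ^ (k + l)" for y z
  proof -
    have "norm (poly p y - poly p z) \<le> (D * (1 + \<bar>y\<bar> + \<bar>z\<bar>) ^ l) * norm (y - z)"
    proof (rule field_differentiable_bound[of "{min y z..max y z}" "poly p" "poly (pderiv p)"])
      fix x assume x: "x \<in> {min y z..max y z}"
      then have "\<bar>x\<bar> \<le> \<bar>y\<bar> + \<bar>z\<bar>" by auto
      then have "D * (1 + \<bar>x\<bar>) ^ l \<le> D * (1 + \<bar>y\<bar> + \<bar>z\<bar>) ^ l"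
        using D by (intro mult_left_mono power_mono) auto
      then show "norm (poly (pderiv p) x) \<le> D * (1 + \<bar>y\<bar> + \<bar>z\<bar>) ^ l" using D(2)[of x] by simp
    qed (auto intro: poly_DERIV has_field_derivative_at_within)
    also have "\<dots> \<le> ((C + D) * (1 + \<bar>y\<bar> + \<bar>z\<bar>) ^ (k + l)) * norm (y - z)"
      using C D by (intro mult_right_mono mult_mono power_increasing) auto
    finally show ?thesis by (simp add: mult_ac)
  qed
  ultimately show ?thesis using C D by (intro exI[of _ "C + D"] exI[of _ "k + l"]) auto
qed

section \<open>Calculus on the finite-dimensional Gaussian space\<close>

definition gauss :: "nat \<Rightarrow> (nat \<Rightarrow> real) measure" where
  "gauss n = (\<Pi>\<^sub>M i\<in>{..<n}. N01)"

interpretation N01: prob_space N01 by (rule prob_space_N01)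

interpretation gauss_factors: product_sigma_finite "\<lambda>_::nat. N01"
  by unfold_locales

lemma prob_space_gauss: "prob_space (gauss n)"
  unfolding gauss_def by (intro prob_space_PiM prob_space_N01)

lemma sets_gauss: "sets (gauss n) = sets (\<Pi>\<^sub>M i\<in>{..<n}. borel)"
  unfolding gauss_def by (intro sets_PiM_cong) auto

lemma gauss_component: "i < n \<Longrightarrow> (\<lambda>x. x i) \<in> borel_measurable (gauss n)"
  using measurable_cong_sets[OF sets_gauss refl, of n "borel :: real measure"]
    measurable_component_singleton[of i "{..<n}" "\<lambda>_. borel :: real measure"] by auto

definition lin :: "nat \<Rightarrow> (nat \<Rightarrow> real) \<Rightarrow> (nat \<Rightarrow> real) \<Rightarrow> real" where
  "lin n a x = (\<Sum>i<n. a i * x i)"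

lemma lin_measurable [measurable]: "lin n a \<in> borel_measurable (gauss n)"
  unfolding lin_def by (intro borel_measurable_sum borel_measurable_times gauss_component) auto

section \<open>Functions of polynomial growth in several variables\<close>

definition absum :: "nat \<Rightarrow> (nat \<Rightarrow> real) \<Rightarrow> real" where
  "absum n x = 1 + (\<Sum>i<n. \<bar>x i\<bar>)"

lemma absum_ge_1: "1 \<le> absum n x"
  unfolding absum_def by (simp add: sum_nonneg)

text \<open>The bound is required at every function, not only at the extensional points that carry
  \<open>gauss n\<close>, so it may be applied to \<open>x(i := y)\<close> without side
  conditions.\<close>

definition tame :: "nat \<Rightarrow> ((nat \<Rightarrow> real) \<Rightarrow> real) \<Rightarrow> bool" where
  "tame n G \<longleftrightarrow> G \<in> borel_measurable (gauss n) \<and> (\<exists>C k. \<forall>x. \<bar>G x\<bar> \<le> C * absum n x ^ k)"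

lemma tameE:
  assumes "tame n G"
  obtains C k where "C \<ge> 0" "\<And>x. \<bar>G x\<bar> \<le> C * absum n x ^ k"
proof -
  obtain C k where C: "\<And>x. \<bar>G x\<bar> \<le> C * absum n x ^ k" using assms unfolding tame_def by blast
  have "0 \<le> C * absum n (\<lambda>_. 0) ^ k" using C[of "\<lambda>_. 0"] by (smt (verit) abs_ge_zero)
  then have "C \<ge> 0" by (simp add: absum_def)
  then show ?thesis using C that by blast
qed

lemma tame_measurable: "tame n G \<Longrightarrow> G \<in> borel_measurable (gauss n)"
  by (simp add: tame_def)

lemma tame_bound:
  assumes "tame n G" "H \<in> borel_measurable (gauss n)" "\<And>x. \<bar>H x\<bar> \<le> C * \<bar>G x\<bar>"
  shows "tame n H"
proof -
  obtain D k where D: "D \<ge> 0" "\<And>x. \<bar>G x\<bar> \<le> D * absum n x ^ k" using tameE[OF assms(1)] by metis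
  have "\<bar>H x\<bar> \<le> (\<bar>C\<bar> * D) * absum n x ^ k" for x
  proof -
    have "C * \<bar>G x\<bar> \<le> \<bar>C\<bar> * (D * absum n x ^ k)"
      using D(2)[of x] by (intro mult_mono) auto
    then show ?thesis using assms(3)[of x] by (simp add: mult_ac)
  qed
  then show ?thesis using assms(2) unfolding tame_def by blast
qed

lemma tame_const: "tame n (\<lambda>_. c)"
proof -
  have "\<bar>c\<bar> \<le> \<bar>c\<bar> * absum n x ^ 0" for x by simp
  then show ?thesis unfolding tame_def by (intro conjI borel_measurable_const) blast
qed

lemma tame_add:
  assumes "tame n f" "tame n g"
  shows "tame n (\<lambda>x. f x + g x)"
proof -
  obtain C k where C: "C \<ge> 0" "\<And>x. \<bar>f x\<bar> \<le> C * absum n x ^ k" using tameE[OF assms(1)] by metis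
  obtain D l where D: "D \<ge> 0" "\<And>x. \<bar>g x\<bar> \<le> D * absum n x ^ l" using tameE[OF assms(2)] by metis
  have "\<bar>f x + g x\<bar> \<le> (C + D) * absum n x ^ max k l" for x
  proof -
    have "\<bar>f x + g x\<bar> \<le> C * absum n x ^ k + D * absum n x ^ l"
      using C(2)[of x] D(2)[of x] by linarith
    also have "\<dots> \<le> C * absum n x ^ max k l + D * absum n x ^ max k l"
      using C D absum_ge_1 by (intro add_mono mult_left_mono power_increasing) auto
    finally show ?thesis by (simp add: algebra_simps)
  qed
  then show ?thesis using assms unfolding tame_def by (intro conjI borel_measurable_add) blast+
qed

lemma tame_mult:
  assumes "tame n f" "tame n g"
  shows "tame n (\<lambda>x. f x * g x)"
proof -
  obtain C k where C: "C \<ge> 0" "\<And>x. \<bar>f x\<bar> \<le> C * absum n x ^ k" using tameE[OF assms(1)] by metis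
  obtain D l where D: "D \<ge> 0" "\<And>x. \<bar>g x\<bar> \<le> D * absum n x ^ l" using tameE[OF assms(2)] by metis
  have "\<bar>f x * g x\<bar> \<le> (C * D) * absum n x ^ (k + l)" for x
  proof -
    have "\<bar>f x * g x\<bar> \<le> (C * absum n x ^ k) * (D * absum n x ^ l)"
      unfolding abs_mult using C D absum_ge_1[of n x] by (intro mult_mono) auto
    then show ?thesis by (simp add: power_add algebra_simps)
  qed
  then show ?thesis using assms unfolding tame_def by (intro conjI borel_measurable_times) blast+
qed

lemma tame_abs: "tame n f \<Longrightarrow> tame n (\<lambda>x. \<bar>f x\<bar>)"
  by (rule tame_bound[of n f _ 1]) (auto simp: tame_def)

lemma tame_cmult: "tame n f \<Longrightarrow> tame n (\<lambda>x. c * f x)"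
  by (intro tame_mult tame_const)

lemma tame_minus: "tame n f \<Longrightarrow> tame n (\<lambda>x. - f x)"
  using tame_cmult[of n f "-1"] by simp

lemma tame_diff: "tame n f \<Longrightarrow> tame n g \<Longrightarrow> tame n (\<lambda>x. f x - g x)"
  using tame_add[OF _ tame_minus, of n f g] by simp

lemma tame_sum: "(\<And>i. i \<in> I \<Longrightarrow> tame n (f i)) \<Longrightarrow> tame n (\<lambda>x. \<Sum>i\<in>I. f i x)"
proof (induction I rule: infinite_finite_induct)
  case (insert i I)
  then show ?case by (simp add: tame_add)
qed (simp_all add: tame_const)

lemma tame_power: "tame n f \<Longrightarrow> tame n (\<lambda>x. f x ^ k)"
  by (induction k) (simp_all add: tame_const tame_mult)

lemma tame_component: "i < n \<Longrightarrow> tame n (\<lambda>x. x i)"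
proof -
  assume i: "i < n"
  have "\<bar>x i\<bar> \<le> 1 * absum n x ^ 1" for x
    using i member_le_sum[of i "{..<n}" "\<lambda>i. \<bar>x i\<bar>"] by (simp add: absum_def)
  then show ?thesis using i unfolding tame_def by (intro conjI gauss_component) blast+
qed

lemma tame_lin: "tame n (lin n a)"
  unfolding lin_def[abs_def] by (intro tame_sum tame_cmult tame_component) auto

lemma tame_comp:
  assumes f: "poly_growth f" "f \<in> borel_measurable borel" and G: "tame n G"
  shows "tame n (\<lambda>x. f (G x))"
proof -
  obtain C k where C: "C \<ge> 0" "\<And>x. \<bar>f x\<bar> \<le> C * (1 + \<bar>x\<bar>) ^ k" using poly_growthE[OF f(1)] by metis
  have "tame n (\<lambda>x. (1 + \<bar>G x\<bar>) ^ k)"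
    by (intro tame_power tame_add tame_abs tame_const G)
  then show ?thesis
    by (rule tame_bound[of _ _ _ C]) (use C f G in \<open>auto simp: tame_def\<close>)
qed

text \<open>The weight \<open>absum n x\<close> is at most the product of the factors
  \<open>1 + \<bar>x i\<bar>\<close>, and powers of this product are integrable coordinate by
  coordinate.\<close>

lemma tame_integrable:
  assumes "tame n f" shows "integrable (gauss n) f"
proof -
  obtain C k where C: "C \<ge> 0" "\<And>x. \<bar>f x\<bar> \<le> C * absum n x ^ k" using tameE[OF assms(1)] by metis
  have "integrable (gauss n) (\<lambda>x. \<Prod>i<n. (1 + \<bar>x i\<bar>) ^ k)"
    unfolding gauss_def by (intro gauss_factors.product_integrable_prod integrable_N01_power) auto
  then have "integrable (gauss n) (\<lambda>x. C * (\<Prod>i<n. (1 + \<bar>x i\<bar>) ^ k))" by (rule integrable_mult_right)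
  then show ?thesis
  proof (rule Bochner_Integration.integrable_bound)
    show "f \<in> borel_measurable (gauss n)" using assms by (simp add: tame_def)
    show "AE x in gauss n. norm (f x) \<le> norm (C * (\<Prod>i<n. (1 + \<bar>x i\<bar>) ^ k))"
    proof (rule AE_I2)
      fix x
      have "absum m x \<le> (\<Prod>i<m. 1 + \<bar>x i\<bar>)" for m
      proof (induction m)
        case (Suc m)
        have "absum (Suc m) x \<le> absum m x + absum m x * \<bar>x m\<bar>"
          using mult_right_mono[OF absum_ge_1[of m x], of "\<bar>x m\<bar>"] by (simp add: absum_def)
        also have "\<dots> = absum m x * (1 + \<bar>x m\<bar>)" by (simp add: algebra_simps)
        also have "\<dots> \<le> (\<Prod>i<m. 1 + \<bar>x i\<bar>) * (1 + \<bar>x m\<bar>)"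
          using Suc by (intro mult_right_mono) auto
        finally show ?case by simp
      qed (simp add: absum_def)
      then have "absum n x ^ k \<le> (\<Prod>i<n. 1 + \<bar>x i\<bar>) ^ k"
        using absum_ge_1[of n x] by (intro power_mono) auto
      then have "\<bar>f x\<bar> \<le> C * (\<Prod>i<n. 1 + \<bar>x i\<bar>) ^ k"
        using C(2)[of x] mult_left_mono[OF _ C(1), of "absum n x ^ k"] by fastforce
      then show "norm (f x) \<le> norm (C * (\<Prod>i<n. (1 + \<bar>x i\<bar>) ^ k))"
        using C(1) by (simp add: prod_power_distrib[symmetric] abs_mult abs_prod power_abs)
    qed
  qed
qed

text \<open>The gradient is carried as data. Differentiability and continuity are asked along single
  coordinates only, because every integration by parts is performed in one coordinate with the
  others frozen.\<close>

definition gsmooth :: "nat \<Rightarrow> ((nat \<Rightarrow> real) \<Rightarrow> real) \<Rightarrow> (nat \<Rightarrow> (nat \<Rightarrow> real) \<Rightarrow> real) \<Rightarrow> bool" where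
  "gsmooth n G dG \<longleftrightarrow> tame n G \<and> (\<forall>i<n. tame n (dG i)) \<and>
     (\<forall>i<n. \<forall>x. ((\<lambda>y. G (x(i := y))) has_real_derivative dG i x) (at (x i))) \<and>
     (\<forall>i<n. \<forall>x. continuous_on UNIV (\<lambda>y. dG i (x(i := y))))"

lemma gsmooth_tame: "gsmooth n G dG \<Longrightarrow> tame n G" "gsmooth n G dG \<Longrightarrow> i < n \<Longrightarrow> tame n (dG i)"
  by (auto simp: gsmooth_def)

lemma gsmooth_deriv:
  assumes "gsmooth n G dG" "i < n"
  shows "((\<lambda>y. G (x(i := y))) has_real_derivative dG i (x(i := y))) (at y)"
proof -
  have "((\<lambda>y'. G ((x(i := y))(i := y'))) has_real_derivative dG i (x(i := y))) (at ((x(i := y)) i))"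
    using assms unfolding gsmooth_def by blast
  then show ?thesis by simp
qed

lemma gsmooth_continuous:
  assumes "gsmooth n G dG" "i < n"
  shows "continuous_on UNIV (\<lambda>y. G (x(i := y)))"
  using DERIV_imp_borel(2)[OF gsmooth_deriv[OF assms]] .

lemma gsmooth_const: "gsmooth n (\<lambda>_. c) (\<lambda>_ _. 0)"
  by (auto simp: gsmooth_def tame_const)

lemma gsmooth_lin: "gsmooth n (lin n a) (\<lambda>i _. a i)"
  unfolding gsmooth_def
proof (intro conjI allI impI tame_lin tame_const)
  fix i x assume i: "i < n"
  have "(\<lambda>y. lin n a (x(i := y))) = (\<lambda>y. a i * y + (\<Sum>j\<in>{..<n} - {i}. a j * x j))"
    using i by (auto simp: lin_def fun_eq_iff sum.remove[of "{..<n}" i])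
  then show "((\<lambda>y. lin n a (x(i := y))) has_real_derivative a i) (at (x i))"
    by (auto intro!: derivative_eq_intros)
qed auto

lemma gsmooth_add:
  assumes "gsmooth n F dF" "gsmooth n G dG"
  shows "gsmooth n (\<lambda>x. F x + G x) (\<lambda>i x. dF i x + dG i x)"
  using assms unfolding gsmooth_def
  by (auto intro!: tame_add DERIV_add continuous_on_add)

lemma gsmooth_mult:
  assumes F: "gsmooth n F dF" and G: "gsmooth n G dG"
  shows "gsmooth n (\<lambda>x. F x * G x) (\<lambda>i x. dF i x * G x + dG i x * F x)"
  unfolding gsmooth_def
proof (intro conjI allI impI tame_mult tame_add gsmooth_tame[OF F] gsmooth_tame[OF G])
  fix i x assume i: "i < n"
  show "((\<lambda>y. F (x(i := y)) * G (x(i := y))) has_real_derivative dF i x * G x + dG i x * F x) (at (x i))"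
    using DERIV_mult[OF gsmooth_deriv[OF F i, of x "x i"] gsmooth_deriv[OF G i, of x "x i"]] by simp
  show "continuous_on UNIV (\<lambda>y. dF i (x(i := y)) * G (x(i := y)) + dG i (x(i := y)) * F (x(i := y)))"
    using F G i unfolding gsmooth_def
    by (intro continuous_intros gsmooth_continuous[OF F] gsmooth_continuous[OF G]) auto
qed

lemma gsmooth_cmult: "gsmooth n F dF \<Longrightarrow> gsmooth n (\<lambda>x. c * F x) (\<lambda>i x. c * dF i x)"
  using gsmooth_mult[OF gsmooth_const[of n c], of F dF] by (simp add: mult.commute)

lemma gsmooth_sum:
  assumes "\<And>j. j \<in> J \<Longrightarrow> gsmooth n (F j) (dF j)"
  shows "gsmooth n (\<lambda>x. \<Sum>j\<in>J. F j x) (\<lambda>i x. \<Sum>j\<in>J. dF j i x)"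
  using assms
proof (induction J rule: infinite_finite_induct)
  case (insert i I)
  then show ?case by (simp add: gsmooth_add)
qed (simp_all add: gsmooth_const)

lemma gsmooth_comp:
  assumes f: "\<And>x. (f has_real_derivative f' x) (at x)" "continuous_on UNIV f'"
      "poly_growth f" "poly_growth f'"
    and G: "gsmooth n G dG"
  shows "gsmooth n (\<lambda>x. f (G x)) (\<lambda>i x. f' (G x) * dG i x)"
  unfolding gsmooth_def
proof (intro conjI allI impI tame_mult gsmooth_tame[OF G])
  show "tame n (\<lambda>x. f (G x))"
    by (rule tame_comp[OF f(3) DERIV_imp_borel(1)[OF f(1)] gsmooth_tame(1)[OF G]])
  show "tame n (\<lambda>x. f' (G x))"
    by (rule tame_comp[OF f(4) borel_measurable_continuous_onI[OF f(2)] gsmooth_tame(1)[OF G]])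
  fix i x assume i: "i < n"
  show "((\<lambda>y. f (G (x(i := y)))) has_real_derivative f' (G x) * dG i x) (at (x i))"
    using DERIV_chain2[OF f(1) gsmooth_deriv[OF G i, of x "x i"]] by simp
  show "continuous_on UNIV (\<lambda>y. f' (G (x(i := y))) * dG i (x(i := y)))"
    using G i unfolding gsmooth_def
    by (intro continuous_on_mult continuous_on_compose2[OF f(2)] gsmooth_continuous[OF G]) auto
qed

lemma gsmooth_hermite:
  "gsmooth n (\<lambda>x. hermite p (lin n a x)) (\<lambda>i x. real p * hermite (p - 1) (lin n a x) * a i)"
  by (rule gsmooth_comp[OF DERIV_hermite _ _ _ gsmooth_lin])
    (intro continuous_intros poly_growth_hermite poly_growth_mult poly_growth_const)+

text \<open>Fubini's theorem isolates coordinate \<open>i\<close>. Along it a tame function has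
  polynomial growth, since moving to \<open>x(i := y)\<close> multiplies the weight by at most
  \<open>1 + \<bar>y\<bar>\<close>, and the one-dimensional formula applies.\<close>

lemma gaussian_ibp_component:
  assumes G: "gsmooth n G dG" and i: "i < n"
  shows "(\<integral>x. x i * G x \<partial>gauss n) = (\<integral>x. dG i x \<partial>gauss n)"
proof -
  have ins: "{..<n} = insert i ({..<n} - {i})" using i by auto
  have split: "(\<integral>x. F x \<partial>gauss n) = (\<integral>x. (\<integral>y. F (x(i := y)) \<partial>N01) \<partial>PiM ({..<n} - {i}) (\<lambda>_. N01))"
    if "tame n F" for F
    using gauss_factors.product_integral_insert[of "{..<n} - {i}" i F, folded ins] tame_integrable[OF that]
    by (simp add: gauss_def)
  have gr: "poly_growth (\<lambda>y. F (x(i := y)))" if F: "tame n F" for F and x :: "nat \<Rightarrow> real"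
  proof -
    obtain C k where C: "C \<ge> 0" "\<And>x. \<bar>F x\<bar> \<le> C * absum n x ^ k" using tameE[OF F] by metis
    show ?thesis
    proof (rule poly_growthI)
      fix y
      have "absum n (x(i := y)) = 1 + (\<bar>y\<bar> + (\<Sum>j\<in>{..<n} - {i}. \<bar>x j\<bar>))"
        using i unfolding absum_def by (subst sum.remove[of "{..<n}" i]) auto
      also have "\<dots> \<le> absum n x + absum n x * \<bar>y\<bar>"
      proof -
        have "(\<Sum>j\<in>{..<n} - {i}. \<bar>x j\<bar>) \<le> (\<Sum>j<n. \<bar>x j\<bar>)" by (intro sum_mono2) auto
        moreover have "\<bar>y\<bar> \<le> absum n x * \<bar>y\<bar>"
          using mult_right_mono[OF absum_ge_1[of n x], of "\<bar>y\<bar>"] by simp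
        ultimately show ?thesis by (simp add: absum_def)
      qed
      also have "\<dots> = absum n x * (1 + \<bar>y\<bar>)" by (simp add: algebra_simps)
      finally have "absum n (x(i := y)) ^ k \<le> (absum n x * (1 + \<bar>y\<bar>)) ^ k"
        using absum_ge_1[of n "x(i:=y)"] by (intro power_mono) auto
      then have "C * absum n (x(i := y)) ^ k \<le> C * (absum n x * (1 + \<bar>y\<bar>)) ^ k"
        using C(1) by (intro mult_left_mono)
      then show "\<bar>F (x(i := y))\<bar> \<le> (C * absum n x ^ k) * (1 + \<bar>y\<bar>) ^ k"
        using C(2)[of "x(i := y)"] by (simp add: power_mult_distrib mult_ac)
    qed
  qed
  have "(\<integral>x. x i * G x \<partial>gauss n) = (\<integral>x. (\<integral>y. (x(i := y)) i * G (x(i := y)) \<partial>N01) \<partial>PiM ({..<n} - {i}) (\<lambda>_. N01))"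
    using split[OF tame_mult[OF tame_component[OF i] gsmooth_tame(1)[OF G]]] .
  also have "\<dots> = (\<integral>x. (\<integral>y. dG i (x(i := y)) \<partial>N01) \<partial>PiM ({..<n} - {i}) (\<lambda>_. N01))"
  proof (rule Bochner_Integration.integral_cong[OF refl])
    fix x
    have "continuous_on UNIV (\<lambda>y. dG i (x(i := y)))" using G i by (simp add: gsmooth_def)
    then have "(\<integral>y. y * G (x(i := y)) \<partial>N01) = (\<integral>y. dG i (x(i := y)) \<partial>N01)"
      by (intro gaussian_ibp_1d gsmooth_deriv[OF G i] gr gsmooth_tame(1)[OF G] gsmooth_tame(2)[OF G i])
    then show "(\<integral>y. (x(i := y)) i * G (x(i := y)) \<partial>N01) = (\<integral>y. dG i (x(i := y)) \<partial>N01)" by simp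
  qed
  also have "\<dots> = (\<integral>x. dG i x \<partial>gauss n)"
    using split[OF gsmooth_tame(2)[OF G i]] by simp
  finally show ?thesis .
qed

text \<open>The derivative in direction \<open>a\<close> of the function with gradient
  \<open>dG\<close>; integration by parts against \<open>lin n a\<close> produces exactly
  this.\<close>

definition dderiv :: "nat \<Rightarrow> (nat \<Rightarrow> real) \<Rightarrow> (nat \<Rightarrow> (nat \<Rightarrow> real) \<Rightarrow> real) \<Rightarrow> (nat \<Rightarrow> real) \<Rightarrow> real" where
  "dderiv n a dG x = (\<Sum>i<n. a i * dG i x)"

definition dot :: "nat \<Rightarrow> (nat \<Rightarrow> real) \<Rightarrow> (nat \<Rightarrow> real) \<Rightarrow> real" where
  "dot n a b = (\<Sum>i<n. a i * b i)"

lemma dot_commute: "dot n a b = dot n b a"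
  by (simp add: dot_def mult.commute)

lemma tame_dderiv: "gsmooth n G dG \<Longrightarrow> tame n (dderiv n a dG)"
  unfolding dderiv_def[abs_def] by (intro tame_sum tame_cmult gsmooth_tame(2)) auto

lemma gaussian_ibp:
  assumes G: "gsmooth n G dG"
  shows "(\<integral>x. lin n a x * G x \<partial>gauss n) = (\<integral>x. dderiv n a dG x \<partial>gauss n)"
proof -
  have "(\<integral>x. lin n a x * G x \<partial>gauss n) = (\<integral>x. (\<Sum>i<n. a i * (x i * G x)) \<partial>gauss n)"
    by (simp add: lin_def sum_distrib_right mult.assoc)
  also have "\<dots> = (\<Sum>i<n. a i * (\<integral>x. x i * G x \<partial>gauss n))"
    by (subst Bochner_Integration.integral_sum)
      (auto intro!: tame_integrable tame_mult tame_component gsmooth_tame[OF G] tame_cmult tame_const)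
  also have "\<dots> = (\<Sum>i<n. a i * (\<integral>x. dG i x \<partial>gauss n))"
    by (intro sum.cong refl arg_cong[where f="\<lambda>z. _ * z"] gaussian_ibp_component G) auto
  also have "\<dots> = (\<integral>x. dderiv n a dG x \<partial>gauss n)"
    unfolding dderiv_def
    by (subst Bochner_Integration.integral_sum)
      (auto intro!: tame_integrable tame_cmult gsmooth_tame(2)[OF G])
  finally show ?thesis .
qed

lemma dderiv_hermite:
  "dderiv n b (\<lambda>i x. real p * hermite (p - 1) (lin n a x) * a i) x = real p * hermite (p - 1) (lin n a x) * dot n b a"
  unfolding dderiv_def dot_def sum_distrib_left by (intro sum.cong refl) (simp only: mult_ac)

text \<open>The Hermite recursion makes the step from \<open>p\<close> to \<open>Suc p\<close>
  adjoint to differentiation along \<open>a\<close>: the subtracted term cancels the derivative of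
  \<open>hermite p (lin n a x)\<close>, which needs \<open>dot n a a = 1\<close>.\<close>

lemma hermite_ibp:
  assumes G: "gsmooth n G dG" and a: "dot n a a = 1"
  shows "(\<integral>x. hermite (Suc p) (lin n a x) * G x \<partial>gauss n) =
     (\<integral>x. hermite p (lin n a x) * dderiv n a dG x \<partial>gauss n)"
proof -
  let ?h = "\<lambda>p x. hermite p (lin n a x)"
  have t: "tame n (?h p)" for p using gsmooth_tame(1)[OF gsmooth_hermite] .
  have GS: "gsmooth n (\<lambda>x. ?h p x * G x) (\<lambda>i x. real p * ?h (p - 1) x * a i * G x + dG i x * ?h p x)"
    by (rule gsmooth_mult[OF gsmooth_hermite G])
  have dd: "dderiv n a (\<lambda>i x. real p * ?h (p - 1) x * a i * G x + dG i x * ?h p x) x =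
      real p * ?h (p - 1) x * G x + ?h p x * dderiv n a dG x" for x
  proof -
    have "dderiv n a (\<lambda>i x. real p * ?h (p - 1) x * a i * G x + dG i x * ?h p x) x =
        (\<Sum>i<n. (real p * ?h (p - 1) x * G x) * (a i * a i) + ?h p x * (a i * dG i x))"
      unfolding dderiv_def by (intro sum.cong) (auto simp: algebra_simps)
    also have "\<dots> = real p * ?h (p - 1) x * G x * dot n a a + ?h p x * dderiv n a dG x"
      unfolding dot_def dderiv_def by (simp add: sum.distrib sum_distrib_left)
    finally show ?thesis using a by simp
  qed
  have i1: "integrable (gauss n) (\<lambda>x. lin n a x * (?h p x * G x))"
    "integrable (gauss n) (\<lambda>x. real p * ?h (p - 1) x * G x)"
    "integrable (gauss n) (\<lambda>x. ?h p x * dderiv n a dG x)"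
    by (intro tame_integrable tame_mult tame_lin tame_const t gsmooth_tame[OF G] tame_dderiv[OF G])+
  have "(\<integral>x. ?h (Suc p) x * G x \<partial>gauss n) =
     (\<integral>x. lin n a x * (?h p x * G x) - real p * ?h (p - 1) x * G x \<partial>gauss n)"
    by (simp add: hermite_Suc algebra_simps)
  also have "\<dots> = (\<integral>x. lin n a x * (?h p x * G x) \<partial>gauss n) - (\<integral>x. real p * ?h (p - 1) x * G x \<partial>gauss n)"
    using i1 by (intro Bochner_Integration.integral_diff)
  also have "\<dots> = (\<integral>x. ?h p x * dderiv n a dG x \<partial>gauss n)"
    unfolding gaussian_ibp[OF GS] dd using i1 by (subst Bochner_Integration.integral_add) auto
  finally show ?thesis .
qed

text \<open>Each integration by parts lowers both degrees and releases a factor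
  \<open>Suc p * dot n a b\<close>.\<close>

lemma hermite_inner:
  assumes "dot n a a = 1" "dot n b b = 1"
  shows "(\<integral>x. hermite p (lin n a x) * hermite p (lin n b x) \<partial>gauss n) = fact p * dot n a b ^ p"
proof (induction p)
  case 0
  interpret prob_space "gauss n" by (rule prob_space_gauss)
  show ?case using prob_space by simp
next
  case (Suc p)
  have "(\<integral>x. hermite (Suc p) (lin n a x) * hermite (Suc p) (lin n b x) \<partial>gauss n) =
    (\<integral>x. real (Suc p) * dot n a b * (hermite p (lin n a x) * hermite p (lin n b x)) \<partial>gauss n)"
    unfolding hermite_ibp[OF gsmooth_hermite assms(1)] dderiv_hermite by (simp add: mult_ac)
  also have "\<dots> = real (Suc p) * dot n a b * (fact p * dot n a b ^ p)"
    by (simp only: integral_mult_right_zero Suc)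
  finally show ?case by (simp add: algebra_simps)
qed

text \<open>Integration by parts gives a recursion with factor \<open>2 * k + 1\<close>, that is a
  double factorial; the full factorial is a crude but convenient majorant.\<close>

lemma lin_moment:
  assumes "dot n a a \<le> 1"
  shows "(\<integral>x. lin n a x ^ (2 * k) \<partial>gauss n) \<le> fact (2 * k)"
proof (induction k)
  case 0
  interpret prob_space "gauss n" by (rule prob_space_gauss)
  show ?case using prob_space by simp
next
  case (Suc k)
  have d: "((\<lambda>y. y ^ (2 * k + 1)) has_real_derivative (2 * k + 1) * y ^ (2 * k)) (at y)" for y :: real
    using DERIV_pow[of "2 * k + 1" y] by simp
  have pg: "poly_growth (\<lambda>y. y ^ l)" for l
    by (induction l) (simp_all add: poly_growth_const poly_growth_mult poly_growth_ident)
  have GS: "gsmooth n (\<lambda>x. lin n a x ^ (2 * k + 1)) (\<lambda>i x. (2 * k + 1) * lin n a x ^ (2 * k) * a i)"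
    by (rule gsmooth_comp[OF d _ _ _ gsmooth_lin])
      (intro continuous_intros pg poly_growth_mult poly_growth_const)+
  have "dderiv n a (\<lambda>i x. (2 * k + 1) * lin n a x ^ (2 * k) * a i) x = (2 * k + 1) * dot n a a * lin n a x ^ (2 * k)" for x
    by (simp add: dderiv_def dot_def sum_distrib_left sum_distrib_right mult_ac)
  then have "(\<integral>x. lin n a x ^ (2 * Suc k) \<partial>gauss n) = (2 * k + 1) * dot n a a * (\<integral>x. lin n a x ^ (2 * k) \<partial>gauss n)"
    using gaussian_ibp[OF GS, of a] by (simp add: mult_ac)
  also have "\<dots> \<le> real (2 * k + 1) * 1 * fact (2 * k)"
    using assms Suc by (intro mult_mono) (auto simp: dot_def sum_nonneg intro!: Bochner_Integration.integral_nonneg)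
  also have "\<dots> \<le> real (2 * k + 2) * (real (2 * k + 1) * 1 * fact (2 * k))"
    using mult_right_mono[of 1 "real (2 * k + 2)" "real (2 * k + 1) * 1 * fact (2 * k)"] by simp
  also have "\<dots> = fact (2 * Suc k)" by (simp add: algebra_simps)
  finally show ?case .
qed

text \<open>Independence of the coordinates factors the characteristic function, and the Gaussian
  exponents add up to \<open>- (t\<^sup>2 / 2 * dot n a a)\<close>.\<close>

lemma distr_lin:
  assumes "dot n a a = 1"
  shows "distr (gauss n) borel (lin n a) = N01"
proof (rule Levy_uniqueness)
  interpret G: prob_space "gauss n" by (rule prob_space_gauss)
  show "real_distribution (distr (gauss n) borel (lin n a))"
    by (intro G.real_distribution_distr lin_measurable)
  show "real_distribution N01" by (rule real_dist_normal_dist)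
  show "char (distr (gauss n) borel (lin n a)) = char N01"
  proof
    fix t
    have "char (distr (gauss n) borel (lin n a)) t = (\<integral>x. iexp (t * lin n a x) \<partial>gauss n)"
      unfolding char_def by (subst integral_distr) auto
    also have "\<dots> = (\<integral>x. (\<Prod>i<n. iexp (t * a i * x i)) \<partial>gauss n)"
      by (simp add: lin_def sum_distrib_left exp_sum mult_ac)
    also have "\<dots> = (\<Prod>i<n. (\<integral>x. iexp (t * a i * x) \<partial>N01))"
      unfolding gauss_def by (intro gauss_factors.product_integral_prod N01.integrable_iexp) auto
    also have "\<dots> = (\<Prod>i<n. char N01 (t * a i))" by (simp add: char_def)
    also have "\<dots> = (\<Prod>i<n. complex_of_real (exp (- (t * a i)\<^sup>2 / 2)))" unfolding char_std_normal_distribution ..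
    also have "\<dots> = complex_of_real (exp (\<Sum>i<n. - (t * a i)\<^sup>2 / 2))" by (simp add: exp_sum)
    also have "(\<Sum>i<n. - (t * a i)\<^sup>2 / 2) = - (t\<^sup>2 / 2 * dot n a a)"
      unfolding dot_def sum_distrib_left sum_negf[symmetric] by (intro sum.cong) (auto simp: power2_eq_square)
    also have "complex_of_real (exp (- (t\<^sup>2 / 2 * dot n a a))) = char N01 t"
      using assms by (simp add: char_std_normal_distribution)
    finally show "char (distr (gauss n) borel (lin n a)) t = char N01 t" .
  qed
qed

section \<open>Off-diagonal chaos\<close>

lemma dderiv_lin: "dderiv n v (\<lambda>i _. a i) x = dot n v a"
  by (simp add: dderiv_def dot_def)

lemma dderiv_add: "dderiv n v (\<lambda>i x. dF i x + dG i x) x = dderiv n v dF x + dderiv n v dG x"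
  by (simp add: dderiv_def sum.distrib algebra_simps)

lemma dderiv_mult:
  "dderiv n v (\<lambda>i x. dF i x * G x + dG i x * F x) x = dderiv n v dF x * G x + dderiv n v dG x * F x"
  by (simp add: dderiv_def sum.distrib sum_distrib_left sum_distrib_right algebra_simps)

lemma dderiv_cmult: "dderiv n v (\<lambda>i x. c * dF i x) x = c * dderiv n v dF x"
  by (simp add: dderiv_def sum_distrib_left algebra_simps)

lemma dderiv_comp: "dderiv n v (\<lambda>i x. g x * dF i x) x = g x * dderiv n v dF x"
  by (simp add: dderiv_def sum_distrib_left algebra_simps)

lemma dderiv_sum: "dderiv n v (\<lambda>i x. \<Sum>j\<in>J. dF j i x) x = (\<Sum>j\<in>J. dderiv n v (dF j) x)"
  by (simp add: dderiv_def sum_distrib_left) (rule sum.swap)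

text \<open>The gradient is only asserted to exist, with the one property that later arguments need:
  it has no component in directions orthogonal to all factors.\<close>

lemma gsmooth_prod_lin:
  fixes u :: "nat \<Rightarrow> nat \<Rightarrow> real"
  shows   "\<exists>dG. gsmooth n (\<lambda>x. \<Prod>p\<in>P. lin n (u p) x) dG \<and>
     (\<forall>v x. (\<forall>p\<in>P. dot n v (u p) = 0) \<longrightarrow> dderiv n v dG x = 0)"
proof (induction P rule: infinite_finite_induct)
  case (insert p P)
  then obtain dG where dG: "gsmooth n (\<lambda>x. \<Prod>p\<in>P. lin n (u p) x) dG"
      "\<And>v x. (\<forall>p\<in>P. dot n v (u p) = 0) \<Longrightarrow> dderiv n v dG x = 0" by blast
  have "gsmooth n (\<lambda>x. lin n (u p) x * (\<Prod>p\<in>P. lin n (u p) x))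
      (\<lambda>i x. u p i * (\<Prod>p\<in>P. lin n (u p) x) + dG i x * lin n (u p) x)"
    by (rule gsmooth_mult[OF gsmooth_lin dG(1)])
  moreover have "dderiv n v (\<lambda>i x. u p i * (\<Prod>p\<in>P. lin n (u p) x) + dG i x * lin n (u p) x) x = 0"
    if "\<forall>p\<in>insert p P. dot n v (u p) = 0" for v x
    using that dG(2)[of v x] by (subst dderiv_mult) (simp add: dderiv_lin)
  ultimately show ?case unfolding prod.insert[OF insert.hyps] by blast
qed (auto intro!: exI[of _ "\<lambda>_ _. 0"] gsmooth_const simp: dderiv_def)

lemma tame_prod_lin:
  fixes u :: "nat \<Rightarrow> nat \<Rightarrow> real"
  shows "tame n (\<lambda>x. \<Prod>p\<in>P. lin n (u p) x)"
proof -
  obtain dG where "gsmooth n (\<lambda>x. \<Prod>p\<in>P. lin n (u p) x) dG"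
    using gsmooth_prod_lin[where n=n and P=P and u=u] by blast
  then show ?thesis by (rule gsmooth_tame(1))
qed

text \<open>Integrating by parts along one factor, the other factors do not react because they are
  orthogonal to it. The derivative falls on the Hermite polynomial alone and lowers its degree, so
  the factors are used up one by one.\<close>

lemma expectation_prod_hermite:
  fixes u :: "nat \<Rightarrow> nat \<Rightarrow> real"
  assumes "finite P" "\<And>p p'. p \<in> P \<Longrightarrow> p' \<in> P \<Longrightarrow> p \<noteq> p' \<Longrightarrow> dot n (u p) (u p') = 0"
  shows "(\<integral>x. (\<Prod>p\<in>P. lin n (u p) x) * hermite (card P) (lin n a x) \<partial>gauss n) =
    fact (card P) * (\<Prod>p\<in>P. dot n (u p) a)"
  using assms
proof (induction P rule: finite_induct)
  case empty
  interpret prob_space "gauss n" by (rule prob_space_gauss)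
  show ?case using prob_space by simp
next
  case (insert p P)
  obtain dG where dG: "gsmooth n (\<lambda>x. \<Prod>p\<in>P. lin n (u p) x) dG"
      "\<And>v x. (\<forall>p\<in>P. dot n v (u p) = 0) \<Longrightarrow> dderiv n v dG x = 0" using gsmooth_prod_lin[where n=n and P=P and u=u] by blast
  let ?k = "card P"
  have "(\<integral>x. (\<Prod>p\<in>insert p P. lin n (u p) x) * hermite (card (insert p P)) (lin n a x) \<partial>gauss n) =
    (\<integral>x. lin n (u p) x * ((\<Prod>p\<in>P. lin n (u p) x) * hermite (Suc ?k) (lin n a x)) \<partial>gauss n)"
    using insert.hyps by (simp add: mult_ac)
  also have "\<dots> = (\<integral>x. (real (Suc ?k) * dot n (u p) a) * ((\<Prod>p\<in>P. lin n (u p) x) * hermite ?k (lin n a x)) \<partial>gauss n)"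
  proof -
    let ?R = "\<lambda>x. \<Prod>p\<in>P. lin n (u p) x" and ?H = "\<lambda>x. hermite (Suc ?k) (lin n a x)"
    let ?dH = "\<lambda>i x. real (Suc ?k) * hermite (Suc ?k - 1) (lin n a x) * a i"
    have GS: "gsmooth n (\<lambda>x. ?R x * ?H x) (\<lambda>i x. dG i x * ?H x + ?dH i x * ?R x)"
      by (rule gsmooth_mult[OF dG(1) gsmooth_hermite])
    have "dderiv n (u p) dG x = 0" for x using insert.hyps insert.prems by (intro dG(2)) auto
    then have "dderiv n (u p) (\<lambda>i x. dG i x * ?H x + ?dH i x * ?R x) x =
        real (Suc ?k) * dot n (u p) a * (?R x * hermite ?k (lin n a x))" for x
      unfolding dderiv_mult[of n "u p" dG ?H ?dH ?R x] dderiv_hermite by (simp add: mult_ac)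
    then show ?thesis using gaussian_ibp[OF GS, of "u p"] by simp
  qed
  also have "\<dots> = (real (Suc ?k) * dot n (u p) a) * (fact ?k * (\<Prod>p\<in>P. dot n (u p) a))"
    using insert.prems by (simp only: integral_mult_right_zero) (subst insert.IH, auto)
  finally show ?case using insert.hyps by (simp add: algebra_simps)
qed

text \<open>A factor present in only one of the products is orthogonal to everything else, and
  integrating by parts along it gives 0; a common factor contributes its variance.\<close>

lemma expectation_prod_prod:
  fixes u :: "nat \<Rightarrow> nat \<Rightarrow> real"
  assumes "finite P" "finite P'" "\<And>p p'. p \<noteq> p' \<Longrightarrow> p \<in> P \<union> P' \<Longrightarrow> p' \<in> P \<union> P' \<Longrightarrow> dot n (u p) (u p') = 0"
  shows "(\<integral>x. (\<Prod>p\<in>P. lin n (u p) x) * (\<Prod>p\<in>P'. lin n (u p) x) \<partial>gauss n) =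
    (if P = P' then (\<Prod>p\<in>P. dot n (u p) (u p)) else 0)"
  using assms
proof (induction P arbitrary: P' rule: finite_induct)
  case empty
  interpret prob_space "gauss n" by (rule prob_space_gauss)
  show ?case
  proof (cases "P' = {}")
    case True
    then show ?thesis using prob_space by simp
  next
    case False
    then obtain p where p: "p \<in> P'" by blast
    obtain dG where dG: "gsmooth n (\<lambda>x. \<Prod>p\<in>P'-{p}. lin n (u p) x) dG"
      "\<And>v x. (\<forall>p\<in>P'-{p}. dot n v (u p) = 0) \<Longrightarrow> dderiv n v dG x = 0" using gsmooth_prod_lin[where n=n and P="P'-{p}" and u=u] by blast
    have "dderiv n (u p) dG x = 0" for x using empty p by (intro dG(2)) auto
    then show ?thesis using gaussian_ibp[OF dG(1), of "u p"] p empty False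
      by (simp add: prod.remove[of P' p])
  qed
next
  case (insert p P)
  obtain dG where dG: "gsmooth n (\<lambda>x. \<Prod>p\<in>P. lin n (u p) x) dG"
      "\<And>v x. (\<forall>p\<in>P. dot n v (u p) = 0) \<Longrightarrow> dderiv n v dG x = 0" using gsmooth_prod_lin[where n=n and P=P and u=u] by blast
  obtain dH where dH: "gsmooth n (\<lambda>x. \<Prod>p\<in>P'-{p}. lin n (u p) x) dH"
      "\<And>v x. (\<forall>p\<in>P'-{p}. dot n v (u p) = 0) \<Longrightarrow> dderiv n v dH x = 0" using gsmooth_prod_lin[where n=n and P="P'-{p}" and u=u] by blast
  have orth: "dot n (u p) (u p') = 0" if "p' \<in> P \<union> (P' - {p})" for p'
    using that insert.hyps by (intro insert.prems(2)) auto
  have z: "dderiv n (u p) dG x = 0" "dderiv n (u p) dH x = 0" for x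
    using orth by (auto intro!: dG(2) dH(2))
  have "(\<integral>x. (\<Prod>p\<in>insert p P. lin n (u p) x) * (\<Prod>p\<in>P'. lin n (u p) x) \<partial>gauss n) =
    (\<integral>x. lin n (u p) x * ((\<Prod>p\<in>P. lin n (u p) x) * (\<Prod>p\<in>P'. lin n (u p) x)) \<partial>gauss n)"
    using insert.hyps by (simp add: mult_ac)
  also have "\<dots> = (if insert p P = P' then (\<Prod>p\<in>insert p P. dot n (u p) (u p)) else 0)"
  proof (cases "p \<in> P'")
    case False
    then have "P' - {p} = P'" by auto
    then have G: "gsmooth n (\<lambda>x. (\<Prod>p\<in>P. lin n (u p) x) * (\<Prod>p\<in>P'. lin n (u p) x))
        (\<lambda>i x. dG i x * (\<Prod>p\<in>P'. lin n (u p) x) + dH i x * (\<Prod>p\<in>P. lin n (u p) x))"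
      using gsmooth_mult[OF dG(1) dH(1)] by simp
    have "dderiv n (u p) (\<lambda>i x. dG i x * (\<Prod>p\<in>P'. lin n (u p) x) + dH i x * (\<Prod>p\<in>P. lin n (u p) x)) x = 0" for x
      using dderiv_mult[of n "u p" dG "\<lambda>x. \<Prod>p\<in>P'. lin n (u p) x" dH "\<lambda>x. \<Prod>p\<in>P. lin n (u p) x" x]
      by (simp add: z)
    then show ?thesis using False gaussian_ibp[OF G, of "u p"] by auto
  next
    case True
    have G: "gsmooth n (\<lambda>x. (\<Prod>p\<in>P. lin n (u p) x) * (lin n (u p) x * (\<Prod>p\<in>P'-{p}. lin n (u p) x)))
        (\<lambda>i x. dG i x * (lin n (u p) x * (\<Prod>p\<in>P'-{p}. lin n (u p) x)) +
          (u p i * (\<Prod>p\<in>P'-{p}. lin n (u p) x) + dH i x * lin n (u p) x) * (\<Prod>p\<in>P. lin n (u p) x))"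
      by (rule gsmooth_mult[OF dG(1) gsmooth_mult[OF gsmooth_lin dH(1)]])
    have eq: "(\<Prod>p\<in>P'. lin n (u p) x) = lin n (u p) x * (\<Prod>p\<in>P'-{p}. lin n (u p) x)" for x
      using insert.prems True by (intro prod.remove) auto
    have "(\<integral>x. lin n (u p) x * ((\<Prod>p\<in>P. lin n (u p) x) * (\<Prod>p\<in>P'. lin n (u p) x)) \<partial>gauss n) =
      (\<integral>x. dot n (u p) (u p) * ((\<Prod>p\<in>P. lin n (u p) x) * (\<Prod>p\<in>P'-{p}. lin n (u p) x)) \<partial>gauss n)"
    proof -
      have "dderiv n (u p) (\<lambda>i x. dG i x * (lin n (u p) x * (\<Prod>p\<in>P'-{p}. lin n (u p) x)) +
          (u p i * (\<Prod>p\<in>P'-{p}. lin n (u p) x) + dH i x * lin n (u p) x) * (\<Prod>p\<in>P. lin n (u p) x)) x =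
          dot n (u p) (u p) * ((\<Prod>p\<in>P. lin n (u p) x) * (\<Prod>p\<in>P'-{p}. lin n (u p) x))" for x
        using dderiv_mult[of n "u p" dG "\<lambda>x. lin n (u p) x * (\<Prod>p\<in>P'-{p}. lin n (u p) x)"
            "\<lambda>i x. u p i * (\<Prod>p\<in>P'-{p}. lin n (u p) x) + dH i x * lin n (u p) x" "\<lambda>x. \<Prod>p\<in>P. lin n (u p) x" x]
          dderiv_mult[of n "u p" "\<lambda>i _. u p i" "\<lambda>x. \<Prod>p\<in>P'-{p}. lin n (u p) x" dH "lin n (u p)" x]
        by (simp add: z dderiv_lin mult_ac)
      then show ?thesis unfolding eq using gaussian_ibp[OF G, of "u p"] by simp
    qed
    also have "\<dots> = dot n (u p) (u p) * (if P = P' - {p} then (\<Prod>p\<in>P. dot n (u p) (u p)) else 0)"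
      using insert.prems by (simp only: integral_mult_right_zero) (subst insert.IH, auto)
    also have "P = P' - {p} \<longleftrightarrow> insert p P = P'" using True insert.hyps by auto
    finally show ?thesis using insert.hyps by auto
  qed
  finally show ?case .
qed

lemma finite_offdiag_indices: "finite (offdiag_indices q m)"
  unfolding offdiag_indices_def by (rule finite_subset[of _ "{..<q} \<rightarrow>\<^sub>E {..<m}"]) (auto intro: finite_PiE)

text \<open>Injective multi-indices with the same image differ by a permutation of the positions.
  This count is the constant \<open>fact q\<close> of the isometry.\<close>

lemma card_offdiag_same_image:
  assumes "i \<in> offdiag_indices q m"
  shows "card {i' \<in> offdiag_indices q m. i' ` {..<q} = i ` {..<q}} \<le> fact q"
proof -
  let ?S = "{i' \<in> offdiag_indices q m. i' ` {..<q} = i ` {..<q}}"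
  have inj: "inj_on i {..<q}" using assms by (simp add: offdiag_indices_def)
  have "?S \<subseteq> (\<lambda>\<pi>. restrict (i \<circ> \<pi>) {..<q}) ` {\<pi>. \<pi> permutes {..<q}}"
  proof
    fix i' assume i': "i' \<in> ?S"
    define \<pi> where "\<pi> r = (if r < q then inv_into {..<q} i (i' r) else r)" for r
    have "bij_betw i' {..<q} (i ` {..<q})"
      using i' by (simp add: bij_betw_def offdiag_indices_def)
    moreover have "bij_betw (inv_into {..<q} i) (i ` {..<q}) {..<q}"
      using inj by (intro bij_betw_inv_into) (simp add: bij_betw_def)
    ultimately have "bij_betw (inv_into {..<q} i \<circ> i') {..<q} {..<q}" by (rule bij_betw_trans)
    then have "bij_betw \<pi> {..<q} {..<q}" by (subst bij_betw_cong[of _ _ "inv_into {..<q} i \<circ> i'"]) (auto simp: \<pi>_def)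
    then have "\<pi> permutes {..<q}" by (rule bij_imp_permutes) (simp add: \<pi>_def)
    moreover have "i' r = restrict (i \<circ> \<pi>) {..<q} r" for r
    proof (cases "r < q")
      case True
      then have "i' r \<in> i ` {..<q}" using i' by blast
      then show ?thesis using True f_inv_into_f[of "i' r" i "{..<q}"] by (simp add: \<pi>_def)
    next
      case False
      then show ?thesis using i' by (auto simp: offdiag_indices_def PiE_def extensional_def)
    qed
    ultimately show "i' \<in> (\<lambda>\<pi>. restrict (i \<circ> \<pi>) {..<q}) ` {\<pi>. \<pi> permutes {..<q}}" by blast
  qed
  then have "card ?S \<le> card {\<pi>. \<pi> permutes {..<q}}"
    by (intro surj_card_le finite_permutations) auto
  then show ?thesis by (simp add: card_permutations)
qed

lemma offdiag_prod_image:
  assumes "i \<in> offdiag_indices q m"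
  shows "(\<Prod>r<q. f (i r)) = (\<Prod>p\<in>i ` {..<q}. f p)"
  using assms by (subst prod.reindex) (auto simp: offdiag_indices_def)

lemma integral_sum_sum:
  fixes f :: "'i \<Rightarrow> 'j \<Rightarrow> 'a \<Rightarrow> real"
  assumes "\<And>i j. i \<in> I \<Longrightarrow> j \<in> J \<Longrightarrow> integrable M (f i j)"
  shows "(\<integral>x. (\<Sum>i\<in>I. \<Sum>j\<in>J. k i j * f i j x) \<partial>M) = (\<Sum>i\<in>I. \<Sum>j\<in>J. k i j * (\<integral>x. f i j x \<partial>M))"
proof -
  have "(\<integral>x. (\<Sum>j\<in>J. k i j * f i j x) \<partial>M) = (\<Sum>j\<in>J. k i j * (\<integral>x. f i j x \<partial>M))" if "i \<in> I" for i
    using assms[OF that] by (subst Bochner_Integration.integral_sum) auto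
  moreover have "(\<integral>x. (\<Sum>i\<in>I. \<Sum>j\<in>J. k i j * f i j x) \<partial>M) = (\<Sum>i\<in>I. \<integral>x. (\<Sum>j\<in>J. k i j * f i j x) \<partial>M)"
    using assms by (intro Bochner_Integration.integral_sum Bochner_Integration.integrable_sum integrable_mult_right)
  ultimately show ?thesis by simp
qed

text \<open>The square is expanded. The mixed term and the square of \<open>Y\<close> are exact; but
  the coefficients \<open>c\<close> need not be symmetric, so in the square of \<open>F\<close> all
  multi-indices with a common image interact and only an inequality remains, the usual loss in
  symmetrising a kernel. The bracket on the right is shaped to be an exact squared distance of
  kernels.\<close>

lemma chaos_distance_bound:
  fixes u :: "nat \<Rightarrow> nat \<Rightarrow> real" and c :: "(nat \<Rightarrow> nat) \<Rightarrow> real" and q :: nat and w :: "'j \<Rightarrow> real" and a :: "'j \<Rightarrow> nat \<Rightarrow> real"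
  assumes u: "\<And>p p'. p < m \<Longrightarrow> p' < m \<Longrightarrow> p \<noteq> p' \<Longrightarrow> dot n (u p) (u p') = 0"
    and a: "\<And>j. j \<in> J \<Longrightarrow> dot n (a j) (a j) = 1"
  defines "F \<equiv> \<lambda>x. \<Sum>i\<in>offdiag_indices q m. c i * (\<Prod>r<q. lin n (u (i r)) x)"
    and "Y \<equiv> \<lambda>x. \<Sum>j\<in>J. w j * hermite q (lin n (a j) x)"
  shows "(\<integral>x. (F x - Y x)\<^sup>2 \<partial>gauss n) \<le> fact q *
    ((\<Sum>i\<in>offdiag_indices q m. (c i)\<^sup>2 * (\<Prod>r<q. dot n (u (i r)) (u (i r))))
     - 2 * (\<Sum>i\<in>offdiag_indices q m. \<Sum>j\<in>J. c i * w j * (\<Prod>r<q. dot n (u (i r)) (a j)))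
     + (\<Sum>j\<in>J. \<Sum>l\<in>J. w j * w l * dot n (a j) (a l) ^ q))"
proof -
  let ?I = "offdiag_indices q m"
  define U where "U i x = (\<Prod>r<q. lin n (u (i r)) x)" for i x
  have Ui: "U i x = (\<Prod>p\<in>i ` {..<q}. lin n (u p) x)" if "i \<in> ?I" for i x
    unfolding U_def using offdiag_prod_image[OF that, of "\<lambda>p. lin n (u p) x"] .
  have tU: "tame n (U i)" if "i \<in> ?I" for i
    using tame_prod_lin[where n=n and P="i ` {..<q}" and u=u] Ui[OF that] by (simp add: tame_def cong: measurable_cong)
  have im: "p < m" if "i \<in> ?I" "p \<in> i ` {..<q}" for i p
    using that by (auto simp: offdiag_indices_def)
  define V where "V i = (\<Prod>r<q. dot n (u (i r)) (u (i r)))" for i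
  have V0: "V i \<ge> 0" for i unfolding V_def by (intro prod_nonneg) (auto simp: dot_def sum_nonneg)
  have Vi: "V i = (\<Prod>p\<in>i ` {..<q}. dot n (u p) (u p))" if "i \<in> ?I" for i
    unfolding V_def using offdiag_prod_image[OF that, of "\<lambda>p. dot n (u p) (u p)"] .
  have EUU: "(\<integral>x. U i x * U i' x \<partial>gauss n) = (if i ` {..<q} = i' ` {..<q} then V i else 0)"
    if "i \<in> ?I" "i' \<in> ?I" for i i'
    unfolding Ui[OF that(1)] Ui[OF that(2)] Vi[OF that(1)]
    by (rule expectation_prod_prod) (use im that u in auto)
  have EUH: "(\<integral>x. U i x * hermite q (lin n b x) \<partial>gauss n) = fact q * (\<Prod>r<q. dot n (u (i r)) b)"
    if "i \<in> ?I" for i b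
  proof -
    have cq: "card (i ` {..<q}) = q" using that by (simp add: offdiag_indices_def card_image)
    show ?thesis
      unfolding Ui[OF that] offdiag_prod_image[OF that, of "\<lambda>p. dot n (u p) b"]
      using expectation_prod_hermite[of "i ` {..<q}" n u b] cq im[OF that] u by simp
  qed
  have tH: "tame n (\<lambda>x. hermite q (lin n b x))" for b using gsmooth_tame(1)[OF gsmooth_hermite] .
  have F: "F x = (\<Sum>i\<in>?I. c i * U i x)" for x by (simp add: F_def U_def)
  have tF: "tame n F" unfolding F[abs_def] by (intro tame_sum tame_cmult tU)
  have tY: "tame n Y" unfolding Y_def by (intro tame_sum tame_cmult tH)
  have int: "integrable (gauss n) (\<lambda>x. F x * F x)" "integrable (gauss n) (\<lambda>x. F x * Y x)" "integrable (gauss n) (\<lambda>x. Y x * Y x)"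
    by (intro tame_integrable tame_mult tF tY)+
  have EFF: "(\<integral>x. F x * F x \<partial>gauss n) \<le> fact q * (\<Sum>i\<in>?I. (c i)\<^sup>2 * V i)"
  proof -
    have "(\<integral>x. F x * F x \<partial>gauss n) = (\<integral>x. (\<Sum>i\<in>?I. \<Sum>i'\<in>?I. c i * c i' * (U i x * U i' x)) \<partial>gauss n)"
      by (simp add: F sum_product mult_ac)
    also have "\<dots> = (\<Sum>i\<in>?I. \<Sum>i'\<in>?I. c i * c i' * (\<integral>x. U i x * U i' x \<partial>gauss n))"
      by (intro integral_sum_sum tame_integrable tame_mult tU tH)
    also have "\<dots> = (\<Sum>i\<in>?I. \<Sum>i'\<in>?I. c i * c i' * (if i ` {..<q} = i' ` {..<q} then V i else 0))"
      by (intro sum.cong refl) (simp add: EUU)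
    \<comment> \<open>Products \<open>c i * c i'\<close> within one image class are split by the
      arithmetic-geometric mean inequality, so each squared coefficient is counted once per member
      of its class.\<close>
    also have "\<dots> \<le> (\<Sum>i\<in>?I. \<Sum>i'\<in>?I. (if i ` {..<q} = i' ` {..<q} then (c i)\<^sup>2 * V i / 2 else 0)
        + (if i ` {..<q} = i' ` {..<q} then (c i')\<^sup>2 * V i' / 2 else 0))"
    proof (intro sum_mono)
      fix i i' assume i: "i \<in> ?I" "i' \<in> ?I"
      have "c i * c i' \<le> ((c i)\<^sup>2 + (c i')\<^sup>2) / 2"
        using sum_squares_bound[of "c i" "c i'"] by simp
      then have "c i * c i' * V i \<le> ((c i)\<^sup>2 + (c i')\<^sup>2) / 2 * V i" using V0 by (intro mult_right_mono)
      moreover have "V i = V i'" if "i ` {..<q} = i' ` {..<q}" using that i Vi by simp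
      ultimately show "c i * c i' * (if i ` {..<q} = i' ` {..<q} then V i else 0)
        \<le> (if i ` {..<q} = i' ` {..<q} then (c i)\<^sup>2 * V i / 2 else 0)
        + (if i ` {..<q} = i' ` {..<q} then (c i')\<^sup>2 * V i' / 2 else 0)"
        by (auto simp: algebra_simps add_divide_distrib)
    qed
    also have "\<dots> = (\<Sum>i\<in>?I. \<Sum>i'\<in>?I. (if i ` {..<q} = i' ` {..<q} then (c i)\<^sup>2 * V i / 2 else 0))
        + (\<Sum>i'\<in>?I. \<Sum>i\<in>?I. (if i ` {..<q} = i' ` {..<q} then (c i')\<^sup>2 * V i' / 2 else 0))"
      by (simp only: sum.distrib) (subst (3) sum.swap, simp)
    also have "(\<Sum>i'\<in>?I. \<Sum>i\<in>?I. (if i ` {..<q} = i' ` {..<q} then (c i')\<^sup>2 * V i' / 2 else 0)) =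
        (\<Sum>i\<in>?I. \<Sum>i'\<in>?I. (if i ` {..<q} = i' ` {..<q} then (c i)\<^sup>2 * V i / 2 else 0))"
      by (intro sum.cong refl) auto
    also have "(\<Sum>i\<in>?I. \<Sum>i'\<in>?I. (if i ` {..<q} = i' ` {..<q} then (c i)\<^sup>2 * V i / 2 else 0)) +
       (\<Sum>i\<in>?I. \<Sum>i'\<in>?I. (if i ` {..<q} = i' ` {..<q} then (c i)\<^sup>2 * V i / 2 else 0)) =
       (\<Sum>i\<in>?I. \<Sum>i'\<in>?I. (if i' ` {..<q} = i ` {..<q} then (c i)\<^sup>2 * V i else 0))"
      unfolding sum.distrib[symmetric] by (intro sum.cong refl) auto
    also have "\<dots> = (\<Sum>i\<in>?I. (c i)\<^sup>2 * V i * real (card {i' \<in> ?I. i' ` {..<q} = i ` {..<q}}))"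
      by (intro sum.cong refl) (simp add: sum.If_cases finite_offdiag_indices Int_def)
    also have "\<dots> \<le> (\<Sum>i\<in>?I. (c i)\<^sup>2 * V i * fact q)"
    proof (intro sum_mono mult_left_mono mult_nonneg_nonneg V0)
      fix i assume "i \<in> ?I"
      from card_offdiag_same_image[OF this]
      have "real (card {i' \<in> ?I. i' ` {..<q} = i ` {..<q}}) \<le> real (fact q)" by (rule of_nat_mono)
      then show "real (card {i' \<in> ?I. i' ` {..<q} = i ` {..<q}}) \<le> fact q" by simp
    qed auto
    finally show ?thesis by (simp add: sum_distrib_left mult_ac)
  qed
  have EFY: "(\<integral>x. F x * Y x \<partial>gauss n) = fact q * (\<Sum>i\<in>?I. \<Sum>j\<in>J. c i * w j * (\<Prod>r<q. dot n (u (i r)) (a j)))"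
  proof -
    have "(\<integral>x. F x * Y x \<partial>gauss n) = (\<integral>x. (\<Sum>i\<in>?I. \<Sum>j\<in>J. c i * w j * (U i x * hermite q (lin n (a j) x))) \<partial>gauss n)"
      by (simp add: F Y_def sum_product mult_ac)
    also have "\<dots> = (\<Sum>i\<in>?I. \<Sum>j\<in>J. c i * w j * (\<integral>x. U i x * hermite q (lin n (a j) x) \<partial>gauss n))"
      by (intro integral_sum_sum tame_integrable tame_mult tU tH)
    also have "\<dots> = (\<Sum>i\<in>?I. \<Sum>j\<in>J. c i * w j * (fact q * (\<Prod>r<q. dot n (u (i r)) (a j))))"
      by (intro sum.cong refl) (simp add: EUH)
    finally show ?thesis by (simp add: sum_distrib_left mult_ac)
  qed
  have EYY: "(\<integral>x. Y x * Y x \<partial>gauss n) = fact q * (\<Sum>j\<in>J. \<Sum>l\<in>J. w j * w l * dot n (a j) (a l) ^ q)"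
  proof -
    have "(\<integral>x. Y x * Y x \<partial>gauss n) = (\<integral>x. (\<Sum>j\<in>J. \<Sum>l\<in>J. w j * w l * (hermite q (lin n (a j) x) * hermite q (lin n (a l) x))) \<partial>gauss n)"
      by (simp add: Y_def sum_product mult_ac)
    also have "\<dots> = (\<Sum>j\<in>J. \<Sum>l\<in>J. w j * w l * (\<integral>x. hermite q (lin n (a j) x) * hermite q (lin n (a l) x) \<partial>gauss n))"
      by (intro integral_sum_sum tame_integrable tame_mult tU tH)
    also have "\<dots> = (\<Sum>j\<in>J. \<Sum>l\<in>J. w j * w l * (fact q * dot n (a j) (a l) ^ q))"
      by (intro sum.cong refl) (simp add: hermite_inner a)
    finally show ?thesis by (simp add: sum_distrib_left mult_ac)
  qed
  have "(\<integral>x. (F x - Y x)\<^sup>2 \<partial>gauss n) = (\<integral>x. F x * F x - 2 * (F x * Y x) + Y x * Y x \<partial>gauss n)"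
    by (simp add: power2_eq_square algebra_simps)
  also have "\<dots> = (\<integral>x. F x * F x \<partial>gauss n) - 2 * (\<integral>x. F x * Y x \<partial>gauss n) + (\<integral>x. Y x * Y x \<partial>gauss n)"
    using int by simp
  finally show ?thesis using EFF unfolding EFY EYY V_def by (simp add: algebra_simps)
qed

section \<open>Brownian increments and elementary integrals\<close>

definition normalized_increments :: "(real \<Rightarrow> 'a \<Rightarrow> real) \<Rightarrow> nat \<Rightarrow> (nat \<Rightarrow> real) \<Rightarrow> 'a \<Rightarrow> nat \<Rightarrow> real" where
  "normalized_increments B n \<sigma> \<omega> =
     (\<lambda>p\<in>{..<n}. (B (\<sigma> (Suc p)) \<omega> - B (\<sigma> p) \<omega>) / sqrt (\<sigma> (Suc p) - \<sigma> p))"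

lemma strict_mono_on_Suc: "strict_mono_on {..n} \<sigma> \<Longrightarrow> p < n \<Longrightarrow> \<sigma> p < \<sigma> (Suc p)" for \<sigma> :: "nat \<Rightarrow> real"
  by (auto simp: strict_mono_on_def)

context two_sided_brownian_motion
begin

text \<open>Gaussianity and independence of the Brownian increments enter here; moments of functions
  of finitely many increments can then be computed on \<open>gauss n\<close>.\<close>

lemma normalized_increments_law:
  assumes \<sigma>: "strict_mono_on {..n} \<sigma>" and n: "n > 0"
  shows "distr M (gauss n) (normalized_increments B n \<sigma>) = gauss n"
    and "normalized_increments B n \<sigma> \<in> measurable M (gauss n)"
proof -
  note measurable_B[measurable]
  let ?Y = "\<lambda>p \<omega>. (B (\<sigma> (Suc p)) \<omega> - B (\<sigma> p) \<omega>) / sqrt (\<sigma> (Suc p) - \<sigma> p)"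
  have ind: "indep_vars (\<lambda>_. borel) ?Y {..<n}"
    by (rule indep_vars_compose2[OF indep_increments[OF \<sigma>], of "\<lambda>p x. x / sqrt (\<sigma> (Suc p) - \<sigma> p)"]) auto
  have d: "distr M borel (?Y p) = N01" if "p < n" for p
  proof -
    have "\<sigma> p < \<sigma> (Suc p)" using strict_mono_on_Suc[OF \<sigma> that] .
    then have "distributed M lborel (?Y p) std_normal_density"
      using normal_standard_normal_convert[of "sqrt (\<sigma> (Suc p) - \<sigma> p)" "\<lambda>\<omega>. B (\<sigma> (Suc p)) \<omega> - B (\<sigma> p) \<omega>" 0]
        gaussian_increments[of "\<sigma> p" "\<sigma> (Suc p)"] by simp
    from distributed_distr_eq_density[OF this] show ?thesis
      using distr_cong[of M M borel lborel "?Y p" "?Y p"] by simp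
  qed
  have "distr M (\<Pi>\<^sub>M i\<in>{..<n}. borel) (\<lambda>\<omega>. \<lambda>i\<in>{..<n}. ?Y i \<omega>) = (\<Pi>\<^sub>M i\<in>{..<n}. distr M borel (?Y i))"
    using ind n by (subst indep_vars_iff_distr_eq_PiM'[symmetric]) auto
  also have "\<dots> = gauss n" unfolding gauss_def by (intro PiM_cong) (auto simp: d)
  finally have eq: "distr M (\<Pi>\<^sub>M i\<in>{..<n}. borel) (normalized_increments B n \<sigma>) = gauss n"
    by (simp add: normalized_increments_def[abs_def])
  show "distr M (gauss n) (normalized_increments B n \<sigma>) = gauss n"
    using eq distr_cong[of M M "gauss n" "\<Pi>\<^sub>M i\<in>{..<n}. borel"] sets_gauss[of n] by simp
  have "normalized_increments B n \<sigma> \<in> measurable M (\<Pi>\<^sub>M i\<in>{..<n}. borel)"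
    unfolding normalized_increments_def[abs_def] by measurable
  then show "normalized_increments B n \<sigma> \<in> measurable M (gauss n)"
    using measurable_cong_sets[OF refl sets_gauss, of M n] by simp
qed

end

text \<open>The coefficients of \<open>B t - B s\<close> with respect to the normalised increments
  over \<open>\<sigma>\<close>; this is meaningful when \<open>s\<close> and \<open>t\<close> are
  nodes.\<close>

definition inc_coeff :: "(nat \<Rightarrow> real) \<Rightarrow> real \<Rightarrow> real \<Rightarrow> nat \<Rightarrow> real" where
  "inc_coeff \<sigma> s t p = (if s \<le> \<sigma> p \<and> \<sigma> (Suc p) \<le> t then sqrt (\<sigma> (Suc p) - \<sigma> p) else 0)"

text \<open>Cells are selected by comparing their endpoints with \<open>s\<close> and
  \<open>t\<close> instead of by index; as both are nodes, the selected cells are consecutive and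
  the sum telescopes.\<close>

lemma telescope_partition:
  fixes g :: "real \<Rightarrow> real"
  assumes \<sigma>: "strict_mono_on {..n} \<sigma>" and st: "s \<in> \<sigma> ` {..n}" "t \<in> \<sigma> ` {..n}" "s \<le> t"
  shows "(\<Sum>p<n. if s \<le> \<sigma> p \<and> \<sigma> (Suc p) \<le> t then g (\<sigma> (Suc p)) - g (\<sigma> p) else 0) = g t - g s"
proof -
  obtain a b where ab: "a \<le> n" "b \<le> n" "s = \<sigma> a" "t = \<sigma> b" using st by auto
  have le: "\<sigma> i \<le> \<sigma> j \<longleftrightarrow> i \<le> j" if "i \<le> n" "j \<le> n" for i j
    using strict_mono_on_leD[OF \<sigma>] that strict_mono_onD[OF \<sigma>] by (metis atMost_iff leD linorder_le_cases not_le_imp_less)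
  have "a \<le> b" using st ab le by auto
  have "(\<Sum>p<n. if s \<le> \<sigma> p \<and> \<sigma> (Suc p) \<le> t then g (\<sigma> (Suc p)) - g (\<sigma> p) else 0) =
      (\<Sum>p<n. if p \<in> {a..<b} then g (\<sigma> (Suc p)) - g (\<sigma> p) else 0)"
    using ab le by (intro sum.cong refl if_cong) auto
  also have "\<dots> = (\<Sum>p\<in>{a..<b}. g (\<sigma> (Suc p)) - g (\<sigma> p))"
    using ab by (subst sum.inter_restrict[symmetric]) (auto intro!: sum.cong)
  also have "\<dots> = g t - g s" using sum_Suc_diff'[OF \<open>a \<le> b\<close>, of "\<lambda>p. g (\<sigma> p)"] ab by simp
  finally show ?thesis .
qed

lemma lin_inc_coeff:
  assumes \<sigma>: "strict_mono_on {..n} \<sigma>" and st: "s \<in> \<sigma> ` {..n}" "t \<in> \<sigma> ` {..n}" "s \<le> t"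
  shows "lin n (inc_coeff \<sigma> s t) (normalized_increments B n \<sigma> \<omega>) = B t \<omega> - B s \<omega>"
proof -
  have "lin n (inc_coeff \<sigma> s t) (normalized_increments B n \<sigma> \<omega>) =
     (\<Sum>p<n. if s \<le> \<sigma> p \<and> \<sigma> (Suc p) \<le> t then B (\<sigma> (Suc p)) \<omega> - B (\<sigma> p) \<omega> else 0)"
    unfolding lin_def using strict_mono_on_Suc[OF \<sigma>]
    by (intro sum.cong refl) (auto simp: inc_coeff_def normalized_increments_def dest!: strict_mono_on_Suc[OF \<sigma>])
  also have "\<dots> = B t \<omega> - B s \<omega>" using telescope_partition[OF \<sigma> st, of "\<lambda>t. B t \<omega>"] .
  finally show ?thesis .
qed

text \<open>The length of the intersection of \<open>{s<..t}\<close> and \<open>{s'<..t'}\<close>.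
  It is at once the covariance of the two Brownian increments and the inner product of the two
  indicators; this coincidence is the isometry.\<close>

definition overlap :: "real \<Rightarrow> real \<Rightarrow> real \<Rightarrow> real \<Rightarrow> real" where
  "overlap s t s' t' = max 0 (min t t' - max s s')"

lemma dot_inc_coeff:
  assumes \<sigma>: "strict_mono_on {..n} \<sigma>" and "s \<in> \<sigma> ` {..n}" "t \<in> \<sigma> ` {..n}" "s' \<in> \<sigma> ` {..n}" "t' \<in> \<sigma> ` {..n}"
  shows "dot n (inc_coeff \<sigma> s t) (inc_coeff \<sigma> s' t') = overlap s t s' t'"
proof -
  have "dot n (inc_coeff \<sigma> s t) (inc_coeff \<sigma> s' t') =
     (\<Sum>p<n. if max s s' \<le> \<sigma> p \<and> \<sigma> (Suc p) \<le> min t t' then \<sigma> (Suc p) - \<sigma> p else 0)"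
    unfolding dot_def
  proof (intro sum.cong refl)
    fix p assume "p \<in> {..<n}"
    then have "\<sigma> p < \<sigma> (Suc p)" using strict_mono_on_Suc[OF \<sigma>] by auto
    then show "inc_coeff \<sigma> s t p * inc_coeff \<sigma> s' t' p =
        (if max s s' \<le> \<sigma> p \<and> \<sigma> (Suc p) \<le> min t t' then \<sigma> (Suc p) - \<sigma> p else 0)"
      by (simp add: inc_coeff_def)
  qed
  also have "\<dots> = overlap s t s' t'"
  proof (cases "max s s' \<le> min t t'")
    case True
    then show ?thesis
      using telescope_partition[OF \<sigma>, of "max s s'" "min t t'" "\<lambda>x. x"] assms
      by (simp add: overlap_def max_def min_def split: if_splits)
  next
    case False
    have "\<not> (max s s' \<le> \<sigma> p \<and> \<sigma> (Suc p) \<le> min t t')" if "p < n" for p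
      using False strict_mono_on_Suc[OF \<sigma> that] by linarith
    then have "(\<Sum>p<n. if max s s' \<le> \<sigma> p \<and> \<sigma> (Suc p) \<le> min t t' then \<sigma> (Suc p) - \<sigma> p else 0) = (\<Sum>p<n. 0)"
      by (intro sum.cong refl) auto
    moreover have "overlap s t s' t' = 0" unfolding overlap_def using False by linarith
    ultimately show ?thesis by simp
  qed
  finally show ?thesis .
qed

lemma overlap_self: "s \<le> t \<Longrightarrow> overlap s t s t = t - s"
  by (simp add: overlap_def)

lemma overlap_cells:
  assumes \<sigma>: "strict_mono_on {..n} \<sigma>" and "p < n" "p' < n" "p \<noteq> p'"
  shows "overlap (\<sigma> p) (\<sigma> (Suc p)) (\<sigma> p') (\<sigma> (Suc p')) = 0"
proof -
  have "\<sigma> (Suc p) \<le> \<sigma> p' \<or> \<sigma> (Suc p') \<le> \<sigma> p"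
    using assms strict_mono_on_leD[OF \<sigma>, of "Suc p" p'] strict_mono_on_leD[OF \<sigma>, of "Suc p'" p]
    by (cases "Suc p \<le> p'") auto
  then show ?thesis by (auto simp: overlap_def)
qed

lemma integral_overlap:
  assumes "s \<le> t" "s' \<le> t'"
  shows "integrable lborel (\<lambda>x. indicator {s<..t} x * indicator {s'<..t'} x :: real)"
    "(\<integral>x. indicator {s<..t} x * indicator {s'<..t'} x \<partial>lborel) = overlap s t s' t'"
proof -
  have eq: "(\<lambda>x. indicator {s<..t} x * indicator {s'<..t'} x :: real) = indicator {max s s'<..min t t'}"
    by (auto split: split_indicator simp: fun_eq_iff)
  show "integrable lborel (\<lambda>x. indicator {s<..t} x * indicator {s'<..t'} x :: real)"
    unfolding eq by (cases "max s s' \<le> min t t'") (auto intro!: integrable_real_indicator)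
  show "(\<integral>x. indicator {s<..t} x * indicator {s'<..t'} x \<partial>lborel) = overlap s t s' t'"
    unfolding eq by (cases "max s s' \<le> min t t'") (auto simp: overlap_def)
qed

lemma exists_partition:
  assumes "finite S" "S \<noteq> {}"
  obtains n and \<sigma> :: "nat \<Rightarrow> real" where "strict_mono_on {..n} \<sigma>" "\<sigma> ` {..n} = S" "Suc n = card S"
proof -
  let ?l = "sorted_list_of_set S"
  define n where "n = card S - 1"
  have len: "length ?l = Suc n" using assms by (simp add: n_def card_gt_0_iff)
  have "strict_mono_on {..n} (\<lambda>p. ?l ! p)"
    using strict_sorted_list_of_set[of S] len by (intro strict_mono_onI) (auto simp: sorted_wrt_iff_nth_less)
  moreover have "(\<lambda>p. ?l ! p) ` {..n} = S"
  proof -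
    have "(\<lambda>p. ?l ! p) ` {..n} = set ?l"
      using len by (auto simp: set_conv_nth)
    then show ?thesis using assms by simp
  qed
  moreover have "Suc n = card S" using len assms by simp
  ultimately show ?thesis using that by blast
qed

section \<open>Step functions and their stochastic integrals\<close>

definition step_fun :: "nat \<Rightarrow> (nat \<Rightarrow> real) \<Rightarrow> (nat \<Rightarrow> real) \<Rightarrow> real \<Rightarrow> real" where
  "step_fun m \<sigma> a x = (\<Sum>i<m. a i * indicator {\<sigma> i<..\<sigma> (Suc i)} x)"

definition step_integral :: "(real \<Rightarrow> 'a \<Rightarrow> real) \<Rightarrow> nat \<Rightarrow> (nat \<Rightarrow> real) \<Rightarrow> (nat \<Rightarrow> real) \<Rightarrow> 'a \<Rightarrow> real" where
  "step_integral B m \<sigma> a \<omega> = (\<Sum>i<m. a i * (B (\<sigma> (Suc i)) \<omega> - B (\<sigma> i) \<omega>))"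

definition step_inner :: "nat \<Rightarrow> (nat \<Rightarrow> real) \<Rightarrow> (nat \<Rightarrow> real) \<Rightarrow> (nat \<Rightarrow> real) \<Rightarrow> real" where
  "step_inner m \<sigma> a b = (\<Sum>i<m. a i * b i * (\<sigma> (Suc i) - \<sigma> i))"

lemma step_fun_measurable [measurable]: "step_fun m \<sigma> a \<in> borel_measurable borel"
  unfolding step_fun_def by measurable

lemma step_fun_indicator:
  assumes "strict_mono_on {..m} \<sigma>" "s \<le> t"
  shows "integrable lborel (\<lambda>x. indicator {s<..t} x * step_fun m \<sigma> a x)"
    "(\<integral>x. indicator {s<..t} x * step_fun m \<sigma> a x \<partial>lborel) =
       (\<Sum>i<m. a i * overlap s t (\<sigma> i) (\<sigma> (Suc i)))"
proof -
  have eq: "indicator {s<..t} x * step_fun m \<sigma> a x =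
      (\<Sum>i<m. a i * (indicator {s<..t} x * indicator {\<sigma> i<..\<sigma> (Suc i)} x))" for x
    unfolding step_fun_def sum_distrib_left by (intro sum.cong refl) (simp only: mult_ac)
  have le: "\<sigma> i \<le> \<sigma> (Suc i)" if "i < m" for i using strict_mono_on_Suc[OF assms(1) that] by simp
  show "integrable lborel (\<lambda>x. indicator {s<..t} x * step_fun m \<sigma> a x)"
    unfolding eq by (intro Bochner_Integration.integrable_sum integrable_mult_right integral_overlap assms le) auto
  show "(\<integral>x. indicator {s<..t} x * step_fun m \<sigma> a x \<partial>lborel) =
       (\<Sum>i<m. a i * overlap s t (\<sigma> i) (\<sigma> (Suc i)))"
    unfolding eq using assms(2) le
    by (subst Bochner_Integration.integral_sum) (auto simp: integral_overlap intro!: integral_overlap)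
qed

lemma step_fun_product:
  assumes "strict_mono_on {..m} \<sigma>"
  shows "integrable lborel (\<lambda>x. step_fun m \<sigma> a x * step_fun m \<sigma> b x)"
    "(\<integral>x. step_fun m \<sigma> a x * step_fun m \<sigma> b x \<partial>lborel) = step_inner m \<sigma> a b"
proof -
  have eq: "step_fun m \<sigma> a x * step_fun m \<sigma> b x =
      (\<Sum>i<m. a i * (indicator {\<sigma> i<..\<sigma> (Suc i)} x * step_fun m \<sigma> b x))" for x
    unfolding step_fun_def[of m \<sigma> a] sum_distrib_right by (intro sum.cong refl) (simp only: mult_ac)
  have le: "\<sigma> i \<le> \<sigma> (Suc i)" if "i < m" for i using strict_mono_on_Suc[OF assms(1) that] by simp
  show "integrable lborel (\<lambda>x. step_fun m \<sigma> a x * step_fun m \<sigma> b x)"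
    unfolding eq by (intro Bochner_Integration.integrable_sum integrable_mult_right step_fun_indicator assms le) auto
  have "(\<integral>x. step_fun m \<sigma> a x * step_fun m \<sigma> b x \<partial>lborel) =
      (\<Sum>i<m. a i * (\<Sum>i'<m. b i' * overlap (\<sigma> i) (\<sigma> (Suc i)) (\<sigma> i') (\<sigma> (Suc i'))))"
    unfolding eq using le assms
    by (subst Bochner_Integration.integral_sum) (auto simp: step_fun_indicator intro!: step_fun_indicator)
  also have "\<dots> = (\<Sum>i<m. a i * (b i * (\<sigma> (Suc i) - \<sigma> i)))"
  proof (intro sum.cong refl arg_cong[where f="\<lambda>z. _ * z"])
    fix i assume i: "i \<in> {..<m}"
    have "(\<Sum>i'<m. b i' * overlap (\<sigma> i) (\<sigma> (Suc i)) (\<sigma> i') (\<sigma> (Suc i'))) =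
        (\<Sum>i'<m. if i' = i then b i * (\<sigma> (Suc i) - \<sigma> i) else 0)"
      using i overlap_cells[OF assms] le by (intro sum.cong refl) (auto simp: overlap_self)
    then show "(\<Sum>i'<m. b i' * overlap (\<sigma> i) (\<sigma> (Suc i)) (\<sigma> i') (\<sigma> (Suc i'))) = b i * (\<sigma> (Suc i) - \<sigma> i)"
      using i by simp
  qed
  finally show "(\<integral>x. step_fun m \<sigma> a x * step_fun m \<sigma> b x \<partial>lborel) = step_inner m \<sigma> a b"
    by (simp add: step_inner_def mult_ac)
qed

section \<open>Tensor products and the isometry\<close>

interpretation lborel_factors: product_sigma_finite "\<lambda>_::nat. lborel :: real measure"
  by unfold_locales

lemma integral_tensor:
  fixes f g :: "nat \<Rightarrow> real \<Rightarrow> real"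
  assumes "\<And>r. r < q \<Longrightarrow> integrable lborel (\<lambda>x. f r x * g r x)"
  shows "integrable (\<Pi>\<^sub>M r\<in>{..<q}. lborel) (\<lambda>x. (\<Prod>r<q. f r (x r)) * (\<Prod>r<q. g r (x r)) :: real)"
    "(\<integral>x. (\<Prod>r<q. f r (x r)) * (\<Prod>r<q. g r (x r)) \<partial>(\<Pi>\<^sub>M r\<in>{..<q}. lborel)) =
      (\<Prod>r<q. \<integral>x. f r x * g r x \<partial>lborel)"
proof -
  show "integrable (\<Pi>\<^sub>M r\<in>{..<q}. lborel) (\<lambda>x. (\<Prod>r<q. f r (x r)) * (\<Prod>r<q. g r (x r)) :: real)"
    unfolding prod.distrib[symmetric]
    by (rule lborel_factors.product_integrable_prod[of "{..<q}" "\<lambda>r x. f r x * g r x"]) (use assms in auto)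
  show "(\<integral>x. (\<Prod>r<q. f r (x r)) * (\<Prod>r<q. g r (x r)) \<partial>(\<Pi>\<^sub>M r\<in>{..<q}. lborel)) =
      (\<Prod>r<q. \<integral>x. f r x * g r x \<partial>lborel)"
    unfolding prod.distrib[symmetric]
    by (rule lborel_factors.product_integral_prod[of "{..<q}" "\<lambda>r x. f r x * g r x"]) (use assms in auto)
qed

text \<open>Boxes with different multi-indices are disjoint and all integrals factor over the
  coordinates, so the square expands exactly. The form of the result matches the bracket in
  \<open>chaos_distance_bound\<close> term by term.\<close>

lemma kernel_distance:
  fixes q :: nat and c :: "(nat \<Rightarrow> nat) \<Rightarrow> real" and a :: "'j \<Rightarrow> nat \<Rightarrow> real" and w :: "'j \<Rightarrow> real" and J :: "'j set"
  assumes \<tau>: "strict_mono_on {..n} \<tau>" and \<sigma>: "strict_mono_on {..m} \<sigma>"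
  defines "e \<equiv> elementary_fun q n \<tau> c"
    and "g \<equiv> \<lambda>x. \<Sum>j\<in>J. w j * (\<Prod>r<q. step_fun m \<sigma> (a j) (x r))"
  shows "integrable (\<Pi>\<^sub>M r\<in>{..<q}. lborel) (\<lambda>x. (e x - g x)\<^sup>2)"
    "(\<integral>x. (e x - g x)\<^sup>2 \<partial>(\<Pi>\<^sub>M r\<in>{..<q}. lborel)) =
     (\<Sum>i\<in>offdiag_indices q n. (c i)\<^sup>2 * (\<Prod>r<q. \<tau> (Suc (i r)) - \<tau> (i r)))
     - 2 * (\<Sum>i\<in>offdiag_indices q n. \<Sum>j\<in>J. c i * w j *
          (\<Prod>r<q. \<Sum>k<m. a j k * overlap (\<tau> (i r)) (\<tau> (Suc (i r))) (\<sigma> k) (\<sigma> (Suc k))))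
     + (\<Sum>j\<in>J. \<Sum>l\<in>J. w j * w l * step_inner m \<sigma> (a j) (a l) ^ q)"
proof -
  let ?P = "\<Pi>\<^sub>M r\<in>{..<q}. lborel :: real measure" and ?I = "offdiag_indices q n"
  define E where "E i x = (\<Prod>r<q. indicator {\<tau> (i r)<..\<tau> (Suc (i r))} (x r) :: real)" for i x
  define H where "H j x = (\<Prod>r<q. step_fun m \<sigma> (a j) (x r))" for j x
  have le: "\<tau> (i r) \<le> \<tau> (Suc (i r))" if "i \<in> ?I" "r < q" for i r
  proof -
    have "i \<in> {..<q} \<rightarrow>\<^sub>E {..<n}" using that(1) unfolding offdiag_indices_def by blast
    then have "i r < n" using that(2) PiE_mem[of i "{..<q}" "\<lambda>_. {..<n}" r] by simp
    then show ?thesis by (rule less_imp_le[OF strict_mono_on_Suc[OF \<tau>]])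
  qed
  define ind where "ind i r x = (indicator {\<tau> (i r)<..\<tau> (Suc (i r))} x :: real)" for i :: "nat \<Rightarrow> nat" and r and x :: real
  have E_ind: "E i x = (\<Prod>r<q. ind i r (x r))" for i x by (simp add: E_def ind_def)
  have ind_ind: "integrable lborel (\<lambda>x. ind i r x * ind i' r x)"
    "(\<integral>x. ind i r x * ind i' r x \<partial>lborel) = overlap (\<tau> (i r)) (\<tau> (Suc (i r))) (\<tau> (i' r)) (\<tau> (Suc (i' r)))"
    if "i \<in> ?I" "i' \<in> ?I" "r < q" for i i' r
    using integral_overlap[OF le[OF that(1,3)] le[OF that(2,3)]] by (simp_all add: ind_def)
  have ind_step: "integrable lborel (\<lambda>x. ind i r x * step_fun m \<sigma> b x)"
    "(\<integral>x. ind i r x * step_fun m \<sigma> b x \<partial>lborel) = (\<Sum>k<m. b k * overlap (\<tau> (i r)) (\<tau> (Suc (i r))) (\<sigma> k) (\<sigma> (Suc k)))"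
    if "i \<in> ?I" "r < q" for i r b
    using step_fun_indicator[OF \<sigma> le[OF that]] by (simp_all add: ind_def)
  have iEE: "integrable ?P (\<lambda>x. E i x * E i' x)" if "i \<in> ?I" "i' \<in> ?I" for i i'
    unfolding E_ind by (rule integral_tensor(1)[of q "ind i" "ind i'"]) (rule ind_ind(1)[OF that])
  have EE: "(\<integral>x. E i x * E i' x \<partial>?P) = (if i = i' then \<Prod>r<q. \<tau> (Suc (i r)) - \<tau> (i r) else 0)" if "i \<in> ?I" "i' \<in> ?I" for i i'
  proof -
    have "(\<integral>x. E i x * E i' x \<partial>?P) = (\<Prod>r<q. overlap (\<tau> (i r)) (\<tau> (Suc (i r))) (\<tau> (i' r)) (\<tau> (Suc (i' r))))"
      unfolding E_ind using integral_tensor(2)[of q "ind i" "ind i'"] ind_ind[OF that] by simp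
    also have "\<dots> = (if i = i' then \<Prod>r<q. \<tau> (Suc (i r)) - \<tau> (i r) else 0)"
    proof (cases "i = i'")
      case True
      then show ?thesis using that le by (auto intro!: prod.cong overlap_self)
    next
      case False
      have "i \<in> {..<q} \<rightarrow>\<^sub>E {..<n}" "i' \<in> {..<q} \<rightarrow>\<^sub>E {..<n}"
        using that by (auto simp: offdiag_indices_def)
      moreover from this have "\<exists>r<q. i r \<noteq> i' r" using False PiE_ext[of i "{..<q}" "\<lambda>_. {..<n}" i'] by blast
      ultimately obtain r where r: "r < q" "i r \<noteq> i' r" "i r < n" "i' r < n" by auto
      then have "overlap (\<tau> (i r)) (\<tau> (Suc (i r))) (\<tau> (i' r)) (\<tau> (Suc (i' r))) = 0"
        by (intro overlap_cells[OF \<tau>])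
      then show ?thesis using r False by (auto intro!: prod_zero)
    qed
    finally show ?thesis .
  qed
  have iEH: "integrable ?P (\<lambda>x. E i x * H j x)" if "i \<in> ?I" for i j
    unfolding E_ind H_def by (rule integral_tensor(1)[of q "ind i" "\<lambda>_. step_fun m \<sigma> (a j)"]) (rule ind_step(1)[OF that])
  have EH: "(\<integral>x. E i x * H j x \<partial>?P) = (\<Prod>r<q. \<Sum>k<m. a j k * overlap (\<tau> (i r)) (\<tau> (Suc (i r))) (\<sigma> k) (\<sigma> (Suc k)))"
    if "i \<in> ?I" for i j
    unfolding E_ind H_def using integral_tensor(2)[of q "ind i" "\<lambda>_. step_fun m \<sigma> (a j)"] ind_step[OF that] by simp
  have iHH: "integrable ?P (\<lambda>x. H j x * H l x)" for j l
    unfolding H_def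
    by (rule integral_tensor(1)[of q "\<lambda>_. step_fun m \<sigma> (a j)" "\<lambda>_. step_fun m \<sigma> (a l)"]) (rule step_fun_product(1)[OF \<sigma>])
  have HH: "(\<integral>x. H j x * H l x \<partial>?P) = step_inner m \<sigma> (a j) (a l) ^ q" for j l
    unfolding H_def
    using integral_tensor(2)[of q "\<lambda>_. step_fun m \<sigma> (a j)" "\<lambda>_. step_fun m \<sigma> (a l)"] step_fun_product[OF \<sigma>]
    by simp
  have e: "e x = (\<Sum>i\<in>?I. c i * E i x)" for x by (simp add: e_def elementary_fun_def E_def)
  have g: "g x = (\<Sum>j\<in>J. w j * H j x)" for x by (simp add: g_def H_def)
  have ee: "e x * e x = (\<Sum>i\<in>?I. \<Sum>i'\<in>?I. (c i * c i') * (E i x * E i' x))" for x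
    unfolding e sum_product by (intro sum.cong refl) (simp only: mult_ac)
  have eg: "e x * g x = (\<Sum>i\<in>?I. \<Sum>j\<in>J. (c i * w j) * (E i x * H j x))" for x
    unfolding e g sum_product by (intro sum.cong refl) (simp only: mult_ac)
  have gg: "g x * g x = (\<Sum>i\<in>J. \<Sum>j\<in>J. (w i * w j) * (H i x * H j x))" for x
    unfolding g sum_product by (intro sum.cong refl) (simp only: mult_ac)
  have int: "integrable ?P (\<lambda>x. e x * e x)" "integrable ?P (\<lambda>x. e x * g x)" "integrable ?P (\<lambda>x. g x * g x)"
    unfolding ee eg gg by (intro Bochner_Integration.integrable_sum integrable_mult_right iEE iEH iHH; assumption)+
  have sq: "(e x - g x)\<^sup>2 = e x * e x - 2 * (e x * g x) + g x * g x" for x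
    by (simp add: power2_eq_square algebra_simps)
  show "integrable ?P (\<lambda>x. (e x - g x)\<^sup>2)" unfolding sq using int by simp
  have Iee: "(\<integral>x. e x * e x \<partial>?P) = (\<Sum>i\<in>?I. (c i)\<^sup>2 * (\<Prod>r<q. \<tau> (Suc (i r)) - \<tau> (i r)))"
  proof -
    have "(\<integral>x. e x * e x \<partial>?P) = (\<Sum>i\<in>?I. \<Sum>i'\<in>?I. (c i * c i') * (\<integral>x. E i x * E i' x \<partial>?P))"
      unfolding ee by (intro integral_sum_sum iEE)
    also have "\<dots> = (\<Sum>i\<in>?I. \<Sum>i'\<in>?I. if i = i' then (c i)\<^sup>2 * (\<Prod>r<q. \<tau> (Suc (i r)) - \<tau> (i r)) else 0)"
      by (intro sum.cong refl) (auto simp: EE power2_eq_square)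
    also have "\<dots> = (\<Sum>i\<in>?I. (c i)\<^sup>2 * (\<Prod>r<q. \<tau> (Suc (i r)) - \<tau> (i r)))"
      by (intro sum.cong refl) (simp add: finite_offdiag_indices)
    finally show ?thesis .
  qed
  have Ieg: "(\<integral>x. e x * g x \<partial>?P) = (\<Sum>i\<in>?I. \<Sum>j\<in>J. (c i * w j) * (\<Prod>r<q. \<Sum>k<m. a j k * overlap (\<tau> (i r)) (\<tau> (Suc (i r))) (\<sigma> k) (\<sigma> (Suc k))))"
    unfolding eg by (subst integral_sum_sum) (auto intro!: iEH sum.cong simp: EH)
  have Igg: "(\<integral>x. g x * g x \<partial>?P) = (\<Sum>j\<in>J. \<Sum>l\<in>J. w j * w l * step_inner m \<sigma> (a j) (a l) ^ q)"
    unfolding gg by (subst integral_sum_sum) (auto intro!: iHH sum.cong simp: HH)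
  show "(\<integral>x. (e x - g x)\<^sup>2 \<partial>?P) = (\<Sum>i\<in>offdiag_indices q n. (c i)\<^sup>2 * (\<Prod>r<q. \<tau> (Suc (i r)) - \<tau> (i r)))
     - 2 * (\<Sum>i\<in>offdiag_indices q n. \<Sum>j\<in>J. c i * w j *
          (\<Prod>r<q. \<Sum>k<m. a j k * overlap (\<tau> (i r)) (\<tau> (Suc (i r))) (\<sigma> k) (\<sigma> (Suc k))))
     + (\<Sum>j\<in>J. \<Sum>l\<in>J. w j * w l * step_inner m \<sigma> (a j) (a l) ^ q)"
    unfolding sq Iee[symmetric] Ieg[symmetric] Igg[symmetric] using int by simp
qed

lemma dot_sum_right: "dot n b (\<lambda>p. \<Sum>k\<in>K. c k * d k p) = (\<Sum>k\<in>K. c k * dot n b (d k))"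
  unfolding dot_def sum_distrib_left by (subst sum.swap) (simp add: mult_ac)

context two_sided_brownian_motion
begin

text \<open>Normalising an increment to variance 1 moves the square root of the cell length into the
  coefficients, which turns the weighted inner product into \<open>dot\<close>.\<close>

lemma step_integral_law:
  assumes \<sigma>: "strict_mono_on {..m} \<sigma>" and m: "m > 0"
  shows "\<exists>b. (\<forall>j l. dot m (b j) (b l) = step_inner m \<sigma> (a j) (a l)) \<and>
    (\<forall>j \<omega>. step_integral B m \<sigma> (a j) \<omega> = lin m (b j) (normalized_increments B m \<sigma> \<omega>))"
proof (intro exI conjI allI)
  let ?b = "\<lambda>j i. a j i * sqrt (\<sigma> (Suc i) - \<sigma> i)"
  show "dot m (?b j) (?b l) = step_inner m \<sigma> (a j) (a l)" for j l
    unfolding dot_def step_inner_def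
    by (intro sum.cong refl) (auto dest!: strict_mono_on_Suc[OF \<sigma>] simp: algebra_simps)
  show "step_integral B m \<sigma> (a j) \<omega> = lin m (?b j) (normalized_increments B m \<sigma> \<omega>)" for j \<omega>
    unfolding lin_def step_integral_def
    by (intro sum.cong refl) (auto dest!: strict_mono_on_Suc[OF \<sigma>] simp: normalized_increments_def)
qed

text \<open>On a common refinement both integrals are functions of one Gaussian vector, and the
  bracket of \<open>chaos_distance_bound\<close> becomes the kernel distance. The unit norm lets
  \<open>hermite q\<close> of a step integral stand for the integral of a tensor power; since only
  moments are compared, the tensor power never has to be approximated off the diagonals.\<close>

lemma wiener_distance:
  fixes q :: nat and c :: "(nat \<Rightarrow> nat) \<Rightarrow> real" and a :: "'j \<Rightarrow> nat \<Rightarrow> real" and w :: "'j \<Rightarrow> real" and J :: "'j set"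
  assumes \<tau>: "strict_mono_on {..n} \<tau>" and \<sigma>: "strict_mono_on {..m} \<sigma>" and m: "m > 0"
    and a: "\<And>j. j \<in> J \<Longrightarrow> step_inner m \<sigma> (a j) (a j) = 1"
  shows "(\<integral>\<^sup>+\<omega>. ennreal ((elementary_integral B q n \<tau> c \<omega> - (\<Sum>j\<in>J. w j * hermite q (step_integral B m \<sigma> (a j) \<omega>)))\<^sup>2) \<partial>M)
    \<le> ennreal (fact q) * (\<integral>\<^sup>+x. ennreal ((elementary_fun q n \<tau> c x - (\<Sum>j\<in>J. w j * (\<Prod>r<q. step_fun m \<sigma> (a j) (x r))))\<^sup>2) \<partial>(\<Pi>\<^sub>M r\<in>{..<q}. lborel))"
proof -
  \<comment> \<open>The nodes of both partitions together, so that increments over cells of either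
    one are sums over cells of the refinement.\<close>
  let ?S = "\<tau> ` {..n} \<union> \<sigma> ` {..m}"
  obtain N \<rho> where \<rho>: "strict_mono_on {..N} \<rho>" "\<rho> ` {..N} = ?S" "Suc N = card ?S"
    using exists_partition[of ?S] by auto
  \<comment> \<open>\<open>\<sigma>\<close> has two distinct nodes because \<open>m > 0\<close>, so
    the refinement has at least one cell.\<close>
  have "N > 0"
  proof (rule ccontr)
    assume "\<not> N > 0"
    moreover have "\<sigma> 0 \<in> \<rho> ` {..N}" "\<sigma> 1 \<in> \<rho> ` {..N}" unfolding \<rho>(2) using m by auto
    ultimately have "\<sigma> 1 = \<sigma> 0" by auto
    then show False using strict_mono_on_Suc[OF \<sigma> m] by simp
  qed
  let ?\<xi> = "normalized_increments B N \<rho>"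
  note law = normalized_increments_law[OF \<rho>(1) \<open>N > 0\<close>]
  define u where "u p = inc_coeff \<rho> (\<tau> p) (\<tau> (Suc p))" for p
  define v where "v k = inc_coeff \<rho> (\<sigma> k) (\<sigma> (Suc k))" for k
  define b where "b j p = (\<Sum>k<m. a j k * v k p)" for j p
  have mem: "p < n \<Longrightarrow> \<tau> p \<in> \<rho> ` {..N} \<and> \<tau> (Suc p) \<in> \<rho> ` {..N}" "k < m \<Longrightarrow> \<sigma> k \<in> \<rho> ` {..N} \<and> \<sigma> (Suc k) \<in> \<rho> ` {..N}" for p k
    unfolding \<rho>(2) by auto
  have le: "p < n \<Longrightarrow> \<tau> p \<le> \<tau> (Suc p)" "k < m \<Longrightarrow> \<sigma> k \<le> \<sigma> (Suc k)" for p k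
    using strict_mono_on_Suc[OF \<tau>] strict_mono_on_Suc[OF \<sigma>] less_imp_le by blast+
  have uu: "dot N (u p) (u p') = (if p = p' then \<tau> (Suc p) - \<tau> p else 0)" if "p < n" "p' < n" for p p'
    unfolding u_def using that mem le overlap_cells[OF \<tau>] by (subst dot_inc_coeff[OF \<rho>(1)]) (auto simp: overlap_self)
  have vv: "dot N (v k) (v k') = (if k = k' then \<sigma> (Suc k) - \<sigma> k else 0)" if "k < m" "k' < m" for k k'
    unfolding v_def using that mem le overlap_cells[OF \<sigma>] by (subst dot_inc_coeff[OF \<rho>(1)]) (auto simp: overlap_self)
  have uv: "dot N (u p) (v k) = overlap (\<tau> p) (\<tau> (Suc p)) (\<sigma> k) (\<sigma> (Suc k))" if "p < n" "k < m" for p k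
    unfolding u_def v_def using that mem by (subst dot_inc_coeff[OF \<rho>(1)]) auto
  have ub: "dot N (u p) (b j) = (\<Sum>k<m. a j k * overlap (\<tau> p) (\<tau> (Suc p)) (\<sigma> k) (\<sigma> (Suc k)))" if "p < n" for p j
    unfolding b_def[abs_def] dot_sum_right using that by (intro sum.cong refl) (auto simp: uv)
  have bb: "dot N (b j) (b l) = step_inner m \<sigma> (a j) (a l)" for j l
  proof -
    have vb: "dot N (v k) (b l) = a l k * (\<sigma> (Suc k) - \<sigma> k)" if "k < m" for k
    proof -
      have "dot N (v k) (b l) = (\<Sum>k'<m. if k' = k then a l k * (\<sigma> (Suc k) - \<sigma> k) else 0)"
        unfolding b_def[abs_def] dot_sum_right using that by (intro sum.cong refl) (auto simp: vv)
      then show ?thesis using that by simp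
    qed
    have "dot N (b j) (b l) = dot N (b l) (b j)" by (rule dot_commute)
    also have "\<dots> = (\<Sum>k<m. a j k * dot N (b l) (v k))" unfolding b_def[of j, abs_def] by (rule dot_sum_right)
    also have "\<dots> = step_inner m \<sigma> (a j) (a l)"
      unfolding step_inner_def by (intro sum.cong refl) (simp add: vb dot_commute[of N "b l"])
    finally show ?thesis .
  qed
  define F where "F x = (\<Sum>i\<in>offdiag_indices q n. c i * (\<Prod>r<q. lin N (u (i r)) x))" for x
  define Y where "Y x = (\<Sum>j\<in>J. w j * hermite q (lin N (b j) x))" for x
  have le2: "(\<integral>x. (F x - Y x)\<^sup>2 \<partial>gauss N) \<le> fact q *
      (\<integral>x. (elementary_fun q n \<tau> c x - (\<Sum>j\<in>J. w j * (\<Prod>r<q. step_fun m \<sigma> (a j) (x r))))\<^sup>2 \<partial>(\<Pi>\<^sub>M r\<in>{..<q}. lborel))"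
  proof -
    have "(\<integral>x. (F x - Y x)\<^sup>2 \<partial>gauss N) \<le> fact q *
    ((\<Sum>i\<in>offdiag_indices q n. (c i)\<^sup>2 * (\<Prod>r<q. dot N (u (i r)) (u (i r))))
     - 2 * (\<Sum>i\<in>offdiag_indices q n. \<Sum>j\<in>J. c i * w j * (\<Prod>r<q. dot N (u (i r)) (b j)))
     + (\<Sum>j\<in>J. \<Sum>l\<in>J. w j * w l * dot N (b j) (b l) ^ q))"
      unfolding F_def Y_def by (rule chaos_distance_bound[where m=n]) (auto simp: uu bb a)
    also have "(\<Sum>i\<in>offdiag_indices q n. (c i)\<^sup>2 * (\<Prod>r<q. dot N (u (i r)) (u (i r)))) =
      (\<Sum>i\<in>offdiag_indices q n. (c i)\<^sup>2 * (\<Prod>r<q. \<tau> (Suc (i r)) - \<tau> (i r)))"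
      by (intro sum.cong refl arg_cong[where f="\<lambda>z. _ * z"] prod.cong) (auto simp: uu offdiag_indices_def PiE_def Pi_def)
    also have "(\<Sum>i\<in>offdiag_indices q n. \<Sum>j\<in>J. c i * w j * (\<Prod>r<q. dot N (u (i r)) (b j))) =
      (\<Sum>i\<in>offdiag_indices q n. \<Sum>j\<in>J. c i * w j * (\<Prod>r<q. \<Sum>k<m. a j k * overlap (\<tau> (i r)) (\<tau> (Suc (i r))) (\<sigma> k) (\<sigma> (Suc k))))"
      by (intro sum.cong refl arg_cong[where f="\<lambda>z. _ * z"] prod.cong) (auto simp: ub offdiag_indices_def PiE_def Pi_def)
    finally show ?thesis unfolding bb kernel_distance(2)[OF \<tau> \<sigma>] .
  qed
  have Fe: "elementary_integral B q n \<tau> c \<omega> = F (?\<xi> \<omega>)" for \<omega>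
    unfolding elementary_integral_def F_def
  proof (intro sum.cong refl arg_cong[where f="\<lambda>z. _ * z"] prod.cong)
    fix i r assume "i \<in> offdiag_indices q n" "r \<in> {..<q}"
    then have "i r < n" by (auto simp: offdiag_indices_def)
    then show "B (\<tau> (Suc (i r))) \<omega> - B (\<tau> (i r)) \<omega> = lin N (u (i r)) (?\<xi> \<omega>)"
      unfolding u_def using mem le by (subst lin_inc_coeff[OF \<rho>(1)]) auto
  qed
  have "step_integral B m \<sigma> (a j) \<omega> = lin N (b j) (?\<xi> \<omega>)" for j \<omega>
  proof -
    have "lin N (b j) (?\<xi> \<omega>) = (\<Sum>k<m. a j k * lin N (v k) (?\<xi> \<omega>))"
      unfolding lin_def b_def sum_distrib_left sum_distrib_right by (subst sum.swap) (simp add: mult_ac)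
    also have "\<dots> = step_integral B m \<sigma> (a j) \<omega>"
      unfolding step_integral_def
    proof (intro sum.cong refl arg_cong[where f="\<lambda>z. _ * z"])
      fix k assume "k \<in> {..<m}"
      then show "lin N (v k) (?\<xi> \<omega>) = B (\<sigma> (Suc k)) \<omega> - B (\<sigma> k) \<omega>"
        unfolding v_def using mem le by (subst lin_inc_coeff[OF \<rho>(1)]) auto
    qed
    finally show ?thesis by simp
  qed
  then have Ye: "(\<Sum>j\<in>J. w j * hermite q (step_integral B m \<sigma> (a j) \<omega>)) = Y (?\<xi> \<omega>)" for \<omega>
    by (simp add: Y_def)
  have tF: "tame N F" unfolding F_def[abs_def]
  proof (intro tame_sum tame_cmult)
    fix i assume i: "i \<in> offdiag_indices q n"
    show "tame N (\<lambda>x. \<Prod>r<q. lin N (u (i r)) x)"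
      using tame_prod_lin[where n=N and P="{..<q}" and u="\<lambda>r. u (i r)"] .
  qed
  have tY: "tame N Y" unfolding Y_def[abs_def] by (intro tame_sum tame_cmult gsmooth_tame(1)[OF gsmooth_hermite])
  have t: "tame N (\<lambda>x. (F x - Y x)\<^sup>2)" by (intro tame_power tame_diff tF tY)
  have "(\<integral>\<^sup>+\<omega>. ennreal ((F (?\<xi> \<omega>) - Y (?\<xi> \<omega>))\<^sup>2) \<partial>M) = (\<integral>\<^sup>+x. ennreal ((F x - Y x)\<^sup>2) \<partial>distr M (gauss N) ?\<xi>)"
    using tame_measurable[OF t] by (subst nn_integral_distr[OF law(2)]) auto
  also have "\<dots> = ennreal (\<integral>x. (F x - Y x)\<^sup>2 \<partial>gauss N)"
    unfolding law(1) by (intro nn_integral_eq_integral tame_integrable t) auto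
  also have "\<dots> \<le> ennreal (fact q * (\<integral>x. (elementary_fun q n \<tau> c x - (\<Sum>j\<in>J. w j * (\<Prod>r<q. step_fun m \<sigma> (a j) (x r))))\<^sup>2 \<partial>(\<Pi>\<^sub>M r\<in>{..<q}. lborel)))"
    by (intro ennreal_leI le2)
  also have "\<dots> = ennreal (fact q) * ennreal (\<integral>x. (elementary_fun q n \<tau> c x - (\<Sum>j\<in>J. w j * (\<Prod>r<q. step_fun m \<sigma> (a j) (x r))))\<^sup>2 \<partial>(\<Pi>\<^sub>M r\<in>{..<q}. lborel))"
    by (rule ennreal_mult') simp
  also have "ennreal (\<integral>x. (elementary_fun q n \<tau> c x - (\<Sum>j\<in>J. w j * (\<Prod>r<q. step_fun m \<sigma> (a j) (x r))))\<^sup>2 \<partial>(\<Pi>\<^sub>M r\<in>{..<q}. lborel))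
     = (\<integral>\<^sup>+x. ennreal ((elementary_fun q n \<tau> c x - (\<Sum>j\<in>J. w j * (\<Prod>r<q. step_fun m \<sigma> (a j) (x r))))\<^sup>2) \<partial>(\<Pi>\<^sub>M r\<in>{..<q}. lborel))"
    by (intro nn_integral_eq_integral[symmetric] kernel_distance(1) \<tau> \<sigma>) auto
  finally show ?thesis unfolding Fe Ye .
qed

end

section \<open>Autoregressive discretisation of the Ornstein-Uhlenbeck kernel\<close>

text \<open>The shift puts time 0 at node \<open>m + 1\<close>, so that cell \<open>m + j\<close>
  ends at time \<open>j / N\<close>. The window reaches back to
  \<open>- (m + 1) / N\<close>.\<close>

definition ar_grid :: "nat \<Rightarrow> nat \<Rightarrow> nat \<Rightarrow> real" where
  "ar_grid N m i = (real i - real m - 1) / real N"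

text \<open>Moving average coefficients of a stationary autoregressive sequence. Cell 0 carries the
  initial value, with \<open>sqrt N\<close> normalising an increment of variance
  \<open>1 / N\<close>; each later cell carries an innovation of variance
  \<open>1 - \<rho>\<^sup>2\<close>. Concentrating the remote past in one cell makes the sequence
  exactly stationary for every \<open>m\<close>.\<close>

definition ar_coef :: "real \<Rightarrow> nat \<Rightarrow> nat \<Rightarrow> nat \<Rightarrow> nat \<Rightarrow> real" where
  "ar_coef \<rho> N m j i =
     (if i = 0 then sqrt N * \<rho> ^ (m + j)
      else if i \<le> m + j then sqrt (N * (1 - \<rho>\<^sup>2)) * \<rho> ^ (m + j - i) else 0)"

abbreviation "ar_step \<rho> N m j \<equiv> step_fun (Suc (m + N)) (ar_grid N m) (ar_coef \<rho> N m j)"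

lemma ar_grid_strict_mono: "N > 0 \<Longrightarrow> strict_mono_on {..k} (ar_grid N m)"
  by (auto simp: strict_mono_on_def ar_grid_def divide_strict_right_mono)

lemma ar_grid_diff: "ar_grid N m (Suc i) - ar_grid N m i = 1 / N"
  by (simp add: ar_grid_def diff_divide_distrib[symmetric])

lemma geometric_sum: "(1 - x) * (\<Sum>k<n. x ^ k) = 1 - x ^ n" for x :: real
  by (metis one_diff_power_eq)

text \<open>The innovations contribute a geometric sum that stops at
  \<open>1 - (\<rho>\<^sup>2) ^ (m + j)\<close>; the initial cell supplies exactly the missing
  power.\<close>

lemma ar_inner_le:
  assumes N: "N > 0" and \<rho>: "0 < \<rho>" "\<rho> < 1" and jl: "j \<le> l" "l \<le> N"
  shows "step_inner (Suc (m + N)) (ar_grid N m) (ar_coef \<rho> N m j) (ar_coef \<rho> N m l) = \<rho> ^ (l - j)"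
proof -
  have r2: "\<rho>\<^sup>2 < 1" using \<rho> by (simp add: power_less_one_iff)
  have "step_inner (Suc (m + N)) (ar_grid N m) (ar_coef \<rho> N m j) (ar_coef \<rho> N m l) =
    (\<Sum>i<Suc (m + N). ar_coef \<rho> N m j i * ar_coef \<rho> N m l i / N)"
    unfolding step_inner_def ar_grid_diff by simp
  also have "\<dots> = (sqrt N * \<rho> ^ (m + j)) * (sqrt N * \<rho> ^ (m + l)) / N
      + (\<Sum>i<m + N. ar_coef \<rho> N m j (Suc i) * ar_coef \<rho> N m l (Suc i) / N)"
    by (subst sum.lessThan_Suc_shift) (simp add: ar_coef_def)
  also have "(sqrt N * \<rho> ^ (m + j)) * (sqrt N * \<rho> ^ (m + l)) / N = \<rho> ^ (l - j) * (\<rho>\<^sup>2) ^ (m + j)"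
  proof -
    have "\<rho> ^ (m + l) = \<rho> ^ (l - j) * \<rho> ^ (m + j)" using jl by (simp add: power_add[symmetric] add.commute)
    then show ?thesis using N by (simp add: power_mult_distrib power2_eq_square real_sqrt_mult_self field_simps)
  qed
  also have "(\<Sum>i<m + N. ar_coef \<rho> N m j (Suc i) * ar_coef \<rho> N m l (Suc i) / N) =
     (\<Sum>i<m + j. (1 - \<rho>\<^sup>2) * \<rho> ^ (l - j) * (\<rho>\<^sup>2) ^ (m + j - Suc i))"
  proof (rule sum.mono_neutral_cong_right)
    fix i assume i: "i \<in> {..<m + j}"
    have e: "m + l - Suc i = (l - j) + (m + j - Suc i)" using i jl by auto
    have "sqrt (N * (1 - \<rho>\<^sup>2)) * sqrt (N * (1 - \<rho>\<^sup>2)) = N * (1 - \<rho>\<^sup>2)" using r2 by simp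
    then have "ar_coef \<rho> N m j (Suc i) * ar_coef \<rho> N m l (Suc i) = N * (1 - \<rho>\<^sup>2) * (\<rho> ^ (m + j - Suc i) * (\<rho> ^ (l - j) * \<rho> ^ (m + j - Suc i)))"
      using i jl unfolding ar_coef_def e power_add by (auto simp: mult_ac)
    also have "\<dots> = N * ((1 - \<rho>\<^sup>2) * \<rho> ^ (l - j) * (\<rho>\<^sup>2) ^ (m + j - Suc i))"
      by (simp add: power2_eq_square power_mult_distrib mult_ac)
    finally show "ar_coef \<rho> N m j (Suc i) * ar_coef \<rho> N m l (Suc i) / N = (1 - \<rho>\<^sup>2) * \<rho> ^ (l - j) * (\<rho>\<^sup>2) ^ (m + j - Suc i)"
      using N by simp
  qed (use jl in \<open>auto simp: ar_coef_def\<close>)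
  also have "\<dots> = \<rho> ^ (l - j) * ((1 - \<rho>\<^sup>2) * (\<Sum>k<m + j. (\<rho>\<^sup>2) ^ k))"
    unfolding sum_distrib_left[symmetric] sum.nat_diff_reindex[of "\<lambda>k. (\<rho>\<^sup>2) ^ k" "m + j"] by simp
  also have "\<dots> = \<rho> ^ (l - j) * (1 - (\<rho>\<^sup>2) ^ (m + j))" by (simp only: geometric_sum)
  finally show ?thesis by (simp add: algebra_simps)
qed

text \<open>With truncated subtraction, \<open>(j - l) + (l - j)\<close> is the distance of the two
  indices.\<close>

lemma ar_inner:
  assumes "N > 0" "0 < \<rho>" "\<rho> < 1" "j \<le> N" "l \<le> N"
  shows "step_inner (Suc (m + N)) (ar_grid N m) (ar_coef \<rho> N m j) (ar_coef \<rho> N m l) = \<rho> ^ ((j - l) + (l - j))"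
proof (cases "j \<le> l")
  case True
  then show ?thesis using ar_inner_le[of N \<rho> j l m] assms by simp
next
  case False
  have "step_inner (Suc (m + N)) (ar_grid N m) (ar_coef \<rho> N m j) (ar_coef \<rho> N m l) =
    step_inner (Suc (m + N)) (ar_grid N m) (ar_coef \<rho> N m l) (ar_coef \<rho> N m j)"
    unfolding step_inner_def by (intro sum.cong refl) (simp only: mult_ac)
  then show ?thesis using ar_inner_le[of N \<rho> l j m] assms False by simp
qed

section \<open>The Ornstein-Uhlenbeck kernel and its discretisation\<close>

definition ou_kernel :: "real \<Rightarrow> real \<Rightarrow> real \<Rightarrow> real" where
  "ou_kernel \<gamma> s x = sqrt (2 * \<gamma>) * (exp (- \<gamma> * (s - x)) * indicator {..s} x)"

lemma ou_kernel_measurable [measurable]: "ou_kernel \<gamma> s \<in> borel_measurable borel"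
  unfolding ou_kernel_def[abs_def] by measurable

lemma ou_kernel_norm:
  assumes "\<gamma> > 0"
  shows "integrable lborel (\<lambda>x. ou_kernel \<gamma> s x * ou_kernel \<gamma> s x)"
    "(\<integral>x. ou_kernel \<gamma> s x * ou_kernel \<gamma> s x \<partial>lborel) = 1"
proof -
  let ?d = "exponential_density (2 * \<gamma>)"
  interpret E: prob_space "density lborel ?d" using assms by (intro prob_space_exponential_density) simp
  have nn: "(\<integral>\<^sup>+x. ennreal (?d x) \<partial>lborel) = ennreal 1"
    using E.emeasure_space_1 by (simp add: emeasure_density)
  have pos: "AE x in lborel. 0 \<le> ?d x" using assms by (simp add: exponential_density_nonneg)
  have id: "integrable lborel ?d" by (rule integrableI_nn_integral_finite[OF _ pos nn]) simp
  have "(\<integral>x. ?d x \<partial>lborel) = 1"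
    using nn_integral_eq_integral[OF id pos] nn integral_nonneg_AE[OF pos] by (metis ennreal_inj zero_le_one)
  \<comment> \<open>Measured backwards from \<open>s\<close>, the squared kernel is the exponential
    density of rate \<open>2 * \<gamma>\<close>; hence the factor \<open>sqrt (2 * \<gamma>)\<close>
    in the kernel.\<close>
  moreover have eq: "ou_kernel \<gamma> s (s + (-1) * x) * ou_kernel \<gamma> s (s + (-1) * x) = ?d x" for x
  proof -
    have "exp (- \<gamma> * x) * exp (- \<gamma> * x) = exp (- x * (2 * \<gamma>))" by (simp add: exp_add[symmetric])
    moreover have "ou_kernel \<gamma> s (s + (-1) * x) * ou_kernel \<gamma> s (s + (-1) * x) =
        (sqrt (2 * \<gamma>) * sqrt (2 * \<gamma>)) * (exp (- \<gamma> * x) * exp (- \<gamma> * x)) * indicator {0..} x"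
      by (auto simp: ou_kernel_def mult_ac split: split_indicator)
    ultimately show ?thesis using assms
      by (auto simp: exponential_density_def split: split_indicator)
  qed
  ultimately show "(\<integral>x. ou_kernel \<gamma> s x * ou_kernel \<gamma> s x \<partial>lborel) = 1"
    by (subst lborel_integral_real_affine[of "-1" _ s]) auto
  show "integrable lborel (\<lambda>x. ou_kernel \<gamma> s x * ou_kernel \<gamma> s x)"
    using lborel_integrable_real_affine_iff[of "-1" "\<lambda>x. ou_kernel \<gamma> s x * ou_kernel \<gamma> s x" s] id eq by simp
qed

lemma integrable_mult_of_squares:
  fixes f g :: "'a \<Rightarrow> real"
  assumes [measurable]: "f \<in> borel_measurable M" "g \<in> borel_measurable M"
    and "integrable M (\<lambda>x. f x * f x)" "integrable M (\<lambda>x. g x * g x)"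
  shows "integrable M (\<lambda>x. f x * g x)"
proof (rule Bochner_Integration.integrable_bound[OF Bochner_Integration.integrable_add[OF assms(3,4)]])
  show "AE x in M. norm (f x * g x) \<le> norm (f x * f x + g x * g x)"
  proof (rule AE_I2)
    fix x
    have "2 * (\<bar>f x\<bar> * \<bar>g x\<bar>) \<le> f x * f x + g x * g x"
      using sum_squares_bound[of "\<bar>f x\<bar>" "\<bar>g x\<bar>"] by (simp add: power2_eq_square mult_ac)
    moreover have "0 \<le> \<bar>f x\<bar> * \<bar>g x\<bar>" by simp
    ultimately have "\<bar>f x\<bar> * \<bar>g x\<bar> \<le> f x * f x + g x * g x" by linarith
    then show "norm (f x * g x) \<le> norm (f x * f x + g x * g x)" by (simp add: abs_mult)
  qed
qed measurable

text \<open>Both kernels have norm 1, so their distance is controlled by a lower bound on the inner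
  product. One factor of the bound is lost through the mesh, the other through the finite window
  into the past.\<close>

lemma ou_ar_inner:
  assumes N: "N > 0" and \<gamma>: "\<gamma> > 0" and \<rho>: "\<rho> = exp (- \<gamma> / N)" and j: "j < N" and s: "real j / N \<le> s" "s \<le> (real j + 1) / N"
  shows "integrable lborel (\<lambda>x. ou_kernel \<gamma> s x * ar_step \<rho> N m j x)"
    "\<rho>\<^sup>2 * (1 - \<rho> ^ (2 * m)) \<le> (\<integral>x. ou_kernel \<gamma> s x * ar_step \<rho> N m j x \<partial>lborel)"
proof -
  have \<rho>01: "0 < \<rho>" "\<rho> < 1" using \<gamma> N by (simp_all add: \<rho>)
  have r2: "\<rho>\<^sup>2 < 1" using \<rho>01 by (simp add: power_less_one_iff)
  let ?mm = "Suc (m + N)" and ?g = "ar_grid N m" and ?c = "ar_coef \<rho> N m j"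
  note mono = ar_grid_strict_mono[OF N, of ?mm m]
  have c0: "0 \<le> ?c i" for i using \<rho>01 r2 by (auto simp: ar_coef_def)
  show int: "integrable lborel (\<lambda>x. ou_kernel \<gamma> s x * ar_step \<rho> N m j x)"
    by (rule integrable_mult_of_squares) (auto intro: ou_kernel_norm \<gamma> step_fun_product mono)
  \<comment> \<open>Cell 0 contributes a nonnegative amount and is dropped. On cell \<open>i\<close>
    the time lag to \<open>s\<close> is at most \<open>(m + j + 2 - i) / N\<close>: one mesh width
    is due to the position of \<open>s\<close> and one to the width of the cell. These two produce
    the factor \<open>\<rho>\<^sup>2\<close>.\<close>
  define b where "b i = (if 0 < i \<and> i \<le> m + j then sqrt (2 * \<gamma>) * \<rho> ^ (m + j + 2 - i) * ?c i else 0)" for i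
  have low: "step_fun ?mm ?g b x \<le> ou_kernel \<gamma> s x * ar_step \<rho> N m j x" for x
    unfolding step_fun_def sum_distrib_left
  proof (rule sum_mono)
    fix i
    show "b i * indicator {?g i<..?g (Suc i)} x \<le> ou_kernel \<gamma> s x * (?c i * indicator {?g i<..?g (Suc i)} x)"
    proof (cases "x \<in> {?g i<..?g (Suc i)} \<and> 0 < i \<and> i \<le> m + j")
      case True
      then have x: "?g i < x" "x \<le> ?g (Suc i)" and i: "0 < i" "i \<le> m + j" by auto
      have "?g (Suc i) \<le> real j / N"
        unfolding ar_grid_def using i N by (intro divide_right_mono) auto
      then have xs: "x \<le> s" using x s by linarith
      have "\<rho> ^ (m + j + 2 - i) = exp (- \<gamma> * (real (m + j + 2 - i) / N))"
        unfolding \<rho> exp_of_nat_mult[symmetric] by (simp add: field_simps)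
      also have "\<dots> \<le> exp (- \<gamma> * (s - x))"
      proof -
        have "s - x \<le> (real j + 1) / N - ?g i" using s x by linarith
        also have "\<dots> = real (m + j + 2 - i) / N" using i unfolding ar_grid_def by (simp add: of_nat_diff diff_divide_distrib add_divide_distrib)
        finally have "\<gamma> * (s - x) \<le> \<gamma> * (real (m + j + 2 - i) / N)" using \<gamma> by (intro mult_left_mono) auto
        then show ?thesis by (simp only: exp_le_cancel_iff mult_minus_left neg_le_iff_le)
      qed
      finally have "\<rho> ^ (m + j + 2 - i) \<le> exp (- \<gamma> * (s - x))" .
      then have "sqrt (2 * \<gamma>) * \<rho> ^ (m + j + 2 - i) * ?c i \<le> sqrt (2 * \<gamma>) * exp (- \<gamma> * (s - x)) * ?c i"
        using c0 \<gamma> by (intro mult_right_mono mult_left_mono) auto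
      then show ?thesis using True xs by (simp add: b_def ou_kernel_def)
    next
      case False
      have "0 \<le> ou_kernel \<gamma> s x" using \<gamma> by (simp add: ou_kernel_def)
      then have "0 \<le> ou_kernel \<gamma> s x * (?c i * indicator {?g i<..?g (Suc i)} x)" using c0 by simp
      then show ?thesis using False by (auto simp: b_def split: split_indicator)
    qed
  qed
  have le: "?g i \<le> ?g (Suc i)" for i using ar_grid_diff[of N m i] N by (smt (verit) divide_nonneg_nonneg of_nat_0_le_iff)
  have isb: "integrable lborel (step_fun ?mm ?g b)" "(\<integral>x. step_fun ?mm ?g b x \<partial>lborel) = (\<Sum>i<?mm. b i / N)"
  proof -
    have i1: "integrable lborel (\<lambda>x. b i * indicator {?g i<..?g (Suc i)} x)" for i
      using le[of i] by (intro integrable_mult_right integrable_real_indicator) auto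
    show "integrable lborel (step_fun ?mm ?g b)"
      unfolding step_fun_def[abs_def] by (intro Bochner_Integration.integrable_sum i1)
    have "(\<integral>x. step_fun ?mm ?g b x \<partial>lborel) = (\<Sum>i<?mm. \<integral>x. b i * indicator {?g i<..?g (Suc i)} x \<partial>lborel)"
      unfolding step_fun_def by (intro Bochner_Integration.integral_sum i1)
    also have "\<dots> = (\<Sum>i<?mm. b i / N)"
      by (intro sum.cong refl) (simp add: le ar_grid_diff)
    finally show "(\<integral>x. step_fun ?mm ?g b x \<partial>lborel) = (\<Sum>i<?mm. b i / N)" .
  qed
  have "\<rho>\<^sup>2 * (1 - \<rho> ^ (2 * m)) \<le> \<rho>\<^sup>2 * (1 - (\<rho>\<^sup>2) ^ (m + j))"
  proof -
    have "\<rho> ^ (2 * (m + j)) \<le> \<rho> ^ (2 * m)" using \<rho>01 by (intro power_decreasing) auto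
    then show ?thesis by (simp add: power_mult[symmetric] mult_left_mono)
  qed
  also have "\<dots> \<le> (\<Sum>i<?mm. b i / N)"
  proof -
    let ?K = "sqrt (2 * \<gamma>) * sqrt (N * (1 - \<rho>\<^sup>2)) / N"
    have "(\<Sum>i<?mm. b i / N) = (\<Sum>i<m + N. b (Suc i) / N)"
      by (subst sum.lessThan_Suc_shift) (simp add: b_def)
    also have "\<dots> = (\<Sum>i<m + j. ?K * \<rho>\<^sup>2 * (\<rho>\<^sup>2) ^ (m + j - Suc i))"
    proof (rule sum.mono_neutral_cong_right)
      fix i assume i: "i \<in> {..<m + j}"
      then have "m + j + 2 - Suc i = 2 + (m + j - Suc i)" by auto
      then show "b (Suc i) / N = ?K * \<rho>\<^sup>2 * (\<rho>\<^sup>2) ^ (m + j - Suc i)"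
        using i unfolding b_def ar_coef_def
        by (simp add: power_add power_mult_distrib power2_eq_square)
    qed (use j in \<open>auto simp: b_def\<close>)
    also have "\<dots> = ?K * \<rho>\<^sup>2 * (\<Sum>k<m + j. (\<rho>\<^sup>2) ^ k)"
      unfolding sum_distrib_left[symmetric] sum.nat_diff_reindex[of "\<lambda>k. (\<rho>\<^sup>2) ^ k" "m + j"] by simp
    finally have e: "(\<Sum>i<?mm. b i / N) = ?K * \<rho>\<^sup>2 * (\<Sum>k<m + j. (\<rho>\<^sup>2) ^ k)" .
    \<comment> \<open>The square of \<open>?K\<close> is
      \<open>2 * \<gamma> / N * (1 - \<rho>\<^sup>2)\<close>, and
      \<open>1 - \<rho>\<^sup>2 \<le> 2 * \<gamma> / N\<close> because the exponential lies above
      its tangent.\<close>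
    have "1 - \<rho>\<^sup>2 \<le> ?K"
    proof -
      have "1 - \<rho>\<^sup>2 \<le> 2 * \<gamma> / N"
        using exp_ge_add_one_self[of "- (2 * \<gamma> / N)"] unfolding \<rho> by (simp add: exp_double[symmetric] field_simps)
      then have "(1 - \<rho>\<^sup>2) * (1 - \<rho>\<^sup>2) \<le> 2 * \<gamma> / N * (1 - \<rho>\<^sup>2)" using r2 by (intro mult_right_mono) auto
      also have "\<dots> = ?K\<^sup>2" using N \<gamma> r2 by (simp add: power_divide power_mult_distrib real_sqrt_pow2) (simp add: power2_eq_square)
      finally have "(1 - \<rho>\<^sup>2)\<^sup>2 \<le> ?K\<^sup>2" by (simp add: power2_eq_square)
      then show ?thesis by (rule power2_le_imp_le) (use \<gamma> r2 in simp)
    qed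
    then have "(1 - \<rho>\<^sup>2) * (\<rho>\<^sup>2 * (\<Sum>k<m + j. (\<rho>\<^sup>2) ^ k)) \<le> ?K * (\<rho>\<^sup>2 * (\<Sum>k<m + j. (\<rho>\<^sup>2) ^ k))"
      by (intro mult_right_mono) (auto intro!: sum_nonneg mult_nonneg_nonneg)
    moreover have "(1 - \<rho>\<^sup>2) * (\<rho>\<^sup>2 * (\<Sum>k<m + j. (\<rho>\<^sup>2) ^ k)) = \<rho>\<^sup>2 * (1 - (\<rho>\<^sup>2) ^ (m + j))"
      using geometric_sum[of "\<rho>\<^sup>2" "m + j"] by (simp add: mult.left_commute)
    ultimately show ?thesis unfolding e by (simp add: mult.assoc)
  qed
  also have "\<dots> \<le> (\<integral>x. ou_kernel \<gamma> s x * ar_step \<rho> N m j x \<partial>lborel)"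
    unfolding isb(2)[symmetric] by (intro integral_mono isb int low)
  finally show "\<rho>\<^sup>2 * (1 - \<rho> ^ (2 * m)) \<le> (\<integral>x. ou_kernel \<gamma> s x * ar_step \<rho> N m j x \<partial>lborel)" .
qed

text \<open>For unit vectors the squared distance of the tensor powers is 2 minus twice the
  \<open>q\<close>-th power of the inner product.\<close>

lemma tensor_distance:
  fixes f g :: "real \<Rightarrow> real"
  assumes [measurable]: "f \<in> borel_measurable borel" "g \<in> borel_measurable borel"
    and f: "integrable lborel (\<lambda>x. f x * f x)" "(\<integral>x. f x * f x \<partial>lborel) = 1"
    and g: "integrable lborel (\<lambda>x. g x * g x)" "(\<integral>x. g x * g x \<partial>lborel) = 1"
    and fg: "0 \<le> \<theta>" "\<theta> \<le> (\<integral>x. f x * g x \<partial>lborel)"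
  shows "(\<integral>\<^sup>+x. ennreal (((\<Prod>r<q. f (x r)) - (\<Prod>r<q. g (x r)))\<^sup>2) \<partial>(\<Pi>\<^sub>M r\<in>{..<q}. lborel)) \<le> ennreal (2 - 2 * \<theta> ^ q)"
proof -
  let ?P = "\<Pi>\<^sub>M r\<in>{..<q}. lborel :: real measure"
  let ?F = "\<lambda>x. \<Prod>r<q. f (x r)" and ?G = "\<lambda>x. \<Prod>r<q. g (x r)"
  have ifg: "integrable lborel (\<lambda>x. f x * g x)" by (rule integrable_mult_of_squares) (auto intro: f g)
  have t: "integrable ?P (\<lambda>x. ?F x * ?F x)" "integrable ?P (\<lambda>x. ?F x * ?G x)" "integrable ?P (\<lambda>x. ?G x * ?G x)"
     "(\<integral>x. ?F x * ?F x \<partial>?P) = 1" "(\<integral>x. ?G x * ?G x \<partial>?P) = 1"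
     "(\<integral>x. ?F x * ?G x \<partial>?P) = (\<integral>x. f x * g x \<partial>lborel) ^ q"
    using integral_tensor[of q "\<lambda>_. f" "\<lambda>_. f"] integral_tensor[of q "\<lambda>_. g" "\<lambda>_. g"]
      integral_tensor[of q "\<lambda>_. f" "\<lambda>_. g"] f g ifg by simp_all
  have sq: "(?F x - ?G x)\<^sup>2 = ?F x * ?F x - 2 * (?F x * ?G x) + ?G x * ?G x" for x
    by (simp add: power2_eq_square algebra_simps)
  have "(\<integral>\<^sup>+x. ennreal ((?F x - ?G x)\<^sup>2) \<partial>?P) = ennreal (\<integral>x. (?F x - ?G x)\<^sup>2 \<partial>?P)"
  proof (rule nn_integral_eq_integral)
    show "integrable ?P (\<lambda>x. (?F x - ?G x)\<^sup>2)" unfolding sq using t(1-3) by simp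
  qed simp
  also have "(\<integral>x. (?F x - ?G x)\<^sup>2 \<partial>?P) = 2 - 2 * (\<integral>x. f x * g x \<partial>lborel) ^ q"
    unfolding sq using t by simp
  also have "ennreal \<dots> \<le> ennreal (2 - 2 * \<theta> ^ q)"
    using fg by (intro ennreal_leI) (auto intro!: power_mono)
  finally show ?thesis .
qed

text \<open>Jensen's inequality on the unit interval, obtained from the nonnegativity of the
  variance.\<close>

lemma square_integral_le:
  fixes u :: "real \<Rightarrow> real"
  assumes "integrable lborel (\<lambda>s. indicator {0..1} s * u s)" "integrable lborel (\<lambda>s. indicator {0..1} s * (u s)\<^sup>2)"
  shows "(\<integral>s. indicator {0..1} s * u s \<partial>lborel)\<^sup>2 \<le> (\<integral>s. indicator {0..1} s * (u s)\<^sup>2 \<partial>lborel)"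
proof -
  define I where "I = (\<integral>s. indicator {0..1} s * u s \<partial>lborel)"
  have "0 \<le> (\<integral>s. indicator {0..1} s * (u s - I)\<^sup>2 \<partial>lborel)"
    by (intro Bochner_Integration.integral_nonneg) simp
  also have "\<dots> = (\<integral>s. indicator {0..1} s * (u s)\<^sup>2 - 2 * I * (indicator {0..1} s * u s) + I\<^sup>2 * indicator {0..1::real} s \<partial>lborel)"
    by (intro Bochner_Integration.integral_cong) (auto simp: power2_eq_square algebra_simps)
  also have "\<dots> = (\<integral>s. indicator {0..1} s * (u s)\<^sup>2 \<partial>lborel) - 2 * I * I + I\<^sup>2"
    using assms by (subst Bochner_Integration.integral_add Bochner_Integration.integral_diff, (auto simp: I_def)[2])+ (simp add: I_def)
  finally show ?thesis by (simp add: I_def power2_eq_square)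
qed

section \<open>The tempered Hermite variable as a limit of Hermite sums\<close>

text \<open>The constant relative to unit-norm kernels: \<open>W 1\<close> is this constant times
  the integral over the unit time interval of \<open>hermite q\<close> along a standard
  Ornstein-Uhlenbeck process.\<close>

definition chaos_const :: "nat \<Rightarrow> real \<Rightarrow> real" where
  "chaos_const q \<gamma> = tempered_hermite_const q \<gamma> / sqrt (2 * \<gamma>) ^ q"

lemma tempered_kernel_eq:
  assumes "\<gamma> > 0"
  shows "tempered_hermite_const q \<gamma> * tempered_hermite_kernel q \<gamma> 1 x =
    (\<integral>s. indicator {0..1} s * (chaos_const q \<gamma> * (\<Prod>r<q. ou_kernel \<gamma> s (x r))) \<partial>lborel)"
proof -
  let ?E = "\<lambda>s. \<Prod>r<q. exp (- \<gamma> * (s - x r)) * indicator {..s} (x r)"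
  have eq: "chaos_const q \<gamma> * (\<Prod>r<q. ou_kernel \<gamma> s (x r)) = tempered_hermite_const q \<gamma> * ?E s" for s
    using assms by (simp add: chaos_const_def ou_kernel_def prod.distrib)
  have "(\<integral>s. indicator {0..1} s * (tempered_hermite_const q \<gamma> * ?E s) \<partial>lborel) =
      tempered_hermite_const q \<gamma> * (\<integral>s. indicator {0..1} s * ?E s \<partial>lborel)"
    unfolding mult.left_commute[of "indicator _ _"] by (rule integral_mult_right_zero)
  then show ?thesis
    unfolding eq tempered_hermite_kernel_def set_lebesgue_integral_def by simp
qed

text \<open>At a fixed time the tensor powers are close by \<open>tensor_distance\<close>, with a
  bound that does not depend on the time. Jensen's inequality over the unit time interval and
  Tonelli's theorem transfer it to the time averages.\<close>

lemma kernel_approx: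
  assumes N: "N > 0" and \<gamma>: "\<gamma> > 0" and \<rho>: "\<rho> = exp (- \<gamma> / N)" and c: "c = chaos_const q \<gamma>"
  shows "(\<integral>\<^sup>+x. ennreal ((tempered_hermite_const q \<gamma> * tempered_hermite_kernel q \<gamma> 1 x -
        (\<Sum>j<N. c / N * (\<Prod>r<q. ar_step \<rho> N m j (x r))))\<^sup>2) \<partial>(\<Pi>\<^sub>M r\<in>{..<q}. lborel))
    \<le> ennreal (c\<^sup>2 * (2 - 2 * (\<rho>\<^sup>2 * (1 - \<rho> ^ (2 * m))) ^ q))"
proof -
  let ?P = "\<Pi>\<^sub>M r\<in>{..<q}. lborel :: real measure"
  have \<rho>01: "0 < \<rho>" "\<rho> < 1" using \<gamma> N by (simp_all add: \<rho>)
  let ?\<theta> = "\<rho>\<^sup>2 * (1 - \<rho> ^ (2 * m))"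
  have \<theta>0: "0 \<le> ?\<theta>" using \<rho>01 by (simp add: power_le_one)
  let ?A = "\<lambda>j. {real j / N..<(real j + 1) / N}"
  define H where "H s x = (\<Prod>r<q. ou_kernel \<gamma> s (x r))" for s x
  define V where "V j x = (\<Prod>r<q. ar_step \<rho> N m j (x r))" for j x
  \<comment> \<open>The indicators select the autoregressive kernel of the half-open cell containing
    \<open>s\<close>, so the time integral of the sum is the discrete average.\<close>
  define D where "D s x = H s x - (\<Sum>j<N. indicator (?A j) s * V j x)" for s x
  have mc[measurable]: "(\<lambda>p. snd p r) \<in> borel_measurable (lborel \<Otimes>\<^sub>M ?P)" if "r < q" for r
  proof -
    have "(\<lambda>x. x r) \<in> measurable ?P lborel" using that by (intro measurable_component_singleton) auto
    then have "(\<lambda>p. (snd p) r) \<in> measurable (lborel \<Otimes>\<^sub>M ?P) lborel"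
      using measurable_compose[OF measurable_snd] by blast
    then show ?thesis by simp
  qed
  have ind: "indicator {..s} (y::real) = (if y \<le> s then 1 else 0 :: real)" for s y by simp
  have mD: "(\<lambda>p. D (fst p) (snd p)) \<in> borel_measurable (lborel \<Otimes>\<^sub>M ?P)"
    unfolding D_def H_def V_def ou_kernel_def ind
    by (intro borel_measurable_diff borel_measurable_prod borel_measurable_sum borel_measurable_times
          borel_measurable_const measurable_If borel_measurable_exp
          borel_measurable_uminus borel_measurable_le
          measurable_compose[OF _ step_fun_measurable] measurable_compose[OF measurable_fst borel_measurable_indicator'] mc)
      (auto intro!: mc borel_measurable_le borel_measurable_indicator')
  have bH: "\<exists>K. \<forall>s\<in>{0..1}. \<bar>H s x\<bar> \<le> K" for x
  proof -
    have b1: "\<bar>ou_kernel \<gamma> s y\<bar> \<le> sqrt (2 * \<gamma>) * exp (\<gamma> * \<bar>y\<bar>)" if "s \<in> {0..1}" for s y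
    proof -
      have "- \<gamma> * (s - y) \<le> \<gamma> * \<bar>y\<bar>"
      proof -
        have "\<gamma> * (y - s) \<le> \<gamma> * \<bar>y\<bar>" using that \<gamma> by (intro mult_left_mono) auto
        then show ?thesis by (simp add: algebra_simps)
      qed
      then have "exp (- \<gamma> * (s - y)) * indicator {..s} y \<le> exp (\<gamma> * \<bar>y\<bar>) * 1"
        by (intro mult_mono) (auto split: split_indicator)
      then have "sqrt (2 * \<gamma>) * (exp (- \<gamma> * (s - y)) * indicator {..s} y) \<le> sqrt (2 * \<gamma>) * exp (\<gamma> * \<bar>y\<bar>)"
        using \<gamma> by (intro mult_left_mono) auto
      then show ?thesis using \<gamma> by (simp add: ou_kernel_def abs_mult)
    qed
    have "\<bar>H s x\<bar> \<le> (\<Prod>r<q. sqrt (2 * \<gamma>) * exp (\<gamma> * \<bar>x r\<bar>))" if "s \<in> {0..1}" for s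
      unfolding H_def abs_prod using b1[OF that] by (intro prod_mono) auto
    then show ?thesis by blast
  qed
  have bD: "\<exists>K. \<forall>s\<in>{0..1}. \<bar>D s x\<bar> \<le> K" for x
  proof -
    obtain K where K: "\<forall>s\<in>{0..1}. \<bar>H s x\<bar> \<le> K" using bH by blast
    have "\<bar>\<Sum>j<N. indicator (?A j) s * V j x\<bar> \<le> (\<Sum>j<N. \<bar>V j x\<bar>)" for s
      by (rule order_trans[OF sum_abs]) (intro sum_mono, auto split: split_indicator)
    then show ?thesis using K unfolding D_def
      by (intro exI[of _ "K + (\<Sum>j<N. \<bar>V j x\<bar>)"]) (smt (verit, best))
  qed
  have mDs: "(\<lambda>s. D s x) \<in> borel_measurable borel" and mHs: "(\<lambda>s. H s x) \<in> borel_measurable borel" for x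
    unfolding D_def H_def ou_kernel_def ind by measurable
  have bi: "integrable lborel (\<lambda>s. indicator {0..1} s * u s)"
    if "u \<in> borel_measurable borel" "\<exists>K. \<forall>s\<in>{0..1}. \<bar>u s\<bar> \<le> K" for u :: "real \<Rightarrow> real"
  proof -
    from that(2) obtain K' where "\<forall>s\<in>{0..1}. \<bar>u s\<bar> \<le> K'" by blast
    then obtain K where K: "\<forall>s\<in>{0..1}. \<bar>u s\<bar> \<le> \<bar>K\<bar>" by (meson abs_ge_self order_trans)
    have "integrable lborel (\<lambda>s. K * indicator {0..1::real} s)" by (intro integrable_mult_right integrable_real_indicator) auto
    then show ?thesis
      by (rule Bochner_Integration.integrable_bound) (use K that(1) in \<open>auto split: split_indicator intro!: AE_I2\<close>)
  qed
  have iD: "integrable lborel (\<lambda>s. indicator {0..1} s * D s x)" for x by (intro bi mDs bD)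
  have iD2: "integrable lborel (\<lambda>s. indicator {0..1} s * (D s x)\<^sup>2)" for x
  proof (rule bi)
    show "(\<lambda>s. (D s x)\<^sup>2) \<in> borel_measurable borel" using mDs by measurable
    obtain K where K: "\<forall>s\<in>{0..1}. \<bar>D s x\<bar> \<le> K" using bD by blast
    have "\<bar>(D s x)\<^sup>2\<bar> \<le> K\<^sup>2" if "s \<in> {0..1}" for s
      using K that by (metis abs_ge_zero abs_of_nonneg power2_abs power_mono zero_le_power2)
    then show "\<exists>K. \<forall>s\<in>{0..1}. \<bar>(D s x)\<^sup>2\<bar> \<le> K" by blast
  qed
  have diff: "tempered_hermite_const q \<gamma> * tempered_hermite_kernel q \<gamma> 1 x - (\<Sum>j<N. c / N * V j x)
     = c * (\<integral>s. indicator {0..1} s * D s x \<partial>lborel)" for x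
  proof -
    have iH: "integrable lborel (\<lambda>s. indicator {0..1} s * H s x)" by (intro bi mHs bH)
    have sub: "?A j \<subseteq> {0..1}" if "j < N" for j
    proof -
      have "(real j + 1) / N \<le> 1" using that N by (simp add: divide_le_eq)
      moreover have "0 \<le> real j / N" by simp
      ultimately show ?thesis unfolding subset_iff atLeastLessThan_iff atLeastAtMost_iff by (meson less_imp_le order_trans)
    qed
    have iA: "integrable lborel (\<lambda>s. V j x * indicator (?A j) s)" "(\<integral>s. V j x * indicator (?A j) s \<partial>lborel) = V j x / N" for j
    proof -
      have "real j / N \<le> (real j + 1) / N" by (intro divide_right_mono) auto
      then show "integrable lborel (\<lambda>s. V j x * indicator (?A j) s)" "(\<integral>s. V j x * indicator (?A j) s \<partial>lborel) = V j x / N"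
        by (auto intro!: integrable_mult_right integrable_real_indicator simp: diff_divide_distrib[symmetric])
    qed
    have "(\<integral>s. indicator {0..1} s * D s x \<partial>lborel) = (\<integral>s. indicator {0..1} s * H s x - (\<Sum>j<N. V j x * indicator (?A j) s) \<partial>lborel)"
    proof (intro Bochner_Integration.integral_cong refl)
      fix s :: real
      have "indicator {0..1} s * (\<Sum>j<N. indicator (?A j) s * V j x) = (\<Sum>j<N. V j x * indicator (?A j) s)"
        unfolding sum_distrib_left
      proof (intro sum.cong refl)
        fix j assume "j \<in> {..<N}"
        then show "indicator {0..1} s * (indicator (?A j) s * V j x) = V j x * indicator (?A j) s"
          using sub[of j] by (auto split: split_indicator)
      qed
      then show "indicator {0..1} s * D s x = indicator {0..1} s * H s x - (\<Sum>j<N. V j x * indicator (?A j) s)"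
        unfolding D_def right_diff_distrib by simp
    qed
    also have "\<dots> = (\<integral>s. indicator {0..1} s * H s x \<partial>lborel) - (\<Sum>j<N. V j x / N)"
    proof -
      have i2: "integrable lborel (\<lambda>s. \<Sum>j<N. V j x * indicator (?A j) s)"
        by (intro Bochner_Integration.integrable_sum iA(1))
      have "(\<integral>s. (\<Sum>j<N. V j x * indicator (?A j) s) \<partial>lborel) = (\<Sum>j<N. V j x / N)"
        unfolding Bochner_Integration.integral_sum[OF iA(1)] iA(2) ..
      then show ?thesis using Bochner_Integration.integral_diff[OF iH i2] by (simp only:)
    qed
    finally have e: "(\<integral>s. indicator {0..1} s * D s x \<partial>lborel) = (\<integral>s. indicator {0..1} s * H s x \<partial>lborel) - (\<Sum>j<N. V j x / N)" .
    have "tempered_hermite_const q \<gamma> * tempered_hermite_kernel q \<gamma> 1 x = c * (\<integral>s. indicator {0..1} s * H s x \<partial>lborel)"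
      unfolding tempered_kernel_eq[OF \<gamma>] H_def c
      by (subst integral_mult_right_zero[symmetric]) (simp add: mult.left_commute)
    then show ?thesis unfolding e by (simp add: right_diff_distrib sum_distrib_left)
  qed
  have sq: "ennreal ((tempered_hermite_const q \<gamma> * tempered_hermite_kernel q \<gamma> 1 x - (\<Sum>j<N. c / N * V j x))\<^sup>2)
      \<le> (\<integral>\<^sup>+s. ennreal (c\<^sup>2 * (indicator {0..1} s * (D s x)\<^sup>2)) \<partial>lborel)" for x
  proof -
    have "(tempered_hermite_const q \<gamma> * tempered_hermite_kernel q \<gamma> 1 x - (\<Sum>j<N. c / N * V j x))\<^sup>2
        \<le> c\<^sup>2 * (\<integral>s. indicator {0..1} s * (D s x)\<^sup>2 \<partial>lborel)"
      unfolding diff power_mult_distrib by (intro mult_left_mono square_integral_le iD iD2) auto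
    also have "\<dots> = (\<integral>s. c\<^sup>2 * (indicator {0..1} s * (D s x)\<^sup>2) \<partial>lborel)" by simp
    finally show ?thesis
      by (subst nn_integral_eq_integral) (auto intro!: ennreal_leI integrable_mult_right iD2)
  qed
  interpret PS: pair_sigma_finite lborel ?P
  proof -
    interpret fp: finite_product_sigma_finite "\<lambda>_. lborel :: real measure" "{..<q}" by standard auto
    show "pair_sigma_finite lborel ?P"
      by (intro pair_sigma_finite.intro lborel.sigma_finite_measure_axioms fp.sigma_finite_measure_axioms)
  qed
  have "(\<integral>\<^sup>+x. ennreal ((tempered_hermite_const q \<gamma> * tempered_hermite_kernel q \<gamma> 1 x - (\<Sum>j<N. c / N * V j x))\<^sup>2) \<partial>?P)
     \<le> (\<integral>\<^sup>+x. (\<integral>\<^sup>+s. ennreal (c\<^sup>2 * (indicator {0..1} s * (D s x)\<^sup>2)) \<partial>lborel) \<partial>?P)"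
    by (intro nn_integral_mono sq)
  also have "\<dots> = (\<integral>\<^sup>+s. (\<integral>\<^sup>+x. ennreal (c\<^sup>2 * (indicator {0..1} s * (D s x)\<^sup>2)) \<partial>?P) \<partial>lborel)"
  proof (rule PS.Fubini'[of "\<lambda>s x. ennreal (c\<^sup>2 * (indicator {0..1} s * (D s x)\<^sup>2))"])
    have "(\<lambda>p. ennreal (c\<^sup>2 * (indicator {0..1} (fst p) * (D (fst p) (snd p))\<^sup>2))) \<in> borel_measurable (lborel \<Otimes>\<^sub>M ?P)"
      using mD by (intro measurable_compose[OF _ measurable_ennreal] borel_measurable_times borel_measurable_const borel_measurable_power)
        (auto intro!: borel_measurable_indicator')
    then show "(\<lambda>(s, x). ennreal (c\<^sup>2 * (indicator {0..1} s * (D s x)\<^sup>2))) \<in> borel_measurable (lborel \<Otimes>\<^sub>M ?P)"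
      by (simp add: case_prod_beta)
  qed
  also have "\<dots> \<le> (\<integral>\<^sup>+s. ennreal (c\<^sup>2 * (2 - 2 * ?\<theta> ^ q)) * indicator {0..1::real} s \<partial>lborel)"
  proof (rule nn_integral_mono_AE)
    \<comment> \<open>The half-open cells miss the endpoint 1, a null set.\<close>
    show "AE s in lborel. (\<integral>\<^sup>+x. ennreal (c\<^sup>2 * (indicator {0..1} s * (D s x)\<^sup>2)) \<partial>?P) \<le> ennreal (c\<^sup>2 * (2 - 2 * ?\<theta> ^ q)) * indicator {0..1} s"
      using AE_lborel_singleton[of 1]
    proof eventually_elim
      fix s :: real assume "s \<noteq> 1"
      show "(\<integral>\<^sup>+x. ennreal (c\<^sup>2 * (indicator {0..1} s * (D s x)\<^sup>2)) \<partial>?P) \<le> ennreal (c\<^sup>2 * (2 - 2 * ?\<theta> ^ q)) * indicator {0..1} s"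
      proof (cases "s \<in> {0..1}")
        case False
        then show ?thesis by simp
      next
        case True
        define j where "j = nat \<lfloor>N * s\<rfloor>"
        have s: "0 \<le> s" "s < 1" using True \<open>s \<noteq> 1\<close> by auto
        have fl: "real j = \<lfloor>N * s\<rfloor>" using s by (simp add: j_def)
        have Ns: "N * s < N" using s N by simp
        have jN: "j < N" using fl Ns by linarith
        have js: "real j \<le> N * s" "N * s < real j + 1" using fl by linarith+
        have sA: "s \<in> ?A j" using js N by (auto simp: field_simps)
        have other: "s \<notin> ?A i" if "i \<noteq> j" for i
        proof
          assume "s \<in> ?A i"
          then have "real i \<le> N * s" "N * s < real i + 1" using N by (auto simp: field_simps)
          with js that show False by linarith
        qed
        have "(\<Sum>i<N. indicator (?A i) s * V i x) = (\<Sum>i<N. if i = j then V j x else 0)" for x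
          using sA other by (intro sum.cong refl) auto
        then have Dj: "D s x = H s x - V j x" for x using jN by (simp add: D_def)
        have "(\<integral>\<^sup>+x. ennreal ((D s x)\<^sup>2) \<partial>?P) \<le> ennreal (2 - 2 * ?\<theta> ^ q)"
          unfolding Dj H_def V_def
        proof (rule tensor_distance)
          show "?\<theta> \<le> (\<integral>x. ou_kernel \<gamma> s x * ar_step \<rho> N m j x \<partial>lborel)"
            by (rule ou_ar_inner(2)[OF N \<gamma> \<rho> jN]) (use sA in auto)
          show "integrable lborel (\<lambda>x. ar_step \<rho> N m j x * ar_step \<rho> N m j x)"
            by (rule step_fun_product[OF ar_grid_strict_mono[OF N]])
          show "(\<integral>x. ar_step \<rho> N m j x * ar_step \<rho> N m j x \<partial>lborel) = 1"
            using ar_inner[OF N \<rho>01, of j j m] jN by (simp add: step_fun_product[OF ar_grid_strict_mono[OF N]])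
        qed (use \<theta>0 ou_kernel_norm[OF \<gamma>] in auto)
        then have "ennreal (c\<^sup>2) * (\<integral>\<^sup>+x. ennreal ((D s x)\<^sup>2) \<partial>?P) \<le> ennreal (c\<^sup>2) * ennreal (2 - 2 * ?\<theta> ^ q)"
          by (intro mult_left_mono) auto
        also have "ennreal (c\<^sup>2) * ennreal (2 - 2 * ?\<theta> ^ q) = ennreal (c\<^sup>2 * (2 - 2 * ?\<theta> ^ q))"
          by (simp add: ennreal_mult')
        also have "ennreal (c\<^sup>2) * (\<integral>\<^sup>+x. ennreal ((D s x)\<^sup>2) \<partial>?P) = (\<integral>\<^sup>+x. ennreal (c\<^sup>2 * (indicator {0..1} s * (D s x)\<^sup>2)) \<partial>?P)"
        proof -
          have "(\<lambda>x. D s x) \<in> borel_measurable ?P"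
            using measurable_compose[OF measurable_Pair1'[of s lborel ?P] mD] by simp
          then show ?thesis using True by (subst nn_integral_cmult[symmetric]) (auto simp: ennreal_mult')
        qed
        finally show ?thesis using True by simp
      qed
    qed
  qed
  also have "\<dots> = ennreal (c\<^sup>2 * (2 - 2 * ?\<theta> ^ q))" by (subst nn_integral_cmult) auto
  finally show ?thesis unfolding V_def .
qed

lemma ennreal_square_diff_le: "ennreal ((a - c)\<^sup>2) \<le> 2 * ennreal ((a - b)\<^sup>2) + 2 * ennreal ((b - c)\<^sup>2)" for a b c :: real
proof -
  have "(a - c)\<^sup>2 \<le> 2 * (a - b)\<^sup>2 + 2 * (b - c)\<^sup>2"
    using zero_le_power2[of "(a - b) - (b - c)"] by (simp add: power2_eq_square algebra_simps)
  then have "ennreal ((a - c)\<^sup>2) \<le> ennreal (2 * (a - b)\<^sup>2 + 2 * (b - c)\<^sup>2)" by (rule ennreal_leI)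
  also have "\<dots> = 2 * ennreal ((a - b)\<^sup>2) + 2 * ennreal ((b - c)\<^sup>2)"
    by (simp add: ennreal_mult')
  finally show ?thesis .
qed

lemma nn_integral_square_diff_le:
  assumes [measurable]: "f \<in> borel_measurable M" "g \<in> borel_measurable M" "h \<in> borel_measurable M"
  shows "(\<integral>\<^sup>+x. ennreal ((f x - h x)\<^sup>2) \<partial>M) \<le> 2 * (\<integral>\<^sup>+x. ennreal ((f x - g x)\<^sup>2) \<partial>M) + 2 * (\<integral>\<^sup>+x. ennreal ((g x - h x)\<^sup>2) \<partial>M)"
proof -
  have "(\<integral>\<^sup>+x. ennreal ((f x - h x)\<^sup>2) \<partial>M) \<le> (\<integral>\<^sup>+x. 2 * ennreal ((f x - g x)\<^sup>2) + 2 * ennreal ((g x - h x)\<^sup>2) \<partial>M)"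
    by (intro nn_integral_mono ennreal_square_diff_le)
  also have "\<dots> = 2 * (\<integral>\<^sup>+x. ennreal ((f x - g x)\<^sup>2) \<partial>M) + 2 * (\<integral>\<^sup>+x. ennreal ((g x - h x)\<^sup>2) \<partial>M)"
    by (subst nn_integral_add) (auto simp: nn_integral_cmult)
  finally show ?thesis .
qed

lemma elementary_fun_measurable [measurable]: "elementary_fun q n \<tau> c \<in> borel_measurable (\<Pi>\<^sub>M r\<in>{..<q}. lborel)"
  unfolding elementary_fun_def[abs_def] by measurable

text \<open>The same elementary functions approximate the kernel and the integral, so the inequality
  for elementary integrals passes to the limit. Splitting a squared difference twice produces the
  factor 4, which is harmless because the kernel distance will tend to 0.\<close>

lemma (in two_sided_brownian_motion) wiener_integral_distance:
  assumes W: "has_multiple_wiener_integral M B q f Y"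
    and \<sigma>: "strict_mono_on {..m} \<sigma>" and m: "m > 0"
    and a: "\<And>j. j \<in> J \<Longrightarrow> step_inner m \<sigma> (a j) (a j) = 1"
  shows "(\<integral>\<^sup>+\<omega>. ennreal ((Y \<omega> - (\<Sum>j\<in>J. w j * hermite q (step_integral B m \<sigma> (a j) \<omega>)))\<^sup>2) \<partial>M)
    \<le> 4 * ennreal (fact q) * (\<integral>\<^sup>+x. ennreal ((f x - (\<Sum>j\<in>J. w j * (\<Prod>r<q. step_fun m \<sigma> (a j) (x r))))\<^sup>2) \<partial>(\<Pi>\<^sub>M r\<in>{..<q}. lborel))"
proof -
  let ?P = "\<Pi>\<^sub>M r\<in>{..<q}. lborel :: real measure"
  note measurable_B[measurable]
  obtain n \<tau> c where nt: "\<And>k. strict_mono_on {..n k} (\<tau> k)"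
    and lim1: "(\<lambda>k. \<integral>\<^sup>+x. ennreal ((f x - elementary_fun q (n k) (\<tau> k) (c k) x)\<^sup>2) \<partial>?P) \<longlonglongrightarrow> 0"
    and lim2: "(\<lambda>k. \<integral>\<^sup>+\<omega>. ennreal ((Y \<omega> - elementary_integral B q (n k) (\<tau> k) (c k) \<omega>)\<^sup>2) \<partial>M) \<longlonglongrightarrow> 0"
    using W unfolding has_multiple_wiener_integral_def by blast
  have [measurable]: "f \<in> borel_measurable ?P" "Y \<in> borel_measurable M"
    using W unfolding has_multiple_wiener_integral_def by blast+
  define g where "g x = (\<Sum>j\<in>J. w j * (\<Prod>r<q. step_fun m \<sigma> (a j) (x r)))" for x
  define X where "X \<omega> = (\<Sum>j\<in>J. w j * hermite q (step_integral B m \<sigma> (a j) \<omega>))" for \<omega>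
  have [measurable]: "step_integral B m \<sigma> b \<in> borel_measurable M" for b
    unfolding step_integral_def[abs_def] by measurable
  have [measurable]: "g \<in> borel_measurable ?P" unfolding g_def[abs_def] by measurable
  have [measurable]: "X \<in> borel_measurable M" unfolding X_def[abs_def] by measurable
  have [measurable]: "elementary_integral B q n \<tau> c \<in> borel_measurable M" for n \<tau> c
    unfolding elementary_integral_def[abs_def] by measurable
  define e where "e k = elementary_fun q (n k) (\<tau> k) (c k)" for k
  define F where "F k = elementary_integral B q (n k) (\<tau> k) (c k)" for k
  have [measurable]: "e k \<in> borel_measurable ?P" "F k \<in> borel_measurable M" for k
    unfolding e_def F_def by measurable
  let ?A = "\<lambda>k. \<integral>\<^sup>+\<omega>. ennreal ((Y \<omega> - F k \<omega>)\<^sup>2) \<partial>M" and ?E = "\<lambda>k. \<integral>\<^sup>+x. ennreal ((f x - e k x)\<^sup>2) \<partial>?P"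
  let ?D = "\<integral>\<^sup>+x. ennreal ((f x - g x)\<^sup>2) \<partial>?P"
  have bound: "(\<integral>\<^sup>+\<omega>. ennreal ((Y \<omega> - X \<omega>)\<^sup>2) \<partial>M) \<le> 2 * ?A k + 2 * (ennreal (fact q) * (2 * ?E k + 2 * ?D))" for k
  proof -
    have "(\<integral>\<^sup>+\<omega>. ennreal ((Y \<omega> - X \<omega>)\<^sup>2) \<partial>M) \<le> 2 * ?A k + 2 * (\<integral>\<^sup>+\<omega>. ennreal ((F k \<omega> - X \<omega>)\<^sup>2) \<partial>M)"
      by (rule nn_integral_square_diff_le) measurable
    also have "(\<integral>\<^sup>+\<omega>. ennreal ((F k \<omega> - X \<omega>)\<^sup>2) \<partial>M) \<le> ennreal (fact q) * (\<integral>\<^sup>+x. ennreal ((e k x - g x)\<^sup>2) \<partial>?P)"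
      unfolding F_def X_def e_def g_def by (rule wiener_distance[OF nt \<sigma> m a])
    also have "(\<integral>\<^sup>+x. ennreal ((e k x - g x)\<^sup>2) \<partial>?P) \<le> 2 * (\<integral>\<^sup>+x. ennreal ((e k x - f x)\<^sup>2) \<partial>?P) + 2 * ?D"
      by (rule nn_integral_square_diff_le) measurable
    also have "(\<integral>\<^sup>+x. ennreal ((e k x - f x)\<^sup>2) \<partial>?P) = ?E k" by (simp add: power2_commute)
    finally show ?thesis by (simp add: add_left_mono mult_left_mono)
  qed
  have "(\<lambda>k. 2 * ?A k + 2 * (ennreal (fact q) * (2 * ?E k + 2 * ?D))) \<longlonglongrightarrow> 2 * 0 + 2 * (ennreal (fact q) * (2 * 0 + 2 * ?D))"
    using lim1 lim2 unfolding e_def F_def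
    by (intro tendsto_add ennreal_tendsto_cmult tendsto_const) auto
  then have "(\<integral>\<^sup>+\<omega>. ennreal ((Y \<omega> - X \<omega>)\<^sup>2) \<partial>M) \<le> 2 * 0 + 2 * (ennreal (fact q) * (2 * 0 + 2 * ?D))"
    by (rule LIMSEQ_le_const) (use bound in auto)
  also have "\<dots> = 4 * ennreal (fact q) * ?D"
    by (simp add: mult_ac)
  finally show ?thesis unfolding X_def g_def .
qed

text \<open>With \<open>m = N * N\<close> past cells of width \<open>1 / N\<close> the window has
  length about \<open>N\<close>. The neglected past then has weight
  \<open>exp (- 2 * \<gamma> * N)\<close>, while the mesh factor \<open>exp (- \<gamma> / N)\<close>
  tends to 1.\<close>

lemma kernel_approx_limit:
  assumes "\<gamma> > 0"
  shows "(\<lambda>N. c\<^sup>2 * (2 - 2 * ((exp (- \<gamma> / real N))\<^sup>2 * (1 - exp (- \<gamma> / real N) ^ (2 * (N * N)))) ^ q)) \<longlonglongrightarrow> 0"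
proof -
  have "(\<lambda>N. exp (- \<gamma> / real N)) \<longlonglongrightarrow> 1" by real_asymp
  moreover have "(\<lambda>N. exp (- \<gamma> / real N) ^ (2 * (N * N))) \<longlonglongrightarrow> 0"
  proof (rule Lim_transform_eventually)
    show "(\<lambda>N. exp (- 2 * \<gamma> * real N)) \<longlonglongrightarrow> 0" using assms by real_asymp
    show "\<forall>\<^sub>F N in sequentially. exp (- 2 * \<gamma> * real N) = exp (- \<gamma> / real N) ^ (2 * (N * N))"
      using eventually_gt_at_top[of 0]
    proof eventually_elim
      fix N :: nat assume "N > 0"
      have "exp (- \<gamma> / real N) ^ (2 * (N * N)) = exp (real (2 * (N * N)) * (- \<gamma> / real N))" by (rule exp_of_nat_mult[symmetric])
      also have "real (2 * (N * N)) * (- \<gamma> / real N) = - 2 * \<gamma> * real N" using \<open>N > 0\<close> by simp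
      finally show "exp (- 2 * \<gamma> * real N) = exp (- \<gamma> / real N) ^ (2 * (N * N))" by simp
    qed
  qed
  ultimately have "(\<lambda>N. c\<^sup>2 * (2 - 2 * ((exp (- \<gamma> / real N))\<^sup>2 * (1 - exp (- \<gamma> / real N) ^ (2 * (N * N)))) ^ q)) \<longlonglongrightarrow> c\<^sup>2 * (2 - 2 * (1\<^sup>2 * (1 - 0)) ^ q)"
    by (intro tendsto_intros)
  then show ?thesis by simp
qed

text \<open>The law of \<open>W 1\<close> is approximated by that of a normalised Hermite sum along a stationary
  autoregressive Gaussian sequence, i.e. an Ornstein-Uhlenbeck process observed on a fine grid.\<close>

lemma tempered_hermite_approx:
  assumes W: "tempered_hermite_process M B q \<gamma> W" and \<gamma>: "\<gamma> > 0" and \<epsilon>: "\<epsilon> > 0"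
  shows "\<forall>\<^sub>F N in sequentially. \<exists>n a. (\<forall>j<N. \<forall>l<N. dot n (a j) (a l) = exp (- \<gamma> / real N) ^ ((j - l) + (l - j))) \<and>
    (\<forall>\<phi> \<phi>' L. test_function \<phi> \<phi>' L \<longrightarrow>
      \<bar>(\<integral>x. \<phi> x \<partial>distr M borel (W 1)) -
        (\<integral>x. \<phi> (chaos_const q \<gamma> / N * (\<Sum>j<N. hermite q (lin n (a j) x))) \<partial>gauss n)\<bar> \<le> L * \<epsilon>)"
proof -
  interpret tempered_hermite_process M B q \<gamma> W by fact
  note measurable_B[measurable]
  let ?c = "chaos_const q \<gamma>"
  have wi: "has_multiple_wiener_integral M B q
        (\<lambda>x. tempered_hermite_const q \<gamma> * tempered_hermite_kernel q \<gamma> 1 x) (W 1)"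
    by (rule wiener_integral) simp
  then have [measurable]: "W 1 \<in> borel_measurable M"
    unfolding has_multiple_wiener_integral_def by blast
  define \<delta> where "\<delta> N = ?c\<^sup>2 * (2 - 2 * ((exp (- \<gamma> / real N))\<^sup>2 * (1 - exp (- \<gamma> / real N) ^ (2 * (N * N)))) ^ q)" for N
  have "\<delta> \<longlonglongrightarrow> 0" unfolding \<delta>_def[abs_def] by (rule kernel_approx_limit[OF \<gamma>])
  then have "\<forall>\<^sub>F N in sequentially. \<delta> N < \<epsilon>\<^sup>2 / (4 * fact q)"
    by (rule order_tendstoD) (use \<epsilon> in simp)
  then show ?thesis using eventually_gt_at_top[of 0]
  proof eventually_elim
    fix N :: nat assume dN: "\<delta> N < \<epsilon>\<^sup>2 / (4 * fact q)" and N: "0 < N"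
    define \<rho> where "\<rho> = exp (- \<gamma> / real N)"
    have \<rho>01: "0 < \<rho>" "\<rho> < 1" using \<gamma> N by (simp_all add: \<rho>_def)
    \<comment> \<open>The window into the past has to grow while the mesh shrinks.\<close>
    let ?m = "N * N"
    let ?mm = "Suc (?m + N)" and ?g = "ar_grid N ?m" and ?a = "ar_coef \<rho> N ?m"
    note mono = ar_grid_strict_mono[OF N, of ?mm ?m]
    obtain b where b: "\<And>j l. dot ?mm (b j) (b l) = step_inner ?mm ?g (?a j) (?a l)"
        "\<And>j \<omega>. step_integral B ?mm ?g (?a j) \<omega> = lin ?mm (b j) (normalized_increments B ?mm ?g \<omega>)"
      using step_integral_law[OF mono, of ?a] by auto
    note law = normalized_increments_law[OF mono zero_less_Suc]
    define Y where "Y x = ?c / N * (\<Sum>j<N. hermite q (lin ?mm (b j) x))" for x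
    have tY: "tame ?mm Y" unfolding Y_def[abs_def] by (intro tame_cmult tame_sum gsmooth_tame(1)[OF gsmooth_hermite])
    define X where "X \<omega> = Y (normalized_increments B ?mm ?g \<omega>)" for \<omega>
    have [measurable]: "X \<in> borel_measurable M"
      unfolding X_def[abs_def] by (rule measurable_compose[OF law(2) tame_measurable[OF tY]])
    have X_eq: "X \<omega> = (\<Sum>j<N. ?c / N * hermite q (step_integral B ?mm ?g (?a j) \<omega>))" for \<omega>
      unfolding X_def Y_def b(2) sum_distrib_left ..
    have "(\<integral>\<^sup>+\<omega>. ennreal ((W 1 \<omega> - X \<omega>)\<^sup>2) \<partial>M)
      \<le> 4 * ennreal (fact q) * (\<integral>\<^sup>+x. ennreal ((tempered_hermite_const q \<gamma> * tempered_hermite_kernel q \<gamma> 1 x -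
         (\<Sum>j<N. ?c / N * (\<Prod>r<q. step_fun ?mm ?g (?a j) (x r))))\<^sup>2) \<partial>(\<Pi>\<^sub>M r\<in>{..<q}. lborel))"
      unfolding X_eq by (rule wiener_integral_distance[OF wi mono zero_less_Suc])
        (use ar_inner[OF N \<rho>01] in auto)
    also have "\<dots> \<le> 4 * ennreal (fact q) * ennreal (\<delta> N)"
      unfolding \<delta>_def using kernel_approx[OF N \<gamma> \<rho>_def refl, of q ?m]
      by (intro mult_left_mono) (auto simp: \<rho>_def)
    also have "\<dots> \<le> 4 * ennreal (fact q) * ennreal (\<epsilon>\<^sup>2 / (4 * fact q))"
      using dN by (intro mult_left_mono ennreal_leI) auto
    also have "\<dots> = ennreal (4 * fact q * (\<epsilon>\<^sup>2 / (4 * fact q)))"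
      by (simp only: ennreal_mult'[symmetric] ennreal_numeral[symmetric] zero_le_numeral fact_ge_zero mult_nonneg_nonneg)
    also have "4 * fact q * (\<epsilon>\<^sup>2 / (4 * fact q)) = \<epsilon>\<^sup>2" by simp
    finally have le: "(\<integral>\<^sup>+\<omega>. ennreal ((W 1 \<omega> - X \<omega>)\<^sup>2) \<partial>M) \<le> ennreal (\<epsilon>\<^sup>2)" .
    have int: "integrable M (\<lambda>\<omega>. (W 1 \<omega> - X \<omega>)\<^sup>2)"
      using le by (intro integrableI_bounded) (auto intro: le_less_trans)
    have "ennreal (\<integral>\<omega>. (W 1 \<omega> - X \<omega>)\<^sup>2 \<partial>M) \<le> ennreal (\<epsilon>\<^sup>2)"
      using le nn_integral_eq_integral[OF int] by simp
    then have le2: "(\<integral>\<omega>. (W 1 \<omega> - X \<omega>)\<^sup>2 \<partial>M) \<le> \<epsilon>\<^sup>2" by simp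
    have main: "\<bar>(\<integral>x. \<phi> x \<partial>distr M borel (W 1)) - (\<integral>x. \<phi> (Y x) \<partial>gauss ?mm)\<bar> \<le> L * \<epsilon>"
      if \<phi>: "test_function \<phi> \<phi>' L" for \<phi> \<phi>' L
    proof -
      note [measurable] = test_function_measurable(1)[OF \<phi>]
      have L0: "0 \<le> L" using \<phi> unfolding test_function_def by (meson abs_ge_zero order_trans)
      have bd: "\<bar>\<phi> x\<bar> \<le> 1" for x using \<phi> by (auto simp: test_function_def)
      have i: "integrable M (\<lambda>\<omega>. \<phi> (W 1 \<omega>))" "integrable M (\<lambda>\<omega>. \<phi> (X \<omega>))"
        using bd by (auto intro!: integrable_const_bound[where B=1])
      have e1: "(\<integral>x. \<phi> x \<partial>distr M borel (W 1)) = (\<integral>\<omega>. \<phi> (W 1 \<omega>) \<partial>M)" by (rule integral_distr) auto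
      have "(\<lambda>x. \<phi> (Y x)) \<in> borel_measurable (gauss ?mm)"
        by (rule measurable_compose[OF tame_measurable[OF tY]]) simp
      then have e2: "(\<integral>x. \<phi> (Y x) \<partial>gauss ?mm) = (\<integral>\<omega>. \<phi> (X \<omega>) \<partial>M)"
        unfolding X_def using integral_distr[OF law(2), of "\<lambda>x. \<phi> (Y x)"] law(1) by simp
      have "\<bar>(\<integral>\<omega>. \<phi> (W 1 \<omega>) \<partial>M) - (\<integral>\<omega>. \<phi> (X \<omega>) \<partial>M)\<bar> = \<bar>\<integral>\<omega>. \<phi> (W 1 \<omega>) - \<phi> (X \<omega>) \<partial>M\<bar>"
        using i by simp
      also have "\<dots> \<le> (\<integral>\<omega>. \<bar>\<phi> (W 1 \<omega>) - \<phi> (X \<omega>)\<bar> \<partial>M)" by (rule integral_abs_bound)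
      \<comment> \<open>A weighted arithmetic-geometric mean inequality replaces Cauchy-Schwarz; its
        weight \<open>\<epsilon>\<close> matches the mean square error
        \<open>\<epsilon>\<^sup>2\<close>.\<close>
      also have "\<dots> \<le> (\<integral>\<omega>. L / 2 * \<epsilon> + L / (2 * \<epsilon>) * (W 1 \<omega> - X \<omega>)\<^sup>2 \<partial>M)"
      proof (rule integral_mono)
        fix \<omega>
        have "\<bar>W 1 \<omega> - X \<omega>\<bar> \<le> \<epsilon> / 2 + (W 1 \<omega> - X \<omega>)\<^sup>2 / (2 * \<epsilon>)"
        proof -
          have "0 \<le> (\<bar>W 1 \<omega> - X \<omega>\<bar> - \<epsilon>)\<^sup>2 / (2 * \<epsilon>)" using \<epsilon> by simp
          also have "\<dots> = \<epsilon> / 2 + (W 1 \<omega> - X \<omega>)\<^sup>2 / (2 * \<epsilon>) - \<bar>W 1 \<omega> - X \<omega>\<bar>"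
            using \<epsilon> by (simp add: power2_diff field_simps power2_eq_square)
          finally show ?thesis by simp
        qed
        then have "L * \<bar>W 1 \<omega> - X \<omega>\<bar> \<le> L * (\<epsilon> / 2 + (W 1 \<omega> - X \<omega>)\<^sup>2 / (2 * \<epsilon>))" using L0 by (rule mult_left_mono)
        then show "\<bar>\<phi> (W 1 \<omega>) - \<phi> (X \<omega>)\<bar> \<le> L / 2 * \<epsilon> + L / (2 * \<epsilon>) * (W 1 \<omega> - X \<omega>)\<^sup>2"
          using test_function_lipschitz[OF \<phi>, of "W 1 \<omega>" "X \<omega>"] by (simp add: algebra_simps)
      qed (use i int in auto)
      also have "\<dots> = L / 2 * \<epsilon> + L / (2 * \<epsilon>) * (\<integral>\<omega>. (W 1 \<omega> - X \<omega>)\<^sup>2 \<partial>M)"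
        using int by (simp add: prob_space)
      also have "\<dots> \<le> L / 2 * \<epsilon> + L / (2 * \<epsilon>) * \<epsilon>\<^sup>2"
        using le2 L0 \<epsilon> by (intro add_left_mono mult_left_mono) auto
      also have "\<dots> = L * \<epsilon>" using \<epsilon> by (simp add: power2_eq_square)
      finally show ?thesis unfolding e1 e2 .
    qed
    have "\<forall>j<N. \<forall>l<N. dot ?mm (b j) (b l) = exp (- \<gamma> / real N) ^ ((j - l) + (l - j))"
      unfolding b(1) using ar_inner[OF N \<rho>01] by (auto simp: \<rho>_def)
    then show "\<exists>n a. (\<forall>j<N. \<forall>l<N. dot n (a j) (a l) = exp (- \<gamma> / real N) ^ ((j - l) + (l - j))) \<and>
    (\<forall>\<phi> \<phi>' L. test_function \<phi> \<phi>' L \<longrightarrow>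
      \<bar>(\<integral>x. \<phi> x \<partial>distr M borel (W 1)) -
        (\<integral>x. \<phi> (chaos_const q \<gamma> / N * (\<Sum>j<N. hermite q (lin n (a j) x))) \<partial>gauss n)\<bar> \<le> L * \<epsilon>)"
      using main unfolding Y_def by blast
  qed
qed

section \<open>Normalisation of the variance\<close>

lemma chaos_const_square:
  assumes "\<gamma> > 0" "q \<ge> 1"
  shows "(chaos_const q \<gamma>)\<^sup>2 = (\<gamma> * q)\<^sup>2 / (2 * fact q * (exp (- (\<gamma> * q)) - 1 + \<gamma> * q))"
    "0 \<le> chaos_const q \<gamma>"
proof -
  have E: "0 < exp (- (\<gamma> * q)) - 1 + \<gamma> * q"
    using exp_minus_greater[of "\<gamma> * q"] assms by simp
  then have "(tempered_hermite_const q \<gamma>)\<^sup>2 = 2 ^ (q - 1) * (real q)\<^sup>2 * \<gamma> ^ (q + 2) / (fact q * (exp (- (\<gamma> * q)) - 1 + \<gamma> * q))"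
    using assms unfolding tempered_hermite_const_def by (subst real_sqrt_pow2) auto
  moreover have "(sqrt (2 * \<gamma>) ^ q)\<^sup>2 = (2 * \<gamma>) ^ q"
    using assms by (simp add: power_mult[symmetric] mult.commute[of q 2] power_mult)
  ultimately have e: "(chaos_const q \<gamma>)\<^sup>2 = 2 ^ (q - 1) * (real q)\<^sup>2 * \<gamma> ^ (q + 2) / (fact q * (exp (- (\<gamma> * q)) - 1 + \<gamma> * q)) / (2 * \<gamma>) ^ q"
    unfolding chaos_const_def power_divide by simp
  obtain p where q: "q = Suc p" using assms by (cases q) auto
  have r: "2 ^ (q - 1) * (real q)\<^sup>2 * \<gamma> ^ (q + 2) / (2 * \<gamma>) ^ q = (\<gamma> * q)\<^sup>2 / 2"
    using assms unfolding q power_mult_distrib power_add by (simp add: field_simps power2_eq_square)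
  have swap: "A / B / D = A / D / B" for A B D :: real by (simp only: divide_divide_eq_left mult.commute)
  show "(chaos_const q \<gamma>)\<^sup>2 = (\<gamma> * q)\<^sup>2 / (2 * fact q * (exp (- (\<gamma> * q)) - 1 + \<gamma> * q))"
    unfolding e swap[of _ "fact q * _"] r by simp
  show "0 \<le> chaos_const q \<gamma>" using assms E unfolding chaos_const_def tempered_hermite_const_def by auto
qed

text \<open>Enlarging the square of indices adds a row, a column and a corner, all of them
  geometric. Multiplying by \<open>(1 - r)\<^sup>2\<close> keeps the identity free of
  division.\<close>

lemma double_geometric_sum:
  "(1 - r)\<^sup>2 * (\<Sum>j<N. \<Sum>l<N. r ^ ((j - l) + (l - j))) = real N * (1 - r\<^sup>2) - 2 * r * (1 - r ^ N)" for r :: real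
proof (induction N)
  case (Suc N)
  let ?f = "\<lambda>j l. r ^ ((j - l) + (l - j))"
  have s: "(\<Sum>l<N. ?f N l) = (\<Sum>k<N. r * r ^ k)" and s': "(\<Sum>j<N. ?f j N) = (\<Sum>k<N. r * r ^ k)"
  proof -
    have "(\<Sum>l<N. ?f N l) = (\<Sum>l<N. r * r ^ (N - Suc l))"
      by (intro sum.cong refl) (auto simp: power_Suc[symmetric] Suc_diff_Suc simp del: power_Suc)
    also have "\<dots> = (\<Sum>k<N. r * r ^ k)" by (rule sum.nat_diff_reindex)
    finally show 1: "(\<Sum>l<N. ?f N l) = (\<Sum>k<N. r * r ^ k)" .
    have "(\<Sum>j<N. ?f j N) = (\<Sum>l<N. ?f N l)" by (intro sum.cong refl) (simp only: add.commute)
    from this 1 show "(\<Sum>j<N. ?f j N) = (\<Sum>k<N. r * r ^ k)" by (rule trans)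
  qed
  have g: "(1 - r) * (\<Sum>k<N. r * r ^ k) = r * (1 - r ^ N)"
    using geometric_sum[of r N] by (simp add: sum_distrib_left[symmetric])
  have "(\<Sum>j<Suc N. \<Sum>l<Suc N. ?f j l) = (\<Sum>j<N. \<Sum>l<N. ?f j l) + 2 * (\<Sum>k<N. r * r ^ k) + 1"
    by (simp only: sum.lessThan_Suc sum.distrib s s') simp
  then have "(1 - r)\<^sup>2 * (\<Sum>j<Suc N. \<Sum>l<Suc N. ?f j l) =
     (1 - r)\<^sup>2 * (\<Sum>j<N. \<Sum>l<N. ?f j l) + 2 * (1 - r) * ((1 - r) * (\<Sum>k<N. r * r ^ k)) + (1 - r)\<^sup>2"
    by (simp add: algebra_simps power2_eq_square)
  also have "\<dots> = real (Suc N) * (1 - r\<^sup>2) - 2 * r * (1 - r ^ Suc N)"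
    unfolding Suc g by (simp add: algebra_simps power2_eq_square)
  finally show ?case .
qed simp

text \<open>The double sum is a Riemann sum for the integral of
  \<open>exp (- \<gamma> * q * \<bar>s - t\<bar>)\<close> over the unit square. The limit 1 is the
  unit variance of \<open>W 1\<close> and explains the shape of
  \<open>tempered_hermite_const\<close>.\<close>

lemma variance_limit:
  assumes "\<gamma> > 0" "q \<ge> 1"
  shows "(\<lambda>N. (chaos_const q \<gamma> / N)\<^sup>2 * fact q * (\<Sum>j<N. \<Sum>l<N. (exp (- \<gamma> / real N) ^ ((j - l) + (l - j))) ^ q)) \<longlonglongrightarrow> 1"
proof -
  define x where "x = \<gamma> * q"
  have x: "x > 0" using assms by (simp add: x_def)
  have E: "0 < exp (- x) - 1 + x" using exp_minus_greater[of x] x by simp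
  have lim: "(\<lambda>N. (real N * (1 - (exp (- x / real N))\<^sup>2) - 2 * exp (- x / real N) * (1 - exp (- x))) / (real N * (1 - exp (- x / real N)))\<^sup>2)
    \<longlonglongrightarrow> (2 * x - 2 * 1 * (1 - exp (- x))) / x\<^sup>2"
  proof -
    have "(\<lambda>N. real N * (1 - (exp (- x / real N))\<^sup>2)) \<longlonglongrightarrow> 2 * x" by real_asymp
    moreover have "(\<lambda>N. exp (- x / real N)) \<longlonglongrightarrow> 1" by real_asymp
    moreover have "(\<lambda>N. real N * (1 - exp (- x / real N))) \<longlonglongrightarrow> x" by real_asymp
    ultimately show ?thesis
      by (rule tendsto_divide[OF tendsto_diff[OF _ tendsto_mult[OF tendsto_mult[OF tendsto_const] tendsto_const]] tendsto_power])
        (use x in auto)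
  qed
  have "(\<lambda>N. (chaos_const q \<gamma>)\<^sup>2 * fact q * ((real N * (1 - (exp (- x / real N))\<^sup>2) - 2 * exp (- x / real N) * (1 - exp (- x))) / (real N * (1 - exp (- x / real N)))\<^sup>2))
    \<longlonglongrightarrow> (chaos_const q \<gamma>)\<^sup>2 * fact q * ((2 * x - 2 * 1 * (1 - exp (- x))) / x\<^sup>2)"
    by (intro tendsto_mult tendsto_const lim)
  also have "(chaos_const q \<gamma>)\<^sup>2 * fact q * ((2 * x - 2 * 1 * (1 - exp (- x))) / x\<^sup>2) = 1"
  proof -
    define Z where "Z = exp (- x) - 1 + x"
    have "2 * x - 2 * 1 * (1 - exp (- x)) = 2 * Z" by (simp add: Z_def)
    moreover have "Z > 0" using E by (simp add: Z_def)
    ultimately show ?thesis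
      unfolding chaos_const_square(1)[OF assms] x_def[symmetric] Z_def[symmetric] using x by simp
  qed
  finally show ?thesis
  proof (rule Lim_transform_eventually)
    show "\<forall>\<^sub>F N in sequentially. (chaos_const q \<gamma>)\<^sup>2 * fact q * ((real N * (1 - (exp (- x / real N))\<^sup>2) - 2 * exp (- x / real N) * (1 - exp (- x))) / (real N * (1 - exp (- x / real N)))\<^sup>2) =
       (chaos_const q \<gamma> / N)\<^sup>2 * fact q * (\<Sum>j<N. \<Sum>l<N. (exp (- \<gamma> / real N) ^ ((j - l) + (l - j))) ^ q)"
      using eventually_gt_at_top[of 0]
    proof eventually_elim
      fix N :: nat assume N: "N > 0"
      \<comment> \<open>Raising the correlations to the power \<open>q\<close> replaces
        \<open>\<gamma>\<close> by \<open>x = \<gamma> * q\<close>; since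
        \<open>r ^ N = exp (- x)\<close> for every \<open>N\<close>, the closed form has an
        elementary limit.\<close>
      define r where "r = exp (- x / real N)"
      have r: "exp (- \<gamma> / real N) ^ q = r"
        unfolding r_def x_def exp_of_nat_mult[symmetric] by (simp add: mult.commute)
      have rN: "r ^ N = exp (- x)"
        unfolding r_def exp_of_nat_mult[symmetric] using N by simp
      have r1: "r < 1" using x N by (simp add: r_def)
      have "(exp (- \<gamma> / real N) ^ d) ^ q = r ^ d" for d
        unfolding r[symmetric] by (simp only: power_mult[symmetric] mult.commute)
      then have "(\<Sum>j<N. \<Sum>l<N. (exp (- \<gamma> / real N) ^ ((j - l) + (l - j))) ^ q) = (real N * (1 - r\<^sup>2) - 2 * r * (1 - exp (- x))) / (1 - r)\<^sup>2"
        using double_geometric_sum[of r N] r1 unfolding rN by (simp add: field_simps)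
      then show "(chaos_const q \<gamma>)\<^sup>2 * fact q * ((real N * (1 - (exp (- x / real N))\<^sup>2) - 2 * exp (- x / real N) * (1 - exp (- x))) / (real N * (1 - exp (- x / real N)))\<^sup>2) =
       (chaos_const q \<gamma> / N)\<^sup>2 * fact q * (\<Sum>j<N. \<Sum>l<N. (exp (- \<gamma> / real N) ^ ((j - l) + (l - j))) ^ q)"
        unfolding r_def[symmetric] by (simp add: power_divide power_mult_distrib)
    qed
  qed
qed

section \<open>Covariances of Hermite polynomials\<close>

abbreviation hlin :: "nat \<Rightarrow> nat \<Rightarrow> (nat \<Rightarrow> real) \<Rightarrow> (nat \<Rightarrow> real) \<Rightarrow> real" where
  "hlin n a v x \<equiv> hermite a (lin n v x)"

lemma tame_hlin: "tame n (hlin n a v)"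
  by (rule gsmooth_tame(1)[OF gsmooth_hermite])

lemma expectation_lin:
  fixes f :: "real \<Rightarrow> real"
  assumes "dot n v v = 1" "f \<in> borel_measurable borel"
  shows "(\<integral>x. f (lin n v x) \<partial>gauss n) = (\<integral>x. f x \<partial>N01)"
  using integral_distr[OF lin_measurable[of n v] assms(2)] distr_lin[OF assms(1)] by simp

text \<open>Moments are recorded as functions of the degrees, so that integration by parts becomes a
  recursion on degrees.\<close>

definition hermite_mean2 :: "nat \<Rightarrow> (nat \<Rightarrow> real) \<Rightarrow> (nat \<Rightarrow> real) \<Rightarrow> nat \<Rightarrow> nat \<Rightarrow> real" where
  "hermite_mean2 n v1 v2 a b = (\<integral>x. hlin n a v1 x * hlin n b v2 x \<partial>gauss n)"

definition hermite_mean4 ::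
  "nat \<Rightarrow> (nat \<Rightarrow> real) \<Rightarrow> (nat \<Rightarrow> real) \<Rightarrow> (nat \<Rightarrow> real) \<Rightarrow> (nat \<Rightarrow> real) \<Rightarrow> nat \<Rightarrow> nat \<Rightarrow> nat \<Rightarrow> nat \<Rightarrow> real" where
  "hermite_mean4 n v1 v2 v3 v4 a b c d =
     (\<integral>x. hlin n a v1 x * (hlin n b v2 x * (hlin n c v3 x * hlin n d v4 x)) \<partial>gauss n)"

lemma hermite_mean2_Suc:
  assumes "dot n v1 v1 = 1"
  shows "hermite_mean2 n v1 v2 (Suc a) b = real b * dot n v1 v2 * hermite_mean2 n v1 v2 a (b - 1)"
proof -
  have "hermite_mean2 n v1 v2 (Suc a) b = (\<integral>x. real b * dot n v1 v2 * (hlin n a v1 x * hlin n (b - 1) v2 x) \<partial>gauss n)"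
    unfolding hermite_mean2_def hermite_ibp[OF gsmooth_hermite assms] dderiv_hermite by (simp add: mult_ac)
  then show ?thesis by (simp only: hermite_mean2_def integral_mult_right_zero)
qed

text \<open>The first Hermite factor is integrated by parts, and the derivative meets the other
  three factors in turn.\<close>

lemma hermite_mean4_Suc:
  assumes "dot n v1 v1 = 1"
  shows "hermite_mean4 n v1 v2 v3 v4 (Suc a) b c d =
    real b * dot n v1 v2 * hermite_mean4 n v1 v2 v3 v4 a (b - 1) c d +
    real c * dot n v1 v3 * hermite_mean4 n v1 v2 v3 v4 a b (c - 1) d +
    real d * dot n v1 v4 * hermite_mean4 n v1 v2 v3 v4 a b c (d - 1)"
proof -
  let ?d = "\<lambda>b v i x. real b * hermite (b - 1) (lin n v x) * v i"
  let ?G = "\<lambda>x. hlin n c v3 x * hlin n d v4 x"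
  let ?dG = "\<lambda>i x. ?d c v3 i x * hlin n d v4 x + ?d d v4 i x * hlin n c v3 x"
  have G: "gsmooth n ?G ?dG" by (rule gsmooth_mult[OF gsmooth_hermite gsmooth_hermite])
  have GS: "gsmooth n (\<lambda>x. hlin n b v2 x * ?G x) (\<lambda>i x. ?d b v2 i x * ?G x + ?dG i x * hlin n b v2 x)"
    by (rule gsmooth_mult[OF gsmooth_hermite G])
  have dd: "dderiv n v1 (\<lambda>i x. ?d b v2 i x * ?G x + ?dG i x * hlin n b v2 x) x =
    real b * dot n v1 v2 * (hlin n (b - 1) v2 x * ?G x) + real c * dot n v1 v3 * (hlin n b v2 x * (hlin n (c - 1) v3 x * hlin n d v4 x))
     + real d * dot n v1 v4 * (hlin n b v2 x * (hlin n c v3 x * hlin n (d - 1) v4 x))" for x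
    unfolding dderiv_mult[of n v1 "?d b v2" ?G ?dG "hlin n b v2" x]
      dderiv_mult[of n v1 "?d c v3" "hlin n d v4" "?d d v4" "hlin n c v3" x] dderiv_hermite
    by (simp add: algebra_simps)
  have i: "integrable (gauss n) (\<lambda>x. k * (hlin n a v1 x * (hlin n b' v2 x * (hlin n c' v3 x * hlin n d' v4 x))))" for k b' c' d'
    by (intro tame_integrable tame_cmult tame_mult tame_hlin)
  have "hermite_mean4 n v1 v2 v3 v4 (Suc a) b c d = (\<integral>x.
    real b * dot n v1 v2 * (hlin n a v1 x * (hlin n (b - 1) v2 x * (hlin n c v3 x * hlin n d v4 x))) +
    real c * dot n v1 v3 * (hlin n a v1 x * (hlin n b v2 x * (hlin n (c - 1) v3 x * hlin n d v4 x))) +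
    real d * dot n v1 v4 * (hlin n a v1 x * (hlin n b v2 x * (hlin n c v3 x * hlin n (d - 1) v4 x))) \<partial>gauss n)"
    unfolding hermite_mean4_def hermite_ibp[OF GS assms] dd by (simp add: algebra_simps)
  also have "\<dots> = real b * dot n v1 v2 * hermite_mean4 n v1 v2 v3 v4 a (b - 1) c d +
    real c * dot n v1 v3 * hermite_mean4 n v1 v2 v3 v4 a b (c - 1) d +
    real d * dot n v1 v4 * hermite_mean4 n v1 v2 v3 v4 a b c (d - 1)"
    unfolding hermite_mean4_def integral_mult_right_zero[symmetric]
    by (simp only: Bochner_Integration.integral_add i Bochner_Integration.integrable_add)
  finally show ?thesis .
qed

text \<open>A product of four numbers is at most the sum of their fourth powers, and each linear
  form is standard normal. The constant therefore depends on the degrees only, not on the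
  correlations.\<close>

lemma hermite_mean4_bound:
  "\<exists>C\<ge>0. \<forall>n v1 v2 v3 v4. dot n v1 v1 = 1 \<longrightarrow> dot n v2 v2 = 1 \<longrightarrow> dot n v3 v3 = 1 \<longrightarrow> dot n v4 v4 = 1 \<longrightarrow>
     \<bar>hermite_mean4 n v1 v2 v3 v4 a b c d\<bar> \<le> C"
proof (intro exI conjI allI impI)
  let ?m = "\<lambda>a. (\<integral>x. hermite a x ^ 4 \<partial>N01)"
  have mnn: "0 \<le> ?m a" for a by (intro Bochner_Integration.integral_nonneg) simp
  show "0 \<le> ?m a + ?m b + ?m c + ?m d" using mnn by (simp add: add_nonneg_nonneg)
  fix n v1 v2 v3 v4 assume u: "dot n v1 v1 = 1" "dot n v2 v2 = 1" "dot n v3 v3 = 1" "dot n v4 v4 = 1"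
  have e: "(\<integral>x. hlin n a v x ^ 4 \<partial>gauss n) = ?m a" if "dot n v v = 1" for a v
    using that by (intro expectation_lin[where f="\<lambda>y. hermite a y ^ 4"]) auto
  have p: "\<bar>x * (y * (z * w))\<bar> \<le> x ^ 4 + y ^ 4 + z ^ 4 + w ^ 4" for x y z w :: real
  proof -
    have aux: "(a / 2 + b / 2) / 2 + (c / 2 + d / 2) / 2 \<le> a + b + c + d"
      if "0 \<le> a" "0 \<le> b" "0 \<le> c" "0 \<le> d" for a b c d :: real
      using that by (simp add: field_simps)
    have s: "\<bar>s * t\<bar> \<le> s\<^sup>2 / 2 + t\<^sup>2 / 2" for s t :: real
      using sum_squares_bound[of "\<bar>s\<bar>" "\<bar>t\<bar>"] by (simp add: abs_mult)
    have f: "(s * t)\<^sup>2 \<le> s ^ 4 / 2 + t ^ 4 / 2" for s t :: real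
      using s[of "s\<^sup>2" "t\<^sup>2"] by (simp add: power_mult_distrib power_mult[symmetric])
    have "\<bar>(x * y) * (z * w)\<bar> \<le> (x * y)\<^sup>2 / 2 + (z * w)\<^sup>2 / 2" by (rule s)
    also have "\<dots> \<le> (x ^ 4 / 2 + y ^ 4 / 2) / 2 + (z ^ 4 / 2 + w ^ 4 / 2) / 2"
      using f by (intro add_mono divide_right_mono) auto
    also have "\<dots> \<le> x ^ 4 + y ^ 4 + z ^ 4 + w ^ 4"
      by (rule aux) simp_all
    finally show ?thesis by (simp add: mult.assoc)
  qed
  have i4: "integrable (gauss n) (\<lambda>x. hlin n a v x ^ 4)" for a v
    by (intro tame_integrable tame_power tame_hlin)
  have "\<bar>hermite_mean4 n v1 v2 v3 v4 a b c d\<bar> \<le> (\<integral>x. \<bar>hlin n a v1 x * (hlin n b v2 x * (hlin n c v3 x * hlin n d v4 x))\<bar> \<partial>gauss n)"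
    unfolding hermite_mean4_def by (rule integral_abs_bound)
  also have "\<dots> \<le> (\<integral>x. hlin n a v1 x ^ 4 + hlin n b v2 x ^ 4 + hlin n c v3 x ^ 4 + hlin n d v4 x ^ 4 \<partial>gauss n)"
    by (intro integral_mono p tame_integrable tame_abs tame_mult tame_add tame_power tame_hlin)
  also have "\<dots> = ?m a + ?m b + ?m c + ?m d"
    by (simp only: Bochner_Integration.integral_add i4 Bochner_Integration.integrable_add e[OF u(1)] e[OF u(2)] e[OF u(3)] e[OF u(4)])
  finally show "\<bar>hermite_mean4 n v1 v2 v3 v4 a b c d\<bar> \<le> ?m a + ?m b + ?m c + ?m d" .
qed

text \<open>Correlations between 0 and 1 allow sums of them to serve as error bounds without
  absolute values. The autoregressive sequence qualifies, its correlations being powers of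
  \<open>\<rho>\<close>.\<close>

definition unit_frame :: "nat \<Rightarrow> (nat \<Rightarrow> real) \<Rightarrow> (nat \<Rightarrow> real) \<Rightarrow> (nat \<Rightarrow> real) \<Rightarrow> (nat \<Rightarrow> real) \<Rightarrow> bool" where
  "unit_frame n v1 v2 v3 v4 \<longleftrightarrow> (\<forall>v\<in>{v1, v2, v3, v4}. dot n v v = 1 \<and> (\<forall>w\<in>{v1, v2, v3, v4}. 0 \<le> dot n v w \<and> dot n v w \<le> 1))"

lemma hermite_mean4_bound':
  "\<exists>C\<ge>0. \<forall>n v1 v2 v3 v4. unit_frame n v1 v2 v3 v4 \<longrightarrow> \<bar>hermite_mean4 n v1 v2 v3 v4 a b c d\<bar> \<le> C"
  using hermite_mean4_bound[of a b c d] by (auto simp: unit_frame_def)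

text \<open>For \<open>b = 0\<close> the covariance is 0. Otherwise the mean of the first pair
  vanishes, and integration by parts along \<open>v2\<close> contracts only across the pairs,
  because the factor at \<open>v1\<close> is constant.\<close>

lemma hermite_covariance_0:
  "\<exists>C\<ge>0. \<forall>n v1 v2 v3 v4. unit_frame n v1 v2 v3 v4 \<longrightarrow>
     \<bar>hermite_mean4 n v1 v2 v3 v4 0 b c d - hermite_mean2 n v1 v2 0 b * hermite_mean2 n v3 v4 c d\<bar>
       \<le> C * (dot n v1 v3 + dot n v1 v4 + dot n v2 v3 + dot n v2 v4)"
proof (cases b)
  case 0
  have "hermite_mean4 n v1 v2 v3 v4 0 b c d - hermite_mean2 n v1 v2 0 b * hermite_mean2 n v3 v4 c d = 0" for n v1 v2 v3 v4
  proof -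
    interpret prob_space "gauss n" by (rule prob_space_gauss)
    show ?thesis using prob_space by (simp add: 0 hermite_mean4_def hermite_mean2_def)
  qed
  then show ?thesis by (intro exI[of _ 0]) simp
next
  case (Suc b')
  obtain C1 where C1: "C1 \<ge> 0" "\<And>n v1 v2 v3 v4. unit_frame n v1 v2 v3 v4 \<Longrightarrow> \<bar>hermite_mean4 n v1 v2 v3 v4 b' 0 (c - 1) d\<bar> \<le> C1"
    using hermite_mean4_bound'[of b' 0 "c - 1" d] by blast
  obtain C2 where C2: "C2 \<ge> 0" "\<And>n v1 v2 v3 v4. unit_frame n v1 v2 v3 v4 \<Longrightarrow> \<bar>hermite_mean4 n v1 v2 v3 v4 b' 0 c (d - 1)\<bar> \<le> C2"
    using hermite_mean4_bound'[of b' 0 c "d - 1"] by blast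
  show ?thesis
  proof (intro exI[of _ "real c * C1 + real d * C2"] conjI allI impI)
    show "0 \<le> real c * C1 + real d * C2" using C1 C2 by simp
    fix n v1 v2 v3 v4 assume uf: "unit_frame n v1 v2 v3 v4"
    then have uf': "unit_frame n v2 v1 v3 v4" by (auto simp: unit_frame_def)
    have d: "0 \<le> dot n v1 v3" "0 \<le> dot n v1 v4" "0 \<le> dot n v2 v3" "0 \<le> dot n v2 v4" "dot n v2 v2 = 1"
      using uf by (auto simp: unit_frame_def)
    have "hermite_mean2 n v1 v2 0 b = hermite_mean2 n v2 v1 b 0"
      by (simp add: hermite_mean2_def)
    also have "\<dots> = 0" unfolding Suc hermite_mean2_Suc[OF d(5)] by simp
    finally have z: "hermite_mean2 n v1 v2 0 b = 0" .
    have "hermite_mean4 n v1 v2 v3 v4 0 b c d = hermite_mean4 n v2 v1 v3 v4 b 0 c d"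
      by (simp add: hermite_mean4_def)
    also have "\<dots> = real c * dot n v2 v3 * hermite_mean4 n v2 v1 v3 v4 b' 0 (c - 1) d +
       real d * dot n v2 v4 * hermite_mean4 n v2 v1 v3 v4 b' 0 c (d - 1)"
      unfolding Suc hermite_mean4_Suc[OF d(5)] by simp
    finally have eq: "hermite_mean4 n v1 v2 v3 v4 0 b c d = real c * dot n v2 v3 * hermite_mean4 n v2 v1 v3 v4 b' 0 (c - 1) d +
       real d * dot n v2 v4 * hermite_mean4 n v2 v1 v3 v4 b' 0 c (d - 1)" .
    define R1 where "R1 = hermite_mean4 n v2 v1 v3 v4 b' 0 (c - 1) d"
    define R2 where "R2 = hermite_mean4 n v2 v1 v3 v4 b' 0 c (d - 1)"
    let ?S = "dot n v1 v3 + dot n v1 v4 + dot n v2 v3 + dot n v2 v4"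
    have S: "0 \<le> ?S" using d by simp
    have R: "\<bar>R1\<bar> \<le> C1" "\<bar>R2\<bar> \<le> C2"
      unfolding R1_def R2_def by (rule C1(2)[OF uf'], rule C2(2)[OF uf'])
    have "\<bar>hermite_mean4 n v1 v2 v3 v4 0 b c d\<bar> \<le> \<bar>real c * dot n v2 v3 * R1\<bar> + \<bar>real d * dot n v2 v4 * R2\<bar>"
      unfolding eq R1_def R2_def by linarith
    also have "\<dots> = real c * dot n v2 v3 * \<bar>R1\<bar> + real d * dot n v2 v4 * \<bar>R2\<bar>"
      using d by (simp add: abs_mult)
    also have "\<dots> \<le> real c * ?S * C1 + real d * ?S * C2"
      using d R C1 C2 S by (intro add_mono mult_mono) auto
    also have "\<dots> = (real c * C1 + real d * C2) * ?S" by (simp add: algebra_simps)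
    finally show "\<bar>hermite_mean4 n v1 v2 v3 v4 0 b c d - hermite_mean2 n v1 v2 0 b * hermite_mean2 n v3 v4 c d\<bar>
       \<le> (real c * C1 + real d * C2) * (dot n v1 v3 + dot n v1 v4 + dot n v2 v3 + dot n v2 v4)"
      by (simp add: z)
  qed
qed

text \<open>Integrating by parts along \<open>v1\<close>, the contraction with \<open>v2\<close>
  reproduces a covariance of lower degrees, while a contraction with \<open>v3\<close> or
  \<open>v4\<close> carries a cross-correlation times a bounded moment. A bound linear in the
  cross-correlations is enough for the rate.\<close>

lemma hermite_covariance:
  "\<exists>C\<ge>0. \<forall>n v1 v2 v3 v4. unit_frame n v1 v2 v3 v4 \<longrightarrow>
     \<bar>hermite_mean4 n v1 v2 v3 v4 a b c d - hermite_mean2 n v1 v2 a b * hermite_mean2 n v3 v4 c d\<bar>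
       \<le> C * (dot n v1 v3 + dot n v1 v4 + dot n v2 v3 + dot n v2 v4)"
proof (induction a arbitrary: b)
  case 0
  show ?case by (rule hermite_covariance_0)
next
  case (Suc a)
  obtain C0 where C0: "C0 \<ge> 0" "\<And>n v1 v2 v3 v4. unit_frame n v1 v2 v3 v4 \<Longrightarrow>
     \<bar>hermite_mean4 n v1 v2 v3 v4 a (b - 1) c d - hermite_mean2 n v1 v2 a (b - 1) * hermite_mean2 n v3 v4 c d\<bar>
       \<le> C0 * (dot n v1 v3 + dot n v1 v4 + dot n v2 v3 + dot n v2 v4)"
    using Suc[of "b - 1"] by blast
  obtain C1 where C1: "C1 \<ge> 0" "\<And>n v1 v2 v3 v4. unit_frame n v1 v2 v3 v4 \<Longrightarrow> \<bar>hermite_mean4 n v1 v2 v3 v4 a b (c - 1) d\<bar> \<le> C1"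
    using hermite_mean4_bound'[of a b "c - 1" d] by blast
  obtain C2 where C2: "C2 \<ge> 0" "\<And>n v1 v2 v3 v4. unit_frame n v1 v2 v3 v4 \<Longrightarrow> \<bar>hermite_mean4 n v1 v2 v3 v4 a b c (d - 1)\<bar> \<le> C2"
    using hermite_mean4_bound'[of a b c "d - 1"] by blast
  show ?case
  proof (intro exI[of _ "real b * C0 + real c * C1 + real d * C2"] conjI allI impI)
    show "0 \<le> real b * C0 + real c * C1 + real d * C2" using C0 C1 C2 by simp
    fix n v1 v2 v3 v4 assume uf: "unit_frame n v1 v2 v3 v4"
    have d: "0 \<le> dot n v1 v2" "dot n v1 v2 \<le> 1" "0 \<le> dot n v1 v3" "0 \<le> dot n v1 v4" "0 \<le> dot n v2 v3" "0 \<le> dot n v2 v4" "dot n v1 v1 = 1"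
      using uf by (auto simp: unit_frame_def)
    let ?S = "dot n v1 v3 + dot n v1 v4 + dot n v2 v3 + dot n v2 v4"
    define R where "R = hermite_mean4 n v1 v2 v3 v4 a (b - 1) c d - hermite_mean2 n v1 v2 a (b - 1) * hermite_mean2 n v3 v4 c d"
    define R1 where "R1 = hermite_mean4 n v1 v2 v3 v4 a b (c - 1) d"
    define R2 where "R2 = hermite_mean4 n v1 v2 v3 v4 a b c (d - 1)"
    have S: "0 \<le> ?S" using d by simp
    have R: "\<bar>R\<bar> \<le> C0 * ?S" "\<bar>R1\<bar> \<le> C1" "\<bar>R2\<bar> \<le> C2"
      unfolding R_def R1_def R2_def by (rule C0(2)[OF uf], rule C1(2)[OF uf], rule C2(2)[OF uf])
    have "hermite_mean4 n v1 v2 v3 v4 (Suc a) b c d - hermite_mean2 n v1 v2 (Suc a) b * hermite_mean2 n v3 v4 c d =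
       real b * dot n v1 v2 * R + real c * dot n v1 v3 * R1 + real d * dot n v1 v4 * R2"
      unfolding hermite_mean4_Suc[OF d(7)] hermite_mean2_Suc[OF d(7)] R_def R1_def R2_def by (simp add: algebra_simps)
    also have "\<bar>\<dots>\<bar> \<le> \<bar>real b * dot n v1 v2 * R\<bar> + \<bar>real c * dot n v1 v3 * R1\<bar> + \<bar>real d * dot n v1 v4 * R2\<bar>"
      by linarith
    also have "\<dots> = real b * dot n v1 v2 * \<bar>R\<bar> + real c * dot n v1 v3 * \<bar>R1\<bar> + real d * dot n v1 v4 * \<bar>R2\<bar>"
      using d by (simp add: abs_mult)
    also have "\<dots> \<le> real b * 1 * (C0 * ?S) + real c * ?S * C1 + real d * ?S * C2"
      using d R C0 C1 C2 S by (intro add_mono mult_mono) auto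
    finally show "\<bar>hermite_mean4 n v1 v2 v3 v4 (Suc a) b c d - hermite_mean2 n v1 v2 (Suc a) b * hermite_mean2 n v3 v4 c d\<bar>
       \<le> (real b * C0 + real c * C1 + real d * C2) * ?S"
      by (simp add: algebra_simps)
  qed
qed

text \<open>In each of the four products the three factors form a path through the four indices,
  \<open>l - j - k - m\<close> in the first. Summing from the ends of the path costs
  \<open>S\<close> per edge and leaves one free index, hence \<open>N * S ^ 3\<close> for each
  path.\<close>

lemma sum_quadruple_bound:
  fixes r :: "nat \<Rightarrow> nat \<Rightarrow> real"
  assumes r0: "\<And>j l. 0 \<le> r j l" and sym: "\<And>j l. r j l = r l j"
    and S: "\<And>j. j < N \<Longrightarrow> (\<Sum>l<N. r j l) \<le> S" and S0: "0 \<le> S"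
  shows "(\<Sum>j<N. \<Sum>l<N. \<Sum>k<N. \<Sum>m<N. r j l * r k m * (r j k + r j m + r l k + r l m)) \<le> 4 * N * S ^ 3"
proof -
  let ?A = "\<Sum>j<N. \<Sum>l<N. \<Sum>k<N. \<Sum>m<N. r j l * r k m * r j k"
  have A: "?A \<le> N * S ^ 3"
  proof -
    have "?A = (\<Sum>j<N. (\<Sum>l<N. r j l) * (\<Sum>k<N. r j k * (\<Sum>m<N. r k m)))"
    proof (intro sum.cong refl)
      fix j
      have "(\<Sum>k<N. \<Sum>m<N. r j l * r k m * r j k) = r j l * (\<Sum>k<N. r j k * (\<Sum>m<N. r k m))" for l
        by (simp add: sum_distrib_left mult_ac)
      then show "(\<Sum>l<N. \<Sum>k<N. \<Sum>m<N. r j l * r k m * r j k) = (\<Sum>l<N. r j l) * (\<Sum>k<N. r j k * (\<Sum>m<N. r k m))"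
        by (simp add: sum_distrib_right)
    qed
    also have "\<dots> \<le> (\<Sum>j<N. S * (S * S))"
    proof (intro sum_mono mult_mono)
      fix j assume j: "j \<in> {..<N}"
      have "(\<Sum>k<N. r j k * (\<Sum>m<N. r k m)) \<le> (\<Sum>k<N. r j k * S)"
        using r0 S by (intro sum_mono mult_left_mono) auto
      also have "\<dots> = (\<Sum>k<N. r j k) * S" by (simp add: sum_distrib_right)
      also have "\<dots> \<le> S * S" using S j S0 by (intro mult_right_mono) auto
      finally show "(\<Sum>k<N. r j k * (\<Sum>m<N. r k m)) \<le> S * S" .
    qed (use S r0 S0 in \<open>auto intro!: sum_nonneg mult_nonneg_nonneg\<close>)
    finally show ?thesis by (simp add: power3_eq_cube mult_ac)
  qed
  have B: "(\<Sum>j<N. \<Sum>l<N. \<Sum>k<N. \<Sum>m<N. r j l * r k m * r j m) = ?A"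
  proof (rule sum.cong[OF refl], rule sum.cong[OF refl])
    fix j l
    have "(\<Sum>k<N. \<Sum>m<N. r j l * r k m * r j m) = (\<Sum>m<N. \<Sum>k<N. r j l * r k m * r j m)"
      by (rule sum.swap)
    also have "\<dots> = (\<Sum>m<N. \<Sum>k<N. r j l * r m k * r j m)"
    proof (intro sum.cong refl)
      fix m k show "r j l * r k m * r j m = r j l * r m k * r j m" using sym[of k m] by simp
    qed
    finally show "(\<Sum>k<N. \<Sum>m<N. r j l * r k m * r j m) = (\<Sum>k<N. \<Sum>m<N. r j l * r k m * r j k)" .
  qed
  \<comment> \<open>Exchanging \<open>j\<close> and \<open>l\<close> preserves \<open>r j l\<close>,
    so the last two products reduce to the first two.\<close>
  have flip: "(\<Sum>j<N. \<Sum>l<N. \<Sum>k<N. \<Sum>m<N. r j l * r k m * f l k m) =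
      (\<Sum>j<N. \<Sum>l<N. \<Sum>k<N. \<Sum>m<N. r j l * r k m * f j k m)" for f
  proof -
    have "(\<Sum>j<N. \<Sum>l<N. \<Sum>k<N. \<Sum>m<N. r j l * r k m * f l k m) = (\<Sum>l<N. \<Sum>j<N. \<Sum>k<N. \<Sum>m<N. r j l * r k m * f l k m)"
      by (rule sum.swap)
    also have "\<dots> = (\<Sum>l<N. \<Sum>j<N. \<Sum>k<N. \<Sum>m<N. r l j * r k m * f l k m)"
    proof (intro sum.cong refl)
      fix l j k m show "r j l * r k m * f l k m = r l j * r k m * f l k m" using sym[of j l] by simp
    qed
    finally show ?thesis .
  qed
  have C: "(\<Sum>j<N. \<Sum>l<N. \<Sum>k<N. \<Sum>m<N. r j l * r k m * r l k) = ?A"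
    by (rule flip[of "\<lambda>j k m. r j k"])
  have D: "(\<Sum>j<N. \<Sum>l<N. \<Sum>k<N. \<Sum>m<N. r j l * r k m * r l m) = ?A"
    unfolding B[symmetric] by (rule flip[of "\<lambda>j k m. r j m"])
  have "(\<Sum>j<N. \<Sum>l<N. \<Sum>k<N. \<Sum>m<N. r j l * r k m * (r j k + r j m + r l k + r l m)) =
     ?A + (\<Sum>j<N. \<Sum>l<N. \<Sum>k<N. \<Sum>m<N. r j l * r k m * r j m) + (\<Sum>j<N. \<Sum>l<N. \<Sum>k<N. \<Sum>m<N. r j l * r k m * r l k)
      + (\<Sum>j<N. \<Sum>l<N. \<Sum>k<N. \<Sum>m<N. r j l * r k m * r l m)"
    by (simp only: distrib_left sum.distrib)
  then show ?thesis using A unfolding B C D by simp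
qed

lemma sum_power_inj_le:
  assumes "finite A" "inj_on h A" "0 \<le> \<rho>" "\<rho> < (1::real)"
  shows "(\<Sum>l\<in>A. \<rho> ^ h l) \<le> 1 / (1 - \<rho>)"
proof -
  have "(\<Sum>l\<in>A. \<rho> ^ h l) = (\<Sum>k\<in>h ` A. \<rho> ^ k)" using assms by (simp add: sum.reindex)
  also have "\<dots> \<le> (\<Sum>k. \<rho> ^ k)" using assms by (intro sum_le_suminf summable_geometric) auto
  also have "\<dots> = 1 / (1 - \<rho>)" using assms by (intro suminf_geometric) auto
  finally show ?thesis .
qed

text \<open>The indices up to \<open>j\<close> and those beyond it give two geometric
  series.\<close>

lemma sum_power_distance_le:
  assumes "0 \<le> \<rho>" "\<rho> < (1::real)"
  shows "(\<Sum>l<N. \<rho> ^ ((j - l) + (l - j))) \<le> 2 / (1 - \<rho>)"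
proof -
  have "(\<Sum>l<N. \<rho> ^ ((j - l) + (l - j))) = (\<Sum>l\<in>{..<N} \<inter> {..j}. \<rho> ^ ((j - l) + (l - j))) + (\<Sum>l\<in>{..<N} - {..j}. \<rho> ^ ((j - l) + (l - j)))"
    by (subst sum.union_disjoint[symmetric]) (auto intro!: sum.cong)
  also have "\<dots> = (\<Sum>l\<in>{..<N} \<inter> {..j}. \<rho> ^ (j - l)) + (\<Sum>l\<in>{..<N} - {..j}. \<rho> ^ (l - j))"
    by (intro arg_cong2[where f="(+)"] sum.cong refl) auto
  also have "\<dots> \<le> 1 / (1 - \<rho>) + 1 / (1 - \<rho>)"
    by (intro add_mono sum_power_inj_le assms) (auto simp: inj_on_def)
  finally show ?thesis by simp
qed

section \<open>The Gaussian regime\<close>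

text \<open>\<open>T\<close> is the squared gradient of \<open>F\<close> divided by the chaos order,
  the quantity of the Malliavin-Stein method. It arises by integrating each Hermite term by parts
  separately, so no inverse of the Ornstein-Uhlenbeck generator is needed. The factor 2 is the
  derivative bound for Stein's equation.\<close>

lemma stein_hermite_sum:
  fixes a :: "nat \<Rightarrow> nat \<Rightarrow> real" and r :: "nat \<Rightarrow> nat \<Rightarrow> real" and w :: real and p n N :: nat
  assumes gram: "\<And>j l. j < N \<Longrightarrow> l < N \<Longrightarrow> dot n (a j) (a l) = r j l" and r1: "\<And>j. r j j = 1"
    and \<phi>: "continuous_on UNIV \<phi>" "\<And>x. 0 \<le> \<phi> x \<and> \<phi> x \<le> (1::real)"
  defines "F \<equiv> \<lambda>x. w * (\<Sum>j<N. hlin n (Suc p) (a j) x)"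
    and "T \<equiv> \<lambda>x. \<Sum>j<N. \<Sum>l<N. (Suc p * w\<^sup>2 * r j l) * (hlin n p (a j) x * hlin n p (a l) x)"
  shows "\<bar>(\<integral>x. \<phi> (F x) \<partial>gauss n) - (\<integral>x. \<phi> x \<partial>N01)\<bar> \<le> 2 * (\<integral>x. \<bar>1 - T x\<bar> \<partial>gauss n)"
proof -
  interpret G: prob_space "gauss n" by (rule prob_space_gauss)
  define m where "m = (\<integral>x. \<phi> x \<partial>N01)"
  obtain f where f0: "\<And>x. (f has_real_derivative x * f x + \<phi> x - (\<integral>x. \<phi> x \<partial>N01)) (at x)"
    "\<And>x. \<bar>x * f x + \<phi> x - (\<integral>x. \<phi> x \<partial>N01)\<bar> \<le> 2"
    using stein_equation[OF \<phi>] by blast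
  define f' where "f' x = x * f x + \<phi> x - m" for x
  have f: "\<And>x. (f has_real_derivative f' x) (at x)" "\<And>x. \<bar>f' x\<bar> \<le> 2"
    using f0 by (simp_all add: f'_def m_def)
  have cf: "continuous_on UNIV f" using DERIV_imp_borel(2)[OF f(1)] .
  have cf': "continuous_on UNIV f'" unfolding f'_def using cf \<phi>(1) by (intro continuous_intros)
  have pf': "poly_growth f'" using f(2) by (rule poly_growth_bounded)
  \<comment> \<open>Only the derivative of \<open>f\<close> comes with a bound; it gives linear
    growth of \<open>f\<close>, enough for integration by parts.\<close>
  have pf: "poly_growth f"
  proof (rule poly_growthI)
    fix x
    have "norm (f x - f 0) \<le> 2 * norm (x - 0)"
      by (rule field_differentiable_bound[of UNIV f f']) (use f in \<open>auto intro: has_field_derivative_at_within\<close>)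
    then have "\<bar>f x - f 0\<bar> \<le> 2 * \<bar>x\<bar>" by simp
    then have "\<bar>f x\<bar> \<le> \<bar>f 0\<bar> + 2 * \<bar>x\<bar>" by linarith
    also have "\<dots> \<le> (\<bar>f 0\<bar> + 2) * (1 + \<bar>x\<bar>) ^ 1" by (simp add: algebra_simps)
    finally show "\<bar>f x\<bar> \<le> (\<bar>f 0\<bar> + 2) * (1 + \<bar>x\<bar>) ^ 1" .
  qed
  let ?dH = "\<lambda>l i x. real (Suc p) * hermite (Suc p - 1) (lin n (a l) x) * a l i"
  let ?dF = "\<lambda>i x. w * (\<Sum>l<N. ?dH l i x)"
  have sF: "gsmooth n F ?dF" unfolding F_def by (intro gsmooth_cmult gsmooth_sum gsmooth_hermite)
  have sfF: "gsmooth n (\<lambda>x. f (F x)) (\<lambda>i x. f' (F x) * ?dF i x)"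
    by (rule gsmooth_comp[OF f(1) cf' pf pf' sF])
  have dd: "dderiv n (a j) (\<lambda>i x. f' (F x) * ?dF i x) x = f' (F x) * (w * (\<Sum>l<N. real (Suc p) * hlin n p (a l) x * r j l))" if "j < N" for j x
  proof -
    have "dderiv n (a j) (\<lambda>i x. f' (F x) * ?dF i x) x = f' (F x) * dderiv n (a j) ?dF x" by (rule dderiv_comp)
    also have "dderiv n (a j) ?dF x = w * dderiv n (a j) (\<lambda>i x. \<Sum>l<N. ?dH l i x) x" by (rule dderiv_cmult)
    also have "dderiv n (a j) (\<lambda>i x. \<Sum>l<N. ?dH l i x) x = (\<Sum>l<N. dderiv n (a j) (?dH l) x)" by (rule dderiv_sum)
    also have "\<dots> = (\<Sum>l<N. real (Suc p) * hlin n p (a l) x * r j l)"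
      unfolding dderiv_hermite using gram[OF that] by simp
    finally show ?thesis .
  qed
  have tF: "tame n F" using gsmooth_tame(1)[OF sF] .
  have tfF: "tame n (\<lambda>x. f (F x))" using gsmooth_tame(1)[OF sfF] .
  have tf'F: "tame n (\<lambda>x. f' (F x))" by (rule tame_comp[OF pf' borel_measurable_continuous_onI[OF cf'] tF])
  have tT: "tame n T" unfolding T_def by (intro tame_sum tame_cmult tame_mult tame_hlin)
  have "(\<integral>x. F x * f (F x) \<partial>gauss n) = (\<integral>x. (\<Sum>j<N. w * (hlin n (Suc p) (a j) x * f (F x))) \<partial>gauss n)"
    by (intro Bochner_Integration.integral_cong refl) (simp add: F_def sum_distrib_left sum_distrib_right mult_ac)
  also have "\<dots> = (\<Sum>j<N. w * (\<integral>x. hlin n (Suc p) (a j) x * f (F x) \<partial>gauss n))"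
    by (subst Bochner_Integration.integral_sum) (auto intro!: tame_integrable tame_cmult tame_mult tame_const tame_hlin tfF)
  also have "\<dots> = (\<Sum>j<N. w * (\<integral>x. hlin n p (a j) x * (f' (F x) * (w * (\<Sum>l<N. real (Suc p) * hlin n p (a l) x * r j l))) \<partial>gauss n))"
  proof (intro sum.cong refl arg_cong[where f="\<lambda>z. w * z"])
    fix j assume j: "j \<in> {..<N}"
    then have "dot n (a j) (a j) = 1" using gram[of j j] r1 by simp
    from hermite_ibp[OF sfF this, of p] show "(\<integral>x. hlin n (Suc p) (a j) x * f (F x) \<partial>gauss n) =
       (\<integral>x. hlin n p (a j) x * (f' (F x) * (w * (\<Sum>l<N. real (Suc p) * hlin n p (a l) x * r j l))) \<partial>gauss n)"
      using dd j by simp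
  qed
  also have "\<dots> = (\<integral>x. (\<Sum>j<N. w * (hlin n p (a j) x * (f' (F x) * (w * (\<Sum>l<N. real (Suc p) * hlin n p (a l) x * r j l))))) \<partial>gauss n)"
  proof -
    have "integrable (gauss n) (\<lambda>x. w * (hlin n p (a j) x * (f' (F x) * (w * (\<Sum>l<N. real (Suc p) * hlin n p (a l) x * r j l)))))" for j
      by (intro tame_integrable tame_cmult tame_mult tame_hlin tf'F tame_sum tame_const)
    then show ?thesis by (subst Bochner_Integration.integral_sum) auto
  qed
  also have "\<dots> = (\<integral>x. f' (F x) * T x \<partial>gauss n)"
  proof (intro Bochner_Integration.integral_cong refl)
    fix x
    have "w * (hlin n p (a j) x * (f' (F x) * (w * (\<Sum>l<N. real (Suc p) * hlin n p (a l) x * r j l)))) =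
      f' (F x) * (\<Sum>l<N. (Suc p * w\<^sup>2 * r j l) * (hlin n p (a j) x * hlin n p (a l) x))" for j
      by (simp only: sum_distrib_left power2_eq_square mult_ac)
    then show "(\<Sum>j<N. w * (hlin n p (a j) x * (f' (F x) * (w * (\<Sum>l<N. real (Suc p) * hlin n p (a l) x * r j l))))) = f' (F x) * T x"
      unfolding T_def by (simp only: sum_distrib_left)
  qed
  finally have ibp: "(\<integral>x. F x * f (F x) \<partial>gauss n) = (\<integral>x. f' (F x) * T x \<partial>gauss n)" .
  have \<phi>eq: "\<phi> (F x) = f' (F x) - F x * f (F x) + m" for x by (simp add: f'_def)
  have i: "integrable (gauss n) (\<lambda>x. f' (F x))" "integrable (gauss n) (\<lambda>x. F x * f (F x))" "integrable (gauss n) (\<lambda>x. f' (F x) * T x)"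
    by (intro tame_integrable tame_mult tf'F tF tfF tT)+
  have "(\<integral>x. \<phi> (F x) \<partial>gauss n) = (\<integral>x. f' (F x) \<partial>gauss n) - (\<integral>x. F x * f (F x) \<partial>gauss n) + m"
    unfolding \<phi>eq using i G.prob_space by simp
  also have "\<dots> = (\<integral>x. f' (F x) * (1 - T x) \<partial>gauss n) + m"
    unfolding ibp right_diff_distrib using i by simp
  finally have "\<bar>(\<integral>x. \<phi> (F x) \<partial>gauss n) - m\<bar> = \<bar>\<integral>x. f' (F x) * (1 - T x) \<partial>gauss n\<bar>" by simp
  also have "\<dots> \<le> (\<integral>x. \<bar>f' (F x) * (1 - T x)\<bar> \<partial>gauss n)" by (rule integral_abs_bound)
  also have "\<dots> \<le> (\<integral>x. 2 * \<bar>1 - T x\<bar> \<partial>gauss n)"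
  proof (rule integral_mono)
    show "integrable (gauss n) (\<lambda>x. \<bar>f' (F x) * (1 - T x)\<bar>)" "integrable (gauss n) (\<lambda>x. 2 * \<bar>1 - T x\<bar>)"
      by (intro tame_integrable tame_abs tame_cmult tame_mult tame_diff tame_const tf'F tT)+
    show "\<bar>f' (F x) * (1 - T x)\<bar> \<le> 2 * \<bar>1 - T x\<bar>" for x
      unfolding abs_mult using f(2) by (intro mult_right_mono) auto
  qed
  finally show ?thesis by (simp add: m_def)
qed

text \<open>The second moment of \<open>1 - T\<close> is squared bias plus variance. The bias stays
  explicit because it vanishes only as the grid is refined. The variance is a sum of covariances of
  pairs, bounded linearly in the cross-correlations and then summed along paths. The constant
  depends on \<open>p\<close> alone.\<close>

lemma variance_hermite_pairs:
  "\<exists>C\<ge>0. \<forall>n N (a :: nat \<Rightarrow> nat \<Rightarrow> real) (r :: nat \<Rightarrow> nat \<Rightarrow> real) (w :: real) (S :: real). (\<forall>j<N. \<forall>l<N. dot n (a j) (a l) = r j l) \<longrightarrow> (\<forall>j. r j j = 1) \<longrightarrow>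
     (\<forall>j l. 0 \<le> r j l \<and> r j l \<le> 1 \<and> r j l = r l j) \<longrightarrow> (\<forall>j<N. (\<Sum>l<N. r j l) \<le> S) \<longrightarrow> 0 \<le> S \<longrightarrow>
     (\<integral>x. (1 - (\<Sum>j<N. \<Sum>l<N. (Suc p * w\<^sup>2 * r j l) * (hlin n p (a j) x * hlin n p (a l) x)))\<^sup>2 \<partial>gauss n)
       \<le> (1 - w\<^sup>2 * fact (Suc p) * (\<Sum>j<N. \<Sum>l<N. r j l ^ Suc p))\<^sup>2 + C * w ^ 4 * (N * S ^ 3)"
proof -
  obtain C where C: "C \<ge> 0" "\<And>n v1 v2 v3 v4. unit_frame n v1 v2 v3 v4 \<Longrightarrow>
     \<bar>hermite_mean4 n v1 v2 v3 v4 p p p p - hermite_mean2 n v1 v2 p p * hermite_mean2 n v3 v4 p p\<bar>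
       \<le> C * (dot n v1 v3 + dot n v1 v4 + dot n v2 v3 + dot n v2 v4)"
    using hermite_covariance[of p p p p] by blast
  show ?thesis
  \<comment> \<open>\<open>(Suc p)\<^sup>2\<close> collects the prefactors of the two pairs, and 4
    counts the paths in \<open>sum_quadruple_bound\<close>.\<close>
  proof (intro exI[of _ "C * (Suc p)\<^sup>2 * 4"] conjI allI impI)
    show "0 \<le> C * real ((Suc p)\<^sup>2) * 4" using C by simp
    fix n N :: nat and a :: "nat \<Rightarrow> nat \<Rightarrow> real" and r :: "nat \<Rightarrow> nat \<Rightarrow> real" and w S :: real
    assume gram: "\<forall>j<N. \<forall>l<N. dot n (a j) (a l) = r j l" and r1: "\<forall>j. r j j = 1"
      and r: "\<forall>j l. 0 \<le> r j l \<and> r j l \<le> 1 \<and> r j l = r l j" and S: "\<forall>j<N. (\<Sum>l<N. r j l) \<le> S" "0 \<le> S"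
    interpret G: prob_space "gauss n" by (rule prob_space_gauss)
    define k where "k j l = Suc p * w\<^sup>2 * r j l" for j l
    define h where "h j l x = hlin n p (a j) x * hlin n p (a l) x" for j l x
    define T where "T x = (\<Sum>j<N. \<Sum>l<N. k j l * h j l x)" for x
    have th: "tame n (h j l)" for j l unfolding h_def[abs_def] by (intro tame_mult tame_hlin)
    have tT: "tame n T" unfolding T_def[abs_def] by (intro tame_sum tame_cmult th)
    have Eh: "(\<integral>x. h j l x \<partial>gauss n) = hermite_mean2 n (a j) (a l) p p" for j l
      by (simp add: h_def hermite_mean2_def)
    have ET: "(\<integral>x. T x \<partial>gauss n) = (\<Sum>j<N. \<Sum>l<N. k j l * hermite_mean2 n (a j) (a l) p p)"
      unfolding T_def Eh[symmetric] by (intro integral_sum_sum tame_integrable th)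
    have ET': "(\<integral>x. T x \<partial>gauss n) = w\<^sup>2 * fact (Suc p) * (\<Sum>j<N. \<Sum>l<N. r j l ^ Suc p)"
      unfolding ET sum_distrib_left
    proof (intro sum.cong refl)
      fix j l assume "j \<in> {..<N}" "l \<in> {..<N}"
      then have "hermite_mean2 n (a j) (a l) p p = fact p * r j l ^ p"
        unfolding hermite_mean2_def using gram r1 by (subst hermite_inner) auto
      then show "k j l * hermite_mean2 n (a j) (a l) p p = w\<^sup>2 * fact (Suc p) * r j l ^ Suc p"
        by (simp add: k_def algebra_simps)
    qed
    have TT: "T x * T x = (\<Sum>j<N. \<Sum>l<N. \<Sum>j'<N. \<Sum>l'<N. (k j l * k j' l') * (h j l x * h j' l' x))" for x
    proof -
      have "T x * T x = (\<Sum>j<N. \<Sum>l<N. k j l * h j l x * T x)" by (simp add: T_def sum_distrib_right)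
      also have "\<dots> = (\<Sum>j<N. \<Sum>l<N. \<Sum>j'<N. \<Sum>l'<N. (k j l * k j' l') * (h j l x * h j' l' x))"
        unfolding T_def sum_distrib_left by (intro sum.cong refl) (simp only: mult_ac)
      finally show ?thesis .
    qed
    have hh: "(\<integral>x. h j l x * h j' l' x \<partial>gauss n) = hermite_mean4 n (a j) (a l) (a j') (a l') p p p p" for j l j' l'
      by (simp add: h_def hermite_mean4_def mult_ac)
    have ETT: "(\<integral>x. T x * T x \<partial>gauss n) = (\<Sum>j<N. \<Sum>l<N. \<Sum>j'<N. \<Sum>l'<N. (k j l * k j' l') * hermite_mean4 n (a j) (a l) (a j') (a l') p p p p)"
    proof -
      have i: "integrable (gauss n) (\<lambda>x. (\<Sum>j'<N. \<Sum>l'<N. (k j l * k j' l') * (h j l x * h j' l' x)))" for j l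
        by (intro tame_integrable tame_sum tame_cmult tame_mult th)
      have "(\<integral>x. T x * T x \<partial>gauss n) = (\<integral>x. (\<Sum>j<N. \<Sum>l<N. 1 * (\<Sum>j'<N. \<Sum>l'<N. (k j l * k j' l') * (h j l x * h j' l' x))) \<partial>gauss n)"
        by (simp only: TT mult_1)
      also have "\<dots> = (\<Sum>j<N. \<Sum>l<N. 1 * (\<integral>x. (\<Sum>j'<N. \<Sum>l'<N. (k j l * k j' l') * (h j l x * h j' l' x)) \<partial>gauss n))"
        by (intro integral_sum_sum i)
      also have "\<dots> = (\<Sum>j<N. \<Sum>l<N. \<Sum>j'<N. \<Sum>l'<N. (k j l * k j' l') * hermite_mean4 n (a j) (a l) (a j') (a l') p p p p)"
        unfolding mult_1 hh[symmetric] by (intro sum.cong refl integral_sum_sum tame_integrable tame_mult th)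
      finally show ?thesis .
    qed
    have E2: "(\<integral>x. T x \<partial>gauss n)\<^sup>2 = (\<Sum>j<N. \<Sum>l<N. \<Sum>j'<N. \<Sum>l'<N. (k j l * k j' l') * (hermite_mean2 n (a j) (a l) p p * hermite_mean2 n (a j') (a l') p p))"
    proof -
      let ?M = "\<lambda>j l. hermite_mean2 n (a j) (a l) p p"
      have "(\<integral>x. T x \<partial>gauss n)\<^sup>2 = (\<Sum>j<N. \<Sum>l<N. k j l * ?M j l * (\<Sum>j<N. \<Sum>l<N. k j l * ?M j l))"
        unfolding ET power2_eq_square by (simp add: sum_distrib_right)
      also have "\<dots> = (\<Sum>j<N. \<Sum>l<N. \<Sum>j'<N. \<Sum>l'<N. (k j l * k j' l') * (?M j l * ?M j' l'))"
        unfolding sum_distrib_left by (intro sum.cong refl) (simp only: mult_ac)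
      finally show ?thesis .
    qed
    have k0: "0 \<le> k j l" for j l using r by (simp add: k_def)
    have var: "(\<integral>x. T x * T x \<partial>gauss n) - (\<integral>x. T x \<partial>gauss n)\<^sup>2 \<le> C * (Suc p)\<^sup>2 * 4 * w ^ 4 * (N * S ^ 3)"
    proof -
      have "(\<integral>x. T x * T x \<partial>gauss n) - (\<integral>x. T x \<partial>gauss n)\<^sup>2 = (\<Sum>j<N. \<Sum>l<N. \<Sum>j'<N. \<Sum>l'<N. (k j l * k j' l') *
          (hermite_mean4 n (a j) (a l) (a j') (a l') p p p p - hermite_mean2 n (a j) (a l) p p * hermite_mean2 n (a j') (a l') p p))"
        unfolding ETT E2 by (simp only: sum_subtractf right_diff_distrib)
      also have "\<dots> \<le> (\<Sum>j<N. \<Sum>l<N. \<Sum>j'<N. \<Sum>l'<N. (k j l * k j' l') * (C * (r j j' + r j l' + r l j' + r l l')))"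
      proof (intro sum_mono mult_left_mono mult_nonneg_nonneg k0)
        fix j l j' l' assume j: "j \<in> {..<N}" "l \<in> {..<N}" "j' \<in> {..<N}" "l' \<in> {..<N}"
        then have "unit_frame n (a j) (a l) (a j') (a l')" using gram r r1 by (auto simp: unit_frame_def)
        from C(2)[OF this] show "hermite_mean4 n (a j) (a l) (a j') (a l') p p p p - hermite_mean2 n (a j) (a l) p p * hermite_mean2 n (a j') (a l') p p
            \<le> C * (r j j' + r j l' + r l j' + r l l')"
          using gram j by auto
      qed
      also have "\<dots> = (\<Sum>j<N. \<Sum>l<N. \<Sum>j'<N. \<Sum>l'<N. (C * (Suc p)\<^sup>2 * w ^ 4) * (r j l * r j' l' * (r j j' + r j l' + r l j' + r l l')))"
      proof (intro sum.cong refl)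
        fix j l j' l'
        have "w ^ 4 = w\<^sup>2 * w\<^sup>2" by (simp add: power2_eq_square power4_eq_xxxx)
        then show "(k j l * k j' l') * (C * (r j j' + r j l' + r l j' + r l l')) =
          (C * (Suc p)\<^sup>2 * w ^ 4) * (r j l * r j' l' * (r j j' + r j l' + r l j' + r l l'))"
          unfolding k_def by (simp only: power2_eq_square[of "Suc p"] of_nat_mult mult_ac)
      qed
      also have "\<dots> = (C * (Suc p)\<^sup>2 * w ^ 4) * (\<Sum>j<N. \<Sum>l<N. \<Sum>j'<N. \<Sum>l'<N. r j l * r j' l' * (r j j' + r j l' + r l j' + r l l'))"
        by (simp only: sum_distrib_left)
      also have "\<dots> \<le> (C * (Suc p)\<^sup>2 * w ^ 4) * (4 * real N * S ^ 3)"
      proof (rule mult_left_mono)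
        show "(\<Sum>j<N. \<Sum>l<N. \<Sum>j'<N. \<Sum>l'<N. r j l * r j' l' * (r j j' + r j l' + r l j' + r l l')) \<le> 4 * real N * S ^ 3"
          by (rule sum_quadruple_bound) (use r S in blast)+
      qed (use C(1) in simp)
      finally show ?thesis by (simp add: mult_ac)
    qed
    have "(\<integral>x. (1 - T x)\<^sup>2 \<partial>gauss n) = (\<integral>x. 1 - 2 * T x + T x * T x \<partial>gauss n)"
      by (simp add: power2_eq_square algebra_simps)
    also have "\<dots> = 1 - 2 * (\<integral>x. T x \<partial>gauss n) + (\<integral>x. T x * T x \<partial>gauss n)"
      using tame_integrable[OF tT] tame_integrable[OF tame_mult[OF tT tT]] G.prob_space by simp
    also have "\<dots> = (1 - (\<integral>x. T x \<partial>gauss n))\<^sup>2 + ((\<integral>x. T x * T x \<partial>gauss n) - (\<integral>x. T x \<partial>gauss n)\<^sup>2)"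
      by (simp add: power2_eq_square algebra_simps)
    also have "\<dots> \<le> (1 - (\<integral>x. T x \<partial>gauss n))\<^sup>2 + C * (Suc p)\<^sup>2 * 4 * w ^ 4 * (N * S ^ 3)"
      using var by simp
    finally have "(\<integral>x. (1 - T x)\<^sup>2 \<partial>gauss n) \<le> (1 - (\<integral>x. T x \<partial>gauss n))\<^sup>2 + C * (Suc p)\<^sup>2 * 4 * w ^ 4 * (N * S ^ 3)" .
    from this[unfolded ET'] show "(\<integral>x. (1 - (\<Sum>j<N. \<Sum>l<N. (Suc p * w\<^sup>2 * r j l) * (hlin n p (a j) x * hlin n p (a l) x)))\<^sup>2 \<partial>gauss n)
       \<le> (1 - w\<^sup>2 * fact (Suc p) * (\<Sum>j<N. \<Sum>l<N. r j l ^ Suc p))\<^sup>2 + C * (Suc p)\<^sup>2 * 4 * w ^ 4 * (N * S ^ 3)"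
      unfolding T_def k_def h_def .
  qed
qed

text \<open>The tangent of \<open>exp (- x)\<close> at 1 yields
  \<open>exp (- x) - 1 + x \<ge> x / 3\<close> for \<open>x \<ge> 1\<close>, so the squared constant
  grows at most linearly in \<open>\<gamma>\<close>. This order makes
  \<open>w ^ 4 * (N * (4 * N / \<gamma>) ^ 3)\<close> of order \<open>1 / \<gamma>\<close>.\<close>

lemma chaos_const_large:
  assumes "\<gamma> \<ge> 1" "q \<ge> 1"
  shows "(chaos_const q \<gamma>)\<^sup>2 \<le> 2 * q * \<gamma>"
proof -
  define x where "x = \<gamma> * q"
  have x: "x \<ge> 1" using assms mult_mono[of 1 \<gamma> 1 "real q"] by (simp add: x_def)
  have e3: "exp (-1 :: real) \<ge> 1 / 3" "exp (-1 :: real) \<le> 1 / 2"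
    using exp_le exp_ge_add_one_self[of "1::real"] by (simp_all add: exp_minus field_simps)
  have E: "x / 3 \<le> exp (- x) - 1 + x"
  proof -
    have "exp (- x) = exp (-1) * exp (1 - x)" by (simp add: exp_add[symmetric])
    also have "\<dots> \<ge> exp (-1) * (2 - x)"
      using exp_ge_add_one_self[of "1 - x"] by (intro mult_left_mono) auto
    finally have "exp (- x) - 1 + x \<ge> x - 1 + exp (-1) * (2 - x)" by simp
    also have "x - 1 + exp (-1) * (2 - x) = (x - 1) * (1 - exp (-1)) + exp (-1)" by (simp add: algebra_simps)
    also have "\<dots> \<ge> (x - 1) * (1 / 3) + 1 / 3"
      using e3 x by (intro add_mono mult_left_mono) auto
    also have "(x - 1) * (1 / 3) + 1 / 3 = x / 3" by (simp add: field_simps)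
    finally show ?thesis .
  qed
  have "(chaos_const q \<gamma>)\<^sup>2 = x\<^sup>2 / (2 * fact q * (exp (- x) - 1 + x))"
    using chaos_const_square(1)[of \<gamma> q] assms by (simp add: x_def)
  also have "\<dots> \<le> x\<^sup>2 / (2 * 1 * (x / 3))"
  proof (intro divide_left_mono mult_mono)
    show "(1::real) \<le> fact q" by (simp add: fact_ge_1)
    show "0 < (2 * fact q * (exp (- x) - 1 + x)) * (2 * 1 * (x / 3))"
      using E x by (intro mult_pos_pos) auto
  qed (use E x in auto)
  also have "\<dots> = 3 / 2 * x" using x by (simp add: power2_eq_square)
  also have "\<dots> \<le> 2 * x" using x by simp
  finally show ?thesis by (simp add: x_def mult_ac)
qed

text \<open>The condition \<open>N \<ge> \<gamma>\<close> keeps the row sums of the correlations of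
  order \<open>N / \<gamma>\<close>. The last summand is the weighted squared bias; for fixed
  \<open>\<gamma>\<close> it vanishes as the grid is refined, by
  \<open>variance_limit\<close>.\<close>

lemma gaussian_regime_bound:
  assumes q: "q \<ge> 1"
  shows "\<exists>K\<ge>0. \<forall>\<gamma>\<ge>1. \<forall>N n a \<phi>. real N \<ge> \<gamma> \<longrightarrow>
    (\<forall>j<N. \<forall>l<N. dot n (a j) (a l) = exp (- \<gamma> / real N) ^ ((j - l) + (l - j))) \<longrightarrow>
    continuous_on UNIV \<phi> \<longrightarrow> (\<forall>x. 0 \<le> \<phi> x \<and> \<phi> x \<le> (1::real)) \<longrightarrow>
    \<bar>(\<integral>x. \<phi> (chaos_const q \<gamma> / N * (\<Sum>j<N. hermite q (lin n (a j) x))) \<partial>gauss n) - (\<integral>x. \<phi> x \<partial>N01)\<bar>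
      \<le> K * \<gamma> powr (- 1 / 2) + \<gamma> powr (1 / 2) *
        (1 - (chaos_const q \<gamma> / N)\<^sup>2 * fact q * (\<Sum>j<N. \<Sum>l<N. (exp (- \<gamma> / real N) ^ ((j - l) + (l - j))) ^ q))\<^sup>2"
proof -
  obtain p where qp: "q = Suc p" using q by (cases q) auto
  obtain C where C: "C \<ge> 0" "\<And>n N (a :: nat \<Rightarrow> nat \<Rightarrow> real) (r :: nat \<Rightarrow> nat \<Rightarrow> real) (w :: real) (S :: real). (\<forall>j<N. \<forall>l<N. dot n (a j) (a l) = r j l) \<Longrightarrow> (\<forall>j. r j j = 1) \<Longrightarrow>
     (\<forall>j l. 0 \<le> r j l \<and> r j l \<le> 1 \<and> r j l = r l j) \<Longrightarrow> (\<forall>j<N. (\<Sum>l<N. r j l) \<le> S) \<Longrightarrow> 0 \<le> S \<Longrightarrow>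
     (\<integral>x. (1 - (\<Sum>j<N. \<Sum>l<N. (Suc p * w\<^sup>2 * r j l) * (hlin n p (a j) x * hlin n p (a l) x)))\<^sup>2 \<partial>gauss n)
       \<le> (1 - w\<^sup>2 * fact (Suc p) * (\<Sum>j<N. \<Sum>l<N. r j l ^ Suc p))\<^sup>2 + C * w ^ 4 * (N * S ^ 3)"
    using variance_hermite_pairs[of p] by blast
  show ?thesis
  \<comment> \<open>\<open>4 * q\<^sup>2\<close> is the square of the factor \<open>2 * q\<close> in
    \<open>chaos_const_large\<close>, 64 is the cube of the 4 in the row sums, and the summand 1
    comes from the mean inequality below.\<close>
  proof (intro exI[of _ "1 + C * (4 * q\<^sup>2 * 64)"] conjI allI impI)
    show "0 \<le> 1 + C * real (4 * q\<^sup>2 * 64)" using C by simp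
    fix \<gamma> :: real and N n :: nat and a :: "nat \<Rightarrow> nat \<Rightarrow> real" and \<phi> :: "real \<Rightarrow> real"
    assume \<gamma>: "\<gamma> \<ge> 1" and N: "real N \<ge> \<gamma>" and gram: "\<forall>j<N. \<forall>l<N. dot n (a j) (a l) = exp (- \<gamma> / real N) ^ ((j - l) + (l - j))"
      and \<phi>: "continuous_on UNIV \<phi>" "\<forall>x. 0 \<le> \<phi> x \<and> \<phi> x \<le> 1"
    define \<rho> where "\<rho> = exp (- \<gamma> / real N)"
    define r where "r j l = \<rho> ^ ((j - l) + (l - j))" for j l :: nat
    define w where "w = chaos_const q \<gamma> / N"
    define \<sigma> where "\<sigma> = w\<^sup>2 * fact (Suc p) * (\<Sum>j<N. \<Sum>l<N. r j l ^ Suc p)"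
    have N0: "real N > 0" using N \<gamma> by linarith
    have \<rho>01: "0 < \<rho>" "\<rho> < 1" using \<gamma> N0 by (simp_all add: \<rho>_def)
    have gram': "\<forall>j<N. \<forall>l<N. dot n (a j) (a l) = r j l" using gram by (simp add: r_def \<rho>_def)
    have r: "\<forall>j l. 0 \<le> r j l \<and> r j l \<le> 1 \<and> r j l = r l j" "\<forall>j. r j j = 1"
      using \<rho>01 by (auto simp: r_def power_le_one add.commute)
    define T where "T x = (\<Sum>j<N. \<Sum>l<N. (Suc p * w\<^sup>2 * r j l) * (hlin n p (a j) x * hlin n p (a l) x))" for x
    have tT: "tame n T" unfolding T_def[abs_def] by (intro tame_sum tame_cmult tame_mult tame_hlin)
    \<comment> \<open>For \<open>y = \<gamma> / N \<le> 1\<close> one has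
      \<open>exp (- y) \<le> 1 / (1 + y) \<le> 1 - y / 2\<close>.\<close>
    have S: "2 / (1 - \<rho>) \<le> 4 * N / \<gamma>"
    proof -
      define y where "y = \<gamma> / N"
      have y: "0 < y" "y \<le> 1" using \<gamma> N N0 by (auto simp: y_def)
      have "\<rho> \<le> 1 - y / 2"
      proof -
        have "\<rho> * (1 + y) \<le> \<rho> * exp y" using \<rho>01 exp_ge_add_one_self[of y] by (intro mult_left_mono) auto
        also have "\<dots> = 1" by (simp add: \<rho>_def y_def exp_add[symmetric])
        also have "1 \<le> (1 - y / 2) * (1 + y)"
          using y mult_left_mono[of y 1 y] by (simp add: algebra_simps)
        finally show ?thesis using y by (simp add: mult_le_cancel_right)
      qed
      then have "2 / (1 - \<rho>) \<le> 2 / (y / 2)" using y by (intro divide_left_mono) auto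
      also have "\<dots> = 4 * N / \<gamma>" by (simp add: y_def)
      finally show ?thesis .
    qed
    have rows: "\<forall>j<N. (\<Sum>l<N. r j l) \<le> 4 * N / \<gamma>"
      using order_trans[OF sum_power_distance_le[where \<rho>=\<rho> and N=N] S] \<rho>01 unfolding r_def by auto
    have "(\<integral>x. (1 - T x)\<^sup>2 \<partial>gauss n) \<le> (1 - \<sigma>)\<^sup>2 + C * w ^ 4 * (N * (4 * N / \<gamma>) ^ 3)"
      unfolding T_def \<sigma>_def by (rule C(2)[OF gram' r(2) r(1) rows]) (use \<gamma> in simp)
    also have "C * w ^ 4 * (N * (4 * N / \<gamma>) ^ 3) \<le> C * (4 * q\<^sup>2 * 64) / \<gamma>"
    proof -
      have "w ^ 4 = ((chaos_const q \<gamma>)\<^sup>2)\<^sup>2 / N ^ 4"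
        by (simp add: w_def power_divide power_mult[symmetric])
      also have "\<dots> \<le> (2 * q * \<gamma>)\<^sup>2 / N ^ 4"
        using chaos_const_large[OF \<gamma> q] by (intro divide_right_mono power_mono) auto
      finally have w4: "w ^ 4 \<le> (2 * q * \<gamma>)\<^sup>2 / N ^ 4" .
      have "C * w ^ 4 * (N * (4 * N / \<gamma>) ^ 3) \<le> C * ((2 * q * \<gamma>)\<^sup>2 / N ^ 4) * (N * (4 * N / \<gamma>) ^ 3)"
        using w4 C \<gamma> by (intro mult_right_mono mult_left_mono) auto
      also have "\<dots> = C * (4 * q\<^sup>2 * 64) / \<gamma>"
        using N0 \<gamma> by (simp add: field_simps power2_eq_square power3_eq_cube power4_eq_xxxx)
      finally show ?thesis .
    qed
    finally have var: "(\<integral>x. (1 - T x)\<^sup>2 \<partial>gauss n) \<le> (1 - \<sigma>)\<^sup>2 + C * (4 * q\<^sup>2 * 64) / \<gamma>" by simp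
    \<comment> \<open>The weight in \<open>2 * \<bar>d\<bar> \<le> 1 / s + s * d\<^sup>2\<close>. As
      the variance is of order \<open>1 / \<gamma>\<close>, both terms become of order
      \<open>1 / s\<close>.\<close>
    define s where "s = \<gamma> powr (1 / 2)"
    have s: "s > 0" "s * s = \<gamma>" using \<gamma> by (simp_all add: s_def powr_add[symmetric])
    have s': "\<gamma> powr (- 1 / 2) = 1 / s" using powr_minus_divide[of \<gamma> "1 / 2"] by (simp add: s_def)
    interpret G: prob_space "gauss n" by (rule prob_space_gauss)
    have "\<bar>(\<integral>x. \<phi> (w * (\<Sum>j<N. hlin n (Suc p) (a j) x)) \<partial>gauss n) - (\<integral>x. \<phi> x \<partial>N01)\<bar> \<le> 2 * (\<integral>x. \<bar>1 - T x\<bar> \<partial>gauss n)"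
      unfolding T_def by (rule stein_hermite_sum) (use gram' r \<phi> in auto)
    also have "2 * (\<integral>x. \<bar>1 - T x\<bar> \<partial>gauss n) = (\<integral>x. 2 * \<bar>1 - T x\<bar> \<partial>gauss n)" by simp
    also have "\<dots> \<le> (\<integral>x. 1 / s + s * (1 - T x)\<^sup>2 \<partial>gauss n)"
    proof (rule integral_mono)
      show "integrable (gauss n) (\<lambda>x. 2 * \<bar>1 - T x\<bar>)" "integrable (gauss n) (\<lambda>x. 1 / s + s * (1 - T x)\<^sup>2)"
        by (intro tame_integrable tame_cmult tame_abs tame_add tame_diff tame_const tame_power tT)+
      fix x
      have e: "s * (1 / s - d)\<^sup>2 = 1 / s + s * d\<^sup>2 - 2 * d" for d
        using s(1) by (simp add: power2_eq_square field_simps)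
      have "0 \<le> s * (1 / s - \<bar>1 - T x\<bar>)\<^sup>2" using s by simp
      also have "\<dots> = 1 / s + s * (1 - T x)\<^sup>2 - 2 * \<bar>1 - T x\<bar>" unfolding e by simp
      finally show "2 * \<bar>1 - T x\<bar> \<le> 1 / s + s * (1 - T x)\<^sup>2" by simp
    qed
    also have "\<dots> = 1 / s + s * (\<integral>x. (1 - T x)\<^sup>2 \<partial>gauss n)"
      using G.prob_space tame_integrable[OF tame_power[OF tame_diff[OF tame_const tT]]] by simp
    also have "\<dots> \<le> 1 / s + s * ((1 - \<sigma>)\<^sup>2 + C * (4 * q\<^sup>2 * 64) / \<gamma>)"
      using var s by (intro add_left_mono mult_left_mono) auto
    also have "\<dots> = (1 + C * (4 * q\<^sup>2 * 64)) * (1 / s) + s * (1 - \<sigma>)\<^sup>2"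
      using s(1) unfolding s(2)[symmetric] by (simp add: field_simps)
    finally show "\<bar>(\<integral>x. \<phi> (chaos_const q \<gamma> / N * (\<Sum>j<N. hermite q (lin n (a j) x))) \<partial>gauss n) - (\<integral>x. \<phi> x \<partial>N01)\<bar>
      \<le> (1 + C * (4 * q\<^sup>2 * 64)) * \<gamma> powr (- 1 / 2) + \<gamma> powr (1 / 2) *
        (1 - (chaos_const q \<gamma> / N)\<^sup>2 * fact q * (\<Sum>j<N. \<Sum>l<N. (exp (- \<gamma> / real N) ^ ((j - l) + (l - j))) ^ q))\<^sup>2"
      unfolding s' s_def[symmetric] \<sigma>_def w_def r_def \<rho>_def qp by simp
  qed
qed

section \<open>The Hermite regime\<close>

text \<open>The cut-off \<open>v\<^sup>2 / (v\<^sup>2 + k)\<close> removes the critical points; dividing it by \<open>v\<close> leaves the smooth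
  function \<open>v / (v\<^sup>2 + k)\<close>, so that no inverse of the derivative ever appears.\<close>

lemma cutoff_bounds:
  fixes v k :: real
  assumes k: "0 < k" "k \<le> 1"
  shows "\<bar>v / (v\<^sup>2 + k)\<bar> \<le> 1 / k" "\<bar>(k - v\<^sup>2) / (v\<^sup>2 + k)\<^sup>2\<bar> \<le> 1 / k" "\<bar>2 * v * k / (v\<^sup>2 + k)\<^sup>2\<bar> \<le> 1 / k"
proof -
  have p: "0 < v\<^sup>2 + k" using k by (simp add: add_nonneg_pos)
  have aux: "\<bar>a / P\<bar> \<le> 1 / k" if "\<bar>a\<bar> * k \<le> P" "0 < P" for a P :: real
    using that k by (simp add: abs_divide field_simps)
  have "\<bar>v\<bar> * k \<le> v\<^sup>2 + k"
  proof (cases "\<bar>v\<bar> \<le> 1")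
    case True
    then have "\<bar>v\<bar> * k \<le> 1 * k" using k by (intro mult_right_mono) auto
    then show ?thesis using zero_le_power2[of v] by linarith
  next
    case False
    have "\<bar>v\<bar> * k \<le> \<bar>v\<bar> * \<bar>v\<bar>" using False k by (intro mult_left_mono) auto
    also have "\<dots> = v\<^sup>2" by (simp add: power2_eq_square)
    finally show ?thesis using k by simp
  qed
  then show "\<bar>v / (v\<^sup>2 + k)\<bar> \<le> 1 / k" using p by (rule aux)
  have "\<bar>k - v\<^sup>2\<bar> \<le> v\<^sup>2 + k" using k zero_le_power2[of v] by linarith
  then have "\<bar>k - v\<^sup>2\<bar> * k \<le> (v\<^sup>2 + k) * (v\<^sup>2 + k)" using k by (intro mult_mono) auto
  then show "\<bar>(k - v\<^sup>2) / (v\<^sup>2 + k)\<^sup>2\<bar> \<le> 1 / k" using p by (intro aux) (simp_all add: power2_eq_square)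
  have "\<bar>2 * v * k\<bar> * k \<le> (v\<^sup>2 + k)\<^sup>2"
  proof (cases "\<bar>v\<bar> \<le> 1 / 2")
    case True
    have "\<bar>2 * v * k\<bar> * k = (2 * \<bar>v\<bar>) * (k * k)" using k by (simp add: abs_mult)
    also have "\<dots> \<le> 1 * (k * k)" using True k by (intro mult_right_mono) auto
    also have "\<dots> \<le> (v\<^sup>2 + k) * (v\<^sup>2 + k)" using k by (simp, intro mult_mono) auto
    finally show ?thesis by (simp add: power2_eq_square)
  next
    case False
    have "\<bar>2 * v * k\<bar> * k = 2 * \<bar>v\<bar> * k * k" using k by (simp add: abs_mult)
    also have "\<dots> \<le> 2 * \<bar>v\<bar> * k * (2 * \<bar>v\<bar>)" using False k by (intro mult_left_mono) auto
    also have "\<dots> = 4 * v\<^sup>2 * k" by (simp add: power2_eq_square)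
    also have "\<dots> \<le> (v\<^sup>2 + k)\<^sup>2" using zero_le_power2[of "v\<^sup>2 - k"] by (simp add: power2_eq_square algebra_simps)
    finally show ?thesis .
  qed
  then show "\<bar>2 * v * k / (v\<^sup>2 + k)\<^sup>2\<bar> \<le> 1 / k" using p by (intro aux) simp_all
qed

lemma cutoff_derivs:
  fixes k :: real
  assumes "0 < k"
  shows "((\<lambda>v. v / (v\<^sup>2 + k)) has_real_derivative (k - v\<^sup>2) / (v\<^sup>2 + k)\<^sup>2) (at v)"
    "((\<lambda>v. v\<^sup>2 / (v\<^sup>2 + k)) has_real_derivative 2 * v * k / (v\<^sup>2 + k)\<^sup>2) (at v)"
proof -
  have p: "v\<^sup>2 + k \<noteq> 0" using assms by (metis add_nonneg_pos less_irrefl zero_le_power2)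
  show "((\<lambda>v. v / (v\<^sup>2 + k)) has_real_derivative (k - v\<^sup>2) / (v\<^sup>2 + k)\<^sup>2) (at v)"
    using p by (auto intro!: derivative_eq_intros simp: power2_eq_square)
  show "((\<lambda>v. v\<^sup>2 / (v\<^sup>2 + k)) has_real_derivative 2 * v * k / (v\<^sup>2 + k)\<^sup>2) (at v)"
    using p by (auto intro!: derivative_eq_intros simp: power2_eq_square algebra_simps)
qed

lemma cutoff_continuous:
  fixes k :: real
  assumes "0 < k"
  shows "continuous_on UNIV (\<lambda>v. (k - v\<^sup>2) / (v\<^sup>2 + k)\<^sup>2)" "continuous_on UNIV (\<lambda>v. 2 * v * k / (v\<^sup>2 + k)\<^sup>2)"
    "continuous_on UNIV (\<lambda>v. v / (v\<^sup>2 + k))" "continuous_on UNIV (\<lambda>v. v\<^sup>2 / (v\<^sup>2 + k))"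
proof -
  have p: "v\<^sup>2 + k \<noteq> 0" for v :: real using assms by (metis add_nonneg_pos less_irrefl zero_le_power2)
  show "continuous_on UNIV (\<lambda>v. (k - v\<^sup>2) / (v\<^sup>2 + k)\<^sup>2)" "continuous_on UNIV (\<lambda>v. 2 * v * k / (v\<^sup>2 + k)\<^sup>2)"
    "continuous_on UNIV (\<lambda>v. v / (v\<^sup>2 + k))" "continuous_on UNIV (\<lambda>v. v\<^sup>2 / (v\<^sup>2 + k))"
    using p by (intro continuous_intros; simp)+
qed

text \<open>The integrand is the \<open>t\<close>-derivative of \<open>\<phi> (Ft x)\<close> times
  the cut-off of \<open>Vt x\<close>. As \<open>Vt\<close> is the derivative of \<open>Ft\<close>
  along \<open>v\<close>, the term with \<open>\<phi>'\<close> is part of a directional derivative,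
  and integration by parts trades it for terms that contain only \<open>\<phi>\<close>. The cut-off
  functions are bounded by \<open>1 / k\<close>, and \<open>L\<close> does not appear.\<close>

lemma interpolation_integrand_bound:
  assumes \<phi>: "test_function \<phi> \<phi>' L" and k: "0 < k" "k \<le> (1::real)" and t: "0 \<le> t" "t \<le> (1::real)"
    and F: "gsmooth n F dF" "gsmooth n F1 dF1" "\<And>x. dderiv n v dF x = F1 x" "\<And>x. dderiv n v dF1 x = F2 x"
    and D: "gsmooth n D dD" "gsmooth n D1 dD1" "\<And>x. dderiv n v dD x = D1 x" "\<And>x. dderiv n v dD1 x = D2 x"
  defines "Ft \<equiv> \<lambda>x. F x + t * D x" and "Vt \<equiv> \<lambda>x. F1 x + t * D1 x"
  shows "\<bar>\<integral>x. \<phi>' (Ft x) * D x * ((Vt x)\<^sup>2 / ((Vt x)\<^sup>2 + k)) + \<phi> (Ft x) * (2 * Vt x * k / ((Vt x)\<^sup>2 + k)\<^sup>2 * D1 x) \<partial>gauss n\<bar>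
    \<le> 1 / k * (\<integral>x. (\<bar>lin n v x\<bar> + 2 + \<bar>F2 x\<bar> + \<bar>D2 x\<bar>) * (\<bar>D x\<bar> + \<bar>D1 x\<bar>) \<partial>gauss n)"
proof -
  define r where "r = (\<lambda>v::real. v / (v\<^sup>2 + k))"
  define r' where "r' = (\<lambda>v::real. (k - v\<^sup>2) / (v\<^sup>2 + k)\<^sup>2)"
  define c' where "c' = (\<lambda>v::real. 2 * v * k / (v\<^sup>2 + k)\<^sup>2)"
  have b\<phi>: "\<bar>\<phi> x\<bar> \<le> 1" "\<bar>\<phi>' x\<bar> \<le> L" for x using \<phi> by (auto simp: test_function_def)
  have d\<phi>: "(\<phi> has_real_derivative \<phi>' x) (at x)" for x using \<phi> by (simp add: test_function_def)
  have c\<phi>': "continuous_on UNIV \<phi>'" using \<phi> by (simp add: test_function_def)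
  have rb: "\<bar>r x\<bar> \<le> 1 / k" "\<bar>r' x\<bar> \<le> 1 / k" "\<bar>c' x\<bar> \<le> 1 / k" for x
    unfolding r_def r'_def c'_def using cutoff_bounds[OF k] by blast+
  have pg: "poly_growth \<phi>" "poly_growth \<phi>'" "poly_growth r" "poly_growth r'" "poly_growth c'"
    using poly_growth_bounded[of \<phi> 1] poly_growth_bounded[of \<phi>' L] poly_growth_bounded[of r "1 / k"]
      poly_growth_bounded[of r' "1 / k"] poly_growth_bounded[of c' "1 / k"] b\<phi> rb by blast+
  have cont: "continuous_on UNIV r'" "continuous_on UNIV c'"
    unfolding r'_def c'_def using cutoff_continuous k by blast+
  have dr: "(r has_real_derivative r' x) (at x)" for x
    unfolding r_def r'_def by (rule cutoff_derivs(1)[OF k(1)])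
  define V2 where "V2 x = F2 x + t * D2 x" for x
  have sFt: "gsmooth n Ft (\<lambda>i x. dF i x + t * dD i x)"
    unfolding Ft_def by (rule gsmooth_add[OF F(1) gsmooth_cmult[OF D(1)]])
  have sVt: "gsmooth n Vt (\<lambda>i x. dF1 i x + t * dD1 i x)"
    unfolding Vt_def by (rule gsmooth_add[OF F(2) gsmooth_cmult[OF D(2)]])
  have s\<phi>: "gsmooth n (\<lambda>x. \<phi> (Ft x)) (\<lambda>i x. \<phi>' (Ft x) * (dF i x + t * dD i x))"
    by (rule gsmooth_comp[OF d\<phi> c\<phi>' pg(1,2) sFt])
  have sr: "gsmooth n (\<lambda>x. r (Vt x)) (\<lambda>i x. r' (Vt x) * (dF1 i x + t * dD1 i x))"
    by (rule gsmooth_comp[OF dr cont(1) pg(3,4) sVt])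
  let ?dr = "\<lambda>i x. r' (Vt x) * (dF1 i x + t * dD1 i x)" and ?d\<phi> = "\<lambda>i x. \<phi>' (Ft x) * (dF i x + t * dD i x)"
  let ?dR = "\<lambda>i x. dD i x * r (Vt x) + ?dr i x * D x"
  have sR: "gsmooth n (\<lambda>x. D x * r (Vt x)) ?dR" by (rule gsmooth_mult[OF D(1) sr])
  \<comment> \<open>The function fed to integration by parts: differentiating
    \<open>\<phi> (Ft x)\<close> along \<open>v\<close> gives \<open>\<phi>' (Ft x) * Vt x\<close>,
    and \<open>r\<close> is the cut-off divided by its argument.\<close>
  have sG: "gsmooth n (\<lambda>x. \<phi> (Ft x) * (D x * r (Vt x))) (\<lambda>i x. ?d\<phi> i x * (D x * r (Vt x)) + ?dR i x * \<phi> (Ft x))"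
    by (rule gsmooth_mult[OF s\<phi> sR])
  have dl: "dderiv n v (\<lambda>i x. dF i x + t * dD i x) x = Vt x" "dderiv n v (\<lambda>i x. dF1 i x + t * dD1 i x) x = V2 x" for x
    unfolding dderiv_add[of n v dF "\<lambda>i x. t * dD i x"] dderiv_add[of n v dF1 "\<lambda>i x. t * dD1 i x"]
      dderiv_cmult[of n v t dD] dderiv_cmult[of n v t dD1] F D Vt_def V2_def by simp_all
  have dd: "dderiv n v (\<lambda>i x. ?d\<phi> i x * (D x * r (Vt x)) + ?dR i x * \<phi> (Ft x)) x =
     \<phi>' (Ft x) * Vt x * (D x * r (Vt x)) + (D1 x * r (Vt x) + r' (Vt x) * V2 x * D x) * \<phi> (Ft x)" for x
    unfolding dderiv_mult[of n v ?d\<phi> "\<lambda>x. D x * r (Vt x)" ?dR "\<lambda>x. \<phi> (Ft x)" x]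
      dderiv_mult[of n v dD "\<lambda>x. r (Vt x)" ?dr D x]
      dderiv_comp[of n v "\<lambda>x. \<phi>' (Ft x)" "\<lambda>i x. dF i x + t * dD i x"]
      dderiv_comp[of n v "\<lambda>x. r' (Vt x)" "\<lambda>i x. dF1 i x + t * dD1 i x"] dl D(3) ..
  have tm: "tame n D" "tame n D1" "tame n (\<lambda>x. \<phi> (Ft x))" "tame n (\<lambda>x. r (Vt x))" "tame n Vt" "tame n Ft"
    using gsmooth_tame(1) D(1,2) s\<phi> sr sVt sFt by blast+
  have tm2: "tame n F2" "tame n D2"
  proof -
    have "dderiv n v dF1 = F2" "dderiv n v dD1 = D2" using F(4) D(4) by (auto simp: fun_eq_iff)
    then show "tame n F2" "tame n D2" using tame_dderiv[OF F(2), of v] tame_dderiv[OF D(2), of v] by simp_all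
  qed
  have tV2: "tame n V2" unfolding V2_def[abs_def] by (intro tame_add tame_cmult tm2)
  have tm3: "tame n (\<lambda>x. r' (Vt x))" "tame n (\<lambda>x. c' (Vt x))" "tame n (\<lambda>x. \<phi>' (Ft x))"
    by (rule tame_comp[OF pg(4) borel_measurable_continuous_onI[OF cont(1)] tm(5)],
        rule tame_comp[OF pg(5) borel_measurable_continuous_onI[OF cont(2)] tm(5)],
        rule tame_comp[OF pg(2) borel_measurable_continuous_onI[OF c\<phi>'] tm(6)])
  let ?A = "\<lambda>x. \<phi>' (Ft x) * Vt x * (D x * r (Vt x))" and ?B = "\<lambda>x. (D1 x * r (Vt x) + r' (Vt x) * V2 x * D x) * \<phi> (Ft x)"
    and ?L = "\<lambda>x. lin n v x * (\<phi> (Ft x) * (D x * r (Vt x)))" and ?C = "\<lambda>x. \<phi> (Ft x) * (c' (Vt x) * D1 x)"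
  have i: "integrable (gauss n) ?A" "integrable (gauss n) ?B" "integrable (gauss n) ?L" "integrable (gauss n) ?C"
    by (intro tame_integrable tame_mult tame_add tame_lin tm tm3 tV2)+
  have ibp: "(\<integral>x. ?L x \<partial>gauss n) = (\<integral>x. ?A x + ?B x \<partial>gauss n)"
    using gaussian_ibp[OF sG, of v] unfolding dd .
  \<comment> \<open>The cut-off equals \<open>Vt x * r (Vt x)\<close> and thus supplies the factor
    \<open>Vt x\<close> required by the chain rule.\<close>
  have "(\<integral>x. \<phi>' (Ft x) * D x * ((Vt x)\<^sup>2 / ((Vt x)\<^sup>2 + k)) + \<phi> (Ft x) * (2 * Vt x * k / ((Vt x)\<^sup>2 + k)\<^sup>2 * D1 x) \<partial>gauss n)
     = (\<integral>x. ?A x + ?C x \<partial>gauss n)"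
    by (intro Bochner_Integration.integral_cong refl) (simp add: r_def c'_def power2_eq_square)
  also have "\<dots> = (\<integral>x. ?L x - ?B x + ?C x \<partial>gauss n)"
    using ibp i by simp
  finally have eq: "(\<integral>x. \<phi>' (Ft x) * D x * ((Vt x)\<^sup>2 / ((Vt x)\<^sup>2 + k)) + \<phi> (Ft x) * (2 * Vt x * k / ((Vt x)\<^sup>2 + k)\<^sup>2 * D1 x) \<partial>gauss n)
     = (\<integral>x. ?L x - ?B x + ?C x \<partial>gauss n)" .
  have "\<bar>\<integral>x. ?L x - ?B x + ?C x \<partial>gauss n\<bar> \<le> (\<integral>x. \<bar>?L x - ?B x + ?C x\<bar> \<partial>gauss n)" by (rule integral_abs_bound)
  also have "\<dots> \<le> (\<integral>x. 1 / k * ((\<bar>lin n v x\<bar> + 2 + \<bar>F2 x\<bar> + \<bar>D2 x\<bar>) * (\<bar>D x\<bar> + \<bar>D1 x\<bar>)) \<partial>gauss n)"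
  proof (rule integral_mono)
    show "integrable (gauss n) (\<lambda>x. \<bar>?L x - ?B x + ?C x\<bar>)" using i by simp
    show "integrable (gauss n) (\<lambda>x. 1 / k * ((\<bar>lin n v x\<bar> + 2 + \<bar>F2 x\<bar> + \<bar>D2 x\<bar>) * (\<bar>D x\<bar> + \<bar>D1 x\<bar>)))"
      by (intro tame_integrable tame_cmult tame_mult tame_add tame_abs tame_lin tame_const tm tm2)
    fix x
    have k0: "0 \<le> 1 / k" using k by simp
    have "\<bar>?L x\<bar> = \<bar>lin n v x\<bar> * (\<bar>\<phi> (Ft x)\<bar> * (\<bar>D x\<bar> * \<bar>r (Vt x)\<bar>))" by (simp add: abs_mult)
    also have "\<dots> \<le> \<bar>lin n v x\<bar> * (1 * (\<bar>D x\<bar> * (1 / k)))"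
      using b\<phi> rb by (intro mult_left_mono mult_mono) auto
    finally have 1: "\<bar>?L x\<bar> \<le> 1 / k * (\<bar>lin n v x\<bar> * \<bar>D x\<bar>)" by (simp add: mult_ac)
    have "\<bar>V2 x\<bar> \<le> \<bar>F2 x\<bar> + \<bar>t * D2 x\<bar>" unfolding V2_def by (rule abs_triangle_ineq)
    also have "\<bar>t * D2 x\<bar> \<le> 1 * \<bar>D2 x\<bar>" unfolding abs_mult using t by (intro mult_right_mono) auto
    finally have V2: "\<bar>V2 x\<bar> \<le> \<bar>F2 x\<bar> + \<bar>D2 x\<bar>" by simp
    have "\<bar>?B x\<bar> = \<bar>D1 x * r (Vt x) + r' (Vt x) * V2 x * D x\<bar> * \<bar>\<phi> (Ft x)\<bar>" by (simp only: abs_mult)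
    also have "\<dots> \<le> (\<bar>D1 x * r (Vt x)\<bar> + \<bar>r' (Vt x) * V2 x * D x\<bar>) * 1"
      using b\<phi> by (intro mult_mono abs_triangle_ineq) auto
    also have "\<dots> = \<bar>D1 x\<bar> * \<bar>r (Vt x)\<bar> + \<bar>r' (Vt x)\<bar> * \<bar>V2 x\<bar> * \<bar>D x\<bar>" by (simp add: abs_mult)
    also have "\<dots> \<le> \<bar>D1 x\<bar> * (1 / k) + (1 / k) * (\<bar>F2 x\<bar> + \<bar>D2 x\<bar>) * \<bar>D x\<bar>"
      using rb V2 k by (intro add_mono mult_mono mult_left_mono) auto
    finally have 2: "\<bar>?B x\<bar> \<le> 1 / k * (\<bar>D1 x\<bar> + (\<bar>F2 x\<bar> + \<bar>D2 x\<bar>) * \<bar>D x\<bar>)" by (simp add: algebra_simps)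
    have "\<bar>?C x\<bar> = \<bar>\<phi> (Ft x)\<bar> * (\<bar>c' (Vt x)\<bar> * \<bar>D1 x\<bar>)" by (simp add: abs_mult)
    also have "\<dots> \<le> 1 * (1 / k * \<bar>D1 x\<bar>)" using b\<phi> rb by (intro mult_mono mult_right_mono) auto
    finally have 3: "\<bar>?C x\<bar> \<le> 1 / k * \<bar>D1 x\<bar>" by simp
    have "\<bar>?L x - ?B x + ?C x\<bar> \<le> \<bar>?L x\<bar> + \<bar>?B x\<bar> + \<bar>?C x\<bar>" by linarith
    also have "\<dots> \<le> 1 / k * (\<bar>lin n v x\<bar> * \<bar>D x\<bar>) + 1 / k * (\<bar>D1 x\<bar> + (\<bar>F2 x\<bar> + \<bar>D2 x\<bar>) * \<bar>D x\<bar>) + 1 / k * \<bar>D1 x\<bar>"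
      using 1 2 3 by linarith
    also have "\<dots> = 1 / k * (\<bar>lin n v x\<bar> * \<bar>D x\<bar> + 2 * \<bar>D1 x\<bar> + (\<bar>F2 x\<bar> + \<bar>D2 x\<bar>) * \<bar>D x\<bar>)" by (simp add: algebra_simps)
    also have "\<dots> \<le> 1 / k * ((\<bar>lin n v x\<bar> + 2 + \<bar>F2 x\<bar> + \<bar>D2 x\<bar>) * (\<bar>D x\<bar> + \<bar>D1 x\<bar>))"
    proof (rule mult_left_mono[OF _ k0])
      have "0 \<le> 2 * \<bar>D x\<bar> + \<bar>lin n v x\<bar> * \<bar>D1 x\<bar> + (\<bar>F2 x\<bar> + \<bar>D2 x\<bar>) * \<bar>D1 x\<bar>" by simp
      then show "\<bar>lin n v x\<bar> * \<bar>D x\<bar> + 2 * \<bar>D1 x\<bar> + (\<bar>F2 x\<bar> + \<bar>D2 x\<bar>) * \<bar>D x\<bar> \<le> (\<bar>lin n v x\<bar> + 2 + \<bar>F2 x\<bar> + \<bar>D2 x\<bar>) * (\<bar>D x\<bar> + \<bar>D1 x\<bar>)"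
        by (simp add: algebra_simps)
    qed
    finally show "\<bar>?L x - ?B x + ?C x\<bar> \<le> 1 / k * ((\<bar>lin n v x\<bar> + 2 + \<bar>F2 x\<bar> + \<bar>D2 x\<bar>) * (\<bar>D x\<bar> + \<bar>D1 x\<bar>))" .
  qed
  also have "\<dots> = 1 / k * (\<integral>x. (\<bar>lin n v x\<bar> + 2 + \<bar>F2 x\<bar> + \<bar>D2 x\<bar>) * (\<bar>D x\<bar> + \<bar>D1 x\<bar>) \<partial>gauss n)" by (rule integral_mult_right_zero)
  finally show ?thesis unfolding eq .
qed

text \<open>The difference is the integral of its derivative along \<open>t\<close>. Exchanging the
  integrals reduces the claim to a fixed \<open>t\<close>, where the bound does not depend on
  \<open>t\<close>.\<close>

lemma interpolation_bound:
  assumes \<phi>: "test_function \<phi> \<phi>' L" and k: "0 < k" "k \<le> (1::real)"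
    and F: "gsmooth n F dF" "gsmooth n F1 dF1" "\<And>x. dderiv n v dF x = F1 x" "\<And>x. dderiv n v dF1 x = F2 x"
    and D: "gsmooth n D dD" "gsmooth n D1 dD1" "\<And>x. dderiv n v dD x = D1 x" "\<And>x. dderiv n v dD1 x = D2 x"
  defines "\<eta> \<equiv> \<lambda>v. v\<^sup>2 / (v\<^sup>2 + k)"
  shows "\<bar>(\<integral>x. \<phi> (F x + D x) * \<eta> (F1 x + D1 x) \<partial>gauss n) - (\<integral>x. \<phi> (F x) * \<eta> (F1 x) \<partial>gauss n)\<bar>
    \<le> 1 / k * (\<integral>x. (\<bar>lin n v x\<bar> + 2 + \<bar>F2 x\<bar> + \<bar>D2 x\<bar>) * (\<bar>D x\<bar> + \<bar>D1 x\<bar>) \<partial>gauss n)"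
    (is "_ \<le> ?B")
proof -
  define c' where "c' = (\<lambda>v::real. 2 * v * k / (v\<^sup>2 + k)\<^sup>2)"
  define A' where "A' t x = \<phi>' (F x + t * D x) * D x * \<eta> (F1 x + t * D1 x) + \<phi> (F x + t * D x) * (c' (F1 x + t * D1 x) * D1 x)" for t x
  have b\<phi>: "\<bar>\<phi> x\<bar> \<le> 1" "\<bar>\<phi>' x\<bar> \<le> L" for x using \<phi> by (auto simp: test_function_def)
  have L0: "0 \<le> L" using b\<phi>(2)[of 0] by linarith
  have d\<phi>: "(\<phi> has_real_derivative \<phi>' x) (at x)" for x using \<phi> by (simp add: test_function_def)
  have c\<phi>': "continuous_on UNIV \<phi>'" using \<phi> by (simp add: test_function_def)
  have c\<phi>: "continuous_on UNIV \<phi>" using DERIV_imp_borel(2)[OF d\<phi>] .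
  have d\<eta>: "(\<eta> has_real_derivative c' y) (at y)" for y unfolding \<eta>_def c'_def by (rule cutoff_derivs(2)[OF k(1)])
  have c\<eta>: "continuous_on UNIV \<eta>" "continuous_on UNIV c'" unfolding \<eta>_def c'_def using cutoff_continuous k by blast+
  have \<eta>b: "\<bar>\<eta> y\<bar> \<le> 1" for y
    using ratio_le_one[of k "y\<^sup>2"] k by (simp add: \<eta>_def add.commute)
  have c'b: "\<bar>c' y\<bar> \<le> 1 / k" for y unfolding c'_def by (rule cutoff_bounds(3)[OF k])
  have [measurable]: "\<phi> \<in> borel_measurable borel" "\<phi>' \<in> borel_measurable borel" "\<eta> \<in> borel_measurable borel" "c' \<in> borel_measurable borel"
    using c\<phi> c\<phi>' c\<eta> by (auto intro: borel_measurable_continuous_onI)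
  have t: "tame n F" "tame n F1" "tame n D" "tame n D1" using gsmooth_tame(1) F D by blast+
  have [measurable]: "F \<in> borel_measurable (gauss n)" "F1 \<in> borel_measurable (gauss n)" "D \<in> borel_measurable (gauss n)" "D1 \<in> borel_measurable (gauss n)"
    using t by (simp_all add: tame_def)
  have cont: "continuous_on UNIV (\<lambda>t. A' t x)" for x
    unfolding A'_def
    by (intro continuous_intros continuous_on_compose2[OF c\<phi>] continuous_on_compose2[OF c\<phi>'] continuous_on_compose2[OF c\<eta>(1)] continuous_on_compose2[OF c\<eta>(2)]) auto
  have ftc: "(\<integral>t. A' t x * indicator {0..1} t \<partial>lborel) = \<phi> (F x + D x) * \<eta> (F1 x + D1 x) - \<phi> (F x) * \<eta> (F1 x)" for x
  proof -
    have "(\<integral>t. A' t x * indicator {0..1} t \<partial>lborel) = \<phi> (F x + 1 * D x) * \<eta> (F1 x + 1 * D1 x) - \<phi> (F x + 0 * D x) * \<eta> (F1 x + 0 * D1 x)"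
    proof (rule integral_FTC_Icc_real)
      fix t :: real
      show "((\<lambda>t. \<phi> (F x + t * D x) * \<eta> (F1 x + t * D1 x)) has_real_derivative A' t x) (at t)"
        unfolding A'_def
        by (rule derivative_eq_intros DERIV_chain2[OF d\<phi>] DERIV_chain2[OF d\<eta>] refl | simp)+
      show "isCont (\<lambda>t. A' t x) t" using cont[of x] by (simp add: continuous_on_eq_continuous_at)
    qed simp
    then show ?thesis by simp
  qed
  \<comment> \<open>The majorant contains \<open>L\<close>, but it only justifies exchanging the
    integrals; the estimate itself comes from \<open>inner\<close>.\<close>
  define H where "H x = L * \<bar>D x\<bar> + 1 / k * \<bar>D1 x\<bar>" for x
  have tH: "tame n H" unfolding H_def[abs_def] by (intro tame_add tame_cmult tame_abs t)
  have [measurable]: "H \<in> borel_measurable (gauss n)" using tH by (simp add: tame_def)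
  have A'b: "\<bar>A' t x\<bar> \<le> H x" for t x
  proof -
    have "\<bar>\<phi>' (F x + t * D x) * D x * \<eta> (F1 x + t * D1 x)\<bar> \<le> L * \<bar>D x\<bar> * 1"
      unfolding abs_mult using b\<phi> \<eta>b L0 by (intro mult_mono mult_right_mono) auto
    moreover have "\<bar>\<phi> (F x + t * D x) * (c' (F1 x + t * D1 x) * D1 x)\<bar> \<le> 1 * (1 / k * \<bar>D1 x\<bar>)"
      unfolding abs_mult using b\<phi> c'b by (intro mult_mono mult_right_mono) auto
    ultimately show ?thesis unfolding A'_def H_def by linarith
  qed
  interpret G: prob_space "gauss n" by (rule prob_space_gauss)
  interpret PS: pair_sigma_finite lborel "gauss n"
    by (intro pair_sigma_finite.intro lborel.sigma_finite_measure_axioms G.sigma_finite_measure_axioms)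
  have ind: "integrable lborel (\<lambda>t. c * indicator {0..1::real} t)" for c :: real
    by (intro integrable_mult_right integrable_real_indicator) auto
  have iH: "integrable (lborel \<Otimes>\<^sub>M gauss n) (\<lambda>p. H (snd p) * indicator {0..1::real} (fst p))"
  proof (rule PS.Fubini_integrable)
    show "integrable lborel (\<lambda>t. \<integral>x. norm (H (snd (t, x)) * indicator {0..1::real} (fst (t, x))) \<partial>gauss n)"
      using ind[of "\<integral>x. \<bar>H x\<bar> \<partial>gauss n"] by (simp add: abs_mult)
    show "AE t in lborel. integrable (gauss n) (\<lambda>x. H (snd (t, x)) * indicator {0..1::real} (fst (t, x)))"
      using tame_integrable[OF tH] by simp
  qed measurable
  have iA: "integrable (lborel \<Otimes>\<^sub>M gauss n) (\<lambda>(t, x). A' t x * indicator {0..1::real} t)"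
  proof (rule Bochner_Integration.integrable_bound[OF iH])
    show "(\<lambda>(t, x). A' t x * indicator {0..1::real} t) \<in> borel_measurable (lborel \<Otimes>\<^sub>M gauss n)"
      unfolding A'_def by measurable
    show "AE p in lborel \<Otimes>\<^sub>M gauss n. norm (case p of (t, x) \<Rightarrow> A' t x * indicator {0..1::real} t) \<le> norm (H (snd p) * indicator {0..1::real} (fst p))"
    proof (rule AE_I2)
      fix p :: "real \<times> (nat \<Rightarrow> real)"
      show "norm (case p of (t, x) \<Rightarrow> A' t x * indicator {0..1::real} t) \<le> norm (H (snd p) * indicator {0..1::real} (fst p))"
        using A'b[of "fst p" "snd p"] by (cases p) (auto simp: abs_mult intro!: mult_right_mono order_trans[OF _ abs_ge_self])
    qed
  qed
  have i1: "integrable (gauss n) (\<lambda>x. \<phi> (F x + D x) * \<eta> (F1 x + D1 x))" "integrable (gauss n) (\<lambda>x. \<phi> (F x) * \<eta> (F1 x))"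
    using b\<phi> \<eta>b by (auto intro!: G.integrable_const_bound[where B=1] AE_I2 mult_le_one simp: abs_mult)
  have "(\<integral>x. \<phi> (F x + D x) * \<eta> (F1 x + D1 x) \<partial>gauss n) - (\<integral>x. \<phi> (F x) * \<eta> (F1 x) \<partial>gauss n) =
     (\<integral>x. (\<integral>t. A' t x * indicator {0..1} t \<partial>lborel) \<partial>gauss n)"
    unfolding ftc using i1 by simp
  also have "\<dots> = (\<integral>t. (\<integral>x. A' t x * indicator {0..1} t \<partial>gauss n) \<partial>lborel)"
    by (rule PS.Fubini_integral[OF iA])
  finally have eq: "(\<integral>x. \<phi> (F x + D x) * \<eta> (F1 x + D1 x) \<partial>gauss n) - (\<integral>x. \<phi> (F x) * \<eta> (F1 x) \<partial>gauss n) =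
     (\<integral>t. (\<integral>x. A' t x * indicator {0..1} t \<partial>gauss n) \<partial>lborel)" .
  have inner: "\<bar>\<integral>x. A' t x * indicator {0..1} t \<partial>gauss n\<bar> \<le> ?B * indicator {0..1} t" for t
  proof (cases "t \<in> {0..1}")
    case True
    then have t: "0 \<le> t" "t \<le> 1" by auto
    from interpolation_integrand_bound[OF \<phi> k t F D] True show ?thesis
      by (simp add: A'_def \<eta>_def c'_def)
  qed simp
  have "\<bar>\<integral>t. (\<integral>x. A' t x * indicator {0..1} t \<partial>gauss n) \<partial>lborel\<bar> \<le> (\<integral>t. \<bar>\<integral>x. A' t x * indicator {0..1} t \<partial>gauss n\<bar> \<partial>lborel)"
    by (rule integral_abs_bound)
  also have "\<dots> \<le> (\<integral>t. ?B * indicator {0..1::real} t \<partial>lborel)"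
    by (intro integral_mono inner ind integrable_abs PS.integrable_fst[OF iA])
  also have "\<dots> = ?B" by simp
  finally show ?thesis unfolding eq .
qed

text \<open>The cut-off is inserted at both ends. At the perturbed end its cost involves
  \<open>F1 + D1\<close>, about whose small values nothing is known; the interpolation bound for the
  constant test function transfers this cost to \<open>F1\<close>. Hence the interpolation bound is
  paid twice, and small values matter for the unperturbed derivative only.\<close>

lemma cutoff_comparison:
  assumes \<phi>: "test_function \<phi> \<phi>' L" and k: "0 < k" "k \<le> (1::real)"
    and F: "gsmooth n F dF" "gsmooth n F1 dF1" "\<And>x. dderiv n v dF x = F1 x" "\<And>x. dderiv n v dF1 x = F2 x"
    and D: "gsmooth n D dD" "gsmooth n D1 dD1" "\<And>x. dderiv n v dD x = D1 x" "\<And>x. dderiv n v dD1 x = D2 x"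
  shows "\<bar>(\<integral>x. \<phi> (F x + D x) \<partial>gauss n) - (\<integral>x. \<phi> (F x) \<partial>gauss n)\<bar>
    \<le> 2 / k * (\<integral>x. (\<bar>lin n v x\<bar> + 2 + \<bar>F2 x\<bar> + \<bar>D2 x\<bar>) * (\<bar>D x\<bar> + \<bar>D1 x\<bar>) \<partial>gauss n)
      + 2 * (\<integral>x. k / ((F1 x)\<^sup>2 + k) \<partial>gauss n)"
proof -
  interpret G: prob_space "gauss n" by (rule prob_space_gauss)
  let ?B = "1 / k * (\<integral>x. (\<bar>lin n v x\<bar> + 2 + \<bar>F2 x\<bar> + \<bar>D2 x\<bar>) * (\<bar>D x\<bar> + \<bar>D1 x\<bar>) \<partial>gauss n)"
  define \<eta> where "\<eta> = (\<lambda>v::real. v\<^sup>2 / (v\<^sup>2 + k))"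
  have \<eta>b: "0 \<le> \<eta> y" "\<eta> y \<le> 1" for y
    using ratio_le_one[of k "y\<^sup>2"] k by (simp_all add: \<eta>_def add.commute)
  have \<eta>c: "1 - \<eta> y = k / (y\<^sup>2 + k)" for y
  proof -
    have "y\<^sup>2 + k \<noteq> 0" using k by (metis add_nonneg_pos less_irrefl zero_le_power2)
    then show ?thesis by (simp add: \<eta>_def field_simps)
  qed
  have b\<phi>: "0 \<le> \<phi> x" "\<phi> x \<le> 1" for x using \<phi> by (auto simp: test_function_def)
  have t: "tame n F" "tame n F1" "tame n D" "tame n D1" using gsmooth_tame(1) F D by blast+
  have [measurable]: "F \<in> borel_measurable (gauss n)" "F1 \<in> borel_measurable (gauss n)" "D \<in> borel_measurable (gauss n)" "D1 \<in> borel_measurable (gauss n)"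
    using t by (simp_all add: tame_def)
  have [measurable]: "\<phi> \<in> borel_measurable borel" using test_function_measurable(1)[OF \<phi>] .
  have [measurable]: "\<eta> \<in> borel_measurable borel" unfolding \<eta>_def using cutoff_continuous(4)[OF k(1)] by (rule borel_measurable_continuous_onI)
  have i: "integrable (gauss n) (\<lambda>x. \<phi> (Y x))" "integrable (gauss n) (\<lambda>x. \<eta> (V x))" "integrable (gauss n) (\<lambda>x. \<phi> (Y x) * \<eta> (V x))"
    if [measurable]: "Y \<in> borel_measurable (gauss n)" "V \<in> borel_measurable (gauss n)" for Y V
    using b\<phi> \<eta>b by (auto intro!: G.integrable_const_bound[where B=1] AE_I2 mult_le_one simp: abs_mult)
  have cut: "\<bar>(\<integral>x. \<phi> (Y x) \<partial>gauss n) - (\<integral>x. \<phi> (Y x) * \<eta> (V x) \<partial>gauss n)\<bar> \<le> 1 - (\<integral>x. \<eta> (V x) \<partial>gauss n)"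
    if [measurable]: "Y \<in> borel_measurable (gauss n)" "V \<in> borel_measurable (gauss n)" for Y V
  proof -
    have "\<bar>(\<integral>x. \<phi> (Y x) \<partial>gauss n) - (\<integral>x. \<phi> (Y x) * \<eta> (V x) \<partial>gauss n)\<bar> = \<bar>\<integral>x. \<phi> (Y x) - \<phi> (Y x) * \<eta> (V x) \<partial>gauss n\<bar>"
      using i[of Y V] by simp
    also have "\<dots> \<le> (\<integral>x. \<bar>\<phi> (Y x) - \<phi> (Y x) * \<eta> (V x)\<bar> \<partial>gauss n)" by (rule integral_abs_bound)
    also have "\<dots> \<le> (\<integral>x. 1 - \<eta> (V x) \<partial>gauss n)"
    proof (rule integral_mono)
      fix x
      have "\<phi> (Y x) - \<phi> (Y x) * \<eta> (V x) = \<phi> (Y x) * (1 - \<eta> (V x))" by (simp add: algebra_simps)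
      moreover have "\<bar>\<phi> (Y x) * (1 - \<eta> (V x))\<bar> \<le> 1 * (1 - \<eta> (V x))"
        unfolding abs_mult using b\<phi> \<eta>b by (intro mult_mono) auto
      ultimately show "\<bar>\<phi> (Y x) - \<phi> (Y x) * \<eta> (V x)\<bar> \<le> 1 - \<eta> (V x)" by simp
    qed (use i[of Y V] in auto)
    also have "\<dots> = 1 - (\<integral>x. \<eta> (V x) \<partial>gauss n)" using i[of Y V] G.prob_space by simp
    finally show ?thesis .
  qed
  have m: "(\<lambda>x. F x + D x) \<in> borel_measurable (gauss n)" "(\<lambda>x. F1 x + D1 x) \<in> borel_measurable (gauss n)" by measurable
  have p1: "\<bar>(\<integral>x. \<phi> (F x + D x) * \<eta> (F1 x + D1 x) \<partial>gauss n) - (\<integral>x. \<phi> (F x) * \<eta> (F1 x) \<partial>gauss n)\<bar> \<le> ?B"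
    unfolding \<eta>_def by (rule interpolation_bound[OF \<phi> k F D])
  \<comment> \<open>With \<open>\<phi> = 1\<close> the interpolation bound compares the two cut-offs
    themselves.\<close>
  have one: "test_function (\<lambda>_. 1) (\<lambda>_. 0) 0" by (auto simp: test_function_def)
  have p2: "\<bar>(\<integral>x. \<eta> (F1 x + D1 x) \<partial>gauss n) - (\<integral>x. \<eta> (F1 x) \<partial>gauss n)\<bar> \<le> ?B"
    using interpolation_bound[OF one k F D] by (simp add: \<eta>_def)
  have c0: "(\<integral>x. k / ((F1 x)\<^sup>2 + k) \<partial>gauss n) = 1 - (\<integral>x. \<eta> (F1 x) \<partial>gauss n)"
    unfolding \<eta>c[symmetric] using i[of F F1] G.prob_space by simp
  have "\<bar>(\<integral>x. \<phi> (F x + D x) \<partial>gauss n) - (\<integral>x. \<phi> (F x) \<partial>gauss n)\<bar> \<le> 2 * ?B + 2 * (1 - (\<integral>x. \<eta> (F1 x) \<partial>gauss n))"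
  proof -
    have arith: "\<bar>a - d\<bar> \<le> 2 * B + 2 * (1 - e0)"
      if "\<bar>a - a'\<bar> \<le> 1 - e1" "\<bar>d - d'\<bar> \<le> 1 - e0" "\<bar>a' - d'\<bar> \<le> B" "\<bar>e1 - e0\<bar> \<le> B"
      for a a' d d' e0 e1 B :: real
      using that by (smt (verit))
    show ?thesis by (rule arith[OF cut[OF m] _ p1 p2]) (rule cut, measurable)
  qed
  then show ?thesis unfolding c0 by simp
qed

section \<open>The normalising constant at small rates\<close>

lemma exp_minus_bounds:
  fixes x :: real
  assumes "x \<ge> 0"
  shows "exp (- x) \<le> 1 - x + x\<^sup>2 / 2" "1 - x + x\<^sup>2 / 2 - x ^ 3 / 6 \<le> exp (- x)"
proof -
  have g: "0 \<le> 1 - y + y\<^sup>2 / 2 - exp (- y)" if "y \<ge> 0" for y :: real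
  proof -
    have "1 - 0 + 0\<^sup>2 / 2 - exp (- 0) \<le> 1 - y + y\<^sup>2 / 2 - exp (- y)"
    proof (rule DERIV_nonneg_imp_nondecreasing[OF that])
      fix t :: real
      have "((\<lambda>y. 1 - y + y\<^sup>2 / 2 - exp (- y)) has_real_derivative (t - 1 + exp (- t))) (at t)"
        by (auto intro!: derivative_eq_intros)
      moreover have "0 \<le> t - 1 + exp (- t)" using exp_ge_add_one_self[of "- t"] by simp
      ultimately show "\<exists>z. ((\<lambda>y. 1 - y + y\<^sup>2 / 2 - exp (- y)) has_real_derivative z) (at t) \<and> 0 \<le> z" by blast
    qed
    then show ?thesis by simp
  qed
  from g[OF assms] show "exp (- x) \<le> 1 - x + x\<^sup>2 / 2" by simp
  have "exp (- 0) - 1 + 0 - 0\<^sup>2 / 2 + 0 ^ 3 / 6 \<le> exp (- x) - 1 + x - x\<^sup>2 / 2 + x ^ 3 / 6"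
  proof (rule DERIV_nonneg_imp_nondecreasing[OF assms])
    fix t :: real assume "0 \<le> t"
    have "((\<lambda>x. exp (- x) - 1 + x - x\<^sup>2 / 2 + x ^ 3 / 6) has_real_derivative (1 - t + t\<^sup>2 / 2 - exp (- t))) (at t)"
      by (auto intro!: derivative_eq_intros simp: power2_eq_square)
    with g[OF \<open>0 \<le> t\<close>] show "\<exists>z. ((\<lambda>x. exp (- x) - 1 + x - x\<^sup>2 / 2 + x ^ 3 / 6) has_real_derivative z) (at t) \<and> 0 \<le> z" by blast
  qed
  then show "1 - x + x\<^sup>2 / 2 - x ^ 3 / 6 \<le> exp (- x)" by simp
qed

text \<open>Times \<open>fact q\<close>, the squared constant is the quotient of
  \<open>x\<^sup>2 / 2\<close> by \<open>exp (- x) - 1 + x\<close>. Taylor bounds place it between 1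
  and \<open>1 + x\<close> for \<open>x = \<gamma> * q \<le> 1\<close>, and so its square root as
  well.\<close>

lemma chaos_const_small:
  fixes \<gamma> :: real
  assumes q: "q \<ge> 1" and \<gamma>: "0 < \<gamma>" "\<gamma> * q \<le> 1"
  shows "\<bar>chaos_const q \<gamma> - 1 / sqrt (fact q)\<bar> \<le> q * \<gamma>" "chaos_const q \<gamma> \<le> 2"
proof -
  define x where "x = \<gamma> * q"
  have x: "0 < x" "x \<le> 1" using q \<gamma> by (simp_all add: x_def)
  define E where "E = exp (- x) - 1 + x"
  have "x\<^sup>2 / 2 * (1 - x / 3) = x\<^sup>2 / 2 - x ^ 3 / 6" by (simp add: power2_eq_square power3_eq_cube field_simps)
  then have E: "x\<^sup>2 / 2 * (1 - x / 3) \<le> E" "E \<le> x\<^sup>2 / 2"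
    unfolding E_def using exp_minus_bounds[of x] x by linarith+
  have pos: "0 < x\<^sup>2 / 2 * (1 - x / 3)" using x by simp
  then have E0: "0 < E" using E(1) by linarith
  define t where "t = chaos_const q \<gamma> * sqrt (fact q)"
  have t2: "t\<^sup>2 = x\<^sup>2 / 2 / E"
    unfolding t_def power_mult_distrib chaos_const_square(1)[OF \<gamma>(1) q] x_def[symmetric] E_def[symmetric]
    by (simp add: field_simps)
  have t0: "0 \<le> t" unfolding t_def using chaos_const_square(2)[OF \<gamma>(1) q] by simp
  have "1 \<le> t\<^sup>2" unfolding t2 using E(2) E0 by simp
  then have t1: "1 \<le> t" using t0 power2_le_imp_le[of 1 t] by simp
  have "t\<^sup>2 \<le> 1 + x"
  proof -
    have "t\<^sup>2 \<le> (x\<^sup>2 / 2) / (x\<^sup>2 / 2 * (1 - x / 3))"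
      unfolding t2 using E pos E0 by (intro divide_left_mono) auto
    also have "\<dots> = 1 / (1 - x / 3)" using x by simp
    also have "\<dots> \<le> 1 + x"
    proof -
      have "x * x \<le> x * 1" using x by (intro mult_left_mono) auto
      then have "1 \<le> (1 + x) * (1 - x / 3)" using x by (simp add: algebra_simps)
      then show ?thesis using x by (simp add: divide_le_eq)
    qed
    finally show ?thesis .
  qed
  moreover have "t \<le> t\<^sup>2" using t1 by (simp add: power2_eq_square)
  ultimately have tx: "t \<le> 1 + x" by linarith
  have f1: "1 \<le> sqrt (fact q :: real)" by (simp add: fact_ge_1)
  have c: "chaos_const q \<gamma> = t / sqrt (fact q)" unfolding t_def by simp
  have "\<bar>chaos_const q \<gamma> - 1 / sqrt (fact q)\<bar> = (t - 1) / sqrt (fact q)"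
    unfolding c diff_divide_distrib[symmetric] using t1 f1 by simp
  also have "\<dots> \<le> (t - 1) / 1" using t1 f1 by (intro divide_left_mono) auto
  also have "\<dots> \<le> q * \<gamma>" using tx by (simp add: x_def mult.commute)
  finally show "\<bar>chaos_const q \<gamma> - 1 / sqrt (fact q)\<bar> \<le> q * \<gamma>" .
  have "chaos_const q \<gamma> \<le> t / 1" unfolding c using t0 f1 by (intro divide_left_mono) auto
  then show "chaos_const q \<gamma> \<le> 2" using tx x by simp
qed

section \<open>Moments of polynomials in two linear forms\<close>

lemma gsmooth_poly: "gsmooth n (\<lambda>x. poly p (lin n a x)) (\<lambda>i x. poly (pderiv p) (lin n a x) * a i)"
  by (rule gsmooth_comp[OF poly_DERIV _ poly_growth_poly poly_growth_poly gsmooth_lin]) (intro continuous_intros)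

lemma dderiv_poly: "dderiv n v (\<lambda>i x. poly p (lin n a x) * a i) x = poly p (lin n a x) * dot n v a"
  unfolding dderiv_def dot_def sum_distrib_left by (intro sum.cong refl) (simp only: mult_ac)

lemma expectation_lin_lin:
  assumes "dot n a a = 1" "dot n b b = 1"
  shows "(\<integral>x. lin n a x * lin n b x \<partial>gauss n) = dot n a b"
proof -
  have "hermite (Suc 0) = (\<lambda>x. x)" by (simp add: hermite_Suc fun_eq_iff)
  then show ?thesis using hermite_inner[OF assms, of "Suc 0"] by simp
qed

text \<open>Two growth weights will accompany one factor that is small in mean square, so each
  weight needs a fourth moment. Estimating \<open>1 + \<bar>y\<bar> + \<bar>z\<bar>\<close> by three
  times the largest summand reduces it to moments of single forms.\<close>

lemma growth_fourth_moment:
  "\<exists>C\<ge>0. \<forall>n v w. dot n v v = 1 \<longrightarrow> dot n w w = 1 \<longrightarrow>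
     (\<integral>x. ((1 + \<bar>lin n v x\<bar> + \<bar>lin n w x\<bar>) ^ m) ^ 4 \<partial>gauss n) \<le> C"
proof (intro exI conjI allI impI)
  let ?M = "2 * (2 * m)"
  show "(0::real) \<le> 3 ^ ?M * (1 + fact ?M + fact ?M)" by simp
  fix n v w assume vw: "dot n v v = 1" "dot n w w = 1"
  interpret G: prob_space "gauss n" by (rule prob_space_gauss)
  have pw: "((1 + \<bar>y\<bar> + \<bar>z\<bar>) ^ m) ^ 4 \<le> 3 ^ ?M * (1 + y ^ ?M + z ^ ?M)" for y z :: real
  proof -
    define b where "b = max 1 (max \<bar>y\<bar> \<bar>z\<bar>)"
    have ev: "y ^ ?M = \<bar>y\<bar> ^ ?M" "z ^ ?M = \<bar>z\<bar> ^ ?M" by (simp_all add: power_even_abs)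
    have "1 + \<bar>y\<bar> + \<bar>z\<bar> \<le> 3 * b" unfolding b_def by linarith
    then have "(1 + \<bar>y\<bar> + \<bar>z\<bar>) ^ ?M \<le> (3 * b) ^ ?M" by (intro power_mono) auto
    also have "\<dots> = 3 ^ ?M * b ^ ?M" by (rule power_mult_distrib)
    also have "\<dots> \<le> 3 ^ ?M * (1 + y ^ ?M + z ^ ?M)"
    proof (rule mult_left_mono)
      have p: "0 \<le> \<bar>y\<bar> ^ ?M" "0 \<le> \<bar>z\<bar> ^ ?M" by (rule zero_le_power, simp)+
      consider "b = 1" | "b = \<bar>y\<bar>" | "b = \<bar>z\<bar>" unfolding b_def by (metis max_def)
      then show "b ^ ?M \<le> 1 + y ^ ?M + z ^ ?M" unfolding ev
      proof cases
        case 1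
        show "b ^ ?M \<le> 1 + \<bar>y\<bar> ^ ?M + \<bar>z\<bar> ^ ?M" unfolding 1 power_one using add_increasing2[OF p(2) add_increasing2[OF p(1) order_refl[of "1::real"]]] .
      next
        case 2
        show "b ^ ?M \<le> 1 + \<bar>y\<bar> ^ ?M + \<bar>z\<bar> ^ ?M" unfolding 2 using add_increasing2[OF p(2) add_increasing[OF zero_le_one order_refl]] .
      next
        case 3
        show "b ^ ?M \<le> 1 + \<bar>y\<bar> ^ ?M + \<bar>z\<bar> ^ ?M" unfolding 3 using add_increasing[OF add_nonneg_nonneg[OF zero_le_one p(1)] order_refl] .
      qed
    qed simp
    finally show ?thesis by (simp add: power_mult[symmetric] mult.commute)
  qed
  have ti: "integrable (gauss n) (\<lambda>x. lin n u x ^ k)" for u k by (intro tame_integrable tame_power tame_lin)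
  have "(\<integral>x. ((1 + \<bar>lin n v x\<bar> + \<bar>lin n w x\<bar>) ^ m) ^ 4 \<partial>gauss n) \<le> (\<integral>x. 3 ^ ?M * (1 + lin n v x ^ ?M + lin n w x ^ ?M) \<partial>gauss n)"
    by (intro integral_mono pw tame_integrable tame_power tame_add tame_abs tame_const tame_lin tame_cmult)
  also have "\<dots> = 3 ^ ?M * (1 + (\<integral>x. lin n v x ^ ?M \<partial>gauss n) + (\<integral>x. lin n w x ^ ?M \<partial>gauss n))"
    using ti G.prob_space by simp
  also have "\<dots> \<le> 3 ^ ?M * (1 + fact ?M + fact ?M)"
    using vw lin_moment[of n v "2 * m"] lin_moment[of n w "2 * m"] by (intro mult_left_mono add_mono) auto
  finally show "(\<integral>x. ((1 + \<bar>lin n v x\<bar> + \<bar>lin n w x\<bar>) ^ m) ^ 4 \<partial>gauss n) \<le> 3 ^ ?M * (1 + fact ?M + fact ?M)" .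
qed

text \<open>One weight serves a polynomial and its first two derivatives. Its exponent is at least 1
  so that it also absorbs the linear form itself.\<close>

lemma poly_derivs_bound:
  fixes p :: "real poly"
  shows "\<exists>A m. A \<ge> 0 \<and> m \<ge> 1 \<and> (\<forall>i\<le>2. (\<forall>y z. \<bar>poly ((pderiv ^^ i) p) z\<bar> \<le> A * (1 + \<bar>y\<bar> + \<bar>z\<bar>) ^ m \<and>
     \<bar>poly ((pderiv ^^ i) p) y - poly ((pderiv ^^ i) p) z\<bar> \<le> A * \<bar>y - z\<bar> * (1 + \<bar>y\<bar> + \<bar>z\<bar>) ^ m))"
proof -
  have "\<forall>i. \<exists>A m. A \<ge> 0 \<and> (\<forall>x. \<bar>poly ((pderiv ^^ i) p) x\<bar> \<le> A * (1 + \<bar>x\<bar>) ^ m) \<and>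
     (\<forall>y z. \<bar>poly ((pderiv ^^ i) p) y - poly ((pderiv ^^ i) p) z\<bar> \<le> A * \<bar>y - z\<bar> * (1 + \<bar>y\<bar> + \<bar>z\<bar>) ^ m)"
    using poly_difference_bound by blast
  then obtain A m where Am: "\<And>i. A i \<ge> 0" "\<And>i x. \<bar>poly ((pderiv ^^ i) p) x\<bar> \<le> A i * (1 + \<bar>x\<bar>) ^ m i"
     "\<And>i y z. \<bar>poly ((pderiv ^^ i) p) y - poly ((pderiv ^^ i) p) z\<bar> \<le> A i * \<bar>y - z\<bar> * (1 + \<bar>y\<bar> + \<bar>z\<bar>) ^ m i"
    by metis
  define A' where "A' = (\<Sum>i\<le>2. A i)"
  define m' where "m' = Suc (\<Sum>i\<le>2. m i)"
  have le: "A i \<le> A'" "m i \<le> m'" if "i \<le> 2" for i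
  proof -
    show "A i \<le> A'" unfolding A'_def using that Am(1) by (intro member_le_sum) auto
    have "m i \<le> (\<Sum>i\<le>2. m i)" using that by (intro member_le_sum) auto
    then show "m i \<le> m'" by (simp add: m'_def)
  qed
  show ?thesis
  proof (intro exI[of _ A'] exI[of _ m'] conjI allI impI)
    show "0 \<le> A'" unfolding A'_def by (intro sum_nonneg Am)
    show "1 \<le> m'" by (simp add: m'_def)
    fix i :: nat and y z :: real assume i: "i \<le> 2"
    have "A i * (1 + \<bar>z\<bar>) ^ m i \<le> A' * (1 + \<bar>y\<bar> + \<bar>z\<bar>) ^ m'"
    proof (rule mult_mono)
      have "(1 + \<bar>z\<bar>) ^ m i \<le> (1 + \<bar>y\<bar> + \<bar>z\<bar>) ^ m i" by (intro power_mono) auto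
      also have "\<dots> \<le> (1 + \<bar>y\<bar> + \<bar>z\<bar>) ^ m'" using le[OF i] by (intro power_increasing) auto
      finally show "(1 + \<bar>z\<bar>) ^ m i \<le> (1 + \<bar>y\<bar> + \<bar>z\<bar>) ^ m'" .
    qed (use le[OF i] Am(1) order_trans[OF Am(1)[of i] le(1)[OF i]] in auto)
    with Am(2)[of i z] show "\<bar>poly ((pderiv ^^ i) p) z\<bar> \<le> A' * (1 + \<bar>y\<bar> + \<bar>z\<bar>) ^ m'" by linarith
    have "A i * \<bar>y - z\<bar> * (1 + \<bar>y\<bar> + \<bar>z\<bar>) ^ m i \<le> A' * \<bar>y - z\<bar> * (1 + \<bar>y\<bar> + \<bar>z\<bar>) ^ m'"
      using le[OF i] order_trans[OF Am(1)[of i] le(1)[OF i]] by (intro mult_mono power_increasing mult_right_mono mult_nonneg_nonneg) auto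
    with Am(3)[of i y z] show "\<bar>poly ((pderiv ^^ i) p) y - poly ((pderiv ^^ i) p) z\<bar> \<le> A' * \<bar>y - z\<bar> * (1 + \<bar>y\<bar> + \<bar>z\<bar>) ^ m'" by linarith
  qed
qed

text \<open>The normalised sum is \<open>F 0 + E 0\<close>, where \<open>F 0\<close> is the term at
  index 0 and \<open>E 0\<close> collects the variation along the sequence and the deviation of the
  constant. The first is of order \<open>sqrt \<gamma>\<close> because \<open>X j - X 0\<close> has
  variance \<open>2 * (1 - \<rho> ^ j) \<le> 2 * \<gamma>\<close>, the second of order
  \<open>\<gamma>\<close>.\<close>

lemma hermite_perturbation_bound:
  assumes q: "q \<ge> 1"
  shows "\<exists>K\<ge>0. \<forall>\<gamma> N n a \<phi> \<phi>' L k. 0 < \<gamma> \<longrightarrow> \<gamma> * q \<le> 1 \<longrightarrow> 0 < N \<longrightarrow>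
    (\<forall>j<N. \<forall>l<N. dot n (a j) (a l) = exp (- \<gamma> / real N) ^ ((j - l) + (l - j))) \<longrightarrow>
    test_function \<phi> \<phi>' L \<longrightarrow> 0 < k \<longrightarrow> k \<le> 1 \<longrightarrow>
    \<bar>(\<integral>x. \<phi> (chaos_const q \<gamma> / N * (\<Sum>j<N. hermite q (lin n (a j) x))) \<partial>gauss n) - (\<integral>z. \<phi> (hermite q z / sqrt (fact q)) \<partial>N01)\<bar>
      \<le> K * sqrt \<gamma> / k + 2 * (\<integral>z. k / ((real q / sqrt (fact q) * hermite (q - 1) z)\<^sup>2 + k) \<partial>N01)"
proof -
  define p where "p = hermite_poly q"
  define pp where "pp i = (pderiv ^^ i) p" for i
  obtain A m where Am: "A \<ge> 0" "m \<ge> 1"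
     "\<And>i y z. i \<le> 2 \<Longrightarrow> \<bar>poly (pp i) z\<bar> \<le> A * (1 + \<bar>y\<bar> + \<bar>z\<bar>) ^ m"
     "\<And>i y z. i \<le> 2 \<Longrightarrow> \<bar>poly (pp i) y - poly (pp i) z\<bar> \<le> A * \<bar>y - z\<bar> * (1 + \<bar>y\<bar> + \<bar>z\<bar>) ^ m"
    using poly_derivs_bound[of p] unfolding pp_def by blast
  obtain C where C: "C \<ge> 0" "\<And>n v w. dot n v v = 1 \<Longrightarrow> dot n w w = 1 \<Longrightarrow>
     (\<integral>x. ((1 + \<bar>lin n v x\<bar> + \<bar>lin n w x\<bar>) ^ m) ^ 4 \<partial>gauss n) \<le> C"
    using growth_fourth_moment[of m] by blast
  \<comment> \<open>\<open>q\<close> is the deviation of the constant per unit of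
    \<open>\<gamma>\<close>; 4 covers \<open>c * (1 - (\<rho> ^ j) ^ i)\<close> with
    \<open>c \<le> 2\<close> and \<open>i \<le> 2\<close>.\<close>
  define b where "b = real q + 4"
  \<comment> \<open>The second moment of \<open>S j\<close> will be at most
    \<open>(4 + 2 * b\<^sup>2) * \<gamma>\<close> and each fourth moment of a weight at most
    \<open>C\<close>; the division by 2 comes from the weighted mean inequality.\<close>
  define K1 where "K1 = (4 + 2 * b\<^sup>2 + C) / 2"
  have K1: "0 \<le> K1" using C by (simp add: K1_def)
  show ?thesis
  \<comment> \<open>\<open>2 + 4 * A\<close> bounds the large factor, \<open>4 * A\<close> adds
    \<open>2 * A\<close> for each of \<open>E 0\<close> and \<open>E 1\<close>, and the leading 2
    stems from \<open>cutoff_comparison\<close>.\<close>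
  proof (intro exI[of _ "2 * ((2 + 4 * A) * (4 * A) * K1)"] conjI allI impI)
    show "0 \<le> 2 * ((2 + 4 * A) * (4 * A) * K1)" using Am K1 by simp
    fix \<gamma> :: real and N n :: nat and a :: "nat \<Rightarrow> nat \<Rightarrow> real" and \<phi> \<phi>' :: "real \<Rightarrow> real" and L k :: real
    assume \<gamma>: "0 < \<gamma>" "\<gamma> * q \<le> 1" and N: "0 < N"
      and gram: "\<forall>j<N. \<forall>l<N. dot n (a j) (a l) = exp (- \<gamma> / real N) ^ ((j - l) + (l - j))"
      and \<phi>: "test_function \<phi> \<phi>' L" and k: "0 < k" "k \<le> 1"
    interpret G: prob_space "gauss n" by (rule prob_space_gauss)
    define \<rho> where "\<rho> = exp (- \<gamma> / real N)"
    define c where "c = chaos_const q \<gamma>"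
    define c0 where "c0 = 1 / sqrt (fact q)"
    have c: "\<bar>c - c0\<bar> \<le> q * \<gamma>" "c \<le> 2" "0 \<le> c"
      unfolding c_def c0_def using chaos_const_small[OF q \<gamma>] chaos_const_square(2)[OF \<gamma>(1) q] by auto
    have c0: "0 < c0" "c0 \<le> 1" unfolding c0_def by (simp_all add: fact_ge_1)
    have g1: "\<gamma> \<le> 1"
    proof -
      have "\<gamma> * 1 \<le> \<gamma> * q" using \<gamma> q by (intro mult_left_mono) auto
      then show ?thesis using \<gamma> by linarith
    qed
    have \<rho>01: "0 < \<rho>" "\<rho> < 1" using \<gamma> N by (simp_all add: \<rho>_def)
    have \<rho>j: "1 - \<rho> ^ j \<le> \<gamma>" if "j < N" for j
    proof -
      have "\<rho> ^ j = exp (real j * (- \<gamma> / real N))" unfolding \<rho>_def by (rule exp_of_nat_mult[symmetric])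
      then have "1 - \<rho> ^ j \<le> real j / real N * \<gamma>" using exp_ge_add_one_self[of "real j * (- \<gamma> / real N)"] by simp
      also have "\<dots> \<le> 1 * \<gamma>" using that \<gamma> by (intro mult_right_mono) (auto simp: divide_le_eq)
      finally show ?thesis by simp
    qed
    have d1: "dot n (a j) (a j) = 1" if "j < N" for j using gram that by auto
    have d0: "dot n (a 0) (a j) = \<rho> ^ j" if "j < N" for j using gram that N by (auto simp: \<rho>_def)
    let ?X = "\<lambda>j x. lin n (a j) x"
    \<comment> \<open>\<open>E i\<close> is the \<open>i\<close>-th derivative of the perturbation
      along \<open>a 0\<close>. Each differentiation of a function of \<open>X j\<close> brings a
      factor \<open>dot n (a 0) (a j) = \<rho> ^ j\<close>, so all derivatives keep the form of an
      average minus its initial term.\<close>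
    define E where "E i x = c / N * (\<Sum>j<N. (\<rho> ^ j) ^ i * poly (pp i) (?X j x)) - c0 * poly (pp i) (?X 0 x)" for i x
    define dE where "dE i l x = c / N * (\<Sum>j<N. (\<rho> ^ j) ^ i * (poly (pderiv (pp i)) (?X j x) * a j l)) + - c0 * (poly (pderiv (pp i)) (?X 0 x) * a 0 l)" for i l x
    have sE: "gsmooth n (E i) (dE i)" for i
    proof -
      have "gsmooth n (\<lambda>x. c / N * (\<Sum>j<N. (\<rho> ^ j) ^ i * poly (pp i) (?X j x)) + - c0 * poly (pp i) (?X 0 x)) (dE i)"
        unfolding dE_def by (intro gsmooth_add gsmooth_cmult gsmooth_sum gsmooth_poly)
      then show ?thesis by (simp add: E_def[abs_def])
    qed
    have pp_Suc: "pderiv (pp i) = pp (Suc i)" for i by (simp add: pp_def)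
    have ddE: "dderiv n (a 0) (dE i) x = E (Suc i) x" for i x
    proof -
      have "dderiv n (a 0) (dE i) x = c / N * (\<Sum>j<N. (\<rho> ^ j) ^ i * (poly (pderiv (pp i)) (?X j x) * dot n (a 0) (a j))) + - c0 * (poly (pderiv (pp i)) (?X 0 x) * dot n (a 0) (a 0))"
        unfolding dE_def
          dderiv_add[of n "a 0" "\<lambda>l x. c / N * (\<Sum>j<N. (\<rho> ^ j) ^ i * (poly (pderiv (pp i)) (?X j x) * a j l))" "\<lambda>l x. - c0 * (poly (pderiv (pp i)) (?X 0 x) * a 0 l)"]
          dderiv_cmult[of n "a 0" "c / N" "\<lambda>l x. \<Sum>j<N. (\<rho> ^ j) ^ i * (poly (pderiv (pp i)) (?X j x) * a j l)"]
          dderiv_cmult[of n "a 0" "- c0" "\<lambda>l x. poly (pderiv (pp i)) (?X 0 x) * a 0 l"]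
          dderiv_sum[where n=n and v="a 0" and J="{..<N}" and dF="\<lambda>j l x. (\<rho> ^ j) ^ i * (poly (pderiv (pp i)) (?X j x) * a j l)"]
          dderiv_cmult[of n "a 0" "(\<rho> ^ j) ^ i" "\<lambda>l x. poly (pderiv (pp i)) (?X j x) * a j l" for j] dderiv_poly ..
      also have "\<dots> = E (Suc i) x"
        unfolding E_def pp_Suc using d0 d1[OF N] by (simp add: mult_ac)
      finally show ?thesis .
    qed
    define F where "F i x = c0 * poly (pp i) (?X 0 x)" for i x
    have sF: "gsmooth n (F i) (\<lambda>l x. c0 * (poly (pderiv (pp i)) (?X 0 x) * a 0 l))" for i
      unfolding F_def by (intro gsmooth_cmult gsmooth_poly)
    have ddF: "dderiv n (a 0) (\<lambda>l x. c0 * (poly (pderiv (pp i)) (?X 0 x) * a 0 l)) x = F (Suc i) x" for i x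
      unfolding pp_Suc dderiv_cmult[of n "a 0" c0 "\<lambda>l x. poly (pp (Suc i)) (?X 0 x) * a 0 l"] dderiv_poly F_def
      using d1[OF N] by simp
    have cmp: "\<bar>(\<integral>x. \<phi> (F 0 x + E 0 x) \<partial>gauss n) - (\<integral>x. \<phi> (F 0 x) \<partial>gauss n)\<bar>
      \<le> 2 / k * (\<integral>x. (\<bar>?X 0 x\<bar> + 2 + \<bar>F 2 x\<bar> + \<bar>E 2 x\<bar>) * (\<bar>E 0 x\<bar> + \<bar>E 1 x\<bar>) \<partial>gauss n)
        + 2 * (\<integral>x. k / ((F 1 x)\<^sup>2 + k) \<partial>gauss n)"
      by (rule cutoff_comparison[OF \<phi> k sF[of 0] sF[of 1] _ _ sE[of 0] sE[of 1]])
        (simp_all add: ddF ddE numeral_2_eq_2)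
    \<comment> \<open>\<open>Q\<close> is the weight that dominates the polynomials and their
      derivatives; \<open>S\<close> is the small factor, an increment of the sequence plus the error
      of the coefficients.\<close>
    define Q where "Q j x = (1 + \<bar>?X j x\<bar> + \<bar>?X 0 x\<bar>) ^ m" for j x
    define S where "S j x = \<bar>?X j x - ?X 0 x\<bar> + b * \<gamma>" for j x
    have Q1: "1 \<le> Q j x" for j x unfolding Q_def by (intro one_le_power) auto
    have Qb: "1 + \<bar>?X 0 x\<bar> \<le> Q j x" for j x
    proof -
      have "1 + \<bar>?X 0 x\<bar> \<le> (1 + \<bar>?X j x\<bar> + \<bar>?X 0 x\<bar>) ^ 1" by simp
      also have "\<dots> \<le> Q j x" unfolding Q_def using Am(2) by (intro power_increasing) auto
      finally show ?thesis .
    qed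
    have S0: "0 \<le> S j x" for j x unfolding S_def b_def using \<gamma> by (intro add_nonneg_nonneg mult_nonneg_nonneg) auto
    have tQ: "tame n (Q j)" and tS: "tame n (S j)" for j
      unfolding Q_def[abs_def] S_def[abs_def]
      by (intro tame_power tame_add tame_abs tame_const tame_lin tame_diff)+
    have Eavg: "E i x = (\<Sum>j<N. c * (\<rho> ^ j) ^ i * poly (pp i) (?X j x) - c0 * poly (pp i) (?X 0 x)) / N" for i x
      using N unfolding E_def sum_subtractf by (simp add: sum_distrib_left sum_divide_distrib[symmetric] diff_divide_distrib mult_ac)
    have Ebound: "\<bar>E i x\<bar> \<le> (\<Sum>j<N. B j) / N"
      if "\<And>j. j < N \<Longrightarrow> \<bar>c * (\<rho> ^ j) ^ i * poly (pp i) (?X j x) - c0 * poly (pp i) (?X 0 x)\<bar> \<le> B j" for i x B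
    proof -
      have "\<bar>E i x\<bar> = \<bar>\<Sum>j<N. c * (\<rho> ^ j) ^ i * poly (pp i) (?X j x) - c0 * poly (pp i) (?X 0 x)\<bar> / N"
        unfolding Eavg by simp
      also have "\<dots> \<le> (\<Sum>j<N. B j) / N"
        by (intro divide_right_mono order_trans[OF sum_abs] sum_mono that) auto
      finally show ?thesis .
    qed
    have cr: "\<bar>c * (\<rho> ^ j) ^ i\<bar> \<le> 2" "\<bar>c * (\<rho> ^ j) ^ i - c0\<bar> \<le> b * \<gamma>" if "j < N" "i \<le> 2" for i j
    proof -
      have r: "0 \<le> (\<rho> ^ j) ^ i" "(\<rho> ^ j) ^ i \<le> 1" using \<rho>01 by (auto intro!: power_le_one)
      have "c * (\<rho> ^ j) ^ i \<le> 2 * 1" using c r by (intro mult_mono) auto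
      then show "\<bar>c * (\<rho> ^ j) ^ i\<bar> \<le> 2" using c r by (simp add: abs_mult)
      have rj: "0 \<le> \<rho> ^ j" "\<rho> ^ j \<le> 1" using \<rho>01 by (auto intro!: power_le_one)
      have "1 - (\<rho> ^ j) ^ i \<le> 2 * \<gamma>"
      proof -
        consider "i = 0" | "i = 1" | "i = 2" using \<open>i \<le> 2\<close> by linarith
        then show ?thesis
        proof cases
          case 3
          have "1 - (\<rho> ^ j) ^ i = (1 - \<rho> ^ j) * (1 + \<rho> ^ j)" unfolding 3 by (simp add: power2_eq_square algebra_simps)
          also have "\<dots> \<le> \<gamma> * 2" using \<rho>j[OF \<open>j < N\<close>] rj \<gamma> by (intro mult_mono) auto
          finally show ?thesis by simp
        qed (use \<rho>j[OF \<open>j < N\<close>] \<gamma> in auto)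
      qed
      then have "c * (1 - (\<rho> ^ j) ^ i) \<le> 2 * (2 * \<gamma>)" using c r by (intro mult_mono) auto
      moreover have "0 \<le> c * (1 - (\<rho> ^ j) ^ i)" using c r by simp
      ultimately show "\<bar>c * (\<rho> ^ j) ^ i - c0\<bar> \<le> b * \<gamma>"
        using c(1) unfolding b_def by (simp add: algebra_simps)
    qed
    have E01: "\<bar>E i x\<bar> \<le> 2 * A * ((\<Sum>j<N. S j x * Q j x) / N)" if "i \<le> 2" for i x
    proof -
      have "\<bar>E i x\<bar> \<le> (\<Sum>j<N. 2 * A * (S j x * Q j x)) / N"
      proof (rule Ebound)
        fix j assume j: "j < N"
        let ?\<alpha> = "c * (\<rho> ^ j) ^ i" and ?y = "poly (pp i) (?X j x)" and ?z = "poly (pp i) (?X 0 x)"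
        have z: "\<bar>?z\<bar> \<le> A * Q j x" using Am(3)[OF that, of "?X 0 x" "?X j x"] by (simp add: Q_def)
        have yz: "\<bar>?y - ?z\<bar> \<le> A * \<bar>?X j x - ?X 0 x\<bar> * Q j x"
          using Am(4)[OF that, of "?X j x" "?X 0 x"] by (simp add: Q_def)
        have "?\<alpha> * ?y - c0 * ?z = ?\<alpha> * (?y - ?z) + (?\<alpha> - c0) * ?z" by (simp add: algebra_simps)
        also have "\<bar>\<dots>\<bar> \<le> \<bar>?\<alpha>\<bar> * \<bar>?y - ?z\<bar> + \<bar>?\<alpha> - c0\<bar> * \<bar>?z\<bar>"
          unfolding abs_mult[symmetric] by (rule abs_triangle_ineq)
        also have "\<dots> \<le> 2 * (A * \<bar>?X j x - ?X 0 x\<bar> * Q j x) + b * \<gamma> * (A * Q j x)"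
          using cr[OF j that] z yz Am(1) by (intro add_mono mult_mono) (auto simp: b_def \<gamma>(1) less_imp_le)
        also have "\<dots> \<le> 2 * (A * \<bar>?X j x - ?X 0 x\<bar> * Q j x) + 2 * (b * \<gamma> * (A * Q j x))"
        proof -
          have "0 \<le> b * \<gamma> * (A * Q j x)" using Am(1) Q1[of j x] \<gamma> by (auto simp: b_def)
          then show ?thesis by linarith
        qed
        also have "\<dots> = 2 * A * (S j x * Q j x)" by (simp add: S_def algebra_simps)
        finally show "\<bar>?\<alpha> * ?y - c0 * ?z\<bar> \<le> 2 * A * (S j x * Q j x)" .
      qed
      then show ?thesis by (simp add: sum_distrib_left[symmetric])
    qed
    have W: "\<bar>?X 0 x\<bar> + 2 + \<bar>F 2 x\<bar> + \<bar>E 2 x\<bar> \<le> (2 + 4 * A) * ((\<Sum>l<N. Q l x) / N)" for x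
    proof -
      \<comment> \<open>The second derivative only has to be bounded, as it multiplies the small
        factor \<open>\<bar>E 0 x\<bar> + \<bar>E 1 x\<bar>\<close>. The 3 adds the coefficient
        bounds 2 and 1 of its two terms.\<close>
      have "\<bar>E 2 x\<bar> \<le> (\<Sum>j<N. 3 * A * Q j x) / N"
      proof (rule Ebound)
        fix j assume j: "j < N"
        let ?\<alpha> = "c * (\<rho> ^ j) ^ 2" and ?y = "poly (pp 2) (?X j x)" and ?z = "poly (pp 2) (?X 0 x)"
        have "\<bar>?y\<bar> \<le> A * Q j x" "\<bar>?z\<bar> \<le> A * Q j x"
          using Am(3)[of 2 "?X j x" "?X 0 x"] Am(3)[of 2 "?X 0 x" "?X j x"] by (simp_all add: Q_def add_ac)
        then have "\<bar>?\<alpha>\<bar> * \<bar>?y\<bar> + \<bar>c0\<bar> * \<bar>?z\<bar> \<le> 2 * (A * Q j x) + 1 * (A * Q j x)"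
          using cr(1)[OF j, of 2] c0 Am(1) Q1[of j x] by (intro add_mono mult_mono) auto
        moreover have "\<bar>?\<alpha> * ?y - c0 * ?z\<bar> \<le> \<bar>?\<alpha>\<bar> * \<bar>?y\<bar> + \<bar>c0\<bar> * \<bar>?z\<bar>"
          unfolding abs_mult[symmetric] by (rule abs_triangle_ineq4)
        ultimately show "\<bar>?\<alpha> * ?y - c0 * ?z\<bar> \<le> 3 * A * Q j x" by simp
      qed
      moreover have "\<bar>?X 0 x\<bar> + 2 + \<bar>F 2 x\<bar> \<le> (\<Sum>j<N. (2 + A) * Q j x) / N"
      proof -
        have "\<bar>?X 0 x\<bar> + 2 + \<bar>F 2 x\<bar> \<le> (2 + A) * Q j x" for j
        proof -
          have "\<bar>poly (pp 2) (?X 0 x)\<bar> \<le> A * Q j x"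
            using Am(3)[of 2 "?X 0 x" "?X j x"] by (simp add: Q_def)
          then have "c0 * \<bar>poly (pp 2) (?X 0 x)\<bar> \<le> 1 * (A * Q j x)" using c0 by (intro mult_mono) auto
          then have "\<bar>F 2 x\<bar> \<le> A * Q j x" using c0 by (simp add: F_def abs_mult)
          then show ?thesis using Qb[of x j] Q1[of j x] by (simp add: algebra_simps)
        qed
        then have "(\<Sum>j<N. \<bar>?X 0 x\<bar> + 2 + \<bar>F 2 x\<bar>) / N \<le> (\<Sum>j<N. (2 + A) * Q j x) / N"
          by (intro divide_right_mono sum_mono) auto
        then show ?thesis using N by simp
      qed
      ultimately have "\<bar>?X 0 x\<bar> + 2 + \<bar>F 2 x\<bar> + \<bar>E 2 x\<bar> \<le> (2 + A) * ((\<Sum>l<N. Q l x) / N) + 3 * A * ((\<Sum>l<N. Q l x) / N)"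
        unfolding sum_distrib_left[symmetric] times_divide_eq_right by linarith
      also have "\<dots> = (2 + 4 * A) * ((\<Sum>l<N. Q l x) / N)" unfolding distrib_right[symmetric] by simp
      finally show ?thesis .
    qed
    have tE: "tame n (E i)" "tame n (F i)" for i using gsmooth_tame(1)[OF sE] gsmooth_tame(1)[OF sF] by blast+
    have SQQ: "(\<integral>x. S j x * Q j x * Q l x \<partial>gauss n) \<le> K1 * sqrt \<gamma>" if j: "j < N" and l: "l < N" for j l
    proof -
      \<comment> \<open>The weight that splits one small and two large factors into
        \<open>1 / (2 * s) * (S j x)\<^sup>2\<close> and fourth powers times \<open>s / 4\<close>.
        The mean of \<open>(S j x)\<^sup>2\<close> is of order \<open>s * s\<close>, so every term
        is of order \<open>s\<close>.\<close>
      define s where "s = sqrt \<gamma>"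
      have s: "0 < s" "s * s = \<gamma>" using \<gamma> by (simp_all add: s_def)
      have ES: "(\<integral>x. (S j x)\<^sup>2 \<partial>gauss n) \<le> (4 + 2 * b\<^sup>2) * \<gamma>"
      proof -
        have i: "integrable (gauss n) (\<lambda>x. ?X u x * ?X v x)" for u v by (intro tame_integrable tame_mult tame_lin)
        have "(\<integral>x. (S j x)\<^sup>2 \<partial>gauss n) \<le> (\<integral>x. 2 * (?X j x * ?X j x - 2 * (?X j x * ?X 0 x) + ?X 0 x * ?X 0 x) + 2 * (b * \<gamma>)\<^sup>2 \<partial>gauss n)"
        proof (rule integral_mono)
          show "integrable (gauss n) (\<lambda>x. (S j x)\<^sup>2)" by (intro tame_integrable tame_power tS)
          show "integrable (gauss n) (\<lambda>x. 2 * (?X j x * ?X j x - 2 * (?X j x * ?X 0 x) + ?X 0 x * ?X 0 x) + 2 * (b * \<gamma>)\<^sup>2)"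
            using i by simp
          fix x
          have "(u + v)\<^sup>2 \<le> 2 * u\<^sup>2 + 2 * v\<^sup>2" for u v :: real
            using zero_le_power2[of "u - v"] by (simp add: power2_eq_square algebra_simps)
          from this[of "\<bar>?X j x - ?X 0 x\<bar>" "b * \<gamma>"]
          show "(S j x)\<^sup>2 \<le> 2 * (?X j x * ?X j x - 2 * (?X j x * ?X 0 x) + ?X 0 x * ?X 0 x) + 2 * (b * \<gamma>)\<^sup>2"
            unfolding S_def by (simp add: power2_diff power2_eq_square[of "?X _ _"] mult_ac)
        qed
        also have "\<dots> = 2 * (1 - 2 * \<rho> ^ j + 1) + 2 * (b * \<gamma>)\<^sup>2"
          using i G.prob_space expectation_lin_lin[OF d1[OF j] d1[OF j]] expectation_lin_lin[OF d1[OF N] d1[OF N]]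
            expectation_lin_lin[OF d1[OF j] d1[OF N]] d1[OF j] d1[OF N] d0[OF j] dot_commute[of n "a j" "a 0"] by simp
        also have "\<dots> \<le> 4 * \<gamma> + 2 * (b\<^sup>2 * \<gamma>)"
        proof (rule add_mono)
          show "2 * (1 - 2 * \<rho> ^ j + 1) \<le> 4 * \<gamma>" using \<rho>j[OF j] by simp
          have "\<gamma>\<^sup>2 \<le> \<gamma>" using \<gamma> g1 by (simp add: power2_eq_square mult_left_le)
          then show "2 * (b * \<gamma>)\<^sup>2 \<le> 2 * (b\<^sup>2 * \<gamma>)" unfolding power_mult_distrib by (intro mult_left_mono) auto
        qed
        finally show ?thesis by (simp add: algebra_simps)
      qed
      have EQ: "(\<integral>x. Q i x ^ 4 \<partial>gauss n) \<le> C" if "i < N" for i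
        unfolding Q_def by (rule C(2)[OF d1[OF that] d1[OF N]])
      have i4: "integrable (gauss n) (\<lambda>x. Q i x ^ 4)" "integrable (gauss n) (\<lambda>x. (S j x)\<^sup>2)" for i
        by (intro tame_integrable tame_power tQ tS)+
      have "(\<integral>x. S j x * Q j x * Q l x \<partial>gauss n) \<le> (\<integral>x. 1 / (2 * s) * (S j x)\<^sup>2 + s / 4 * (Q j x ^ 4 + Q l x ^ 4) \<partial>gauss n)"
      proof (rule integral_mono)
        show "integrable (gauss n) (\<lambda>x. S j x * Q j x * Q l x)" by (intro tame_integrable tame_mult tQ tS)
        show "integrable (gauss n) (\<lambda>x. 1 / (2 * s) * (S j x)\<^sup>2 + s / 4 * (Q j x ^ 4 + Q l x ^ 4))" using i4 by simp
        fix x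
        have ineq: "u * v * w \<le> 1 / (2 * s) * u\<^sup>2 + s / 4 * (v ^ 4 + w ^ 4)" for u v w :: real
        proof -
          have "0 \<le> (u - s * (v * w))\<^sup>2 / (2 * s)" using s by simp
          also have "\<dots> = 1 / (2 * s) * u\<^sup>2 + s / 2 * (v * w)\<^sup>2 - u * v * w"
            using s(1) by (simp add: power2_eq_square field_simps)
          finally have 1: "u * v * w \<le> 1 / (2 * s) * u\<^sup>2 + s / 2 * (v * w)\<^sup>2" by simp
          have "(v * w)\<^sup>2 \<le> (v ^ 4 + w ^ 4) / 2"
            using zero_le_power2[of "v\<^sup>2 - w\<^sup>2"] by (simp add: power2_eq_square power4_eq_xxxx algebra_simps)
          then have "s / 2 * (v * w)\<^sup>2 \<le> s / 2 * ((v ^ 4 + w ^ 4) / 2)" using s by (intro mult_left_mono) auto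
          with 1 show ?thesis by simp
        qed
        show "S j x * Q j x * Q l x \<le> 1 / (2 * s) * (S j x)\<^sup>2 + s / 4 * (Q j x ^ 4 + Q l x ^ 4)" by (rule ineq)
      qed
      also have "\<dots> = 1 / (2 * s) * (\<integral>x. (S j x)\<^sup>2 \<partial>gauss n) + s / 4 * ((\<integral>x. Q j x ^ 4 \<partial>gauss n) + (\<integral>x. Q l x ^ 4 \<partial>gauss n))"
        using i4 by simp
      also have "\<dots> \<le> 1 / (2 * s) * ((4 + 2 * b\<^sup>2) * \<gamma>) + s / 4 * (C + C)"
        using s ES EQ[OF j] EQ[OF l] by (intro add_mono mult_left_mono) auto
      also have "\<dots> = K1 * s" using s(1) unfolding s(2)[symmetric] K1_def by (simp add: field_simps)
      finally show ?thesis by (simp add: s_def)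
    qed
    have mainB: "(\<integral>x. (\<bar>?X 0 x\<bar> + 2 + \<bar>F 2 x\<bar> + \<bar>E 2 x\<bar>) * (\<bar>E 0 x\<bar> + \<bar>E 1 x\<bar>) \<partial>gauss n) \<le> (2 + 4 * A) * (4 * A) * K1 * sqrt \<gamma>"
    proof -
      let ?K = "(2 + 4 * A) * (4 * A) / (real N)\<^sup>2"
      have "(\<integral>x. (\<bar>?X 0 x\<bar> + 2 + \<bar>F 2 x\<bar> + \<bar>E 2 x\<bar>) * (\<bar>E 0 x\<bar> + \<bar>E 1 x\<bar>) \<partial>gauss n)
         \<le> (\<integral>x. (\<Sum>l<N. \<Sum>j<N. ?K * (S j x * Q j x * Q l x)) \<partial>gauss n)"
      proof (rule integral_mono)
        show "integrable (gauss n) (\<lambda>x. (\<bar>?X 0 x\<bar> + 2 + \<bar>F 2 x\<bar> + \<bar>E 2 x\<bar>) * (\<bar>E 0 x\<bar> + \<bar>E 1 x\<bar>))"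
          by (intro tame_integrable tame_mult tame_add tame_abs tame_lin tame_const tE)
        show "integrable (gauss n) (\<lambda>x. \<Sum>l<N. \<Sum>j<N. ?K * (S j x * Q j x * Q l x))"
          by (intro tame_integrable tame_sum tame_cmult tame_mult tQ tS)
        fix x
        have "\<bar>E 0 x\<bar> + \<bar>E 1 x\<bar> \<le> 4 * A * ((\<Sum>j<N. S j x * Q j x) / N)"
          using E01[of 0 x] E01[of 1 x] by simp
        then have "(\<bar>?X 0 x\<bar> + 2 + \<bar>F 2 x\<bar> + \<bar>E 2 x\<bar>) * (\<bar>E 0 x\<bar> + \<bar>E 1 x\<bar>) \<le>
          ((2 + 4 * A) * ((\<Sum>l<N. Q l x) / N)) * (4 * A * ((\<Sum>j<N. S j x * Q j x) / N))"
          using W[of x] Am(1) Q1 by (intro mult_mono) (auto intro!: mult_nonneg_nonneg divide_nonneg_nonneg sum_nonneg order_trans[OF zero_le_one Q1])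
        also have "\<dots> = ?K * ((\<Sum>l<N. Q l x) * (\<Sum>j<N. S j x * Q j x))" by (simp add: power2_eq_square)
        also have "\<dots> = ?K * (\<Sum>l<N. \<Sum>j<N. Q l x * (S j x * Q j x))" by (simp only: sum_product)
        also have "\<dots> = (\<Sum>l<N. \<Sum>j<N. ?K * (Q l x * (S j x * Q j x)))" by (simp only: sum_distrib_left)
        also have "\<dots> = (\<Sum>l<N. \<Sum>j<N. ?K * (S j x * Q j x * Q l x))"
          by (intro sum.cong refl) (simp only: mult_ac)
        finally show "(\<bar>?X 0 x\<bar> + 2 + \<bar>F 2 x\<bar> + \<bar>E 2 x\<bar>) * (\<bar>E 0 x\<bar> + \<bar>E 1 x\<bar>) \<le> (\<Sum>l<N. \<Sum>j<N. ?K * (S j x * Q j x * Q l x))" .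
      qed
      also have "\<dots> = (\<Sum>l<N. \<Sum>j<N. ?K * (\<integral>x. S j x * Q j x * Q l x \<partial>gauss n))"
        by (intro integral_sum_sum tame_integrable tame_mult tQ tS)
      also have "\<dots> \<le> (\<Sum>l<N. \<Sum>j<N. ?K * (K1 * sqrt \<gamma>))"
        using SQQ Am(1) by (intro sum_mono mult_left_mono) auto
      also have "\<dots> = (2 + 4 * A) * (4 * A) * K1 * sqrt \<gamma>" using N by (simp add: power2_eq_square)
      finally show ?thesis .
    qed
    have FE: "F 0 x + E 0 x = chaos_const q \<gamma> / N * (\<Sum>j<N. hermite q (lin n (a j) x))" for x
      by (simp add: F_def E_def pp_def p_def hermite_def c_def)
    have [measurable]: "\<phi> \<in> borel_measurable borel" using test_function_measurable(1)[OF \<phi>] .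
    have F0: "(\<integral>x. \<phi> (F 0 x) \<partial>gauss n) = (\<integral>z. \<phi> (hermite q z / sqrt (fact q)) \<partial>N01)"
    proof -
      have "F 0 x = hermite q (?X 0 x) / sqrt (fact q)" for x by (simp add: F_def pp_def p_def hermite_def c0_def)
      then show ?thesis
        using expectation_lin[OF d1[OF N], of "\<lambda>z. \<phi> (hermite q z / sqrt (fact q))"] by simp
    qed
    have F1: "(\<integral>x. k / ((F 1 x)\<^sup>2 + k) \<partial>gauss n) = (\<integral>z. k / ((real q / sqrt (fact q) * hermite (q - 1) z)\<^sup>2 + k) \<partial>N01)"
    proof -
      obtain q' where q': "q = Suc q'" using q by (cases q) auto
      have "F 1 x = real q / sqrt (fact q) * hermite (q - 1) (?X 0 x)" for x
        unfolding F_def pp_def p_def q' hermite_def c0_def by (simp add: hermite_poly_pderiv del: hermite_poly.simps)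
      then show ?thesis
        using expectation_lin[OF d1[OF N], of "\<lambda>z. k / ((real q / sqrt (fact q) * hermite (q - 1) z)\<^sup>2 + k)"] by simp
    qed
    have "2 / k * (\<integral>x. (\<bar>?X 0 x\<bar> + 2 + \<bar>F 2 x\<bar> + \<bar>E 2 x\<bar>) * (\<bar>E 0 x\<bar> + \<bar>E 1 x\<bar>) \<partial>gauss n) \<le> 2 / k * ((2 + 4 * A) * (4 * A) * K1 * sqrt \<gamma>)"
      using mainB k by (intro mult_left_mono) auto
    also have "\<dots> = 2 * ((2 + 4 * A) * (4 * A) * K1) * sqrt \<gamma> / k" by simp
    finally show "\<bar>(\<integral>x. \<phi> (chaos_const q \<gamma> / N * (\<Sum>j<N. hermite q (lin n (a j) x))) \<partial>gauss n) - (\<integral>z. \<phi> (hermite q z / sqrt (fact q)) \<partial>N01)\<bar>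
      \<le> 2 * ((2 + 4 * A) * (4 * A) * K1) * sqrt \<gamma> / k + 2 * (\<integral>z. k / ((real q / sqrt (fact q) * hermite (q - 1) z)\<^sup>2 + k) \<partial>N01)"
      using cmp unfolding FE F0 F1 by linarith
  qed
qed

section \<open>Rates of convergence\<close>

text \<open>Two errors compete: the interpolation error \<open>sqrt \<gamma> / k\<close> grows as
  the cut-off shrinks, while the loss near the critical points grows with \<open>k\<close>. A radius
  \<open>r\<close> splits that loss into a sublevel measure of order \<open>r\<close> and a
  remainder, and \<open>r\<close>, \<open>k\<close> are chosen so that all contributions
  agree.\<close>

lemma hermite_regime_bound:
  assumes q: "q \<ge> 1"
  shows "\<exists>K\<ge>0. \<forall>\<gamma> N n a \<phi> \<phi>' L. 0 < \<gamma> \<longrightarrow> \<gamma> * real q \<le> 1 \<longrightarrow> 0 < N \<longrightarrow>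
    (\<forall>j<N. \<forall>l<N. dot n (a j) (a l) = exp (- \<gamma> / real N) ^ ((j - l) + (l - j))) \<longrightarrow>
    test_function \<phi> \<phi>' L \<longrightarrow>
    \<bar>(\<integral>x. \<phi> (chaos_const q \<gamma> / N * (\<Sum>j<N. hermite q (lin n (a j) x))) \<partial>gauss n) - (\<integral>z. \<phi> (hermite q z / sqrt (fact q)) \<partial>N01)\<bar>
      \<le> K * \<gamma> powr (1 / (4 * real q))"
proof -
  obtain K where K: "K \<ge> 0" "\<And>\<gamma> N n a \<phi> \<phi>' L k. 0 < \<gamma> \<Longrightarrow> \<gamma> * real q \<le> 1 \<Longrightarrow> 0 < N \<Longrightarrow>
    (\<forall>j<N. \<forall>l<N. dot n (a j) (a l) = exp (- \<gamma> / real N) ^ ((j - l) + (l - j))) \<Longrightarrow>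
    test_function \<phi> \<phi>' L \<Longrightarrow> 0 < k \<Longrightarrow> k \<le> 1 \<Longrightarrow>
    \<bar>(\<integral>x. \<phi> (chaos_const q \<gamma> / N * (\<Sum>j<N. hermite q (lin n (a j) x))) \<partial>gauss n) - (\<integral>z. \<phi> (hermite q z / sqrt (fact q)) \<partial>N01)\<bar>
      \<le> K * sqrt \<gamma> / k + 2 * (\<integral>z. k / ((real q / sqrt (fact q) * hermite (q - 1) z)\<^sup>2 + k) \<partial>N01)"
    using hermite_perturbation_bound[OF q] by blast
  define c where "c = real q / sqrt (fact q)"
  have c: "c > 0" using q by (simp add: c_def)
  show ?thesis
  proof (intro exI[of _ "K + 2 * (2 * real (q - 1) + 1 / c\<^sup>2)"] conjI allI impI)
    show "0 \<le> K + 2 * (2 * real (q - 1) + 1 / c\<^sup>2)" using K(1) by simp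
    fix \<gamma> :: real and N n :: nat and a :: "nat \<Rightarrow> nat \<Rightarrow> real" and \<phi> \<phi>' :: "real \<Rightarrow> real" and L :: real
    assume \<gamma>: "0 < \<gamma>" "\<gamma> * real q \<le> 1" and N: "0 < N"
      and gram: "\<forall>j<N. \<forall>l<N. dot n (a j) (a l) = exp (- \<gamma> / real N) ^ ((j - l) + (l - j))"
      and \<phi>: "test_function \<phi> \<phi>' L"
    have g1: "\<gamma> \<le> 1"
    proof -
      have "\<gamma> * 1 \<le> \<gamma> * q" using \<gamma> q by (intro mult_left_mono) auto
      then show ?thesis using \<gamma> by linarith
    qed
    define r where "r = \<gamma> powr (1 / (4 * real q))"
    have r: "0 < r" using \<gamma> by (simp add: r_def)
    have r1: "r \<le> 1" unfolding r_def using \<gamma> g1 by (intro powr_le1) auto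
    have rs: "r ^ (2 * q) = sqrt \<gamma>"
    proof -
      have "r ^ (2 * q) = r powr real (2 * q)" by (rule powr_realpow[OF r, symmetric])
      also have "\<dots> = \<gamma> powr (1 / 2)" unfolding r_def powr_powr using q by simp
      finally show ?thesis using \<gamma> by (simp add: powr_half_sqrt)
    qed
    \<comment> \<open>The exponent is one below that of \<open>sqrt \<gamma> = r ^ (2 * q)\<close>
      and one above that of the squared sublevel threshold \<open>r ^ (2 * (q - 1))\<close>, so both
      quotients equal \<open>r\<close>.\<close>
    define k where "k = r ^ (2 * q - 1)"
    have k: "0 < k" "k \<le> 1" using r r1 by (simp_all add: k_def power_le_one)
    have rk: "sqrt \<gamma> / k = r"
    proof -
      have "r ^ (2 * q) = r * k" unfolding k_def using q by (metis One_nat_def Suc_pred mult_pos_pos not_less_eq_eq not_one_le_zero pos2 power_Suc le_eq_less_or_eq less_eq_Suc_le)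
      then show ?thesis using k rs by simp
    qed
    have "(\<integral>z. k / ((c * hermite (q - 1) z)\<^sup>2 + k) \<partial>N01) = (\<integral>z. (sqrt k)\<^sup>2 / ((c * hermite (q - 1) z)\<^sup>2 + (sqrt k)\<^sup>2) \<partial>N01)"
      using k by simp
    also have "\<dots> \<le> 2 * real (q - 1) * r + (sqrt k)\<^sup>2 / (c\<^sup>2 * r ^ (2 * (q - 1)))"
      by (rule expectation_small_derivative[OF r c])
    also have "(sqrt k)\<^sup>2 / (c\<^sup>2 * r ^ (2 * (q - 1))) = 1 / c\<^sup>2 * r"
    proof -
      have "2 * q - 1 = Suc (2 * (q - 1))" using q by auto
      then have "k = r * r ^ (2 * (q - 1))" by (simp add: k_def)
      then show ?thesis using k r c by simp
    qed
    finally have small: "(\<integral>z. k / ((c * hermite (q - 1) z)\<^sup>2 + k) \<partial>N01) \<le> (2 * real (q - 1) + 1 / c\<^sup>2) * r"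
      by (simp add: algebra_simps)
    have "\<bar>(\<integral>x. \<phi> (chaos_const q \<gamma> / N * (\<Sum>j<N. hermite q (lin n (a j) x))) \<partial>gauss n) - (\<integral>z. \<phi> (hermite q z / sqrt (fact q)) \<partial>N01)\<bar>
      \<le> K * sqrt \<gamma> / k + 2 * (\<integral>z. k / ((c * hermite (q - 1) z)\<^sup>2 + k) \<partial>N01)"
      unfolding c_def by (rule K(2)[OF \<gamma> N gram \<phi> k])
    also have "K * sqrt \<gamma> / k = K * r" unfolding rk[symmetric] by simp
    also have "K * r + 2 * (\<integral>z. k / ((c * hermite (q - 1) z)\<^sup>2 + k) \<partial>N01) \<le> K * r + 2 * ((2 * real (q - 1) + 1 / c\<^sup>2) * r)"
      using small by simp
    also have "\<dots> = (K + 2 * (2 * real (q - 1) + 1 / c\<^sup>2)) * r" by (simp add: algebra_simps)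
    finally show "\<bar>(\<integral>x. \<phi> (chaos_const q \<gamma> / N * (\<Sum>j<N. hermite q (lin n (a j) x))) \<partial>gauss n) - (\<integral>z. \<phi> (hermite q z / sqrt (fact q)) \<partial>N01)\<bar>
      \<le> (K + 2 * (2 * real (q - 1) + 1 / c\<^sup>2)) * \<gamma> powr (1 / (4 * real q))" by (simp add: r_def)
  qed
qed

lemma tempered_hermite_prob_space:
  assumes "tempered_hermite_process M B q \<gamma> W"
  shows "prob_space (distr M borel (W 1))"
proof -
  interpret tempered_hermite_process M B q \<gamma> W by fact
  have "has_multiple_wiener_integral M B q
        (\<lambda>x. tempered_hermite_const q \<gamma> * tempered_hermite_kernel q \<gamma> 1 x) (W 1)"
    by (rule wiener_integral) simp
  then have "W 1 \<in> borel_measurable M" unfolding has_multiple_wiener_integral_def by blast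
  then show ?thesis by (rule prob_space_distr)
qed

text \<open>For a fixed test function the mesh error and \<open>s N\<close> both disappear as the
  grid is refined. What remains is \<open>K\<close>, which does not depend on the test function and
  therefore survives the supremum.\<close>

lemma tv_dist_tempered_hermite_le:
  assumes W: "tempered_hermite_process M B q \<gamma> W" and \<gamma>: "\<gamma> > 0"
    and \<nu>: "prob_space \<nu>" "sets \<nu> = sets borel"
    and s: "s \<longlonglongrightarrow> 0"
    and le: "\<And>N n a \<phi> \<phi>' L. real N \<ge> \<gamma> \<Longrightarrow> 0 < N \<Longrightarrow>
      (\<forall>j<N. \<forall>l<N. dot n (a j) (a l) = exp (- \<gamma> / real N) ^ ((j - l) + (l - j))) \<Longrightarrow> test_function \<phi> \<phi>' L \<Longrightarrow>
      \<bar>(\<integral>x. \<phi> (chaos_const q \<gamma> / N * (\<Sum>j<N. hermite q (lin n (a j) x))) \<partial>gauss n) - (\<integral>x. \<phi> x \<partial>\<nu>)\<bar> \<le> K + s N"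
  shows "tv_dist (distr M borel (W 1)) \<nu> \<le> K"
proof (rule tv_dist_le_test_functions[OF tempered_hermite_prob_space[OF W] \<nu>(1) _ \<nu>(2)])
  show "sets (distr M borel (W 1)) = sets borel" by simp
  fix \<phi> \<phi>' L assume \<phi>: "test_function \<phi> \<phi>' L"
  have L: "0 \<le> L" using \<phi> unfolding test_function_def by (meson abs_ge_zero order_trans)
  show "\<bar>(\<integral>x. \<phi> x \<partial>distr M borel (W 1)) - (\<integral>x. \<phi> x \<partial>\<nu>)\<bar> \<le> K"
  proof (rule field_le_epsilon)
    fix e :: real assume e: "e > 0"
    \<comment> \<open>The mesh error is then \<open>L * d \<le> e / 2\<close>, also when
      \<open>L = 0\<close>.\<close>
    define d where "d = e / (2 * (L + 1))"
    have d: "d > 0" "L * d \<le> e / 2" using e L by (auto simp: d_def field_simps)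
    have "\<forall>\<^sub>F N in sequentially. s N < e / 2" using s by (rule order_tendstoD) (use e in simp)
    moreover have "\<forall>\<^sub>F N in sequentially. real N \<ge> \<gamma>"
      using filterlim_real_sequentially unfolding filterlim_at_top by blast
    ultimately have "\<forall>\<^sub>F N in sequentially. \<bar>(\<integral>x. \<phi> x \<partial>distr M borel (W 1)) - (\<integral>x. \<phi> x \<partial>\<nu>)\<bar> \<le> K + e"
      using eventually_gt_at_top[of 0] tempered_hermite_approx[OF W \<gamma> d(1)]
    proof eventually_elim
      case (elim N)
      then obtain n a where na: "\<forall>j<N. \<forall>l<N. dot n (a j) (a l) = exp (- \<gamma> / real N) ^ ((j - l) + (l - j))"
        "\<bar>(\<integral>x. \<phi> x \<partial>distr M borel (W 1)) - (\<integral>x. \<phi> (chaos_const q \<gamma> / N * (\<Sum>j<N. hermite q (lin n (a j) x))) \<partial>gauss n)\<bar> \<le> L * d"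
        using \<phi> by blast
      from le[OF elim(2,3) na(1) \<phi>] na(2) d(2) elim(1) show ?case by linarith
    qed
    then show "\<bar>(\<integral>x. \<phi> x \<partial>distr M borel (W 1)) - (\<integral>x. \<phi> x \<partial>\<nu>)\<bar> \<le> K + e"
      by (simp add: eventually_sequentially) blast
  qed
qed

theorem theorem1p1:
  fixes q :: nat
  assumes "q \<ge> 1"
  shows "\<exists>(C :: real) (a :: real \<Rightarrow> real) (b :: real \<Rightarrow> real).
    C > 0 \<and> (a \<longlongrightarrow> 0) at_top \<and> (b \<longlongrightarrow> 0) (at_right 0) \<and>
    (\<forall>\<gamma>\<ge>1. \<forall>(M :: 'a measure) B W. tempered_hermite_process M B q \<gamma> W \<longrightarrow>
       tv_dist (distr M borel (W 1)) (density lborel std_normal_density)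
         \<le> C * \<gamma> powr (- 1 / 2) * (1 + a \<gamma>)) \<and>
    (\<forall>\<gamma>>0. \<forall>(M :: 'a measure) B W. tempered_hermite_process M B q \<gamma> W \<longrightarrow>
       tv_dist (distr M borel (W 1))
           (distr (density lborel std_normal_density) borel
              (\<lambda>z. poly (hermite_poly q) z / sqrt (fact q)))
         \<le> C * \<gamma> powr (1 / (4 * real q)) * (1 + b \<gamma>))"
proof -
  obtain K1 where K1: "K1 \<ge> 0" "\<And>\<gamma> N n a \<phi>. \<gamma> \<ge> 1 \<Longrightarrow> real N \<ge> \<gamma> \<Longrightarrow>
    (\<forall>j<N. \<forall>l<N. dot n (a j) (a l) = exp (- \<gamma> / real N) ^ ((j - l) + (l - j))) \<Longrightarrow>
    continuous_on UNIV \<phi> \<Longrightarrow> (\<forall>x. 0 \<le> \<phi> x \<and> \<phi> x \<le> (1::real)) \<Longrightarrow>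
    \<bar>(\<integral>x. \<phi> (chaos_const q \<gamma> / N * (\<Sum>j<N. hermite q (lin n (a j) x))) \<partial>gauss n) - (\<integral>x. \<phi> x \<partial>N01)\<bar>
      \<le> K1 * \<gamma> powr (- 1 / 2) + \<gamma> powr (1 / 2) *
        (1 - (chaos_const q \<gamma> / N)\<^sup>2 * fact q * (\<Sum>j<N. \<Sum>l<N. (exp (- \<gamma> / real N) ^ ((j - l) + (l - j))) ^ q))\<^sup>2"
    using gaussian_regime_bound[OF assms] by blast
  obtain K2 where K2: "K2 \<ge> 0" "\<And>\<gamma> N n a \<phi> \<phi>' L. 0 < \<gamma> \<Longrightarrow> \<gamma> * real q \<le> 1 \<Longrightarrow> 0 < N \<Longrightarrow>
    (\<forall>j<N. \<forall>l<N. dot n (a j) (a l) = exp (- \<gamma> / real N) ^ ((j - l) + (l - j))) \<Longrightarrow>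
    test_function \<phi> \<phi>' L \<Longrightarrow>
    \<bar>(\<integral>x. \<phi> (chaos_const q \<gamma> / N * (\<Sum>j<N. hermite q (lin n (a j) x))) \<partial>gauss n) - (\<integral>z. \<phi> (hermite q z / sqrt (fact q)) \<partial>N01)\<bar>
      \<le> K2 * \<gamma> powr (1 / (4 * real q))"
    using hermite_regime_bound[OF assms] by blast
  define H where "H = distr N01 borel (\<lambda>z. poly (hermite_poly q) z / sqrt (fact q))"
  have mH: "(\<lambda>z. poly (hermite_poly q) z / sqrt (fact q)) \<in> borel_measurable N01"
    using hermite_measurable[of q] by (simp add: hermite_def[abs_def])
  have pH: "prob_space H" unfolding H_def using mH by (rule N01.prob_space_distr)
  have eH: "(\<integral>x. \<phi> x \<partial>H) = (\<integral>z. \<phi> (hermite q z / sqrt (fact q)) \<partial>N01)"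
    if "test_function \<phi> \<phi>' L" for \<phi> \<phi>' L
    unfolding H_def using integral_distr[OF mH test_function_measurable(1)[OF that]] by (simp add: hermite_def)
  \<comment> \<open>The summand \<open>q\<close> takes care of the second bound when
    \<open>\<gamma> * q > 1\<close>, and it makes \<open>C\<close> positive.\<close>
  define C where "C = K1 + K2 + q"
  have Cq: "real q \<le> C" "K1 \<le> C" "K2 \<le> C" using K1(1) K2(1) by (simp_all add: C_def)
  have part1: "tv_dist (distr M borel (W 1)) N01 \<le> C * \<gamma> powr (- 1 / 2)"
    if \<gamma>: "\<gamma> \<ge> 1" and W: "tempered_hermite_process M B q \<gamma> W" for \<gamma> and M :: "'a measure" and B W
  proof -
    let ?v = "\<lambda>N. (chaos_const q \<gamma> / real N)\<^sup>2 * fact q * (\<Sum>j<N. \<Sum>l<N. (exp (- \<gamma> / real N) ^ ((j - l) + (l - j))) ^ q)"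
    have "(\<lambda>N. \<gamma> powr (1 / 2) * (1 - ?v N)\<^sup>2) \<longlonglongrightarrow> \<gamma> powr (1 / 2) * (1 - 1)\<^sup>2"
      by (intro tendsto_mult tendsto_const tendsto_power tendsto_diff variance_limit) (use \<gamma> assms in auto)
    then have lim: "(\<lambda>N. \<gamma> powr (1 / 2) * (1 - ?v N)\<^sup>2) \<longlonglongrightarrow> 0" by simp
    have "tv_dist (distr M borel (W 1)) N01 \<le> K1 * \<gamma> powr (- 1 / 2)"
    proof (rule tv_dist_tempered_hermite_le[OF W _ prob_space_N01 _ lim])
      fix N n a \<phi> \<phi>' L
      assume N: "real N \<ge> \<gamma>" "0 < N" and gram: "\<forall>j<N. \<forall>l<N. dot n (a j) (a l) = exp (- \<gamma> / real N) ^ ((j - l) + (l - j))"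
        and \<phi>: "test_function \<phi> \<phi>' L"
      have "continuous_on UNIV \<phi>" "\<forall>x. 0 \<le> \<phi> x \<and> \<phi> x \<le> 1"
        using \<phi> DERIV_imp_borel(2)[of \<phi> \<phi>'] by (auto simp: test_function_def)
      from K1(2)[OF \<gamma> N(1) gram this]
      show "\<bar>(\<integral>x. \<phi> (chaos_const q \<gamma> / N * (\<Sum>j<N. hermite q (lin n (a j) x))) \<partial>gauss n) - (\<integral>x. \<phi> x \<partial>N01)\<bar>
        \<le> K1 * \<gamma> powr (- 1 / 2) + \<gamma> powr (1 / 2) * (1 - ?v N)\<^sup>2" .
    qed (use \<gamma> in auto)
    also have "\<dots> \<le> C * \<gamma> powr (- 1 / 2)" using Cq by (intro mult_right_mono) auto
    finally show ?thesis .
  qed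
  have part2: "tv_dist (distr M borel (W 1)) H \<le> C * \<gamma> powr (1 / (4 * real q))"
    if \<gamma>: "\<gamma> > 0" and W: "tempered_hermite_process M B q \<gamma> W" for \<gamma> and M :: "'a measure" and B W
  proof (cases "\<gamma> * real q \<le> 1")
    case True
    have "tv_dist (distr M borel (W 1)) H \<le> K2 * \<gamma> powr (1 / (4 * real q))"
    proof (rule tv_dist_tempered_hermite_le[OF W \<gamma> pH _ tendsto_const])
      show "sets H = sets borel" by (simp add: H_def)
      fix N n a \<phi> \<phi>' L
      assume N: "real N \<ge> \<gamma>" "0 < N" and gram: "\<forall>j<N. \<forall>l<N. dot n (a j) (a l) = exp (- \<gamma> / real N) ^ ((j - l) + (l - j))"
        and \<phi>: "test_function \<phi> \<phi>' L"
      from K2(2)[OF \<gamma> True N(2) gram \<phi>]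
      show "\<bar>(\<integral>x. \<phi> (chaos_const q \<gamma> / N * (\<Sum>j<N. hermite q (lin n (a j) x))) \<partial>gauss n) - (\<integral>x. \<phi> x \<partial>H)\<bar>
        \<le> K2 * \<gamma> powr (1 / (4 * real q)) + 0"
        by (simp add: eH[OF \<phi>])
    qed
    also have "\<dots> \<le> C * \<gamma> powr (1 / (4 * real q))" using Cq by (intro mult_right_mono) auto
    finally show ?thesis .
  next
    case False
    have q1: "real q \<ge> 1" using assms by simp
    \<comment> \<open>Total variation never exceeds 1, so away from small rates it suffices that the
      right side is at least 1. For \<open>\<gamma> < 1\<close> the fractional power of
      \<open>\<gamma>\<close> is at least \<open>\<gamma>\<close>, and
      \<open>\<gamma> * q > 1\<close>.\<close>
    have "1 \<le> q * \<gamma> powr (1 / (4 * real q))"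
    proof (cases "\<gamma> \<ge> 1")
      case True
      then have "1 \<le> \<gamma> powr (1 / (4 * real q))" by (intro ge_one_powr_ge_zero) auto
      then show ?thesis using q1 mult_mono[of 1 "real q" 1 "\<gamma> powr (1 / (4 * real q))"] by simp
    next
      case le: False
      have "1 / (4 * real q) \<le> 1" using q1 by (simp add: divide_le_eq)
      then have "\<gamma> powr 1 \<le> \<gamma> powr (1 / (4 * real q))" using le \<gamma> by (intro powr_mono') auto
      then have "q * \<gamma> \<le> q * \<gamma> powr (1 / (4 * real q))" using \<gamma> by (intro mult_left_mono) auto
      then show ?thesis using False by (simp add: mult.commute)
    qed
    also have "\<dots> \<le> C * \<gamma> powr (1 / (4 * real q))" using Cq by (intro mult_right_mono) auto
    finally show ?thesis
      using tv_dist_le_one[OF tempered_hermite_prob_space[OF W] pH] by linarith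
  qed
  have "C > 0" using Cq(1) assms by linarith
  \<comment> \<open>Both bounds hold without a correction factor, so the zero function is the
    witness for \<open>a\<close> and for \<open>b\<close>.\<close>
  then show ?thesis
    using part1 part2 unfolding H_def
    by (intro exI[of _ C] exI[of _ "\<lambda>_. 0"]) (simp add: tendsto_const)
qed

end
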